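(* Let $n\ge 2$. There is a constant $\gamma>0$, depending only on $n$ and the ellipticity, such that the following holds for every divergence form elliptic operator $L=\operatorname{div}A(X)\nabla$ in $\mathbb{R}^n_+$ (real, not necessarily symmetric, with the given ellipticity). Assume that there is a constant $A<\infty$ such that for every cube $Q\subset\mathbb{R}^{n-1}$ and every Borel set $H\subset Q$, the solution $u$ of $Lu=0$ in $\mathbb{R}^n_+$ with boundary data $u|_{\partial\mathbb{R}^n_+}=\chi_H$ satisfies the Carleson measure condition $$\frac{1}{|(1+\gamma)Q|}\int_{T((1+\gamma)Q)}t\,|\nabla u(y,t)|^2\,dy\,dt\le A .$$ Then for every cube $Q_0\subset\mathbb{R}^{n-1}$, the elliptic measure $\omega=\omega^{A_{Q_0}}$ belongs to $A_\infty(Q_0)$; that is, for every $\varepsilon\in(0,1)$ there exists $\delta\in(0,1)$ such that for every cube $Q\subset Q_0$ and every Borel set $E\subset Q$, $$\frac{\omega(E)}{\omega(Q)}<\delta\quad\Longrightarrow\quad\frac{|E|}{|Q|}<\varepsilon .$$ Moreover, there exists $p_0>1$, depending on the ellipticity, the dimension and $A$, such that for every $p_0\le p<\infty$ there is a constant $\widetilde C$, depending on the ellipticity, the dimension, $A$ and $p$, such that for every continuous compactly supported $F$ on $\mathbb{R}^{n-1}$ the solution $u$ of $Lu=0$ in $\mathbb{R}^n_+$ with $u|_{\partial\mathbb{R}^n_+}=F$ satisfies $$\|u^*\|_{L^p(\mathbb{R}^{n-1})}\le\widetilde C\,\|F\|_{L^p(\mathbb{R}^{n-1})},\qquad u^*(x,0)=\sup_{X\in\Gamma_\gamma(x,0)}|u(X)|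 .$$
   Context: $\mathbb{R}^n_+=\{(x,t):x\in\mathbb{R}^{n-1},\,t>0\}$, and $\partial\mathbb{R}^n_+$ is identified with $\mathbb{R}^{n-1}$. $L=\operatorname{div}A(X)\nabla$, where $A(X)=(a_{ij}(X))_{i,j=1}^n$ is a real $n\times n$ matrix, not necessarily symmetric, with $a_{ij}\in L^\infty(\mathbb{R}^n_+)$, and there is $\lambda>0$ with $\lambda|\xi|^2\le\langle A(X)\xi,\xi\rangle\le\lambda^{-1}|\xi|^2$ for all $\xi\in\mathbb{R}^n$ (and a.e. $X$). "Depending only on the ellipticity" means depending only on $\lambda$ and $\sup_{i,j}\|a_{ij}\|_{L^\infty}$. Solutions of $Lu=0$ are weak solutions. Elliptic measure $\omega^X$ of $L$ with pole at $X\in\mathbb{R}^n_+$ is the probability measure on $\mathbb{R}^{n-1}$ such that for continuous compactly supported $g$ the bounded weak solution of $Lu=0$ in $\mathbb{R}^n_+$, $u=g$ on $\mathbb{R}^{n-1}$, is $u(X)=\int g\,d\omega^X$. For a bounded Borel function $F$ on $\mathbb{R}^{n-1}$, "the solution with boundary data $F$" is $u(X)=\int_{\partial\mathbb{R}^n_+}F\,d\omega^X$. A cube $Q\subset\mathbb{R}^{n-1}$ with center $x_Q$ and side length $\ell(Q)$ is $\{x:\max_i|(x-x_Q)_i|<\ell(Q)/2\}$; $(1+\gamma)Q$ is the concentric cube with side length $(1+\gamma)\ell(Q)$; $A_Q=(x_Q,\ell(Q))$; $T(Q)=\{(x,t):x\in Q,\ 0\le t\le\ell(Q)\}$; $|\cdot|$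 of a subset of $\mathbb{R}^{n-1}$ is Lebesgue measure. $\Gamma_\gamma(x,0)=\{(y,s)\in\mathbb{R}^n_+:|y-x|\le\gamma s\}$. *)

theory Defs
  imports "HOL-Analysis.Analysis"
begin

text \<open>
  Points of \<open>R^n\<close> are pairs \<open>(x, t)\<close> with \<open>x\<close> in \<open>R^(n-1)\<close>, rendered as \<open>real ^ 'm\<close>, so that
  \<open>n = CARD('m) + 1\<close> is an arbitrary integer at least 2.
\<close>

type_synonym 'm point = "(real ^ 'm) \<times> real"

definition half_space :: "'m::finite point set" where
  "half_space = {X. 0 < snd X}"

text \<open>
  The matrix \<open>A(X)\<close> is given as the linear map it represents; its entries \<open>a_ij(X)\<close> are
  \<open>A X j \<bullet> i\<close> for \<open>i\<close>, \<open>j\<close> in the standard basis. \<open>Lam\<close> is an upper bound for the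
  \<open>L^\<infinity>\<close> norms of the entries.
\<close>

definition elliptic :: "real \<Rightarrow> real \<Rightarrow> ('m::finite point \<Rightarrow> 'm point \<Rightarrow>\<^sub>L 'm point) \<Rightarrow> bool" where
  "elliptic lam Lam A \<longleftrightarrow>
     0 < lam \<and>
     (\<forall>i\<in>Basis. \<forall>j\<in>Basis.
        (\<lambda>X. A X j \<bullet> i) \<in> borel_measurable (lebesgue_on half_space) \<and>
        (AE X in lebesgue_on half_space. \<bar>A X j \<bullet> i\<bar> \<le> Lam)) \<and>
     (AE X in lebesgue_on half_space. \<forall>\<xi>.
        lam * (norm \<xi>)\<^sup>2 \<le> A X \<xi> \<bullet> \<xi> \<and> A X \<xi> \<bullet> \<xi> \<le> inverse lam * (norm \<xi>)\<^sup>2)"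

primrec Ck :: "nat \<Rightarrow> ('a::euclidean_space \<Rightarrow> real) \<Rightarrow> bool" where
  "Ck 0 f \<longleftrightarrow> continuous_on UNIV f"
| "Ck (Suc k) f \<longleftrightarrow>
     (\<forall>x. f differentiable (at x)) \<and>
     (\<forall>b\<in>Basis. Ck k (\<lambda>x. frechet_derivative f (at x) b))"

definition test_function :: "'a::euclidean_space set \<Rightarrow> ('a \<Rightarrow> real) \<Rightarrow> bool" where
  "test_function U \<phi> \<longleftrightarrow>
     (\<forall>k. Ck k \<phi>) \<and> compact (closure {x. \<phi> x \<noteq> 0}) \<and> closure {x. \<phi> x \<noteq> 0} \<subseteq> U"

definition grad :: "('a::euclidean_space \<Rightarrow> real) \<Rightarrow> 'a \<Rightarrow> 'a" where
  "grad \<phi> x = (\<Sum>b\<in>Basis. frechet_derivative \<phi> (at x) b *\<^sub>R b)"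

definition L2_loc :: "'a::euclidean_space set \<Rightarrow> ('a \<Rightarrow> 'b::euclidean_space) \<Rightarrow> bool" where
  "L2_loc U f \<longleftrightarrow>
     f \<in> borel_measurable (lebesgue_on U) \<and>
     (\<forall>K. compact K \<and> K \<subseteq> U \<longrightarrow> set_integrable lebesgue K (\<lambda>x. (norm (f x))\<^sup>2))"

text \<open>\<open>u\<close> lies in \<open>W^{1,2}_loc(U)\<close> with weak gradient \<open>G\<close>, which is unique up to null sets.\<close>

definition has_weak_gradient ::
    "'a::euclidean_space set \<Rightarrow> ('a \<Rightarrow> real) \<Rightarrow> ('a \<Rightarrow> 'a) \<Rightarrow> bool" where
  "has_weak_gradient U u G \<longleftrightarrow>
     L2_loc U u \<and> L2_loc U G \<and>
     (\<forall>\<phi>. test_function U \<phi> \<longrightarrow>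
        (\<forall>b\<in>Basis. (LINT x:U|lebesgue. u x * (grad \<phi> x \<bullet> b)) =
                   - (LINT x:U|lebesgue. (G x \<bullet> b) * \<phi> x)))"

definition weak_solution ::
    "('m::finite point \<Rightarrow> 'm point \<Rightarrow>\<^sub>L 'm point) \<Rightarrow> ('m point \<Rightarrow> real) \<Rightarrow> bool" where
  "weak_solution A u \<longleftrightarrow>
     (\<exists>G. has_weak_gradient half_space u G \<and>
        (\<forall>\<phi>. test_function half_space \<phi> \<longrightarrow>
           (LINT X:half_space|lebesgue. A X (G X) \<bullet> grad \<phi> X) = 0))"

definition continuous_compact_support :: "('a::euclidean_space \<Rightarrow> real) \<Rightarrow> bool" where
  "continuous_compact_support g \<longleftrightarrow>
     continuous_on UNIV g \<and> compact (closure {x. g x \<noteq> 0})"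

text \<open>
  The bounded solution of the Dirichlet problem, by its continuous representative; only the
  values of \<open>u\<close> in the open half space matter, so the boundary values are limits.
\<close>

definition bounded_dirichlet_solution ::
    "('m::finite point \<Rightarrow> 'm point \<Rightarrow>\<^sub>L 'm point) \<Rightarrow> (real ^ 'm \<Rightarrow> real) \<Rightarrow>
     ('m point \<Rightarrow> real) \<Rightarrow> bool" where
  "bounded_dirichlet_solution A g u \<longleftrightarrow>
     bounded (u ` half_space) \<and> continuous_on half_space u \<and> weak_solution A u \<and>
     (\<forall>x. (u \<longlongrightarrow> g x) (at (x, 0) within half_space))"

definition solution_with_data ::
    "('m::finite point \<Rightarrow> (real ^ 'm) measure) \<Rightarrow> (real ^ 'm \<Rightarrow> real) \<Rightarrow> 'm point \<Rightarrow> real" where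
  "solution_with_data \<omega> F X = (LINT y|\<omega> X. F y)"

text \<open>
  Bounded solutions are determined by their boundary values, so this pins down \<open>\<omega> X\<close> for every
  pole \<open>X\<close> in the open half space; \<open>\<omega>\<close> is arbitrary elsewhere.
\<close>

definition elliptic_measure ::
    "('m::finite point \<Rightarrow> 'm point \<Rightarrow>\<^sub>L 'm point) \<Rightarrow>
     ('m point \<Rightarrow> (real ^ 'm) measure) \<Rightarrow> bool" where
  "elliptic_measure A \<omega> \<longleftrightarrow>
     (\<forall>X\<in>half_space. sets (\<omega> X) = sets borel \<and> emeasure (\<omega> X) (space (\<omega> X)) = 1) \<and>
     (\<forall>g. continuous_compact_support g \<longrightarrow>
        bounded_dirichlet_solution A g (solution_with_data \<omega> g))"

definition cube :: "real ^ 'm::finite \<Rightarrow> real \<Rightarrow> (real ^ 'm) set" where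
  "cube c l = {x. \<forall>i. \<bar>(x - c) $ i\<bar> < l / 2}"

definition carleson_box :: "real ^ 'm::finite \<Rightarrow> real \<Rightarrow> 'm point set" where
  "carleson_box c l = {(x, t). x \<in> cube c l \<and> 0 \<le> t \<and> t \<le> l}"

definition carleson_condition ::
    "real \<Rightarrow> ennreal \<Rightarrow> ('m::finite point \<Rightarrow> (real ^ 'm) measure) \<Rightarrow> bool" where
  "carleson_condition \<gamma> K \<omega> \<longleftrightarrow>
     (\<forall>c l H. 0 < l \<and> H \<in> sets borel \<and> H \<subseteq> cube c l \<longrightarrow>
        (\<exists>G. has_weak_gradient half_space (solution_with_data \<omega> (indicator H)) G \<and>
           (\<integral>\<^sup>+X\<in>carleson_box c ((1 + \<gamma>) * l). ennreal (snd X * (norm (G X))\<^sup>2) \<partial>lebesgue)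
             / emeasure lebesgue (cube c ((1 + \<gamma>) * l)) \<le> K))"

definition A_infinity :: "(real ^ 'm::finite) set \<Rightarrow> (real ^ 'm) measure \<Rightarrow> bool" where
  "A_infinity Q0 \<mu> \<longleftrightarrow>
     (\<forall>\<epsilon>\<in>{0<..<1}. \<exists>\<delta>\<in>{0<..<1}. \<forall>c l E.
        0 < l \<and> cube c l \<subseteq> Q0 \<and> E \<in> sets borel \<and> E \<subseteq> cube c l \<longrightarrow>
        measure \<mu> E / measure \<mu> (cube c l) < \<delta> \<longrightarrow>
        measure lebesgue E / measure lebesgue (cube c l) < \<epsilon>)"

definition cone :: "real \<Rightarrow> real ^ 'm::finite \<Rightarrow> 'm point set" where
  "cone \<gamma> x = {(y, s). (y, s) \<in> half_space \<and> norm (y - x) \<le> \<gamma> * s}"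

text \<open>A real supremum suffices, since it is only applied to bounded functions.\<close>

definition nontangential_max :: "real \<Rightarrow> ('m::finite point \<Rightarrow> real) \<Rightarrow> real ^ 'm \<Rightarrow> real" where
  "nontangential_max \<gamma> u x = (SUP X\<in>cone \<gamma> x. \<bar>u X\<bar>)"

definition Lp_norm :: "real \<Rightarrow> ('a::euclidean_space \<Rightarrow> real) \<Rightarrow> ennreal" where
  "Lp_norm p f =
     (let I = \<integral>\<^sup>+x. ennreal (\<bar>f x\<bar> powr p) \<partial>lebesgue
      in if I = \<infinity> then \<infinity> else ennreal (enn2real I powr (1 / p)))"

end

theory Submission
 imports Defs "HOL-Computational_Algebra.Polynomial"
begin

text \<open>
 Aperture \<open>1\<close> already works. Truncations \<open>(u - k)\<^sub>+\<close> of bounded solutions satisfy Caccioppoli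
 inequalities in translation form, and De Giorgi's method turns these into interior Hoelder bounds,
 a qualitative Harnack inequality, decay at the boundary, a maximum principle and a change of pole
 comparison for elliptic measure.

 The key claim is that a subset of a ball of radius \<open>r\<close> which fills a fixed fraction of it has elliptic
 measure bounded below from height \<open>r\<close>. Otherwise the set has tiny elliptic measure, and the set of
 points below which its elliptic measure is not small is only boundedly larger; iterating, one gets an
 increasing chain of open sets, none of which contains a large ball. The union \<open>H\<close> of the cores of the
 Whitney balls of each layer, minus the previous layer, has \<open>\<omega>(H)\<close> oscillating by \<open>1/2\<close> at the scale of
 every Whitney ball, so every layer contributes a fixed amount to the Carleson integral of \<open>\<omega>(H)\<close>, which
 is absurd for many layers.

 Comparison and Harnack carry this to any pole, which is \<open>A\<^sub>\<infinity>\<close>. For the \<open>L\<^sup>p\<close> bound, an open set \<open>V\<close> is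
 enlarged to a comparable \<open>V'\<close> outside of which, on cones, \<open>\<omega>(V) \<le> \<kappa> \<omega>(V')\<close> with \<open>\<kappa> < 1\<close>. Applying
 this repeatedly to dyadic level sets of the data controls the maximal function when \<open>2\<^sup>p\<close> exceeds the
 volume growth.
\<close>

section \<open>Smoothing\<close>

text \<open>The Carleson hypothesis concerns one indicator at a time, so the contradiction needs a
  single set \<open>H\<close> oscillating on many disjoint regions at once; the enlargement from one
  layer to the next is made so large that Whitney regions of different layers cannot meet. Each
  layer costs a fixed multiple of the volume of the initial set, while the hypothesis allows only
  \<open>K\<close> times the volume of a cube of side 8\<open>r\<close>. This fixes the number
  \<open>J\<close> of layers; the starting height \<open>a\<close> is then a small multiple of
  \<open>r\<close>, so that \<open>J\<close> enlargements stay in a ball of radius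
  2\<open>r\<close>. A cube of side 4\<open>r\<close> contains that ball and its double contains the
  whole configuration, which is why \<gamma> = 1 suffices. Boundary estimates are interior estimates
  in disguise: a truncation that vanishes at the boundary is extended by zero below it and remains
  in the class \<open>DG\<close>, and the lower half space supplies the zero set that the growth
  lemma asks for. Uniformity in the operator comes from the order of quantifiers: constants are
  fixed before the family \<omega> and depend on \<open>L\<close>, the dimension and possibly
  \<open>K\<close> only.\<close>

abbreviation borel_maps :: "('a::topological_space => 'b::topological_space) set" ("\<B>") where
 "\<B> \<equiv> borel_measurable borel"

section \<open>Calculus of the recursively defined classes \<open>Ck\<close>\<close>

lemma Ck_SucI:
 assumes "\<And>x. (f has_derivative f' x) (at x)" "\<And>b. b \<in> Basis ==> Ck k (\<lambda>x. f' x b)"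
 shows "Ck (Suc k) f" using assms by (auto simp: differentiable_def frechet_derivative_at[OF assms(1), symmetric])

lemma Ck_SucD:
 assumes "Ck (Suc k) f"
 shows "(f has_derivative frechet_derivative f (at x)) (at x)"
  and "b \<in> Basis ==> Ck k (\<lambda>x. frechet_derivative f (at x) b)" using assms by (auto simp: frechet_derivative_works)

lemma Ck_continuous: "Ck k f ==> continuous_on UNIV f"
 by (cases k) (auto intro!: continuous_at_imp_continuous_on differentiable_imp_continuous_within)

lemma Ck_Suc_imp: "Ck (Suc k) f ==> Ck k f"
proof (induction k arbitrary: f)
 case 0
 then show ?case using Ck_continuous[of "Suc 0"] by simp
next
 case (Suc k)
 show ?case by (rule Ck_SucI[OF Ck_SucD(1)[OF Suc.prems]]) (rule Suc.IH, rule Ck_SucD(2)[OF Suc.prems])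
qed

lemma Ck_const: "Ck k (\<lambda>x::'a::euclidean_space. c)"
proof (induction k arbitrary: c)
 case (Suc k)
 show ?case by (rule Ck_SucI[where f' = "\<lambda>x h. 0"]) (auto intro: Suc)
qed auto

lemma Ck_inner: "Ck k (\<lambda>x::'a::euclidean_space. x \<bullet> c)"
proof (cases k)
 case (Suc j)
 have "Ck (Suc j) (\<lambda>x::'a. x \<bullet> c)"
  by (rule Ck_SucI[where f' = "\<lambda>x h. h \<bullet> c"]) (auto intro!: derivative_eq_intros Ck_const)
 then show ?thesis using Suc by simp
qed (auto intro!: continuous_intros)

lemma Ck_add: "Ck k f ==> Ck k g ==> Ck k (\<lambda>x. f x + g x)"
proof (induction k arbitrary: f g)
 case 0
 then show ?case by (auto intro!: continuous_intros)
next
 case (Suc k)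
 show ?case by (rule Ck_SucI, rule has_derivative_add[OF Ck_SucD(1)[OF Suc.prems(1)] Ck_SucD(1)[OF Suc.prems(2)]])
    (intro Suc.IH Ck_SucD(2)[OF Suc.prems(1)] Ck_SucD(2)[OF Suc.prems(2)])
qed

lemma Ck_mult: "Ck k f ==> Ck k g ==> Ck k (\<lambda>x. f x * g x)"
proof (induction k arbitrary: f g)
 case 0
 then show ?case by (auto intro!: continuous_intros)
next
 case (Suc k)
 show ?case by (rule Ck_SucI, rule has_derivative_mult[OF Ck_SucD(1)[OF Suc.prems(1)] Ck_SucD(1)[OF Suc.prems(2)]])
    (intro Ck_add Suc.IH Ck_SucD(2)[OF Suc.prems(1)] Ck_SucD(2)[OF Suc.prems(2)] Suc.prems Ck_Suc_imp)
qed

lemma Ck_affine: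
 fixes f :: "'a::euclidean_space => real"
 assumes "Ck k f" shows "Ck k (\<lambda>x. f (z + a *\<^sub>R x))" using assms
proof (induction k arbitrary: f)
 case 0
 then show ?case by (auto intro!: continuous_on_compose2[of UNIV f] continuous_intros)
next
 case (Suc k)
 have lin: "frechet_derivative f (at y) (a *\<^sub>R h) = a * frechet_derivative f (at y) h" for y h
  using linear_scale[OF has_derivative_linear[OF Ck_SucD(1)[OF Suc.prems]]] by simp
 have d: "((\<lambda>x. z + a *\<^sub>R x) has_derivative (\<lambda>h. a *\<^sub>R h)) (at x)" for x by (auto intro!: derivative_eq_intros)
 have "((\<lambda>x. f (z + a *\<^sub>R x)) has_derivative (\<lambda>h. a * frechet_derivative f (at (z + a *\<^sub>R x)) h)) (at x)" for x
  using has_derivative_compose[OF d[of x] Ck_SucD(1)[OF Suc.prems, of "z + a *\<^sub>R x"]] by (simp add: lin)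
 then show ?case by (rule Ck_SucI) (intro Ck_mult Ck_const Suc.IH Ck_SucD(2)[OF Suc.prems])
qed

section \<open>A smooth bump function\<close>

definition exp_poly :: "real poly => real => real" where
 "exp_poly p s = (if 0 < s then poly p (1 / s) * exp (- (1 / s)) else 0)"

lemma poly_exp_tendsto_0: "((\<lambda>x::real. poly p x * exp (- x)) \<longlongrightarrow> 0) at_top"
proof -
 have "((\<lambda>x::real. \<Sum>i\<le>degree p. coeff p i * (x ^ i / exp x)) \<longlongrightarrow> (\<Sum>i\<le>degree p. coeff p i * 0)) at_top"
  by (intro tendsto_sum tendsto_mult tendsto_const tendsto_power_div_exp_0)
 then show ?thesis by (simp add: poly_altdef sum_distrib_right exp_minus divide_inverse mult.assoc)
qed

lemma exp_poly_at_right: "((\<lambda>s. poly p (1 / s) * exp (- (1 / s))) \<longlongrightarrow> 0) (at_right (0::real))"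
 using filterlim_compose[OF poly_exp_tendsto_0[of p] filterlim_inverse_at_top_right] by (simp add: inverse_eq_divide)

text \<open>The functions p(1/s) exp(-1/s), extended by zero to s \<le> 0, are closed under
  differentiation: p turns into x^2 (p - p'). Smoothness of the bump is then one induction over all
  p at once.\<close>

lemma exp_poly_has_derivative:
 "(exp_poly p has_real_derivative exp_poly ([:0, 0, 1:] * (p - pderiv p)) s) (at s)"
proof -
 consider "s > 0" | "s < 0" | "s = 0" by linarith
 then show ?thesis
 proof cases
  case 1
  have "((\<lambda>s. poly p (1 / s) * exp (- (1 / s))) has_real_derivative
    exp_poly ([:0, 0, 1:] * (p - pderiv p)) s) (at s)"
   using 1 unfolding exp_poly_def by (auto intro!: derivative_eq_intros DERIV_chain2[OF poly_DERIV]
        simp: field_simps power2_eq_square)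
  then show ?thesis by (rule DERIV_cong_ev[THEN iffD1, rotated -1, OF _ refl _ refl])
     (use 1 in \<open>auto simp: exp_poly_def elim!: eventually_mono[OF order_tendstoD(1)[OF tendsto_ident_at]]
       intro!: eventually_mono[OF eventually_nhds_in_open[of "{0<..}"]]\<close>)
 next
  case 2
  have "((\<lambda>s. 0) has_real_derivative exp_poly ([:0, 0, 1:] * (p - pderiv p)) s) (at s)" using 2 unfolding exp_poly_def by simp
  then show ?thesis by (rule DERIV_cong_ev[THEN iffD1, rotated -1, OF _ refl _ refl])
     (use 2 in \<open>auto simp: exp_poly_def intro!: eventually_mono[OF eventually_nhds_in_open[of "{..<0}"]]\<close>)
 next
  case 3
  \<comment> \<open>Dividing by h multiplies the polynomial by x, so the difference quotient at 0 is
    again of the family and has right limit 0.\<close>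
  have 1: "((\<lambda>h. exp_poly p h / h) \<longlongrightarrow> 0) (at_right 0)"
   by (rule Lim_transform_eventually[OF exp_poly_at_right[of "[:0,1:] * p"]])
     (auto simp: exp_poly_def eventually_at_filter)
  have 2: "((\<lambda>h. exp_poly p h / h) \<longlongrightarrow> 0) (at_left 0)" by (rule Lim_transform_eventually[OF tendsto_const])
     (auto simp: exp_poly_def eventually_at_filter)
  have "((\<lambda>h. exp_poly p h / h) \<longlongrightarrow> 0) (at 0)" using 1 2 by (simp add: filterlim_split_at)
  then show ?thesis using 3 by (simp add: DERIV_def exp_poly_def)
 qed
qed

lemma Ck_exp_poly: "Ck k (\<lambda>x::'a::euclidean_space. exp_poly p (1 - x \<bullet> x))"
proof (induction k arbitrary: p)
 case 0
 have "continuous_on UNIV (exp_poly p)" using exp_poly_has_derivative by (meson DERIV_isCont continuous_at_imp_continuous_on)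
 then show ?case by (auto intro!: continuous_on_compose2[of UNIV "exp_poly p"] continuous_intros)
next
 case (Suc k)
 let ?q = "[:0, 0, 1:] * (p - pderiv p)"
 have sq: "((\<lambda>x::'a. 1 - x \<bullet> x) has_derivative (\<lambda>h. - (2 * (x \<bullet> h)))) (at x)" for x
  by (auto intro!: derivative_eq_intros simp: inner_commute)
 have "((\<lambda>x::'a. exp_poly p (1 - x \<bullet> x)) has_derivative
   (\<lambda>h. exp_poly ?q (1 - x \<bullet> x) * (- 2 * (h \<bullet> x)))) (at x)" for x
  using has_derivative_compose[OF sq[of x], of "exp_poly p" "(*) (exp_poly ?q (1 - x \<bullet> x))"]
   exp_poly_has_derivative[of p "1 - x \<bullet> x"] by (simp add: has_field_derivative_def inner_commute)
 then show ?case
 proof (rule Ck_SucI)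
  fix b :: 'a
  have "Ck k (\<lambda>x::'a. exp_poly ?q (1 - x \<bullet> x) * (- 2 * (x \<bullet> b)))" by (intro Ck_mult Suc Ck_inner Ck_const)
  then show "Ck k (\<lambda>x::'a. exp_poly ?q (1 - x \<bullet> x) * (- 2 * (b \<bullet> x)))" by (simp add: inner_commute)
 qed
qed

lemma integrable_continuous_bounded_support:
 fixes f :: "'a::euclidean_space => 'b::euclidean_space"
 assumes "continuous_on UNIV f" "\<And>x. r <= norm x ==> f x = 0"
 shows "integrable lborel f"
proof -
 have "integrable lborel (\<lambda>x. indicator (cball 0 r) x *\<^sub>R f x)"
  using borel_integrable_compact[of "cball 0 r" f] continuous_on_subset[OF assms(1)] by (auto simp: set_integrable_def)
 also have "(\<lambda>x. indicator (cball 0 r) x *\<^sub>R f x) = f" using assms(2) by (auto simp: indicator_def fun_eq_iff not_le)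
 finally show ?thesis .
qed

lemma ex_mollifier:
 "\<exists>\<rho>::'a::euclidean_space => real. (\<forall>k. Ck k \<rho>) \<and> (\<forall>x. 0 <= \<rho> x) \<and> (\<forall>x. 1 <= norm x --> \<rho> x = 0) \<and>
   integral\<^sup>L lborel \<rho> = 1"
proof -
 define f :: "'a => real" where "f x = exp_poly 1 (1 - x \<bullet> x)" for x
 have Ck: "Ck k f" for k unfolding f_def by (rule Ck_exp_poly)
 have cont: "continuous_on UNIV f" using Ck Ck_continuous by blast
 have nn: "0 <= f x" for x by (simp add: f_def exp_poly_def)
 have supp: "f x = 0" if "1 <= norm x" for x using that power_mono[of 1 "norm x" 2] by (simp add: f_def exp_poly_def power2_norm_eq_inner)
 have int: "integrable lborel f" by (rule integrable_continuous_bounded_support[OF cont supp])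
 have "integral\<^sup>L lborel f \<noteq> 0"
 proof
  assume "integral\<^sup>L lborel f = 0"
  then have "AE x in lborel. f x = 0" using integral_nonneg_eq_0_iff_AE[OF int] nn by auto
  then have "AE x in lborel. x \<notin> ball (0::'a) 1"
  proof (rule AE_mp, intro AE_I2 impI notI)
   fix x :: 'a assume "f x = 0" "x \<in> ball 0 1"
   then have "x \<bullet> x < 1" using power_strict_mono[of "norm x" 1 2] by (simp add: power2_norm_eq_inner)
   then show False using \<open>f x = 0\<close> by (simp add: f_def exp_poly_def)
  qed
  then have "emeasure lborel (ball (0::'a) 1) = 0" by (subst (asm) AE_iff_measurable[OF _ refl]) (simp_all add: ball_def)
  then show False using emeasure_lborel_ball_finite content_ball_pos[of 1 "0::'a"] by (simp add: measure_def)
 qed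
 moreover have "0 <= integral\<^sup>L lborel f" using nn by simp
 ultimately have pos: "0 < integral\<^sup>L lborel f" by simp
 let ?c = "inverse (integral\<^sup>L lborel f)"
 show ?thesis using Ck pos nn supp int by (intro exI[of _ "\<lambda>x. ?c * f x"]) (auto intro!: Ck_mult Ck_const)
qed

text \<open>With the gradient as an explicit argument, products, compositions and convolutions
  report their gradients as vector fields; \<open>C1_grad\<close> identifies the field with
  \<open>grad\<close>.\<close>

definition C1 :: "('a::euclidean_space => real) => ('a => 'a) => bool" where
 "C1 f f' \<longleftrightarrow> (\<forall>x. (f has_derivative (\<lambda>h. f' x \<bullet> h)) (at x)) \<and> continuous_on UNIV f'"

lemma C1D: "C1 f f' ==> (f has_derivative (\<lambda>h. f' x \<bullet> h)) (at x)"
 and C1_continuous_grad: "C1 f f' ==> continuous_on UNIV f'" by (auto simp: C1_def)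

lemma C1_continuous: "C1 f f' ==> continuous_on UNIV f" using C1D by (metis continuous_at_imp_continuous_on has_derivative_continuous)

lemma C1_grad: "C1 f f' ==> grad f = f'" by (auto simp: grad_def fun_eq_iff frechet_derivative_at[OF C1D, symmetric] euclidean_representation)

lemma grad_inner: "b \<in> Basis ==> grad f x \<bullet> b = frechet_derivative f (at x) b"
 by (simp add: grad_def inner_sum_left inner_Basis if_distrib sum.delta cong: if_cong)

lemma C1_Ck:
 assumes "Ck (Suc 0) f" shows "C1 f (grad f)" unfolding C1_def
proof
 have "frechet_derivative f (at x) h = grad f x \<bullet> h" for x h
 proof -
  interpret linear "frechet_derivative f (at x)" using has_derivative_linear[OF Ck_SucD(1)[OF assms]] .
  have "frechet_derivative f (at x) (\<Sum>b\<in>Basis. (h \<bullet> b) *\<^sub>R b) = grad f x \<bullet> h"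
   by (simp only: sum scaleR) (simp add: grad_def inner_sum_left inner_sum_right inner_commute mult.commute)
  then show ?thesis by (simp add: euclidean_representation)
 qed
 then show "\<forall>x. (f has_derivative (\<lambda>h. grad f x \<bullet> h)) (at x)" using Ck_SucD(1)[OF assms] by (metis (no_types, lifting) ext)
 show "continuous_on UNIV (grad f)" unfolding grad_def[abs_def] using assms by (auto intro!: continuous_intros)
qed

lemma C1_mult:
 assumes "C1 f f'" "C1 g g'"
 shows "C1 (\<lambda>x. f x * g x) (\<lambda>x. f x *\<^sub>R g' x + g x *\<^sub>R f' x)" unfolding C1_def
proof (intro conjI allI)
 fix x
 have "(\<lambda>h. f x * (g' x \<bullet> h) + (f' x \<bullet> h) * g x) = (\<bullet>) (f x *\<^sub>R g' x + g x *\<^sub>R f' x)"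
  by (auto simp: inner_add_left)
 then show "((\<lambda>x. f x * g x) has_derivative (\<bullet>) (f x *\<^sub>R g' x + g x *\<^sub>R f' x)) (at x)"
  using has_derivative_mult[OF C1D[OF assms(1), of x] C1D[OF assms(2), of x]] by simp
next
 show "continuous_on UNIV (\<lambda>x. f x *\<^sub>R g' x + g x *\<^sub>R f' x)"
  by (intro continuous_intros C1_continuous[OF assms(1)] C1_continuous[OF assms(2)]
   C1_continuous_grad[OF assms(1)] C1_continuous_grad[OF assms(2)])
qed

lemma C1_compose:
 assumes "C1 f f'" "\<And>s. (F has_real_derivative F' s) (at s)" "continuous_on UNIV F'"
 shows "C1 (\<lambda>x. F (f x - k)) (\<lambda>x. F' (f x - k) *\<^sub>R f' x)" unfolding C1_def
proof (intro conjI allI)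
 fix x
 have "((\<lambda>x. f x - k) has_derivative (\<lambda>h. f' x \<bullet> h)) (at x)"
  using has_derivative_diff[OF C1D[OF assms(1), of x] has_derivative_const[of k]] by simp
 from has_derivative_compose[OF this, of F "(*) (F' (f x - k))"]
 show "((\<lambda>x. F (f x - k)) has_derivative (\<lambda>h. (F' (f x - k) *\<^sub>R f' x) \<bullet> h)) (at x)"
  using assms(2)[of "f x - k"] by (simp add: has_field_derivative_def)
next
 show "continuous_on UNIV (\<lambda>x. F' (f x - k) *\<^sub>R f' x)" using C1_continuous[OF assms(1)] C1_continuous_grad[OF assms(1)]
  by (auto intro!: continuous_intros continuous_on_compose2[OF assms(3)])
qed

lemma C1_affine:
 assumes "C1 f f'"
 shows "C1 (\<lambda>x. c * f (z + a *\<^sub>R x)) (\<lambda>x. (c * a) *\<^sub>R f' (z + a *\<^sub>R x))" unfolding C1_def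
proof (intro conjI allI)
 fix x
 have d: "((\<lambda>x. z + a *\<^sub>R x) has_derivative (\<lambda>h. a *\<^sub>R h)) (at x)" by (auto intro!: derivative_eq_intros)
 from has_derivative_mult_right[OF has_derivative_compose[OF d C1D[OF assms, of "z + a *\<^sub>R x"]], of c]
 show "((\<lambda>x. c * f (z + a *\<^sub>R x)) has_derivative (\<lambda>h. ((c * a) *\<^sub>R f' (z + a *\<^sub>R x)) \<bullet> h)) (at x)"
  by (simp add: mult.assoc)
next
 show "continuous_on UNIV (\<lambda>x. (c * a) *\<^sub>R f' (z + a *\<^sub>R x))"
  by (intro continuous_intros continuous_on_compose2[OF C1_continuous_grad[OF assms]]) auto
qed

lemma C1_grad_zero:
 assumes "C1 f f'" "open S" "x \<in> S" "\<And>y. y \<in> S ==> f y = c"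
 shows "f' x = 0"
proof -
 have "(f has_derivative (\<lambda>h. 0)) (at x)" by (rule has_derivative_transform_within_open[OF has_derivative_const[of c] assms(2,3)])
    (simp add: assms(4))
 then have "(\<lambda>h. f' x \<bullet> h) = (\<lambda>h. 0)" using has_derivative_unique[OF C1D[OF assms(1)]] by blast
 then show ?thesis by (metis inner_eq_zero_iff)
qed

lemma integrable_bounded_support:
 fixes f :: "'a::euclidean_space => 'b::euclidean_space"
 assumes "f \<in> \<B>" "\<And>x. norm (f x) <= B" "\<And>x. r < dist x0 x ==> f x = 0"
 shows "integrable lborel f"
proof (rule integrableI_bounded_set[where A = "cball x0 r" and B = B])
 show "emeasure lborel (cball x0 r) < \<infinity>" using emeasure_lborel_cball_finite by auto
qed (use assms in auto)

lemma uniformly_continuous_bounded_support: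
 fixes f :: "'a::euclidean_space => 'b::real_normed_vector"
 assumes "continuous_on UNIV f" "\<And>x. r < norm x ==> f x = 0"
 shows "uniformly_continuous_on UNIV f" unfolding uniformly_continuous_on_def
proof (intro allI impI)
 fix e :: real assume "0 < e"
 have "uniformly_continuous_on (cball 0 (r + 1)) f" by (rule compact_uniformly_continuous) (auto intro: continuous_on_subset[OF assms(1)])
 then obtain d where d: "d > 0" "\<And>x y. norm x <= r + 1 ==> norm y <= r + 1 ==> dist y x < d ==> dist (f y) (f x) < e"
  using \<open>0 < e\<close> unfolding uniformly_continuous_on_def by (metis mem_cball_0)
 have "dist (f y) (f x) < e" if "dist y x < min d 1" for x y
 proof (cases "norm x <= r + 1 \<and> norm y <= r + 1")
  case False
  then have "r < norm x" "r < norm y" using that norm_triangle_ineq2[of x y] norm_triangle_ineq2[of y x] by (auto simp: dist_norm norm_minus_commute)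
  then show ?thesis using assms(2) \<open>0 < e\<close> by simp
 qed (use d that in auto)
 then show "\<exists>d>0. \<forall>x\<in>UNIV. \<forall>y\<in>UNIV. dist y x < d --> dist (f y) (f x) < e"
  using d(1) by (intro exI[of _ "min d 1"]) auto
qed

lemma bounded_bounded_support:
 fixes f :: "'a::euclidean_space => 'b::real_normed_vector"
 assumes "continuous_on UNIV f" "\<And>x. r < norm x ==> f x = 0"
 obtains B where "B > 0" "\<And>x. norm (f x) <= B"
proof -
 have "compact (f ` cball 0 r)" by (rule compact_continuous_image) (auto intro: continuous_on_subset[OF assms(1)])
 then obtain B where "B > 0" "\<And>x. norm x <= r ==> norm (f x) <= B" using compact_imp_bounded bounded_pos by (metis image_eqI mem_cball_0)
 then show thesis using assms(2) that[of B] by (metis less_imp_le norm_zero not_le)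
qed

text \<open>Bounded support makes \<open>f'\<close> uniformly continuous; the mean value inequality
  for f minus its linear part at x then bounds the remainder uniformly in x, as differentiation
  under the integral sign requires.\<close>

lemma C1_uniform_remainder:
 assumes "C1 f f'" "\<And>x. r < norm x ==> f x = 0" "0 < e"
 shows "\<exists>d>0. \<forall>x h. norm h < d --> \<bar>f (x + h) - f x - f' x \<bullet> h\<bar> <= e * norm h"
proof -
 have z: "f' x = 0" if "r < norm x" for x by (rule C1_grad_zero[OF assms(1), of "- cball 0 r"]) (use that assms(2) in auto)
 have "uniformly_continuous_on UNIV f'" by (rule uniformly_continuous_bounded_support[OF C1_continuous_grad[OF assms(1)] z])
 then obtain d where d: "d > 0" "\<And>x y. dist y x < d ==> dist (f' y) (f' x) < e" using assms(3) unfolding uniformly_continuous_on_def by auto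
 have "\<bar>f (x + h) - f x - f' x \<bullet> h\<bar> <= e * norm h" if h: "norm h < d" for x h
 proof -
  have "norm ((\<lambda>z. f z - f' x \<bullet> z) (x + h) - (\<lambda>z. f z - f' x \<bullet> z) x) <= e * norm (x + h - x)"
  proof (rule differentiable_bound[of "ball x d"])
   fix z assume "z \<in> ball x d"
   then have "norm (f' z - f' x) < e" using d(2)[of x z] by (simp add: dist_norm norm_minus_commute)
   then show "onorm (\<lambda>h. (f' z - f' x) \<bullet> h) <= e"
    by (intro onorm_bound) (use \<open>0 < e\<close> in \<open>auto intro!: order_trans[OF Cauchy_Schwarz_ineq2] mult_right_mono\<close>)
   show "((\<lambda>z. f z - f' x \<bullet> z) has_derivative (\<lambda>h. (f' z - f' x) \<bullet> h)) (at z within ball x d)"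
    using has_derivative_diff[OF has_derivative_at_withinI[OF C1D[OF assms(1), of z]]
      bounded_linear_imp_has_derivative[OF bounded_linear_inner_right[of "f' x"]]] by (simp add: inner_diff_left)
  qed (use h d(1) in \<open>auto simp: dist_norm\<close>)
  then show ?thesis by (simp add: inner_add_right algebra_simps)
 qed
 then show ?thesis using d(1) by blast
qed

lemma lborel_integral_affine:
 fixes f :: "'a::euclidean_space => 'b::euclidean_space"
 assumes [measurable]: "f \<in> \<B>" and "c \<noteq> 0"
 shows "(LINT x|lborel. f x) = \<bar>c\<bar> ^ DIM('a) *\<^sub>R (LINT x|lborel. f (t + c *\<^sub>R x))"
 by (subst lborel_affine[OF \<open>c \<noteq> 0\<close>, of t]) (simp add: integral_density integral_distr)

lemma lborel_nn_integral_affine: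
 fixes f :: "'a::euclidean_space => ennreal"
 assumes [measurable]: "f \<in> \<B>" and "c \<noteq> 0"
 shows "(\<integral>\<^sup>+x. f x \<partial>lborel) = ennreal (\<bar>c\<bar> ^ DIM('a)) * (\<integral>\<^sup>+x. f (t + c *\<^sub>R x) \<partial>lborel)"
 by (subst lborel_affine[OF \<open>c \<noteq> 0\<close>, of t]) (simp add: nn_integral_density nn_integral_distr nn_integral_cmult)

lemma lborel_nn_integral_shift:
 fixes f :: "'a::euclidean_space => ennreal"
 assumes [measurable]: "f \<in> \<B>"
 shows "(\<integral>\<^sup>+x. f (x + t) \<partial>lborel) = (\<integral>\<^sup>+x. f x \<partial>lborel)"
 using lborel_nn_integral_affine[of f 1 t] by (simp add: add.commute)

section \<open>Convolution with compactly supported kernels\<close>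

lemma conv_continuous:
 fixes K :: "'a::euclidean_space => 'b::euclidean_space"
 assumes [measurable]: "m \<in> \<B>" and B: "\<And>x. \<bar>m x\<bar> <= B"
  and K: "continuous_on UNIV K" "\<And>x. r < norm x ==> K x = 0"
 shows "integrable lborel (\<lambda>z. m z *\<^sub>R K (z - x))"
  and "continuous_on UNIV (\<lambda>x. LINT z|lborel. m z *\<^sub>R K (z - x))"
proof -
 have [measurable]: "K \<in> \<B>" by (rule borel_measurable_continuous_onI[OF K(1)])
 obtain D where D: "D > 0" "\<And>x. norm (K x) <= D" using bounded_bounded_support[OF K] by blast
 have B0: "B \<ge> 0" using B[of 0] by linarith
 show int: "integrable lborel (\<lambda>z. m z *\<^sub>R K (z - x))" for x by (rule integrable_bounded_support[of _ "B * D" r x])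
    (use B D B0 K(2) in \<open>auto intro!: mult_mono simp: dist_norm norm_minus_commute\<close>)
 show "continuous_on UNIV (\<lambda>x. LINT z|lborel. m z *\<^sub>R K (z - x))"
 proof (rule continuous_at_imp_continuous_on, intro ballI, rule continuous_at_sequentiallyI)
  fix x :: 'a and u :: "nat => 'a" assume u: "u \<longlonglongrightarrow> x"
  then obtain R where R: "\<And>n. norm (u n) <= R" using convergent_imp_Bseq[of u] by (auto simp: convergent_def Bseq_def)
  show "(\<lambda>n. LINT z|lborel. m z *\<^sub>R K (z - u n)) \<longlonglongrightarrow> (LINT z|lborel. m z *\<^sub>R K (z - x))"
  proof (rule integral_dominated_convergence[where w = "\<lambda>z. B * D * indicator (cball 0 (r + R)) z"])
   have "emeasure lborel (cball (0::'a) (r + R)) < \<infinity>" using emeasure_lborel_cball_finite by auto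
   then show "integrable lborel (\<lambda>z. B * D * indicator (cball (0::'a) (r + R)) z)"
    by (intro integrable_mult_right integrable_real_indicator) auto
   have "(\<lambda>n. K (z - u n)) \<longlonglongrightarrow> K (z - x)" for z
    by (rule continuous_on_tendsto_compose[OF K(1)]) (auto intro!: tendsto_intros u)
   then show "AE z in lborel. (\<lambda>n. m z *\<^sub>R K (z - u n)) \<longlonglongrightarrow> m z *\<^sub>R K (z - x)"
    by (auto intro!: tendsto_intros)
   show "AE z in lborel. norm (m z *\<^sub>R K (z - u n)) <= B * D * indicator (cball 0 (r + R)) z" for n
   proof (intro AE_I2)
    fix z
    show "norm (m z *\<^sub>R K (z - u n)) <= B * D * indicator (cball 0 (r + R)) z"
    proof (cases "norm z <= r + R")
     case False
     then have "r < norm (z - u n)" using R[of n] norm_triangle_ineq2[of z "u n"] by linarith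
     then show ?thesis using K(2) B0 D by simp
    qed (use B D B0 in \<open>auto intro!: mult_mono\<close>)
   qed
  qed auto
 qed
qed

text \<open>Differentiation under the integral, using the uniform remainder of the kernel. The minus
  sign stems from the convention \<open>K (z - x)\<close>, in which x enters reflected.\<close>

lemma C1_conv:
 fixes K :: "'a::euclidean_space => real"
 assumes [measurable]: "m \<in> \<B>" and B: "\<And>x. \<bar>m x\<bar> <= B"
  and K: "C1 K K'" "\<And>x. r < norm x ==> K x = 0"
 shows "C1 (\<lambda>x. LINT z|lborel. m z * K (z - x)) (\<lambda>x. - (LINT z|lborel. m z *\<^sub>R K' (z - x)))"
proof -
 have z: "K' x = 0" if "r < norm x" for x by (rule C1_grad_zero[OF K(1), of "- cball 0 r"]) (use that K(2) in auto)
 note c' = conv_continuous[OF assms(1) B C1_continuous_grad[OF K(1)] z]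
 have c: "integrable lborel (\<lambda>z. m z * K (z - x))" for x using conv_continuous(1)[OF assms(1) B C1_continuous[OF K(1)] K(2)] by simp
 have [measurable]: "K \<in> \<B>" "K' \<in> \<B>"
  by (auto intro!: borel_measurable_continuous_onI C1_continuous[OF K(1)] C1_continuous_grad[OF K(1)])
 have B0: "B \<ge> 0" using B[of 0] by linarith
 show ?thesis unfolding C1_def
 proof (intro conjI allI)
  show "continuous_on UNIV (\<lambda>x. - (LINT z|lborel. m z *\<^sub>R K' (z - x)))" using c'(2) by (intro continuous_intros) auto
  fix x
  show "((\<lambda>x. LINT z|lborel. m z * K (z - x)) has_derivative
      (\<bullet>) (- (LINT z|lborel. m z *\<^sub>R K' (z - x)))) (at x)"
   unfolding has_derivative_at_alt
  proof (intro conjI allI impI)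
   show "bounded_linear ((\<bullet>) (- (LINT z|lborel. m z *\<^sub>R K' (z - x))))" by (rule bounded_linear_inner_right)
   fix e :: real assume e: "0 < e"
   \<comment> \<open>For steps shorter than 1 the remainder vanishes off
     \<open>cball x (r + 1)\<close>, so its integral is at most B V times its supremum; the
     tolerance is divided by B V + 1 to keep the denominator positive.\<close>
   define V where "V = measure lborel (cball x (r + 1))"
   have V: "0 <= V" by (simp add: V_def)
   have pos: "0 < e / (B * V + 1)" using e B0 V by (simp add: add_nonneg_pos)
   from C1_uniform_remainder[OF K(1) K(2) pos]
   obtain d where d: "d > 0" "\<forall>x h. norm h < d --> \<bar>K (x + h) - K x - K' x \<bullet> h\<bar> <= e / (B * V + 1) * norm h" by blast
   have "\<bar>(LINT z|lborel. m z * K (z - y)) - (LINT z|lborel. m z * K (z - x)) -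
      (- (LINT z|lborel. m z *\<^sub>R K' (z - x))) \<bullet> (y - x)\<bar> <= e * norm (y - x)"
    if y: "norm (y - x) < min d 1" for y
   proof -
    let ?g = "\<lambda>z. m z * (K ((z - x) + (x - y)) - K (z - x) - K' (z - x) \<bullet> (x - y))"
    have "(LINT z|lborel. m z *\<^sub>R K' (z - x)) \<bullet> (y - x) = (LINT z|lborel. (m z *\<^sub>R K' (z - x)) \<bullet> (y - x))"
     by (rule integral_inner_left[symmetric]) (rule c'(1))
    then have "(LINT z|lborel. m z * K (z - y)) - (LINT z|lborel. m z * K (z - x)) -
      (- (LINT z|lborel. m z *\<^sub>R K' (z - x))) \<bullet> (y - x) =
      (LINT z|lborel. m z * K (z - y)) - (LINT z|lborel. m z * K (z - x)) +
      (LINT z|lborel. (m z *\<^sub>R K' (z - x)) \<bullet> (y - x))"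
     by simp
    also have "\<dots> = (LINT z|lborel. ?g z)"
    proof -
     have "?g = (\<lambda>z. m z * K (z - y) - m z * K (z - x) + (m z *\<^sub>R K' (z - x)) \<bullet> (y - x))"
      by (auto simp: algebra_simps inner_diff_right)
     then show ?thesis using c[of x] c[of y] integrable_inner_left[OF c'(1)[where x = x], of "y - x"] by simp
    qed
    also have "\<bar>\<dots>\<bar> <= (LINT z|lborel. B * (e / (B * V + 1) * norm (x - y)) * indicator (cball x (r + 1)) z)"
    proof (rule integral_abs_bound_integral)
     have "emeasure lborel (cball x (r + 1)) < \<infinity>" using emeasure_lborel_cball_finite by auto
     then show "integrable lborel (\<lambda>z. B * (e / (B * V + 1) * norm (x - y)) * indicator (cball x (r + 1)) z)"
      by (intro integrable_mult_right integrable_real_indicator) auto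
     have bd: "norm (?g z) <= B * (e / (B * V + 1) * norm (x - y)) * indicator (cball x (r + 1)) z" for z
     proof (cases "dist x z <= r + 1")
      case True
      have "\<bar>m z\<bar> * \<bar>K ((z - x) + (x - y)) - K (z - x) - K' (z - x) \<bullet> (x - y)\<bar> <= B * (e / (B * V + 1) * norm (x - y))"
       using y by (intro mult_mono B d(2)[rule_format] B0) (auto simp: norm_minus_commute)
      then show ?thesis using True by (simp add: abs_mult)
     next
      case False
      then have "r + 1 < norm (z - x)" by (simp add: dist_norm norm_minus_commute)
      moreover from this have "r < norm ((z - x) + (x - y))" using y norm_diff_ineq[of "z - x" "x - y"] by (simp add: norm_minus_commute)
      ultimately show ?thesis using K(2) z False by simp
     qed
     then show "\<bar>?g z\<bar> <= B * (e / (B * V + 1) * norm (x - y)) * indicator (cball x (r + 1)) z" for z by simp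
     let ?C = "B * (e / (B * V + 1) * norm (x - y))"
     have C: "0 <= ?C" using B0 V e by simp
     show "integrable lborel ?g"
     proof (rule integrable_bounded_support)
      show "norm (?g z) <= ?C" for z using bd[of z] C by (cases "z \<in> cball x (r + 1)") auto
      show "?g z = 0" if "r + 1 < dist x z" for z using bd[of z] that by simp
     qed measurable
    qed
    also have "\<dots> = B * (e / (B * V + 1) * norm (x - y)) * V" by (simp add: V_def)
    also have "\<dots> = (B * V / (B * V + 1)) * (e * norm (x - y))" by simp
    also have "\<dots> <= 1 * (e * norm (x - y))" using B0 V e by (intro mult_right_mono) (auto simp: divide_le_eq add_nonneg_pos)
    finally show ?thesis by (simp add: norm_minus_commute)
   qed
   then show "\<exists>d>0. \<forall>y. norm (y - x) < d -->
      norm ((LINT z|lborel. m z * K (z - y)) - (LINT z|lborel. m z * K (z - x)) -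
       (- (LINT z|lborel. m z *\<^sub>R K' (z - x))) \<bullet> (y - x)) <= e * norm (y - x)"
    using d(1) by (intro exI[of _ "min d 1"]) auto
  qed
 qed
qed

lemma Ck_conv:
 fixes K :: "'a::euclidean_space => real"
 assumes m: "m \<in> \<B>" and B: "\<And>x. \<bar>m x\<bar> <= B"
  and K: "\<And>k. Ck k K" "\<And>x. r < norm x ==> K x = 0"
 shows "Ck k (\<lambda>x. LINT z|lborel. m z * K (z - x))" using K
proof (induction k arbitrary: K)
 case 0
 show ?case using conv_continuous(2)[OF m B Ck_continuous[OF 0(1)] 0(2)] by simp
next
 case (Suc k)
 have C: "C1 K (grad K)" using Suc.prems(1) by (rule C1_Ck)
 note d = C1_conv[OF m B C Suc.prems(2)]
 have z: "grad K x = 0" if "r < norm x" for x by (rule C1_grad_zero[OF C, of "- cball 0 r"]) (use that Suc.prems(2) in auto)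
 show ?case
 proof (rule Ck_SucI[where f' = "\<lambda>x h. (- (LINT z|lborel. m z *\<^sub>R grad K (z - x))) \<bullet> h"])
  show "((\<lambda>x. LINT z|lborel. m z * K (z - x)) has_derivative
    (\<lambda>h. (- (LINT z|lborel. m z *\<^sub>R grad K (z - x))) \<bullet> h)) (at x)" for x
   by (rule C1D[OF d])
  fix b :: 'a assume b: "b \<in> Basis"
  have "Ck k (\<lambda>x. LINT z|lborel. m z * (- 1 * frechet_derivative K (at (z - x)) b))"
  proof (rule Suc.IH)
   show "Ck j (\<lambda>x. - 1 * frechet_derivative K (at x) b)" for j using Suc.prems(1)[of "Suc j"] b by (intro Ck_mult Ck_const) auto
   show "- 1 * frechet_derivative K (at x) b = 0" if "r < norm x" for x using z[OF that] grad_inner[OF b, of K x] by simp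
  qed
  also have "(\<lambda>x. LINT z|lborel. m z * (- 1 * frechet_derivative K (at (z - x)) b)) =
    (\<lambda>x. - (LINT z|lborel. m z *\<^sub>R grad K (z - x)) \<bullet> b)"
  proof
   fix x
   have "(LINT z|lborel. m z *\<^sub>R grad K (z - x)) \<bullet> b = (LINT z|lborel. (m z *\<^sub>R grad K (z - x)) \<bullet> b)"
    by (rule integral_inner_left[symmetric]) (rule conv_continuous(1)[OF m B C1_continuous_grad[OF C] z])
   then show "(LINT z|lborel. m z * (- 1 * frechet_derivative K (at (z - x)) b)) =
     - (LINT z|lborel. m z *\<^sub>R grad K (z - x)) \<bullet> b"
    by (simp add: grad_inner[OF b])
  qed
  finally show "Ck k (\<lambda>x. - (LINT z|lborel. m z *\<^sub>R grad K (z - x)) \<bullet> b)" .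
 qed
qed

section \<open>Mollifiers and cutoff functions\<close>

definition moll :: "'a::euclidean_space => real" where
 "moll = (SOME \<rho>. (\<forall>k. Ck k \<rho>) \<and> (\<forall>x. 0 <= \<rho> x) \<and> (\<forall>x. 1 <= norm x --> \<rho> x = 0) \<and> integral\<^sup>L lborel \<rho> = 1)"

lemma moll: "Ck k moll" "0 <= moll x" "1 <= norm x ==> moll x = 0" "integral\<^sup>L lborel moll = 1"
 using someI_ex[OF ex_mollifier, folded moll_def] by auto

text \<open>The summand 0 keeps the affine shape \<open>z + a *\<^sub>R x\<close> on which
  \<open>Ck_affine\<close> and \<open>C1_affine\<close> match.\<close>

definition mollr :: "real => 'a::euclidean_space => real" where
 "mollr e z = inverse e ^ DIM('a) * moll (0 + inverse e *\<^sub>R z)"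

lemma mollr_nonneg: "0 < e ==> 0 <= mollr e z" by (simp add: mollr_def moll)

lemma mollr_zero: "0 < e ==> e <= norm z ==> mollr e z = 0" by (simp add: mollr_def moll(3) field_simps)

lemma Ck_mollr: "Ck k (mollr e)" unfolding mollr_def by (intro Ck_mult Ck_const Ck_affine moll)

lemma continuous_mollr: "continuous_on UNIV (mollr e)" using Ck_continuous Ck_mollr by blast

lemma measurable_mollr [measurable]: "mollr e \<in> \<B>" by (rule borel_measurable_continuous_onI[OF continuous_mollr])

lemma integrable_mollr: "0 < e ==> integrable lborel (\<lambda>z. mollr e (z - x))"
 using conv_continuous(1)[of "\<lambda>_. 1" 1 "mollr e" e x, OF _ _ continuous_mollr mollr_zero] by (auto simp: less_imp_le)

lemma integral_mollr:
 assumes "0 < e" shows "(LINT z|lborel. mollr e (z - x :: 'a::euclidean_space)) = 1"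
proof -
 have "(LINT z|lborel. mollr e (z - x)) = \<bar>e\<bar> ^ DIM('a) *\<^sub>R (LINT z|lborel. mollr e (x + e *\<^sub>R z - x))"
  by (rule lborel_integral_affine) (use assms in auto)
 also have "\<dots> = (LINT z|lborel. moll (z::'a))" using assms by (simp add: mollr_def field_simps)
 finally show ?thesis by (simp add: moll)
qed

lemma nn_integral_mollr:
 assumes "0 < e" shows "(\<integral>\<^sup>+z. ennreal (mollr e (z - x :: 'a::euclidean_space)) \<partial>lborel) = 1"
 by (subst nn_integral_eq_integral) (auto simp: integral_mollr integrable_mollr mollr_nonneg assms)

definition mol :: "real => ('a::euclidean_space => 'b::euclidean_space) => 'a => 'b" where
 "mol e f x = (LINT z|lborel. mollr e (z - x) *\<^sub>R f z)"

text \<open>\<open>mol e f x\<close> is an average of f over the ball of radius e about x, hence as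
  close to y as the averaged values are. Bounds, limits and supports of mollifications are read off
  from this.\<close>

lemma mol_close:
 assumes [measurable]: "f \<in> \<B>" and e: "0 < e"
  and c: "\<And>z. dist x z < e ==> norm (f z - y) <= \<eta>"
 shows "norm (mol e f x - y) <= \<eta>"
proof -
 have bd: "norm (mollr e (z - x) *\<^sub>R (f z - y)) <= mollr e (z - x) * \<eta>" for z
 proof (cases "dist x z < e")
  case True
  then show ?thesis using c mollr_nonneg[OF e, of "z - x"] by (simp add: mult_left_mono)
 next
  case False
  then show ?thesis using mollr_zero[OF e, of "z - x"] by (simp add: dist_norm norm_minus_commute)
 qed
 have i1: "integrable lborel (\<lambda>z. mollr e (z - x) * \<eta>)" using integrable_mollr[OF e, of x] by simp
 have i2: "integrable lborel (\<lambda>z. mollr e (z - x) *\<^sub>R (f z - y))"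
  by (rule Bochner_Integration.integrable_bound[OF i1]) (use bd in \<open>auto intro!: AE_I2 order_trans[OF _ abs_ge_self]\<close>)
 have i3: "integrable lborel (\<lambda>z. mollr e (z - x) *\<^sub>R y)" using integrable_mollr[OF e, of x] by simp
 have "mol e f x = (LINT z|lborel. mollr e (z - x) *\<^sub>R (f z - y) + mollr e (z - x) *\<^sub>R y)" unfolding mol_def by (simp add: algebra_simps)
 also have "\<dots> = (LINT z|lborel. mollr e (z - x) *\<^sub>R (f z - y)) + y"
  using i2 i3 integral_mollr[OF e, of x] integrable_mollr[OF e, of x] by simp
 finally have "norm (mol e f x - y) = norm (LINT z|lborel. mollr e (z - x) *\<^sub>R (f z - y))" by simp
 also have "\<dots> <= (LINT z|lborel. mollr e (z - x) * \<eta>)" using i2 i1 bd by (intro Bochner_Integration.integral_norm_bound_integral) auto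
 also have "\<dots> = \<eta>" using integral_mollr[OF e, of x] by simp
 finally show ?thesis .
qed

lemma mol_bound:
 assumes "f \<in> \<B>" "0 < e" "\<And>z. norm (f z) <= B"
 shows "norm (mol e f x) <= B" using mol_close[of f e x 0 B] assms by simp

lemma mol_tendsto:
 assumes f: "f \<in> \<B>" "isCont f x" and e: "\<And>j. 0 < e j" "e \<longlonglongrightarrow> 0"
 shows "(\<lambda>j. mol (e j) f x) \<longlonglongrightarrow> f x"
proof (rule tendstoI)
 fix \<epsilon> :: real assume "0 < \<epsilon>"
 then obtain d where d: "d > 0" "\<And>z. dist z x < d ==> dist (f z) (f x) < \<epsilon> / 2"
  using f(2) unfolding continuous_at_eps_delta by (metis half_gt_zero)
 have "\<forall>\<^sub>F j in sequentially. e j < d" by (rule order_tendstoD(2)[OF e(2) d(1)])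
 then show "\<forall>\<^sub>F j in sequentially. dist (mol (e j) f x) (f x) < \<epsilon>"
 proof eventually_elim
  case (elim j)
  have "norm (mol (e j) f x - f x) <= \<epsilon> / 2"
  proof (rule mol_close[OF f(1) e(1)])
   fix z assume "dist x z < e j"
   then show "norm (f z - f x) <= \<epsilon> / 2" using d(2)[of z] elim by (simp add: dist_norm norm_minus_commute)
  qed
  then show ?case using \<open>0 < \<epsilon>\<close> by (simp add: dist_norm)
 qed
qed

lemma C1_mol:
 fixes u :: "'a::euclidean_space => real"
 assumes "u \<in> \<B>" "\<And>x. \<bar>u x\<bar> <= B" "0 < e"
 shows "C1 (mol e u) (\<lambda>x. - (LINT z|lborel. u z *\<^sub>R grad (mollr e) (z - x)))"
 using C1_conv[OF assms(1,2) C1_Ck[OF Ck_mollr] mollr_zero[OF assms(3) less_imp_le]] by (simp add: mol_def[abs_def] mult.commute)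

lemma Ck_mol:
 fixes u :: "'a::euclidean_space => real"
 assumes "u \<in> \<B>" "\<And>x. \<bar>u x\<bar> <= B" "0 < e"
 shows "Ck k (mol e u)" using Ck_conv[OF assms(1,2) Ck_mollr mollr_zero[OF assms(3) less_imp_le]] by (simp add: mol_def[abs_def] mult.commute)

lemma grad_mollr: "grad (mollr e) z = (inverse e ^ DIM('a) * inverse e) *\<^sub>R grad moll (inverse e *\<^sub>R (z::'a::euclidean_space))"
proof -
 have "C1 (mollr e :: 'a => real) (\<lambda>x. (inverse e ^ DIM('a) * inverse e) *\<^sub>R grad moll (0 + inverse e *\<^sub>R x))"
  unfolding mollr_def by (rule C1_affine[OF C1_Ck[OF moll(1)]])
 from C1_grad[OF this] show ?thesis by simp
qed

lemma measurable_grad_mollr [measurable]: "grad (mollr e) \<in> \<B>"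
 by (rule borel_measurable_continuous_onI[OF C1_continuous_grad[OF C1_Ck[OF Ck_mollr]]])

lemma norm_mol_grad_bound:
 fixes u :: "'a::euclidean_space => real"
 assumes [measurable]: "u \<in> \<B>" and u: "\<And>x. \<bar>u x\<bar> <= 1" and e: "0 < e"
 shows "norm (LINT z|lborel. u z *\<^sub>R grad (mollr e) (z - x)) <= (LINT z|lborel. norm (grad moll (z::'a))) / e"
proof -
 have z: "grad moll y = 0" if "1 < norm y" for y :: 'a
  by (rule C1_grad_zero[OF C1_Ck[OF moll(1)], of "- cball 0 1" _ 0]) (use that in \<open>auto intro!: moll(3)\<close>)
 have c: "continuous_on UNIV (grad (moll :: 'a => real))" by (rule C1_continuous_grad[OF C1_Ck[OF moll(1)]])
 have [measurable]: "grad (moll :: 'a => real) \<in> \<B>" by (rule borel_measurable_continuous_onI[OF c])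
 have ze: "grad (mollr e) y = 0" if "e < norm y" for y :: 'a using z[of "inverse e *\<^sub>R y"] that e by (simp add: grad_mollr field_simps)
 have ce: "continuous_on UNIV (grad (mollr e :: 'a => real))" by (rule C1_continuous_grad[OF C1_Ck[OF Ck_mollr]])
 have i1: "integrable lborel (\<lambda>z. u z *\<^sub>R grad (mollr e) (z - x))" by (rule conv_continuous(1)[OF _ u ce ze]) auto
 have i2: "integrable lborel (\<lambda>z. norm (grad (mollr e) (z - x)))"
  using conv_continuous(1)[OF _ _ ce ze, where m = "\<lambda>_. 1" and B = 1 and x = x] by auto
 have "norm (LINT z|lborel. u z *\<^sub>R grad (mollr e) (z - x)) <= (LINT z|lborel. norm (grad (mollr e) (z - x)))"
  using i1 i2 u by (intro Bochner_Integration.integral_norm_bound_integral) (auto intro: mult_left_le_one_le)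
 also have "\<dots> = \<bar>e\<bar> ^ DIM('a) *\<^sub>R (LINT z|lborel. norm (grad (mollr e) (x + e *\<^sub>R z - x)))"
  by (rule lborel_integral_affine) (use e in auto)
 also have "\<dots> = (LINT z|lborel. norm (grad moll (z::'a))) / e" using e by (simp add: grad_mollr field_simps)
 finally show ?thesis .
qed

text \<open>The cutoff is the indicator of S mollified at scale \<delta>. Its gradient is bounded by
  the L^1 norm of the gradient of the rescaled mollifier, that is by a constant of the space divided
  by \<delta>; the constant is common to all S.\<close>

lemma ex_cutoff:
 "\<exists>C>0. \<forall>(S::'a::euclidean_space set) \<delta>. S \<in> sets borel \<and> 0 < \<delta> -->
   (\<exists>\<theta> \<theta>'. C1 \<theta> \<theta>' \<and> (\<forall>x. 0 <= \<theta> x \<and> \<theta> x <= 1) \<and> (\<forall>x. ball x \<delta> \<subseteq> S --> \<theta> x = 1) \<and>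
    (\<forall>x. ball x \<delta> \<inter> S = {} --> \<theta> x = 0) \<and> (\<forall>x. norm (\<theta>' x) <= C / \<delta>))"
proof -
 define C where "C = (LINT z|lborel. norm (grad moll (z::'a))) + 1"
 have "C > 0" by (simp add: C_def add_nonneg_pos)
 moreover have "\<exists>\<theta> \<theta>'. C1 \<theta> \<theta>' \<and> (\<forall>x. 0 <= \<theta> x \<and> \<theta> x <= 1) \<and> (\<forall>x. ball x \<delta> \<subseteq> S --> \<theta> x = 1) \<and>
    (\<forall>x. ball x \<delta> \<inter> S = {} --> \<theta> x = 0) \<and> (\<forall>x. norm (\<theta>' x) <= C / \<delta>)"
  if S [measurable]: "S \<in> sets borel" and d: "0 < \<delta>" for S :: "'a set" and \<delta>
 proof (intro exI conjI allI impI)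
  let ?u = "indicator S :: 'a => real"
  show "C1 (mol \<delta> ?u) (\<lambda>x. - (LINT z|lborel. ?u z *\<^sub>R grad (mollr \<delta>) (z - x)))"
   by (rule C1_mol[of _ 1]) (use d in \<open>auto simp: indicator_def\<close>)
  fix x
  show "mol \<delta> ?u x <= 1" using mol_bound[of ?u \<delta> 1 x] d by (simp add: indicator_def)
  show "0 <= mol \<delta> ?u x"
   unfolding mol_def by (rule Bochner_Integration.integral_nonneg) (use d in \<open>auto intro!: mult_nonneg_nonneg mollr_nonneg\<close>)
  show "mol \<delta> ?u x = 1" if "ball x \<delta> \<subseteq> S"
   using mol_close[of ?u \<delta> x 1 0] d that by (auto simp: indicator_def subset_iff)
  show "mol \<delta> ?u x = 0" if "ball x \<delta> \<inter> S = {}"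
   using mol_close[of ?u \<delta> x 0 0] d that by (auto simp: indicator_def disjoint_iff)
  have "norm (LINT z|lborel. ?u z *\<^sub>R grad (mollr \<delta>) (z - x)) <= (LINT z|lborel. norm (grad moll (z::'a))) / \<delta>"
   by (rule norm_mol_grad_bound) (use d in \<open>auto simp: indicator_def\<close>)
  also have "\<dots> <= C / \<delta>" using d by (simp add: C_def divide_right_mono)
  finally show "norm (- (LINT z|lborel. ?u z *\<^sub>R grad (mollr \<delta>) (z - x))) <= C / \<delta>" by simp
 qed
 ultimately show ?thesis by blast
qed

text \<open>On a set of finite measure square integrability is stronger than integrability, by
  \<open>norm (G x) <= 1 + (norm (G x))^2\<close>.\<close>

lemma integrable_bounded_times_L2:
 fixes G :: "'a::euclidean_space => 'b::euclidean_space"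
 assumes [measurable]: "G \<in> \<B>" "\<phi> \<in> \<B>"
  and K: "compact K" "integrable lborel (\<lambda>x. indicator K x * (norm (G x))^2)"
  and \<phi>: "\<And>x. \<bar>\<phi> x\<bar> <= B" "\<And>x. x \<notin> K ==> \<phi> x = (0::real)"
 shows "integrable lborel (\<lambda>x. \<phi> x *\<^sub>R G x)"
proof (rule Bochner_Integration.integrable_bound)
 have [measurable]: "K \<in> sets borel" using K(1) by (simp add: borel_compact)
 have "emeasure lborel K < \<infinity>" using K(1) by (intro emeasure_bounded_finite compact_imp_bounded)
 then have "integrable lborel (\<lambda>x. indicator K x :: real)" by (intro integrable_real_indicator) auto
 then show "integrable lborel (\<lambda>x. B * (indicator K x + indicator K x * (norm (G x))^2))" using K(2) by simp
 have B0: "0 <= B" using \<phi>(1)[of 0] by linarith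
 show "AE x in lborel. norm (\<phi> x *\<^sub>R G x) <= norm (B * (indicator K x + indicator K x * (norm (G x))^2))"
 proof (intro AE_I2)
  fix x
  have "norm (G x) <= 1 + (norm (G x))^2"
   using zero_le_power2[of "norm (G x) - 1"] norm_ge_zero[of "G x"] by (simp add: power2_diff del: norm_ge_zero)
  then have "\<bar>\<phi> x\<bar> * norm (G x) <= B * (1 + (norm (G x))^2)" by (intro mult_mono \<phi>) (auto simp: B0)
  then show "norm (\<phi> x *\<^sub>R G x) <= norm (B * (indicator K x + indicator K x * (norm (G x))^2))"
   using \<phi>(2)[of x] B0 by (cases "x \<in> K") auto
 qed
qed auto

section \<open>Approximation in L^2\<close>

lemma L2_dense:
 fixes f :: "'a::euclidean_space => 'b::euclidean_space"
 assumes [measurable]: "f \<in> \<B>" and f: "integrable lborel (\<lambda>x. (norm (f x))^2)" and "0 < \<epsilon>"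
 obtains c R where "continuous_on UNIV c" "\<And>x. R < norm x ==> c x = 0"
  "integrable lborel (\<lambda>x. (norm (f x - c x))^2)" "(LINT x|lborel. (norm (f x - c x))^2) < \<epsilon>"
proof -
 define F where "F n x = (if norm x <= real n \<and> norm (f x) <= real n then f x else 0)" for n x
 have [measurable]: "F n \<in> \<B>" for n unfolding F_def by measurable
 have "(\<lambda>n. LINT x|lborel. (norm (f x - F n x))^2) \<longlonglongrightarrow> (LINT x|(lborel::'a measure). (0::real))"
 proof (rule integral_dominated_convergence[OF _ _ f])
  have "(\<lambda>n. (norm (f x - F n x))^2) \<longlonglongrightarrow> 0" for x
  proof (rule tendsto_eventually, rule eventually_sequentiallyI[of "nat \<lceil>max (norm x) (norm (f x))\<rceil>"])
   fix n assume "nat \<lceil>max (norm x) (norm (f x))\<rceil> <= n"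
   then have "max (norm x) (norm (f x)) <= real n" by linarith
   then show "(norm (f x - F n x))^2 = 0" by (simp add: F_def)
  qed
  then show "AE x in lborel. (\<lambda>n. (norm (f x - F n x))^2) \<longlonglongrightarrow> 0" by simp
  show "AE x in lborel. norm ((norm (f x - F n x))^2) <= (norm (f x))^2" for n by (simp add: F_def)
 qed auto
 then have "\<forall>\<^sub>F n in sequentially. (LINT x|lborel. (norm (f x - F n x))^2) < \<epsilon> / 4"
  using \<open>0 < \<epsilon>\<close> by (intro order_tendstoD(2)) auto
 then have "\<forall>\<^sub>F n in sequentially. (LINT x|lborel. (norm (f x - F n x))^2) < \<epsilon> / 4 \<and> 1 <= n"
  by (intro eventually_conj eventually_ge_at_top)
 then obtain n where n: "(LINT x|lborel. (norm (f x - F n x))^2) < \<epsilon> / 4" "1 <= n" using eventually_happens'[OF sequentially_bot] by blast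
 have "F n \<in> borel_measurable (lebesgue_on UNIV)" by (simp add: lebesgue_on_UNIV_eq measurable_completion)
 then have "F n measurable_on UNIV" by (subst measurable_on_iff_borel_measurable) auto
 then obtain N g where N: "negligible N" and g: "\<And>i. continuous_on UNIV (g i)"
  "\<And>x. x \<notin> N ==> (\<lambda>i. g i x) \<longlonglongrightarrow> F n x" unfolding measurable_on_def by auto
 \<comment> \<open>\<open>th\<close> cuts off between the radii n and n + 1, and \<open>cl\<close>
   is the radial retraction onto the ball of radius n. Together they leave \<open>F n\<close>
   unchanged and give the continuous approximants a common bound and support, so that dominated
   convergence applies.\<close>
 define th where "th x = max 0 (min 1 (real n + 1 - norm x))" for x :: 'a
 define cl where "cl y = (real n / max (real n) (norm y)) *\<^sub>R y" for y :: 'b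
 define c where "c i x = th x *\<^sub>R cl (g i x)" for i x
 have cl_le: "norm (cl y) <= real n" for y using n(2) by (auto simp: cl_def divide_le_eq max_def mult.commute)
 have cl_cont: "continuous_on UNIV cl" unfolding cl_def using n(2) by (intro continuous_intros) auto
 have c_cont: "continuous_on UNIV (c i)" for i
  unfolding c_def th_def using continuous_on_compose2[OF cl_cont g(1)[of i]] by (intro continuous_intros) auto
 have [measurable]: "c i \<in> \<B>" for i by (rule borel_measurable_continuous_onI[OF c_cont])
 have c_supp: "c i x = 0" if "real n + 1 < norm x" for i x using that by (simp add: c_def th_def)
 have c_le: "norm (c i x) <= real n" for i x using mult_mono[of "\<bar>th x\<bar>" 1 "norm (cl (g i x))" "real n"] cl_le by (simp add: c_def th_def)
 have F_le: "norm (F n x) <= real n" for x by (simp add: F_def)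
 have F_supp: "F n x = 0" if "real n + 1 < norm x" for x using that by (simp add: F_def)
 have bd: "(norm (F n x - c i x))^2 <= (2 * real n)^2 * indicator (cball 0 (real n + 1)) x" for i x
 proof (cases "norm x <= real n + 1")
  case True
  have "norm (F n x - c i x) <= 2 * real n" using norm_triangle_ineq4[of "F n x" "c i x"] F_le[of x] c_le[of i x] by linarith
  from power_mono[OF this, of 2] show ?thesis using True by simp
 next
  case False
  then show ?thesis using F_supp[of x] c_supp[of x i] by simp
 qed
 have ic: "integrable lborel (\<lambda>x. (2 * real n)^2 * indicator (cball 0 (real n + 1)) x :: real)"
  using emeasure_lborel_cball_finite by (intro integrable_mult_right integrable_real_indicator) (auto simp: less_top)
 have "(\<lambda>i. LINT x|lborel. (norm (F n x - c i x))^2) \<longlonglongrightarrow> (LINT x|(lborel::'a measure). (0::real))"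
 proof (rule integral_dominated_convergence[OF _ _ ic])
  have "AE x in lebesgue. x \<notin> N" using N by (simp add: negligible_iff_null_sets AE_not_in)
  then have "AE x in lborel. x \<notin> N" by (simp add: AE_completion_iff)
  then show "AE x in lborel. (\<lambda>i. (norm (F n x - c i x))^2) \<longlonglongrightarrow> 0"
  proof eventually_elim
   case (elim x)
   have "(\<lambda>i. cl (g i x)) \<longlonglongrightarrow> cl (F n x)" by (rule continuous_on_tendsto_compose[OF cl_cont g(2)[OF elim]]) auto
   then have "(\<lambda>i. (norm (F n x - c i x))^2) \<longlonglongrightarrow> (norm (F n x - th x *\<^sub>R cl (F n x)))^2"
    unfolding c_def by (intro tendsto_intros)
   moreover have "th x *\<^sub>R cl (F n x) = F n x"
   proof (cases "norm x <= real n")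
    case True
    then show ?thesis using F_le[of x] n(2) by (simp add: th_def cl_def max_def)
   qed (simp add: F_def cl_def)
   ultimately show ?case by simp
  qed
  show "AE x in lborel. norm ((norm (F n x - c i x))^2) <= (2 * real n)^2 * indicator (cball 0 (real n + 1)) x" for i using bd by simp
 qed auto
 then have "\<forall>\<^sub>F i in sequentially. (LINT x|lborel. (norm (F n x - c i x))^2) < \<epsilon> / 4"
  using \<open>0 < \<epsilon>\<close> by (intro order_tendstoD(2)) auto
 then obtain i where i: "(LINT x|lborel. (norm (F n x - c i x))^2) < \<epsilon> / 4" using eventually_happens'[OF sequentially_bot] by blast
 have i1: "integrable lborel (\<lambda>x. (norm (f x - F n x))^2)" by (rule Bochner_Integration.integrable_bound[OF f]) (auto simp: F_def)
 have i2: "integrable lborel (\<lambda>x. (norm (F n x - c i x))^2)"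
  by (rule Bochner_Integration.integrable_bound[OF ic]) (use bd in \<open>auto intro: order_trans\<close>)
 have le: "(norm (f x - c i x))^2 <= 2 * (norm (f x - F n x))^2 + 2 * (norm (F n x - c i x))^2" for x
 proof -
  have "norm (f x - c i x) <= norm (f x - F n x) + norm (F n x - c i x)" using norm_triangle_ineq[of "f x - F n x" "F n x - c i x"] by simp
  then have "(norm (f x - c i x))^2 <= (norm (f x - F n x) + norm (F n x - c i x))^2" by (simp add: power_mono)
  also have "\<dots> <= 2 * (norm (f x - F n x))^2 + 2 * (norm (F n x - c i x))^2"
   using sum_squares_bound[of "norm (f x - F n x)" "norm (F n x - c i x)"] by (simp add: power2_sum)
  finally show ?thesis .
 qed
 have i12: "integrable lborel (\<lambda>x. 2 * (norm (f x - F n x))^2 + 2 * (norm (F n x - c i x))^2)" using i1 i2 by simp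
 have i3: "integrable lborel (\<lambda>x. (norm (f x - c i x))^2)"
  by (rule Bochner_Integration.integrable_bound[OF i12]) (use le in \<open>auto intro!: AE_I2\<close>)
 have "(LINT x|lborel. (norm (f x - c i x))^2) <= (LINT x|lborel. 2 * (norm (f x - F n x))^2 + 2 * (norm (F n x - c i x))^2)"
  by (rule integral_mono[OF i3 i12 le])
 also have "\<dots> < \<epsilon>" using i1 i2 n(1) i by simp
 finally show thesis using that[of "c i" "real n + 1"] c_cont c_supp i3 by blast
qed

lemma integrable_mollr_L2:
 fixes f :: "'a::euclidean_space => 'b::euclidean_space"
 assumes [measurable]: "f \<in> \<B>" and f: "integrable lborel (\<lambda>x. (norm (f x))^2)" and e: "0 < e"
 shows "integrable lborel (\<lambda>z. mollr e (z - x) *\<^sub>R f z)"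
proof -
 obtain B where B: "\<And>x::'a. norm (mollr e x :: real) <= B"
  using bounded_bounded_support[OF continuous_mollr mollr_zero[OF e less_imp_le]] by metis
 show ?thesis
 proof (rule integrable_bounded_times_L2[where K = "cball x e" and B = B])
  show "integrable lborel (\<lambda>x'. indicator (cball x e) x' * (norm (f x'))^2)"
   by (rule Bochner_Integration.integrable_bound[OF f]) (auto simp: indicator_def)
  show "mollr e (z - x) = 0" if "z \<notin> cball x e" for z using that mollr_zero[OF e, of "z - x"] by (simp add: dist_norm norm_minus_commute)
 qed (use B in auto)
qed

text \<open>Cauchy-Schwarz with respect to the probability density \<open>mollr e\<close>, whose
  square root is split off, followed by Tonelli. Where the averaged function is not integrable,
  \<open>mol\<close> is 0 and the pointwise bound is trivial.\<close>

lemma mol_L2_le: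
 fixes f :: "'a::euclidean_space => 'b::euclidean_space"
 assumes [measurable]: "f \<in> \<B>" and e: "0 < e"
 shows "(\<integral>\<^sup>+x. ennreal ((norm (mol e f x))^2) \<partial>lborel) <= (\<integral>\<^sup>+x. ennreal ((norm (f x))^2) \<partial>lborel)"
proof -
 have pt: "ennreal ((norm (mol e f x))^2) <= (\<integral>\<^sup>+z. ennreal (mollr e (z - x)) * ennreal ((norm (f z))^2) \<partial>lborel)" for x
 proof -
  have "ennreal (norm (mol e f x)) <= (\<integral>\<^sup>+z. ennreal (norm (mollr e (z - x) *\<^sub>R f z)) \<partial>lborel)"
  proof (cases "integrable lborel (\<lambda>z. mollr e (z - x) *\<^sub>R f z)")
   case True
   then show ?thesis unfolding mol_def by (rule integral_norm_bound_ennreal)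
  qed (simp add: mol_def not_integrable_integral_eq)
  also have "\<dots> = (\<integral>\<^sup>+z. ennreal (sqrt (mollr e (z - x))) * ennreal (sqrt (mollr e (z - x)) * norm (f z)) \<partial>lborel)"
   by (intro nn_integral_cong) (simp add: ennreal_mult'[symmetric] mollr_nonneg[OF e] mult.assoc[symmetric])
  finally have "(ennreal (norm (mol e f x)))^2 <= \<dots>^2" by (rule power_mono) auto
  also have "\<dots> <= (\<integral>\<^sup>+z. (ennreal (sqrt (mollr e (z - x))))^2 \<partial>lborel) *
    (\<integral>\<^sup>+z. (ennreal (sqrt (mollr e (z - x)) * norm (f z)))^2 \<partial>lborel)"
   by (rule Cauchy_Schwarz_nn_integral) auto
  also have "(\<integral>\<^sup>+z. (ennreal (sqrt (mollr e (z - x))))^2 \<partial>lborel) = 1"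
   using nn_integral_mollr[OF e, of x] by (simp add: ennreal_power mollr_nonneg[OF e])
  also have "(\<integral>\<^sup>+z. (ennreal (sqrt (mollr e (z - x)) * norm (f z)))^2 \<partial>lborel) =
    (\<integral>\<^sup>+z. ennreal (mollr e (z - x)) * ennreal ((norm (f z))^2) \<partial>lborel)"
   by (intro nn_integral_cong) (simp add: ennreal_power power_mult_distrib mollr_nonneg[OF e] ennreal_mult')
  finally show ?thesis by (simp add: ennreal_power)
 qed
 have "(\<integral>\<^sup>+x. ennreal ((norm (mol e f x))^2) \<partial>lborel) \<le>
   (\<integral>\<^sup>+x. \<integral>\<^sup>+z. ennreal (mollr e (z - x)) * ennreal ((norm (f z))^2) \<partial>lborel \<partial>lborel)"
  by (rule nn_integral_mono) (rule pt)
 also have "\<dots> = (\<integral>\<^sup>+z. \<integral>\<^sup>+x. ennreal (mollr e (z - x)) * ennreal ((norm (f z))^2) \<partial>lborel \<partial>lborel)"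
  by (rule lborel_pair.Fubini') measurable
 also have "\<dots> = (\<integral>\<^sup>+z. ennreal ((norm (f z))^2) \<partial>lborel)"
 proof (intro nn_integral_cong)
  fix z :: 'a
  have "(\<integral>\<^sup>+x. ennreal (mollr e (z - x)) \<partial>lborel) = (\<integral>\<^sup>+x. ennreal (mollr e (x - 0 :: 'a)) \<partial>lborel)"
   using lborel_nn_integral_affine[of "\<lambda>x. ennreal (mollr e (z - x))" "-1" z] by simp
  then show "(\<integral>\<^sup>+x. ennreal (mollr e (z - x)) * ennreal ((norm (f z))^2) \<partial>lborel) = ennreal ((norm (f z))^2)"
   using nn_integral_mollr[OF e, of "0::'a"] by (simp add: nn_integral_multc)
 qed
 finally show ?thesis .
qed

lemma measurable_mol [measurable]:
 fixes f :: "'a::euclidean_space => 'b::euclidean_space"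
 assumes [measurable]: "f \<in> \<B>"
 shows "mol e f \<in> \<B>"
proof -
 have "(\<lambda>x. LINT z|lborel. mollr e (z - x) *\<^sub>R f z) \<in> borel_measurable (lborel :: 'a measure)"
  by (rule lborel.borel_measurable_lebesgue_integral) measurable
 then show ?thesis by (simp add: mol_def[abs_def])
qed

lemma norm_add3_square:
 fixes a b c :: "'a::real_inner"
 shows "(norm (a + b + c))^2 <= 3 * (norm a)^2 + 3 * (norm b)^2 + 3 * (norm c)^2"
proof -
 have "norm (a + b + c) <= norm a + norm b + norm c" using norm_triangle_ineq[of "a + b" c] norm_triangle_ineq[of a b] by linarith
 then have "(norm (a + b + c))^2 <= (norm a + norm b + norm c)^2" by (simp add: power_mono)
 also have "\<dots> <= 3 * (norm a)^2 + 3 * (norm b)^2 + 3 * (norm c)^2"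
  using sum_squares_bound[of "norm a" "norm b"] sum_squares_bound[of "norm a" "norm c"]
   sum_squares_bound[of "norm b" "norm c"] by (simp add: power2_eq_square algebra_simps)
 finally show ?thesis .
qed

lemma mol_L2_tendsto:
 fixes f :: "'a::euclidean_space => 'b::euclidean_space"
 assumes [measurable]: "f \<in> \<B>" and f: "integrable lborel (\<lambda>x. (norm (f x))^2)" and "0 < \<epsilon>"
 shows "\<exists>\<delta>>0. \<forall>e. 0 < e \<and> e < \<delta> --> (\<integral>\<^sup>+x. ennreal ((norm (mol e f x - f x))^2) \<partial>lborel) <= ennreal \<epsilon>"
proof -
 obtain c R where c: "continuous_on UNIV c" "\<And>x. R < norm x ==> c x = 0"
  "integrable lborel (\<lambda>x. (norm (f x - c x))^2)" "(LINT x|lborel. (norm (f x - c x))^2) < \<epsilon> / 12"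
  using L2_dense[OF assms(1) f, of "\<epsilon> / 12"] \<open>0 < \<epsilon>\<close> by auto
 have [measurable]: "c \<in> \<B>" by (rule borel_measurable_continuous_onI[OF c(1)])
 have u: "uniformly_continuous_on UNIV c" by (rule uniformly_continuous_bounded_support[OF c(1,2)])
 define V where "V = measure lborel (cball (0::'a) (R + 1))"
 \<comment> \<open>The uniform error \<eta> of the continuous part, squared and integrated over a
   set of volume V, costs at most \<epsilon> / 12; each of the three terms of
   \<open>norm_add3_square\<close> then contributes at most 3 \<epsilon> / 12.\<close>
 define \<eta> where "\<eta> = sqrt (\<epsilon> / (12 * (V + 1)))"
 have V: "0 <= V" by (simp add: V_def)
 have "0 < \<eta>" using \<open>0 < \<epsilon>\<close> V by (simp add: \<eta>_def)
 then obtain d where d: "d > 0" "\<And>x y. dist y x < d ==> dist (c y) (c x) < \<eta>" using u unfolding uniformly_continuous_on_def by auto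
 define r where "r x = f x - c x" for x
 have [measurable]: "r \<in> \<B>" unfolding r_def by measurable
 have Ir: "(\<integral>\<^sup>+x. ennreal ((norm (r x))^2) \<partial>lborel) <= ennreal (\<epsilon> / 12)"
  using c(3,4) by (subst nn_integral_eq_integral) (auto simp: r_def intro!: ennreal_leI)
 have "(\<integral>\<^sup>+x. ennreal ((norm (mol e f x - f x))^2) \<partial>lborel) <= ennreal \<epsilon>" if e: "0 < e" "e < min d 1" for e
 proof -
  have lin: "mol e f x = mol e r x + mol e c x" for x
  proof -
   have "integrable lborel (\<lambda>z. mollr e (z - x) *\<^sub>R r z)" by (rule integrable_mollr_L2) (use c(3) e in \<open>auto simp: r_def\<close>)
   moreover have "integrable lborel (\<lambda>x. (norm (c x))^2)"
    by (rule integrable_continuous_bounded_support[of _ "R + 1"]) (auto intro!: continuous_intros c(1) simp: c(2))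
   then have "integrable lborel (\<lambda>z. mollr e (z - x) *\<^sub>R c z)" by (rule integrable_mollr_L2[rotated]) (use e in auto)
   ultimately show ?thesis unfolding mol_def by (subst Bochner_Integration.integral_add[symmetric]) (auto simp: r_def algebra_simps)
  qed
  have cc: "(norm (mol e c x - c x))^2 <= \<eta>^2 * indicator (cball 0 (R + 1)) x" for x
  proof (cases "norm x <= R + 1")
   case True
   have "norm (mol e c x - c x) <= \<eta>"
    by (rule mol_close) (use e d(2)[of _ x] in \<open>auto simp: dist_norm norm_minus_commute less_imp_le\<close>)
   from power_mono[OF this, of 2] show ?thesis using True by simp
  next
   case False
   have "norm (mol e c x - 0) <= 0"
   proof (rule mol_close)
    fix z assume "dist x z < e"
    then have "R < norm z" using False e norm_triangle_ineq2[of x z] by (simp add: dist_norm)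
    then show "norm (c z - 0) <= 0" using c(2) by simp
   qed (use e in auto)
   then show ?thesis using False c(2)[of x] by simp
  qed
  have "(\<integral>\<^sup>+x. ennreal ((norm (mol e f x - f x))^2) \<partial>lborel) \<le>
    (\<integral>\<^sup>+x. (3 * ennreal ((norm (mol e r x))^2) + ennreal (3 * \<eta>^2) * indicator (cball 0 (R + 1)) x) + 3 * ennreal ((norm (r x))^2) \<partial>lborel)"
  proof (intro nn_integral_mono)
   fix x :: 'a
   have "mol e f x - f x = mol e r x + (mol e c x - c x) + (- r x)" by (simp add: lin r_def)
   then have "(norm (mol e f x - f x))^2 <= 3 * (norm (mol e r x))^2 + 3 * (norm (mol e c x - c x))^2 + 3 * (norm (r x))^2"
    using norm_add3_square[of "mol e r x" "mol e c x - c x" "- r x"] by simp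
   also have "\<dots> <= (3 * (norm (mol e r x))^2 + 3 * \<eta>^2 * indicator (cball 0 (R + 1)) x) + 3 * (norm (r x))^2" using cc[of x] by simp
   finally have "ennreal ((norm (mol e f x - f x))^2) <= ennreal ((3 * (norm (mol e r x))^2 + 3 * \<eta>^2 * indicator (cball 0 (R + 1)) x) + 3 * (norm (r x))^2)"
    by (rule ennreal_leI)
   then show "ennreal ((norm (mol e f x - f x))^2) <= (3 * ennreal ((norm (mol e r x))^2) + ennreal (3 * \<eta>^2) * indicator (cball 0 (R + 1)) x) + 3 * ennreal ((norm (r x))^2)"
    by (cases "norm x <= R + 1") (simp_all add: ennreal_mult')
  qed
  also have "\<dots> = 3 * (\<integral>\<^sup>+x. ennreal ((norm (mol e r x))^2) \<partial>lborel) + ennreal (3 * \<eta>^2) * emeasure lborel (cball (0::'a) (R + 1)) +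
    3 * (\<integral>\<^sup>+x. ennreal ((norm (r x))^2) \<partial>lborel)"
  proof -
   have [measurable]: "cball (0::'a) (R + 1) \<in> sets borel" by simp
   have m [measurable]: "(\<lambda>x. ennreal ((norm (mol e r x))^2)) \<in> borel_measurable lborel"
    "(\<lambda>x. ennreal ((norm (r x))^2)) \<in> borel_measurable lborel" by measurable
   have "(\<integral>\<^sup>+x. (3 * ennreal ((norm (mol e r x))^2) + ennreal (3 * \<eta>^2) * indicator (cball (0::'a) (R + 1)) x) + 3 * ennreal ((norm (r x))^2) \<partial>lborel) =
    (\<integral>\<^sup>+x. 3 * ennreal ((norm (mol e r x))^2) + ennreal (3 * \<eta>^2) * indicator (cball (0::'a) (R + 1)) x \<partial>lborel) + (\<integral>\<^sup>+x. 3 * ennreal ((norm (r x))^2) \<partial>lborel)"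
    by (rule nn_integral_add) measurable
   also have "(\<integral>\<^sup>+x. 3 * ennreal ((norm (mol e r x))^2) + ennreal (3 * \<eta>^2) * indicator (cball (0::'a) (R + 1)) x \<partial>lborel) =
    (\<integral>\<^sup>+x. 3 * ennreal ((norm (mol e r x))^2) \<partial>lborel) + (\<integral>\<^sup>+x. ennreal (3 * \<eta>^2) * indicator (cball (0::'a) (R + 1)) x \<partial>lborel)"
    by (rule nn_integral_add) measurable
   finally show ?thesis by (simp add: nn_integral_cmult[OF m(1)] nn_integral_cmult[OF m(2)] nn_integral_cmult_indicator)
  qed
  also have "\<dots> <= 3 * ennreal (\<epsilon> / 12) + ennreal (3 * \<eta>^2) * ennreal V + 3 * ennreal (\<epsilon> / 12)"
  proof (intro add_mono mult_left_mono)
   show "(\<integral>\<^sup>+x. ennreal ((norm (mol e r x))^2) \<partial>lborel) <= ennreal (\<epsilon> / 12)"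
    by (rule order_trans[OF mol_L2_le Ir]) (use e in auto)
   show "emeasure lborel (cball (0::'a) (R + 1)) <= ennreal V" using emeasure_lborel_cball_finite[of "0::'a" "R + 1"]
    by (subst emeasure_eq_ennreal_measure) (auto simp: V_def)
  qed (use Ir in auto)
  also have "\<dots> = ennreal (3 * (\<epsilon> / 12) + 3 * \<eta>^2 * V + 3 * (\<epsilon> / 12))"
   using \<open>0 < \<epsilon>\<close> V by (simp add: ennreal_mult'[symmetric] ennreal_plus[symmetric] del: ennreal_plus flip: ennreal_numeral)
  also have "\<dots> <= ennreal \<epsilon>"
  proof (rule ennreal_leI)
   have "\<eta>^2 * V = \<epsilon> / 12 * (V / (V + 1))" using \<open>0 < \<epsilon>\<close> V by (simp add: \<eta>_def field_simps)
   also have "\<dots> <= \<epsilon> / 12 * 1" using \<open>0 < \<epsilon>\<close> V by (intro mult_left_mono) auto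
   finally show "3 * (\<epsilon> / 12) + 3 * \<eta>^2 * V + 3 * (\<epsilon> / 12) <= \<epsilon>" using \<open>0 < \<epsilon>\<close> by simp
  qed
  finally show ?thesis .
 qed
 then show ?thesis using d(1) by (intro exI[of _ "min d 1"]) auto
qed

text \<open>The \<open>L\<^sup>1\<close> majorant makes the later passages to the limit instances of dominated convergence.\<close>

lemma mol_dominated_subsequence:
 fixes f :: "'a::euclidean_space => 'b::euclidean_space"
 assumes [measurable]: "f \<in> \<B>" and f: "integrable lborel (\<lambda>x. (norm (f x))^2)" and "0 < d"
 obtains e M where "\<And>j::nat. 0 < e j" "\<And>j. e j < d" "e \<longlonglongrightarrow> 0" "integrable lborel M"
  "AE x in lborel. (\<lambda>j. mol (e j) f x) \<longlonglongrightarrow> f x \<and> (\<forall>j. (norm (mol (e j) f x))^2 <= M x)"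
proof -
 have ex: "\<forall>j. \<exists>e. 0 < e \<and> e < d \<and> e < 1 / (real j + 1) \<and> (\<integral>\<^sup>+x. ennreal ((norm (mol e f x - f x))^2) \<partial>lborel) <= ennreal ((1/2) ^ j)"
 proof
  fix j
  obtain \<delta> where \<delta>: "\<delta> > 0" "\<And>e. 0 < e ==> e < \<delta> ==> (\<integral>\<^sup>+x. ennreal ((norm (mol e f x - f x))^2) \<partial>lborel) <= ennreal ((1/2) ^ j)"
   using mol_L2_tendsto[OF assms(1) f, of "(1/2) ^ j"] by auto
  have "0 < min (min \<delta> d) (1 / (real j + 1))" using \<delta>(1) \<open>0 < d\<close> by simp
  then obtain e where "0 < e" "e < min (min \<delta> d) (1 / (real j + 1))" using dense by blast
  then show "\<exists>e. 0 < e \<and> e < d \<and> e < 1 / (real j + 1) \<and> (\<integral>\<^sup>+x. ennreal ((norm (mol e f x - f x))^2) \<partial>lborel) <= ennreal ((1/2) ^ j)"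
   using \<delta>(2) by (intro exI[of _ e]) auto
 qed
 from choice[OF ex] obtain e where e': "\<forall>j. 0 < e j \<and> e j < d \<and> e j < 1 / (real j + 1) \<and>
  (\<integral>\<^sup>+x. ennreal ((norm (mol (e j) f x - f x))^2) \<partial>lborel) <= ennreal ((1/2) ^ j)"
  by (elim exE) (rule that)
 then have e: "\<And>j. 0 < e j" "\<And>j. e j < d" "\<And>j. e j < 1 / (real j + 1)"
  "\<And>j. (\<integral>\<^sup>+x. ennreal ((norm (mol (e j) f x - f x))^2) \<partial>lborel) <= ennreal ((1/2) ^ j)" by auto
 have e0: "e \<longlonglongrightarrow> 0"
 proof (rule tendsto_sandwich[OF _ _ tendsto_const])
  show "(\<lambda>j. 1 / (real j + 1)) \<longlonglongrightarrow> 0" using LIMSEQ_inverse_real_of_nat by (simp add: inverse_eq_divide add.commute)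
 qed (use e in \<open>auto intro!: eventuallyI less_imp_le\<close>)
 \<comment> \<open>The squared errors are summable in L^1 by the choice of the scales. Finiteness of
   their sum almost everywhere gives pointwise convergence and, at the same time, the
   majorant.\<close>
 define S where "S x = (\<Sum>j. ennreal ((norm (mol (e j) f x - f x))^2))" for x
 have [measurable]: "S \<in> \<B>" unfolding S_def by measurable
 have "(\<integral>\<^sup>+x. S x \<partial>lborel) = (\<Sum>j. \<integral>\<^sup>+x. ennreal ((norm (mol (e j) f x - f x))^2) \<partial>lborel)"
  unfolding S_def by (rule nn_integral_suminf) measurable
 also have "\<dots> <= (\<Sum>j. ennreal ((1/2) ^ j))" by (intro suminf_le e(4)) auto
 also have "\<dots> = ennreal 2" by (subst suminf_ennreal2) (auto simp: suminf_geometric)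
 finally have S: "(\<integral>\<^sup>+x. S x \<partial>lborel) < \<infinity>" using ennreal_less_top le_less_trans by (metis infinity_ennreal_def)
 then have fin: "AE x in lborel. S x \<noteq> \<infinity>" by (intro nn_integral_noteq_infinite) auto
 define M where "M x = 2 * (norm (f x))^2 + 2 * enn2real (S x)" for x
 have "integrable lborel (\<lambda>x. enn2real (S x))"
 proof (rule integrableI_bounded)
  have "(\<integral>\<^sup>+x. ennreal (norm (enn2real (S x))) \<partial>lborel) <= (\<integral>\<^sup>+x. S x \<partial>lborel)"
   by (intro nn_integral_mono) (simp add: ennreal_enn2real_if)
  then show "(\<integral>\<^sup>+x. ennreal (norm (enn2real (S x))) \<partial>lborel) < \<infinity>" using S by simp
 qed auto
 then have M: "integrable lborel M" unfolding M_def using f by simp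
 have "AE x in lborel. (\<lambda>j. mol (e j) f x) \<longlonglongrightarrow> f x \<and> (\<forall>j. (norm (mol (e j) f x))^2 <= M x)" using fin
 proof eventually_elim
  case (elim x)
  let ?a = "\<lambda>j. (norm (mol (e j) f x - f x))^2"
  have sm: "summable ?a" by (rule summable_suminf_not_top) (use elim in \<open>auto simp: S_def\<close>)
  have "?a \<longlonglongrightarrow> 0" by (rule summable_LIMSEQ_zero[OF sm])
  then have "(\<lambda>j. sqrt (?a j)) \<longlonglongrightarrow> sqrt 0" by (rule tendsto_real_sqrt)
  then have "(\<lambda>j. mol (e j) f x) \<longlonglongrightarrow> f x" by (subst LIM_zero_iff[symmetric]) (simp add: tendsto_norm_zero_iff)
  moreover have "(norm (mol (e j) f x))^2 <= M x" for j
  proof -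
   have "(\<Sum>i\<in>{j}. ennreal (?a i)) <= S x" unfolding S_def by (rule sum_le_suminf) (rule summableI, simp_all)
   then have "ennreal (?a j) <= S x" by (simp only: sum.insert sum.empty finite.emptyI empty_iff add_0_right not_False_eq_True)
   then have "enn2real (ennreal (?a j)) <= enn2real (S x)" by (rule enn2real_mono) (use elim in \<open>simp add: less_top\<close>)
   then have "?a j <= enn2real (S x)" by simp
   moreover have "(norm (mol (e j) f x))^2 <= 2 * ?a j + 2 * (norm (f x))^2"
   proof -
    have "norm (mol (e j) f x) <= norm (mol (e j) f x - f x) + norm (f x)" using norm_triangle_ineq[of "mol (e j) f x - f x" "f x"] by simp
    then have "(norm (mol (e j) f x))^2 <= (norm (mol (e j) f x - f x) + norm (f x))^2" by (simp add: power_mono)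
    also have "\<dots> <= 2 * ?a j + 2 * (norm (f x))^2"
     using sum_squares_bound[of "norm (mol (e j) f x - f x)" "norm (f x)"] by (simp add: power2_sum)
    finally show ?thesis .
   qed
   ultimately show ?thesis by (simp add: M_def)
  qed
  ultimately show ?case by blast
 qed
 then show thesis using that e(1,2) e0 M by blast
qed

section \<open>Differences of a C^1 function controlled by its gradient\<close>

lemma square_integral_le:
 fixes g :: "real => real"
 assumes "continuous_on {0..1} g"
 shows "(integral {0..1} g)^2 <= integral {0..1} (\<lambda>t. (g t)^2)"
proof -
 define c where "c = integral {0..1} g"
 have i: "g integrable_on {0..1}" "(\<lambda>t. (g t)^2) integrable_on {0..1}"
  by (auto intro!: integrable_continuous_interval continuous_intros assms)
 \<comment> \<open>The variance of g over the unit interval is nonnegative.\<close>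
 have "0 <= integral {0..1} (\<lambda>t. (g t - c)^2)" by (rule Henstock_Kurzweil_Integration.integral_nonneg)
   (auto intro!: integrable_continuous_interval continuous_intros assms)
 also have "(\<lambda>t. (g t - c)^2) = (\<lambda>t. (g t)^2 + c^2 - (2 * c) * g t)" by (auto simp: power2_diff)
 also have "integral {0..1} \<dots> = integral {0..1} (\<lambda>t. (g t)^2) + c^2 - 2 * c * integral {0..1} g"
  using i by (subst Henstock_Kurzweil_Integration.integral_diff Henstock_Kurzweil_Integration.integral_add,
    auto intro!: integrable_add integrable_on_mult_right)+
 finally show ?thesis by (simp add: c_def power2_eq_square)
qed

lemma C1_increment_le:
 assumes f: "C1 f f'"
 shows "ennreal ((f (x + h) - f x)^2) <= (\<integral>\<^sup>+t. indicator {0..1} t * ennreal ((norm h)^2 * (norm (f' (x + t *\<^sub>R h)))^2) \<partial>lborel)"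
proof -
 let ?g = "\<lambda>t. f' (x + t *\<^sub>R h) \<bullet> h"
 have cg: "continuous_on {0..1} (\<lambda>t. f' (x + t *\<^sub>R h))"
  by (rule continuous_on_compose2[OF C1_continuous_grad[OF f]]) (auto intro!: continuous_intros)
 have "(?g has_integral f (x + 1 *\<^sub>R h) - f (x + 0 *\<^sub>R h)) {0..1}"
 proof (rule fundamental_theorem_of_calculus)
  fix t :: real
  have "((\<lambda>t. x + t *\<^sub>R h) has_derivative (\<lambda>s. s *\<^sub>R h)) (at t within {0..1})" by (auto intro!: derivative_eq_intros)
  from has_derivative_compose[OF this C1D[OF f]]
  show "((\<lambda>t. f (x + t *\<^sub>R h)) has_vector_derivative ?g t) (at t within {0..1})" by (simp add: has_vector_derivative_def)
 qed auto
 then have "f (x + h) - f x = integral {0..1} ?g" by (simp add: integral_unique)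
 then have "(f (x + h) - f x)^2 <= integral {0..1} (\<lambda>t. (?g t)^2)"
  using square_integral_le[of ?g] continuous_on_inner[OF cg continuous_on_const] by simp
 also have "\<dots> <= integral {0..1} (\<lambda>t. (norm h)^2 * (norm (f' (x + t *\<^sub>R h)))^2)"
 proof (rule integral_le)
  fix t
  have "\<bar>?g t\<bar>^2 <= (norm (f' (x + t *\<^sub>R h)) * norm h)^2" by (rule power_mono[OF Cauchy_Schwarz_ineq2]) auto
  then show "(?g t)^2 <= (norm h)^2 * (norm (f' (x + t *\<^sub>R h)))^2" by (simp add: power_mult_distrib mult.commute)
 qed (auto intro!: integrable_continuous_interval continuous_intros cg)
 finally have "ennreal ((f (x + h) - f x)^2) <= ennreal (integral {0..1} (\<lambda>t. (norm h)^2 * (norm (f' (x + t *\<^sub>R h)))^2))"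
  by (rule ennreal_leI)
 also have "\<dots> = (\<integral>\<^sup>+t. indicator {0..1} t * ennreal ((norm h)^2 * (norm (f' (x + t *\<^sub>R h)))^2) \<partial>lborel)"
 proof -
  have c: "continuous_on UNIV (\<lambda>t. (norm h)^2 * (norm (f' (x + t *\<^sub>R h)))^2)"
   by (intro continuous_intros continuous_on_compose2[OF C1_continuous_grad[OF f]]) auto
  have "((\<lambda>t. (norm h)^2 * (norm (f' (x + t *\<^sub>R h)))^2) has_integral
    integral {0..1} (\<lambda>t. (norm h)^2 * (norm (f' (x + t *\<^sub>R h)))^2)) {0..1}"
   by (intro integrable_integral integrable_continuous_interval continuous_on_subset[OF c]) auto
  from nn_integral_has_integral_lebesgue[OF _ this]
  have "(\<integral>\<^sup>+t. ennreal (indicator {0..1} t * ((norm h)^2 * (norm (f' (x + t *\<^sub>R h)))^2)) \<partial>lborel) =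
    ennreal (integral {0..1} (\<lambda>t. (norm h)^2 * (norm (f' (x + t *\<^sub>R h)))^2))"
   by simp
  then show ?thesis by (simp add: indicator_mult_ennreal mult.commute)
 qed
 finally show ?thesis .
qed

lemma convex_between: "convex B ==> x \<in> B ==> x + h \<in> B ==> 0 <= t ==> t <= 1 ==> x + t *\<^sub>R h \<in> B"
 using convexD_alt[of B x "x + h" t] by (simp add: algebra_simps)

text \<open>The increment is integrated along the segment from x to x + h. Both indicators appear
  because convexity keeps the segment in B only if both ends lie there; Tonelli and translation
  invariance of \<open>lborel\<close> do the rest.\<close>

lemma C1_translation_estimate:
 assumes f: "C1 f f'" and B: "convex B" and [measurable]: "B \<in> sets borel"
 shows "(\<integral>\<^sup>+x. indicator B x * indicator B (x + h) * ennreal ((f (x + h) - f x)^2) \<partial>lborel) \<le>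
   ennreal ((norm h)^2) * (\<integral>\<^sup>+x. indicator B x * ennreal ((norm (f' x))^2) \<partial>lborel)"
proof -
 have [measurable]: "f' \<in> \<B>" "f \<in> \<B>" by (auto intro!: borel_measurable_continuous_onI C1_continuous_grad[OF f] C1_continuous[OF f])
 let ?F = "\<lambda>x t. indicator {0..1} t * (ennreal ((norm h)^2) * (indicator B (x + t *\<^sub>R h) * ennreal ((norm (f' (x + t *\<^sub>R h)))^2)))"
 have "(\<integral>\<^sup>+x. indicator B x * indicator B (x + h) * ennreal ((f (x + h) - f x)^2) \<partial>lborel) \<le>
   (\<integral>\<^sup>+x. \<integral>\<^sup>+t. ?F x t \<partial>lborel \<partial>lborel)"
 proof (intro nn_integral_mono)
  fix x
  show "indicator B x * indicator B (x + h) * ennreal ((f (x + h) - f x)^2) <= (\<integral>\<^sup>+t. ?F x t \<partial>lborel)"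
  proof (cases "x \<in> B \<and> x + h \<in> B")
   case True
   have "(\<integral>\<^sup>+t. indicator {0..1} t * ennreal ((norm h)^2 * (norm (f' (x + t *\<^sub>R h)))^2) \<partial>lborel) = (\<integral>\<^sup>+t. ?F x t \<partial>lborel)"
    using True convex_between[OF B] by (intro nn_integral_cong) (auto simp: indicator_def ennreal_mult')
   then show ?thesis using C1_increment_le[OF f, of x h] True by simp
  qed auto
 qed
 also have "\<dots> = (\<integral>\<^sup>+t. \<integral>\<^sup>+x. ?F x t \<partial>lborel \<partial>lborel)"
  by (rule pair_sigma_finite.Fubini') (auto intro!: pair_sigma_finite.intro lborel.sigma_finite_measure_axioms)
 also have "\<dots> = (\<integral>\<^sup>+t. indicator {0..1::real} t * (ennreal ((norm h)^2) * (\<integral>\<^sup>+x. indicator B x * ennreal ((norm (f' x))^2) \<partial>lborel)) \<partial>lborel)"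
 proof (intro nn_integral_cong)
  fix t :: real
  have "(\<integral>\<^sup>+x. ?F x t \<partial>lborel) = indicator {0..1} t * (ennreal ((norm h)^2) * (\<integral>\<^sup>+x. indicator B (x + t *\<^sub>R h) * ennreal ((norm (f' (x + t *\<^sub>R h)))^2) \<partial>lborel))"
   by (simp add: nn_integral_cmult)
  then show "(\<integral>\<^sup>+x. ?F x t \<partial>lborel) = indicator {0..1} t * (ennreal ((norm h)^2) * (\<integral>\<^sup>+x. indicator B x * ennreal ((norm (f' x))^2) \<partial>lborel))"
   using lborel_nn_integral_shift[of "\<lambda>x. indicator B x * ennreal ((norm (f' x))^2)" "t *\<^sub>R h"] by simp
 qed
 also have "\<dots> = ennreal ((norm h)^2) * (\<integral>\<^sup>+x. indicator B x * ennreal ((norm (f' x))^2) \<partial>lborel)"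
  by (subst nn_integral_multc) auto
 finally show ?thesis .
qed

section \<open>Weak gradients and energy estimates\<close>

text \<open>A Borel and globally bounded counterpart of \<open>has_weak_gradient\<close>. Test
  functions vanish off U, so the integrals extend over the whole space and the values of w and G off
  U do not enter them.\<close>

definition wgrad :: "'a::euclidean_space set => ('a => real) => ('a => 'a) => bool" where
 "wgrad U w G \<longleftrightarrow> open U \<and> w \<in> \<B> \<and> G \<in> \<B> \<and> (\<exists>B. \<forall>x. \<bar>w x\<bar> <= B) \<and>
   (\<forall>K. compact K \<and> K \<subseteq> U --> integrable lborel (\<lambda>x. indicator K x * (norm (G x))^2)) \<and>
   (\<forall>\<phi>. test_function U \<phi> --> (\<forall>b\<in>Basis. (LINT x|lborel. w x * (grad \<phi> x \<bullet> b)) = - (LINT x|lborel. (G x \<bullet> b) * \<phi> x)))"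

text \<open>F stands for the flux A G, and the equation says that it is weakly divergence free.
  Carrying F separately removes the matrix from the estimates.\<close>

definition wflux :: "'a::euclidean_space set => ('a => 'a) => bool" where
 "wflux U F \<longleftrightarrow> open U \<and> F \<in> \<B> \<and>
   (\<forall>K. compact K \<and> K \<subseteq> U --> integrable lborel (\<lambda>x. indicator K x * (norm (F x))^2)) \<and>
   (\<forall>\<phi>. test_function U \<phi> --> (LINT x|lborel. F x \<bullet> grad \<phi> x) = 0)"

text \<open>The coefficients survive only as two pointwise relations between gradient and flux:
  coercivity with \<open>lam\<close> and growth with \<open>La\<close>.\<close>

definition wsol :: "real => real => 'a::euclidean_space set => ('a => real) => ('a => 'a) => ('a => 'a) => bool" where
 "wsol lam La U w G F \<longleftrightarrow> wgrad U w G \<and> wflux U F \<and> continuous_on U w \<and>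
   (AE x in lborel. lam * (norm (G x))^2 <= F x \<bullet> G x \<and> norm (F x) <= La * norm (G x))"

definition nb :: "'a::euclidean_space set => real => 'a set" where
 "nb K d = (\<Union>x\<in>K. cball x d)"

lemma compact_nb: assumes "compact K" shows "compact (nb K d)"
proof -
 have "nb K d = (\<Union>x\<in>K. \<Union>y\<in>cball 0 d. {x + y})"
 proof (intro set_eqI iffI)
  fix z assume "z \<in> nb K d"
  then obtain x where "x \<in> K" "dist x z <= d" by (auto simp: nb_def)
  then show "z \<in> (\<Union>x\<in>K. \<Union>y\<in>cball 0 d. {x + y})"
   by (intro UN_I[of x] UN_I[of "z - x"]) (auto simp: dist_norm norm_minus_commute)
 next
  fix z assume "z \<in> (\<Union>x\<in>K. \<Union>y\<in>cball 0 d. {x + y})"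
  then obtain x y where "x \<in> K" "norm y <= d" "z = x + y" by auto
  then show "z \<in> nb K d" unfolding nb_def by (intro UN_I[of x]) (auto simp: dist_norm)
 qed
 then show ?thesis using compact_sums'[OF assms compact_cball, of 0 d] by simp
qed

lemma nb_subset_open:
 assumes "compact K" "open U" "K \<subseteq> U"
 obtains d where "d > 0" "nb K d \<subseteq> U" using compact_subset_open_imp_cball_epsilon_subset[OF assms] unfolding nb_def by metis

lemma nb_iff: "z \<in> nb K d \<longleftrightarrow> (\<exists>x\<in>K. dist x z <= d)" by (auto simp: nb_def)

lemma nb_trans: "z \<in> nb K d ==> dist z y <= e ==> y \<in> nb K (d + e)" unfolding nb_iff by (meson add_mono dist_triangle order_trans)

lemma nb_mono: "d <= e ==> nb K d \<subseteq> nb K e" unfolding subset_iff nb_iff by (meson order_trans)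

lemma subset_nb: "0 <= d ==> K \<subseteq> nb K d" unfolding subset_iff nb_iff by (metis dist_self)

text \<open>The shifted mollifier is itself a test function as soon as its supporting ball lies in
  U, so mollification commutes with the weak gradient there.\<close>

lemma grad_mol_eq:
 assumes w: "wgrad U w G" and e: "0 < e" "cball x e \<subseteq> U"
 shows "- (LINT z|lborel. w z *\<^sub>R grad (mollr e) (z - x)) = mol e G x"
proof (rule euclidean_eqI)
 fix b :: 'a assume b: "b \<in> Basis"
 let ?\<phi> = "\<lambda>z. mollr e (- x + 1 *\<^sub>R z)"
 have [measurable]: "w \<in> \<B>" "G \<in> \<B>" using w by (auto simp: wgrad_def)
 obtain B where B: "\<And>x. \<bar>w x\<bar> <= B" using w by (auto simp: wgrad_def)
 have supp: "{z. ?\<phi> z \<noteq> 0} \<subseteq> cball x e"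
 proof
  fix z assume "z \<in> {z. ?\<phi> z \<noteq> 0}"
  then have "\<not> e <= norm (z - x)" using mollr_zero[OF e(1), of "z - x"] by auto
  then show "z \<in> cball x e" by (simp add: dist_norm norm_minus_commute)
 qed
 then have cl: "closure {z. ?\<phi> z \<noteq> 0} \<subseteq> cball x e" by (rule closure_minimal) simp
 have "test_function U ?\<phi>" unfolding test_function_def
 proof (intro conjI allI)
  show "Ck k ?\<phi>" for k by (intro Ck_affine Ck_mollr)
  show "compact (closure {z. ?\<phi> z \<noteq> 0})" using bounded_subset[OF bounded_cball supp] by (simp add: compact_closure)
  show "closure {z. ?\<phi> z \<noteq> 0} \<subseteq> U" using cl e(2) by blast
 qed
 then have id: "(LINT z|lborel. w z * (grad ?\<phi> z \<bullet> b)) = - (LINT z|lborel. (G z \<bullet> b) * ?\<phi> z)"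
  using w b by (auto simp: wgrad_def)
 have g: "grad ?\<phi> = (\<lambda>z. grad (mollr e) (z - x))" using C1_grad[OF C1_affine[OF C1_Ck[OF Ck_mollr], of 1 e "- x" 1]] by simp
 have i1: "integrable lborel (\<lambda>z. w z *\<^sub>R grad (mollr e) (z - x))"
 proof (rule conv_continuous(1))
  show "continuous_on UNIV (grad (mollr e :: 'a => real))" by (rule C1_continuous_grad[OF C1_Ck[OF Ck_mollr]])
  show "grad (mollr e) y = 0" if "e < norm y" for y :: 'a by (rule C1_grad_zero[OF C1_Ck[OF Ck_mollr], where S = "- cball 0 e" and c = 0])
     (use that e in \<open>auto intro!: mollr_zero\<close>)
 qed (use B in auto)
 obtain B' where B': "\<And>x::'a. norm (mollr e x :: real) <= B'"
  using bounded_bounded_support[OF continuous_mollr mollr_zero[OF e(1) less_imp_le]] by metis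
 have i2: "integrable lborel (\<lambda>z. mollr e (z - x) *\<^sub>R G z)"
 proof (rule integrable_bounded_times_L2[where K = "cball x e" and B = B'])
  show "integrable lborel (\<lambda>y. indicator (cball x e) y * (norm (G y))^2)" using w e(2) by (auto simp: wgrad_def)
  show "mollr e (z - x) = 0" if "z \<notin> cball x e" for z using that supp by auto
 qed (use B' in auto)
 have "(LINT z|lborel. w z *\<^sub>R grad (mollr e) (z - x)) \<bullet> b = (LINT z|lborel. (w z *\<^sub>R grad (mollr e) (z - x)) \<bullet> b)"
  by (rule integral_inner_left[symmetric]) (rule i1)
 also have "\<dots> = - (LINT z|lborel. (mollr e (z - x) *\<^sub>R G z) \<bullet> b)" using id[unfolded g] by (simp add: mult.commute)
 also have "(LINT z|lborel. (mollr e (z - x) *\<^sub>R G z) \<bullet> b) = mol e G x \<bullet> b"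
  unfolding mol_def by (rule integral_inner_left) (rule i2)
 finally show "- (LINT z|lborel. w z *\<^sub>R grad (mollr e) (z - x)) \<bullet> b = mol e G x \<bullet> b" by simp
qed

text \<open>A change of variables makes \<zeta> the differentiated kernel and the mollifier the
  bounded factor in \<open>C1_conv\<close>; the reflection introduced thereby is undone with
  \<open>C1_affine\<close>.\<close>

lemma C1_mol_C1:
 fixes \<zeta> :: "'a::euclidean_space => real"
 assumes z: "C1 \<zeta> \<zeta>'" "\<And>x. r < norm x ==> \<zeta> x = 0" and e: "0 < e"
 shows "C1 (mol e \<zeta>) (mol e \<zeta>')"
proof -
 have [measurable]: "\<zeta> \<in> \<B>" "\<zeta>' \<in> \<B>"
  by (auto intro!: borel_measurable_continuous_onI C1_continuous[OF z(1)] C1_continuous_grad[OF z(1)])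
 obtain B where B: "\<And>x::'a. \<bar>mollr e x\<bar> <= B"
  using bounded_bounded_support[OF continuous_mollr mollr_zero[OF e less_imp_le]] by (metis real_norm_def)
 have sh: "mol e g x = (LINT y|lborel. mollr e y *\<^sub>R g (y - - x))"
  if [measurable]: "g \<in> \<B>" for g :: "'a => 'b::euclidean_space" and x
  unfolding mol_def by (subst lborel_integral_affine[of _ 1 x]) (auto simp: add.commute)
 have "C1 (\<lambda>x. 1 * (LINT y|lborel. mollr e y * \<zeta> (y - (0 + (-1) *\<^sub>R x))))
   (\<lambda>x. (1 * (-1)) *\<^sub>R - (LINT y|lborel. mollr e y *\<^sub>R \<zeta>' (y - (0 + (-1) *\<^sub>R x))))"
  by (rule C1_affine[OF C1_conv[OF _ B z]]) auto
 moreover have "mol e \<zeta> = (\<lambda>x. LINT y|lborel. mollr e y *\<^sub>R \<zeta> (y - - x))"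
  "mol e \<zeta>' = (\<lambda>x. LINT y|lborel. mollr e y *\<^sub>R \<zeta>' (y - - x))" by (rule ext, rule sh, measurable)+
 ultimately show ?thesis by simp
qed

text \<open>The energy argument tests with functions that are only C^1. Their mollifications are
  smooth, stay supported in \<open>nb K d\<close> inside U, and their gradients converge
  boundedly.\<close>

lemma wflux_C1:
 assumes F: "wflux U F" and z: "C1 \<zeta> \<zeta>'" and K: "compact K" "K \<subseteq> U" "\<And>x. x \<notin> K ==> \<zeta> x = 0"
 shows "(LINT x|lborel. F x \<bullet> \<zeta>' x) = 0"
proof -
 have [measurable]: "F \<in> \<B>" "\<zeta> \<in> \<B>" "\<zeta>' \<in> \<B>"
  using F by (auto intro!: borel_measurable_continuous_onI C1_continuous[OF z(1)] C1_continuous_grad[OF z(1)] simp: wflux_def)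
 obtain d where d: "d > 0" "nb K d \<subseteq> U" using nb_subset_open[OF K(1) _ K(2)] F by (auto simp: wflux_def)
 obtain r where r: "\<And>x. x \<in> K ==> norm x <= r" using K(1) compact_imp_bounded bounded_iff by metis
 have z0: "\<zeta>' x = 0" if "x \<notin> K" for x by (rule C1_grad_zero[OF z, of "- K" _ 0]) (use that K compact_imp_closed in auto)
 have zr: "\<zeta> x = 0" "\<zeta>' x = 0" if "r < norm x" for x using K(3) z0 r that by fastforce+
 obtain B where B: "0 < B" "\<And>x. norm (\<zeta>' x) <= B" using bounded_bounded_support[OF C1_continuous_grad[OF z] zr(2)] by metis
 obtain Bz where Bz: "\<And>x. norm (\<zeta> x) <= Bz" using bounded_bounded_support[OF C1_continuous[OF z] zr(1)] by metis
 define e where "e j = d * inverse (real (Suc j))" for j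
 have e: "0 < e j" "e j <= d" for j using d(1) mult_left_mono[of "inverse (real (Suc j))" 1 d] by (auto simp: e_def divide_simps)
 have "(\<lambda>j. d * inverse (real (Suc j))) \<longlonglongrightarrow> d * 0" by (intro tendsto_intros LIMSEQ_inverse_real_of_nat)
 then have e0: "e \<longlonglongrightarrow> 0" by (simp add: e_def[abs_def])
 have out: "mol (e j) g x = 0" if "x \<notin> nb K d" and [measurable]: "g \<in> \<B>" and "\<And>x. x \<notin> K ==> g x = 0"
  for x j and g :: "'a => 'b::euclidean_space"
 proof -
  have "norm (mol (e j) g x - 0) <= 0"
  proof (rule mol_close)
   fix y assume "dist x y < e j"
   then have "y \<notin> K" using that(1) e(2)[of j] by (auto simp: nb_iff dist_commute)
   then show "norm (g y - 0) <= 0" using that(3) by simp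
  qed (use e in auto)
  then show ?thesis by simp
 qed
 have g: "grad (mol (e j) \<zeta>) = mol (e j) \<zeta>'" for j by (rule C1_grad[OF C1_mol_C1[OF z zr(1) e(1)]])
 have eq0: "(LINT x|lborel. F x \<bullet> mol (e j) \<zeta>' x) = 0" for j
 proof -
  have s: "{x. mol (e j) \<zeta> x \<noteq> 0} \<subseteq> nb K d" using out[of _ \<zeta> j] K(3) by auto
  have "test_function U (mol (e j) \<zeta>)" unfolding test_function_def
  proof (intro conjI allI)
   show "Ck k (mol (e j) \<zeta>)" for k by (rule Ck_mol) (use Bz e in auto)
   show "compact (closure {x. mol (e j) \<zeta> x \<noteq> 0})"
    using bounded_subset[OF compact_imp_bounded[OF compact_nb[OF K(1)]] s] by (simp add: compact_closure)
   show "closure {x. mol (e j) \<zeta> x \<noteq> 0} \<subseteq> U"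
    using closure_minimal[OF s compact_imp_closed[OF compact_nb[OF K(1)]]] d(2) by blast
  qed
  then show ?thesis using F by (auto simp: wflux_def g[symmetric])
 qed
 let ?w = "\<lambda>x. B * (indicator (nb K d) x * (1 + (norm (F x))^2))"
 have cK: "compact (nb K d)" by (rule compact_nb[OF K(1)])
 have [measurable]: "nb K d \<in> sets borel" using cK by (simp add: borel_compact)
 have "(\<lambda>j. LINT x|lborel. F x \<bullet> mol (e j) \<zeta>' x) \<longlonglongrightarrow> (LINT x|lborel. F x \<bullet> \<zeta>' x)"
 proof (rule integral_dominated_convergence[where w = ?w])
  have "emeasure lborel (nb K d) < \<infinity>" using cK by (intro emeasure_bounded_finite compact_imp_bounded)
  then have "integrable lborel (\<lambda>x. indicator (nb K d) x :: real)" by (intro integrable_real_indicator) auto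
  then show "integrable lborel ?w" using F cK d(2) by (auto simp: wflux_def distrib_left)
  show "AE x in lborel. (\<lambda>j. F x \<bullet> mol (e j) \<zeta>' x) \<longlonglongrightarrow> F x \<bullet> \<zeta>' x"
  proof (intro AE_I2 tendsto_inner tendsto_const mol_tendsto e e0)
   show "isCont \<zeta>' x" for x using C1_continuous_grad[OF z] by (simp add: continuous_on_eq_continuous_at)
  qed auto
  show "AE x in lborel. norm (F x \<bullet> mol (e j) \<zeta>' x) <= ?w x" for j
  proof (intro AE_I2)
   fix x
   show "norm (F x \<bullet> mol (e j) \<zeta>' x) <= ?w x"
   proof (cases "x \<in> nb K d")
    case True
    have "\<bar>F x \<bullet> mol (e j) \<zeta>' x\<bar> <= norm (F x) * norm (mol (e j) \<zeta>' x)" by (rule Cauchy_Schwarz_ineq2)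
    also have "\<dots> <= (1 + (norm (F x))^2) * B"
    proof (intro mult_mono)
     show "norm (F x) <= 1 + (norm (F x))^2"
      using zero_le_power2[of "norm (F x) - 1"] norm_ge_zero[of "F x"] by (simp add: power2_diff del: norm_ge_zero)
     show "norm (mol (e j) \<zeta>' x) <= B" by (rule mol_bound) (use e B in auto)
    qed auto
    finally show ?thesis using True by (simp add: mult.commute)
   next
    case False
    then show ?thesis using out[of x \<zeta>' j] z0 by simp
   qed
  qed
 qed auto
 then show ?thesis using LIMSEQ_unique[OF _ tendsto_const] by (simp add: eq0)
qed

text \<open>
 The Caccioppoli inequality is stated through differences, so that no weak gradient of the truncation
 \<open>v\<close> is needed. Vanishing of \<open>\<phi>\<close> below a level \<open>k > 0\<close> keeps the test functions away from the set
 where \<open>v\<close> is extended by zero.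
\<close>

definition DG :: "real => 'a::euclidean_space set => ('a => real) => bool" where
 "DG L D v \<longleftrightarrow> v \<in> \<B> \<and> continuous_on D v \<and> (\<forall>x. 0 <= v x) \<and>
   (\<forall>x0 a b k \<phi> \<Phi> \<Psi> P h. 0 < a \<and> a < b \<and> cball x0 b \<subseteq> D \<and> 0 < k \<and>
    continuous_on UNIV \<phi> \<and> continuous_on UNIV P \<and> (\<forall>s. 0 <= P s) \<and>
    (\<forall>s\<le>k. \<phi> s = 0 \<and> \<Phi> s = 0 \<and> \<Psi> s = 0) \<and>
    (\<forall>s. (\<Phi> has_real_derivative \<phi> s) (at s)) \<and> (\<forall>s. (\<Psi> has_real_derivative (\<phi> s)^2) (at s)) \<and>
    (\<forall>x\<in>ball x0 b. (\<Psi> (v x))^2 <= P (v x) * (\<phi> (v x))^2) -->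
    (\<integral>\<^sup>+x. indicator (ball x0 a) x * indicator (ball x0 a) (x + h) * ennreal ((\<Phi> (v (x + h)) - \<Phi> (v x))^2) \<partial>lborel)
     <= ennreal (L * (norm h)^2 / (b - a)^2) * (\<integral>\<^sup>+x. indicator (ball x0 b) x * ennreal (P (v x)) \<partial>lborel))"

section \<open>The Caccioppoli inequality in translation form\<close>

lemma bounded_on_bounded:
 assumes "continuous_on UNIV (f :: real => real)"
 obtains Q where "0 < Q" "\<And>s. \<bar>s\<bar> <= B ==> \<bar>f (s - k)\<bar> <= Q"
proof -
 have "compact ((\<lambda>s. f (s - k)) ` {-B..B})"
  by (rule compact_continuous_image) (auto intro!: continuous_intros continuous_on_compose2[OF assms])
 then obtain Q where "0 < Q" "\<forall>y\<in>(\<lambda>s. f (s - k)) ` {-B..B}. norm y <= Q" using compact_imp_bounded bounded_pos by blast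
 then show thesis by (intro that[of Q]) (auto simp: abs_le_iff)
qed

lemma amgm_square:
 fixes t X Y :: real
 assumes "t^2 <= 4 * (X * Y)" "0 <= X" "0 <= Y" "0 < c"
 shows "t <= c / 2 * X + 2 / c * Y"
proof (rule power2_le_imp_le)
 have "4 * A * B <= (A + B)^2" for A B :: real using sum_squares_bound[of A B] by (simp add: power2_sum)
 then have "4 * (c / 2 * X) * (2 / c * Y) <= (c / 2 * X + 2 / c * Y)^2" .
 moreover have "4 * (c / 2 * X) * (2 / c * Y) = 4 * (X * Y)" using assms(4) by simp
 ultimately show "t^2 <= (c / 2 * X + 2 / c * Y)^2" using assms(1) by linarith
qed (use assms in auto)

lemma norm_indicator_mult_le: "t <= b ==> 0 <= t ==> norm (indicator A x * t) <= (b::real)" by (cases "x \<in> A") auto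

text \<open>The test function is \<theta> \<eta>^2 \<Psi>(w - k0), with \<eta> the cutoff between
  the balls and \<theta> a cutoff around \<open>Kc\<close>. Its gradient contains \<phi>^2 G, which
  yields the coercive term, and a cross term \<Psi> F . \<eta>'; the condition \<Psi>^2 \<le> P
  \<phi>^2 is exactly what lets Young's inequality absorb the latter and leave P. Since \<Phi>' =
  \<phi>, the coercive term bounds the gradient of \<Phi>(v), hence its differences. All chain rules
  are applied to C^1 mollifications of w and then passed to the limit.\<close>

lemma energy_estimate:
 fixes w :: "'a::euclidean_space => real" and v :: "'a => real"
 assumes sol: "wsol lam La U w G F" and lam: "0 < lam" "0 <= La"
  and \<Omega>: "open \<Omega>" "\<Omega> \<subseteq> U" and v: "v = (\<lambda>x. if x \<in> \<Omega> then max 0 (w x - k0) else 0)"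
  and k: "0 < k" and Kc: "compact Kc" "Kc \<subseteq> \<Omega>"
  and Kc2: "\<And>x. x \<in> \<Omega> ==> x \<in> cball x0 b ==> k0 + k <= w x ==> x \<in> Kc"
  and ab: "0 < a" "a < b"
  and \<eta>: "C1 \<eta> \<eta>'" "\<And>x. 0 <= \<eta> x \<and> \<eta> x <= 1" "\<And>x. x \<in> ball x0 a ==> \<eta> x = 1"
   "\<And>x. x \<notin> ball x0 b ==> \<eta> x = 0" "\<And>x. norm (\<eta>' x) <= N"
  and \<phi>: "continuous_on UNIV \<phi>" and P: "continuous_on UNIV P" "\<And>s. 0 <= P s"
  and van: "\<And>s. s <= k ==> \<phi> s = 0" "\<And>s. s <= k ==> \<Phi> s = 0" "\<And>s. s <= k ==> \<Psi> s = 0"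
  and der: "\<And>s. (\<Phi> has_real_derivative \<phi> s) (at s)" "\<And>s. (\<Psi> has_real_derivative (\<phi> s)^2) (at s)"
  and \<Psi>P: "\<And>x. x \<in> ball x0 b ==> (\<Psi> (v x))^2 <= P (v x) * (\<phi> (v x))^2"
 shows "(\<integral>\<^sup>+x. indicator (ball x0 a) x * indicator (ball x0 a) (x + h) * ennreal ((\<Phi> (v (x + h)) - \<Phi> (v x))^2) \<partial>lborel)
     <= ennreal ((norm h)^2 * (4 / lam^2 * (La^2 * N^2))) * (\<integral>\<^sup>+x. indicator (ball x0 b) x * ennreal (P (v x)) \<partial>lborel)"
proof -
 have wg: "wgrad U w G" and wf: "wflux U F" and wc: "continuous_on U w"
  and AEF: "AE x in lborel. lam * (norm (G x))^2 <= F x \<bullet> G x \<and> norm (F x) <= La * norm (G x)" using sol by (auto simp: wsol_def)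
 have opU: "open U" using wg by (simp add: wgrad_def)
 have [measurable]: "w \<in> \<B>" "G \<in> \<B>" "F \<in> \<B>" using wg wf by (auto simp: wgrad_def wflux_def)
 obtain B where B: "\<And>x. \<bar>w x\<bar> <= B" using wg by (auto simp: wgrad_def)
 have \<Phi>c: "continuous_on UNIV \<Phi>" and \<Psi>c: "continuous_on UNIV \<Psi>" using der by (meson DERIV_isCont continuous_at_imp_continuous_on)+
 have [measurable]: "\<phi> \<in> \<B>" "P \<in> \<B>" "\<Phi> \<in> \<B>" "\<Psi> \<in> \<B>"
  by (auto intro!: borel_measurable_continuous_onI \<phi> P \<Phi>c \<Psi>c)
 have [measurable]: "\<Omega> \<in> sets borel" using \<Omega>(1) by simp
 have [measurable]: "v \<in> \<B>" unfolding v by measurable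
 have [measurable]: "\<eta> \<in> \<B>" "\<eta>' \<in> \<B>"
  by (auto intro!: borel_measurable_continuous_onI C1_continuous[OF \<eta>(1)] C1_continuous_grad[OF \<eta>(1)])
 obtain d4 where d4: "d4 > 0" "nb Kc d4 \<subseteq> \<Omega>" using nb_subset_open[OF Kc(1) \<Omega>(1) Kc(2)] .
 \<comment> \<open>Four equal margins around \<open>Kc\<close>: \<theta> is 1 within distance d and
   lives in \<open>K3\<close> (3d), and mollification at scales below d seen from \<open>K3\<close>
   stays in \<open>K4\<close> (4d), still inside \<Omega>.\<close>
 define d where "d = d4 / 4"
 have d: "0 < d" "4 * d = d4" using d4 by (auto simp: d_def)
 define K3 where "K3 = nb Kc (3 * d)"
 define K4 where "K4 = nb Kc (4 * d)"
 have cK: "compact K3" "compact K4" unfolding K3_def K4_def by (rule compact_nb[OF Kc(1)])+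
 have [measurable]: "K3 \<in> sets borel" "K4 \<in> sets borel" "nb Kc (2 * d) \<in> sets borel"
  using cK compact_nb[OF Kc(1)] by (simp_all add: borel_compact)
 have K4\<Omega>: "K4 \<subseteq> \<Omega>" using d4 d by (simp add: K4_def)
 have K34: "K3 \<subseteq> K4" unfolding K3_def K4_def by (rule nb_mono) (use d in simp)
 have K3\<Omega>: "K3 \<subseteq> \<Omega>" using K34 K4\<Omega> by simp
 have near: "cball x e \<subseteq> K4" if "x \<in> K3" "e < d" for x e
  using that nb_trans[of x Kc "3 * d" _ d] unfolding K3_def K4_def by (auto simp: subset_iff)
 obtain C0 where C0: "0 < C0 \<and> (\<forall>(S::'a set) \<delta>. S \<in> sets borel \<and> 0 < \<delta> -->
   (\<exists>\<theta> \<theta>'. C1 \<theta> \<theta>' \<and> (\<forall>x. 0 <= \<theta> x \<and> \<theta> x <= 1) \<and> (\<forall>x. ball x \<delta> \<subseteq> S --> \<theta> x = 1) \<and>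
    (\<forall>x. ball x \<delta> \<inter> S = {} --> \<theta> x = 0) \<and> (\<forall>x. norm (\<theta>' x) <= C0 / \<delta>)))"
  using ex_cutoff[where ?'a = 'a] by (elim exE) (rule that)
 have nbS: "nb Kc (2 * d) \<in> sets borel \<and> 0 < d" using d(1) compact_nb[OF Kc(1)] by (simp add: borel_compact)
 obtain \<theta> \<theta>' where T: "C1 \<theta> \<theta>' \<and> (\<forall>x. 0 <= \<theta> x \<and> \<theta> x <= 1) \<and> (\<forall>x. ball x d \<subseteq> nb Kc (2 * d) --> \<theta> x = 1) \<and>
    (\<forall>x. ball x d \<inter> nb Kc (2 * d) = {} --> \<theta> x = 0) \<and> (\<forall>x. norm (\<theta>' x) <= C0 / d)"
  using C0[THEN conjunct2, rule_format, OF nbS] by (elim exE) (rule that)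
 have \<theta>: "C1 \<theta> \<theta>'" "\<And>x. 0 <= \<theta> x" "\<And>x. \<theta> x <= 1"
  and \<theta>1: "\<And>x. ball x d \<subseteq> nb Kc (2 * d) ==> \<theta> x = 1" and \<theta>0: "\<And>x. ball x d \<inter> nb Kc (2 * d) = {} ==> \<theta> x = 0"
  and \<theta>': "\<And>x. norm (\<theta>' x) <= C0 / d" using T by simp_all
 have [measurable]: "\<theta> \<in> \<B>" "\<theta>' \<in> \<B>"
  by (auto intro!: borel_measurable_continuous_onI C1_continuous[OF \<theta>(1)] C1_continuous_grad[OF \<theta>(1)])
 have \<theta>K3: "\<theta> x = 0" if "x \<notin> K3" for x
 proof (rule \<theta>0, rule ccontr)
  assume "ball x d \<inter> nb Kc (2 * d) \<noteq> {}"
  then obtain y where "dist x y < d" "y \<in> nb Kc (2 * d)" by auto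
  then have "x \<in> nb Kc (2 * d + d)" using nb_trans[of y Kc "2 * d" x d] by (simp add: dist_commute)
  then show False using that by (simp add: K3_def)
 qed
 have \<theta>Kc: "\<theta> y = 1" if "x \<in> Kc" "dist x y < d" for x y
 proof (rule \<theta>1, rule subsetI)
  fix z assume "z \<in> ball y d"
  then have "dist x z <= 2 * d" using that dist_triangle[of x z y] by simp
  then show "z \<in> nb Kc (2 * d)" using that by (auto simp: nb_iff)
 qed
 have \<theta>'Kc: "\<theta>' x = 0" if "x \<in> Kc" for x by (rule C1_grad_zero[OF \<theta>(1), of "ball x d" _ 1]) (use \<theta>Kc that d in auto)
 have \<theta>'K3: "\<theta>' x = 0" if "x \<notin> K3" for x
  by (rule C1_grad_zero[OF \<theta>(1), of "- K3" _ 0]) (use \<theta>K3 that cK compact_imp_closed in auto)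
 have inK: "x \<in> Kc" if "x \<in> \<Omega>" "x \<in> cball x0 b" "\<not> w x - k0 <= k" for x by (rule Kc2) (use that in auto)
 have KcK3: "Kc \<subseteq> K3" unfolding K3_def by (rule subset_nb) (use d in simp)
 \<comment> \<open>G is only locally square integrable; cutting it off to \<open>K4\<close> makes it
   globally so, and on \<open>K3\<close> the gradients of the mollified w are the mollifications of
   f.\<close>
 define f where "f x = indicator K4 x *\<^sub>R G x" for x
 have [measurable]: "f \<in> \<B>" unfolding f_def by measurable
 have if2: "integrable lborel (\<lambda>x. (norm (f x))^2)"
 proof -
  have "(\<lambda>x. (norm (f x))^2) = (\<lambda>x. indicator K4 x * (norm (G x))^2)" by (auto simp: f_def indicator_def)
  then show ?thesis using wg cK(2) K4\<Omega> \<Omega>(2) by (auto simp: wgrad_def)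
 qed
 obtain e M where e: "\<And>j::nat. 0 < e j" "\<And>j. e j < d" "e \<longlonglongrightarrow> 0" and M: "integrable lborel M"
  and conv: "AE x in lborel. (\<lambda>j. mol (e j) f x) \<longlonglongrightarrow> f x \<and> (\<forall>j. (norm (mol (e j) f x))^2 <= M x)"
  using mol_dominated_subsequence[OF _ if2 d(1)] by auto
 define u where "u j = mol (e j) w" for j
 define W where "W j x = - (LINT z|lborel. w z *\<^sub>R grad (mollr (e j)) (z - x))" for j x
 have uC1: "C1 (u j) (W j)" for j unfolding u_def W_def[abs_def] by (rule C1_mol[OF _ B e(1)]) measurable
 have [measurable]: "u j \<in> \<B>" "W j \<in> \<B>" for j
  by (auto intro!: borel_measurable_continuous_onI C1_continuous[OF uC1] C1_continuous_grad[OF uC1])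
 have uB: "\<bar>u j x\<bar> <= B" for j x unfolding u_def using mol_bound[of w "e j" B x] e(1) B by simp
 have W: "W j x = mol (e j) f x" if "x \<in> K3" for j x
 proof -
  have c: "cball x (e j) \<subseteq> K4" by (rule near[OF that e(2)])
  have "W j x = mol (e j) G x" unfolding W_def by (rule grad_mol_eq[OF wg e(1)]) (use c K4\<Omega> \<Omega>(2) in blast)
  also have "\<dots> = mol (e j) f x" unfolding mol_def
  proof (intro Bochner_Integration.integral_cong refl)
   fix z
   show "mollr (e j) (z - x) *\<^sub>R G z = mollr (e j) (z - x) *\<^sub>R f z"
   proof (cases "z \<in> cball x (e j)")
    case True
    then show ?thesis using c by (auto simp: f_def)
   next
    case False
    then show ?thesis using mollr_zero[OF e(1), of j "z - x"] by (simp add: dist_norm norm_minus_commute)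
   qed
  qed
  finally show ?thesis .
 qed
 have ulim: "(\<lambda>j. u j x) \<longlonglongrightarrow> w x" if "x \<in> \<Omega>" for x unfolding u_def
 proof (rule mol_tendsto)
  show "isCont w x" using wc opU that \<Omega>(2) by (auto simp: continuous_on_eq_continuous_at)
 qed (use e in auto)
 obtain Q1 where Q1: "0 < Q1" "\<And>s. \<bar>s\<bar> <= B ==> \<bar>\<Psi> (s - k0)\<bar> <= Q1" using bounded_on_bounded[OF \<Psi>c, where B = B and k = k0] by blast
 obtain Q2 where Q2: "0 < Q2" "\<And>s. \<bar>s\<bar> <= B ==> \<bar>\<phi> (s - k0)\<bar> <= Q2" using bounded_on_bounded[OF \<phi>, where B = B and k = k0] by blast
 obtain Q3 where Q3: "0 < Q3" "\<And>s. \<bar>s\<bar> <= B ==> \<bar>\<Phi> (s - k0)\<bar> <= Q3" using bounded_on_bounded[OF \<Phi>c, where B = B and k = k0] by blast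
 obtain Q4 where Q4: "0 < Q4" "\<And>s. \<bar>s\<bar> <= B ==> \<bar>P (s - k0)\<bar> <= Q4" using bounded_on_bounded[OF P(1), where B = B and k = k0] by blast
 have cl: "(\<lambda>j. g (u j x - k0)) \<longlonglongrightarrow> g (w x - k0)" if "continuous_on UNIV g" "x \<in> \<Omega>" for g :: "real => real" and x
  by (rule continuous_on_tendsto_compose[OF that(1)]) (auto intro!: tendsto_intros ulim that)
 define p where "p x = \<theta> x * (\<eta> x * \<eta> x)" for x
 define p' where "p' x = \<theta> x *\<^sub>R (\<eta> x *\<^sub>R \<eta>' x + \<eta> x *\<^sub>R \<eta>' x) + (\<eta> x * \<eta> x) *\<^sub>R \<theta>' x" for x
 have pC1: "C1 p p'" unfolding p_def[abs_def] p'_def[abs_def] by (intro C1_mult \<theta> \<eta>)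
 have [measurable]: "p \<in> \<B>" "p' \<in> \<B>" by (auto intro!: borel_measurable_continuous_onI C1_continuous[OF pC1] C1_continuous_grad[OF pC1])
 have p01: "0 <= p x" "p x <= 1" for x unfolding p_def using \<theta> \<eta>(2)[of x] by (auto intro!: mult_nonneg_nonneg mult_le_one)
 have pK3: "p x = 0" "p' x = 0" if "x \<notin> K3" for x using \<theta>K3[OF that] \<theta>'K3[OF that] by (auto simp: p_def p'_def)
 have N0: "0 <= N" using order_trans[OF norm_ge_zero \<eta>(5)[of x0]] .
 define N' where "N' = 2 * N + C0 / d"
 have C0d: "0 <= C0 / d" using order_trans[OF norm_ge_zero \<theta>'[of x0]] .
 have p'N: "norm (p' x) <= N'" for x
 proof -
  have "norm (p' x) <= \<bar>\<theta> x\<bar> * (\<bar>\<eta> x\<bar> * norm (\<eta>' x) + \<bar>\<eta> x\<bar> * norm (\<eta>' x)) + \<bar>\<eta> x * \<eta> x\<bar> * norm (\<theta>' x)"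
   unfolding p'_def by (rule order_trans[OF norm_triangle_ineq]) (auto intro!: add_mono mult_left_mono order_trans[OF norm_triangle_ineq])
  also have "\<dots> <= 1 * (1 * N + 1 * N) + 1 * (C0 / d)" using \<theta> \<theta>' \<eta>(2)[of x] \<eta>(5)[of x] N0 C0d
   by (intro add_mono mult_mono) (auto intro!: mult_le_one)
  finally show ?thesis by (simp add: N'_def)
 qed
 have N'0: "0 <= N'" using N0 C0d by (simp add: N'_def)
 \<comment> \<open>\<open>D j\<close> is the gradient of the admissible test function p \<Psi>(u j -
   k0), and \<open>Dl\<close> is its limit, with w and G in place of the mollified
   quantities.\<close>
 define D where "D j x = p x *\<^sub>R ((\<phi> (u j x - k0))^2 *\<^sub>R W j x) + \<Psi> (u j x - k0) *\<^sub>R p' x" for j x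
 define Dl where "Dl x = p x *\<^sub>R ((\<phi> (w x - k0))^2 *\<^sub>R G x) + \<Psi> (w x - k0) *\<^sub>R p' x" for x
 have "C1 (\<lambda>x. p x * \<Psi> (u j x - k0)) (D j)" for j unfolding D_def[abs_def]
  by (intro C1_mult pC1 C1_compose[OF uC1 der(2)] continuous_intros \<phi>)
 then have D0: "(LINT x|lborel. F x \<bullet> D j x) = 0" for j by (rule wflux_C1[OF wf _ cK(1)]) (use K3\<Omega> \<Omega>(2) pK3 in auto)
 have [measurable]: "D j \<in> \<B>" "Dl \<in> \<B>" for j unfolding D_def Dl_def by measurable
 have limG: "AE x in lborel. x \<in> K3 --> (\<lambda>j. W j x) \<longlonglongrightarrow> G x \<and> (\<forall>j. (norm (W j x))^2 <= M x)" using conv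
 proof eventually_elim
  case (elim x)
  then show ?case using W[of x] K34 by (auto simp: f_def)
 qed
 have iK3: "integrable lborel (\<lambda>x. indicator K3 x :: real)"
  using emeasure_bounded_finite[OF compact_imp_bounded[OF cK(1)]] by (intro integrable_real_indicator) auto
 have iFK: "integrable lborel (\<lambda>x. indicator K3 x * (norm (F x))^2)" using wf cK(1) K3\<Omega> \<Omega>(2) by (auto simp: wflux_def)
 have iMK: "integrable lborel (\<lambda>x. indicator K3 x * M x)" using integrable_mult_indicator[OF _ M, of K3] by simp
 let ?w = "\<lambda>x. Q2^2 * (indicator K3 x * (norm (F x))^2) + Q2^2 * (indicator K3 x * M x) + Q1 * N' * (indicator K3 x + indicator K3 x * (norm (F x))^2)"
 have iw: "integrable lborel ?w" using iFK iMK iK3 by simp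
 have limFD: "AE x in lborel. (\<lambda>j. F x \<bullet> D j x) \<longlonglongrightarrow> F x \<bullet> Dl x" using limG
 proof eventually_elim
  case (elim x)
  show ?case
  proof (cases "x \<in> K3")
   case True
   then have x: "x \<in> \<Omega>" "(\<lambda>j. W j x) \<longlonglongrightarrow> G x" using K3\<Omega> elim by auto
   show ?thesis unfolding D_def Dl_def by (intro tendsto_intros cl[OF \<phi>] cl[OF \<Psi>c] x)
  qed (simp add: D_def Dl_def pK3)
 qed
 have bdFD: "AE x in lborel. norm (F x \<bullet> D j x) <= ?w x" for j using limG
 proof eventually_elim
  case (elim x)
  show ?case
  proof (cases "x \<in> K3")
   case True
   have "norm (D j x) <= Q2^2 * norm (W j x) + Q1 * N'" unfolding D_def
   proof (rule order_trans[OF norm_triangle_ineq], intro add_mono)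
    have "\<bar>\<phi> (u j x - k0)\<bar>^2 <= Q2^2" by (rule power_mono[OF Q2(2)[OF uB]]) simp
    then have "p x * ((\<phi> (u j x - k0))^2 * norm (W j x)) <= 1 * (Q2^2 * norm (W j x))"
     using p01[of x] by (intro mult_mono) (auto intro!: mult_right_mono)
    then show "norm (p x *\<^sub>R ((\<phi> (u j x - k0))^2 *\<^sub>R W j x)) <= Q2^2 * norm (W j x)" using p01[of x] by simp
    show "norm (\<Psi> (u j x - k0) *\<^sub>R p' x) <= Q1 * N'" using Q1(2)[OF uB] p'N[of x] Q1(1) by (auto intro!: mult_mono)
   qed
   then have "norm (F x) * norm (D j x) <= norm (F x) * (Q2^2 * norm (W j x) + Q1 * N')" by (intro mult_left_mono) auto
   also have "\<dots> = Q2^2 * (norm (F x) * norm (W j x)) + Q1 * N' * norm (F x)" by (simp add: algebra_simps)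
   also have "\<dots> <= Q2^2 * ((norm (F x))^2 + M x) + Q1 * N' * (1 + (norm (F x))^2)"
   proof (intro add_mono mult_left_mono)
    have "(norm (W j x))^2 <= M x" using elim True by blast
    moreover have "0 <= norm (F x) * norm (W j x)" by simp
    ultimately show "norm (F x) * norm (W j x) <= (norm (F x))^2 + M x" using sum_squares_bound[of "norm (F x)" "norm (W j x)"] by linarith
    show "norm (F x) <= 1 + (norm (F x))^2"
     using zero_le_power2[of "norm (F x) - 1"] norm_ge_zero[of "F x"] by (simp add: power2_diff del: norm_ge_zero)
   qed (use Q1 N'0 in auto)
   finally have "norm (F x) * norm (D j x) <= ?w x" using True by (simp add: algebra_simps)
   then show ?thesis using Cauchy_Schwarz_ineq2[of "F x" "D j x"] by simp
  qed (simp add: D_def pK3)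
 qed
 have iFD: "integrable lborel (\<lambda>x. F x \<bullet> Dl x)" by (rule integrable_dominated_convergence[OF _ _ iw limFD bdFD]) auto
 have "(\<lambda>j. LINT x|lborel. F x \<bullet> D j x) \<longlonglongrightarrow> (LINT x|lborel. F x \<bullet> Dl x)"
  by (rule integral_dominated_convergence[OF _ _ iw limFD bdFD]) auto
 then have zero: "(LINT x|lborel. F x \<bullet> Dl x) = 0" using LIMSEQ_unique[OF _ tendsto_const] by (simp add: D0)
 have [measurable]: "ball x0 b \<in> sets borel" "ball x0 a \<in> sets borel" by simp_all
 have [measurable]: "(\<lambda>x. P (v x)) \<in> \<B>" "(\<lambda>x. \<Phi> (v x)) \<in> \<B>"
  by (rule measurable_compose[where f = v and N = borel]; measurable)+
 define X where "X x = p x * ((\<phi> (w x - k0))^2 * (norm (G x))^2)" for x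
 define Y where "Y x = \<theta> x * (indicator (ball x0 b) x * (La^2 * N^2 * P (v x)))" for x
 have [measurable]: "X \<in> \<B>" "Y \<in> \<B>" unfolding X_def Y_def by measurable
 have X0: "0 <= X x" for x using p01 by (simp add: X_def)
 have Y0: "0 <= Y x" for x using \<theta> P(2) by (simp add: Y_def)
 have vw: "g (v x) = g (w x - k0)" if "x \<in> \<Omega>" "\<And>s. s <= k ==> g s = 0" for g :: "real => real" and x
  using that k by (cases "w x - k0 <= 0") (auto simp: v max_def)
 have iX: "integrable lborel X"
 proof (rule Bochner_Integration.integrable_bound)
  show "integrable lborel (\<lambda>x. Q2^2 * (indicator K3 x * (norm (G x))^2))" using wg cK(1) K3\<Omega> \<Omega>(2) by (auto simp: wgrad_def)
  show "AE x in lborel. norm (X x) <= norm (Q2^2 * (indicator K3 x * (norm (G x))^2))"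
  proof (intro AE_I2)
   fix x
   have "\<bar>\<phi> (w x - k0)\<bar>^2 <= Q2^2" by (rule power_mono[OF Q2(2)[OF B]]) simp
   then have "p x * ((\<phi> (w x - k0))^2 * (norm (G x))^2) <= 1 * (Q2^2 * (norm (G x))^2)"
    using p01[of x] by (intro mult_mono) (auto intro!: mult_right_mono)
   then show "norm (X x) <= norm (Q2^2 * (indicator K3 x * (norm (G x))^2))" using X0[of x] pK3[of x] by (cases "x \<in> K3") (auto simp: X_def)
  qed
 qed auto
 have iY: "integrable lborel Y"
 proof (rule Bochner_Integration.integrable_bound)
  let ?c = "La^2 * N^2 * (Q4 + P 0)"
  show "integrable lborel (\<lambda>x. ?c * indicator K3 x)" using iK3 by simp
  show "AE x in lborel. norm (Y x) <= norm (?c * indicator K3 x)"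
  proof (intro AE_I2)
   fix x
   have "P (v x) <= Q4 + P 0" using Q4(1) P(2)[of 0] order_trans[OF abs_ge_self Q4(2)[OF B[of x]]] by (auto simp: v max_def)
   then have "La^2 * N^2 * P (v x) <= ?c" by (intro mult_left_mono) auto
   then have "indicator (ball x0 b) x * (La^2 * N^2 * P (v x)) <= ?c" using P(2)[of 0] P(2)[of "v x"] Q4(1) by (auto simp: indicator_def)
   then have "\<theta> x * (indicator (ball x0 b) x * (La^2 * N^2 * P (v x))) <= 1 * ?c" by (rule mult_mono[OF \<theta>(3)]) (use P(2) in auto)
   then show "norm (Y x) <= norm (?c * indicator K3 x)" using Y0[of x] \<theta>K3[of x] by (cases "x \<in> K3") (auto simp: Y_def)
  qed
 qed auto
 have "AE x in lborel. lam / 2 * X x - 2 / lam * Y x <= F x \<bullet> Dl x" using AEF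
 proof eventually_elim
  case (elim x)
  show ?case
  proof (cases "x \<in> K3")
   case False
   then show ?thesis by (simp add: X_def Y_def Dl_def pK3 \<theta>K3)
  next
   case True
   then have x\<Omega>: "x \<in> \<Omega>" using K3\<Omega> by auto
   \<comment> \<open>Where \<Psi>(w - k0) \<eta>^2 is nonzero, the point lies in \<open>Kc\<close>,
     near which \<theta> is constant; so the gradient of \<theta> never contributes.\<close>
   have z: "\<Psi> (w x - k0) * (\<eta> x * \<eta> x) = 0 \<or> \<theta>' x = 0"
   proof (cases "w x - k0 <= k \<or> x \<notin> ball x0 b")
    case True then show ?thesis using van(3) \<eta>(4) by auto
   next
    case False then show ?thesis using inK[OF x\<Omega>] \<theta>'Kc by auto
   qed
   have "\<Psi> (w x - k0) *\<^sub>R p' x = (2 * \<theta> x * \<eta> x * \<Psi> (w x - k0)) *\<^sub>R \<eta>' x"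
   proof -
    have "p' x = (2 * \<theta> x * \<eta> x) *\<^sub>R \<eta>' x + (\<eta> x * \<eta> x) *\<^sub>R \<theta>' x"
     by (simp add: p'_def mult_ac flip: scaleR_add_left)
    then have "\<Psi> (w x - k0) *\<^sub>R p' x = (2 * \<theta> x * \<eta> x * \<Psi> (w x - k0)) *\<^sub>R \<eta>' x + (\<Psi> (w x - k0) * (\<eta> x * \<eta> x)) *\<^sub>R \<theta>' x"
     by (simp add: scaleR_add_right mult_ac)
    moreover have "(\<Psi> (w x - k0) * (\<eta> x * \<eta> x)) *\<^sub>R \<theta>' x = 0" using z by auto
    ultimately show ?thesis by simp
   qed
   then have FD: "F x \<bullet> Dl x = p x * (\<phi> (w x - k0))^2 * (F x \<bullet> G x) + (2 * \<theta> x * \<eta> x * \<Psi> (w x - k0)) * (F x \<bullet> \<eta>' x)"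
    by (simp add: Dl_def inner_add_right)
   have "lam * X x <= p x * (\<phi> (w x - k0))^2 * (F x \<bullet> G x)"
    using mult_left_mono[of "lam * (norm (G x))^2" "F x \<bullet> G x" "p x * (\<phi> (w x - k0))^2"] elim p01[of x]
    by (simp add: X_def algebra_simps)
   \<comment> \<open>The square of the cross term is at most 4 X Y, and Young's inequality absorbs
     it into half of the coercive term lam X.\<close>
   moreover have "- (lam / 2 * X x + 2 / lam * Y x) <= (2 * \<theta> x * \<eta> x * \<Psi> (w x - k0)) * (F x \<bullet> \<eta>' x)"
   proof (cases "x \<in> ball x0 b")
    case False
    then have "(2 * \<theta> x * \<eta> x * \<Psi> (w x - k0)) * (F x \<bullet> \<eta>' x) = 0" using \<eta>(4) by simp
    moreover have "0 <= lam / 2 * X x + 2 / lam * Y x" using lam X0[of x] Y0[of x] by (intro add_nonneg_nonneg mult_nonneg_nonneg) auto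
    ultimately show ?thesis by linarith
   next
    case xb: True
    let ?t = "- ((2 * \<theta> x * \<eta> x * \<Psi> (w x - k0)) * (F x \<bullet> \<eta>' x))"
    have 1: "(F x \<bullet> \<eta>' x)^2 <= (La * norm (G x) * N)^2"
    proof -
     have "\<bar>F x \<bullet> \<eta>' x\<bar> <= norm (F x) * norm (\<eta>' x)" by (rule Cauchy_Schwarz_ineq2)
     also have "\<dots> <= (La * norm (G x)) * N" using elim \<eta>(5)[of x] lam by (intro mult_mono) auto
     finally have "\<bar>F x \<bullet> \<eta>' x\<bar>^2 <= (La * norm (G x) * N)^2" by (rule power_mono) auto
     then show ?thesis by simp
    qed
    have 2: "(\<Psi> (w x - k0))^2 <= P (v x) * (\<phi> (w x - k0))^2"
     using \<Psi>P[OF xb] vw[where g = \<Psi>, OF x\<Omega> van(3)] vw[where g = \<phi>, OF x\<Omega> van(1)] by simp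
    have "?t^2 = 4 * (\<theta> x)^2 * (\<eta> x)^2 * ((\<Psi> (w x - k0))^2 * (F x \<bullet> \<eta>' x)^2)" by (simp add: power_mult_distrib mult_ac)
    also have "\<dots> <= 4 * (\<theta> x)^2 * (\<eta> x)^2 * ((P (v x) * (\<phi> (w x - k0))^2) * (La * norm (G x) * N)^2)"
     by (rule mult_left_mono[OF mult_mono[OF 2 1]]) (auto intro!: mult_nonneg_nonneg P(2))
    also have "\<dots> = 4 * (X x * Y x)" using xb by (simp add: X_def Y_def p_def power_mult_distrib power2_eq_square mult_ac)
    finally have "?t <= lam / 2 * X x + 2 / lam * Y x" by (rule amgm_square) (use X0 Y0 lam in auto)
    then show ?thesis by linarith
   qed
   ultimately show ?thesis unfolding FD by linarith
  qed
 qed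
 then have "(LINT x|lborel. lam / 2 * X x - 2 / lam * Y x) <= (LINT x|lborel. F x \<bullet> Dl x)" by (intro integral_mono_AE iFD) (use iX iY in auto)
 then have "lam / 2 * (LINT x|lborel. X x) <= 2 / lam * (LINT x|lborel. Y x)" using iX iY zero by simp
 then have "2 / lam * (lam / 2 * (LINT x|lborel. X x)) <= 2 / lam * (2 / lam * (LINT x|lborel. Y x))" using lam by (intro mult_left_mono) auto
 then have XY: "(LINT x|lborel. X x) <= 4 / lam^2 * (LINT x|lborel. Y x)" using lam by (simp add: power2_eq_square)
 have YP: "ennreal (LINT x|lborel. Y x) <= ennreal (La^2 * N^2) * (\<integral>\<^sup>+x. indicator (ball x0 b) x * ennreal (P (v x)) \<partial>lborel)"
 proof -
  have "ennreal (LINT x|lborel. Y x) = (\<integral>\<^sup>+x. ennreal (Y x) \<partial>lborel)" using iY Y0 by (simp add: nn_integral_eq_integral)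
  also have "\<dots> <= (\<integral>\<^sup>+x. ennreal (La^2 * N^2) * (indicator (ball x0 b) x * ennreal (P (v x))) \<partial>lborel)"
  proof (intro nn_integral_mono)
   fix x
   have "Y x <= indicator (ball x0 b) x * (La^2 * N^2 * P (v x))"
    unfolding Y_def using mult_right_mono[OF \<theta>(3)[of x], of "indicator (ball x0 b) x * (La^2 * N^2 * P (v x))"] P(2) by simp
   then have "ennreal (Y x) <= ennreal (indicator (ball x0 b) x * (La^2 * N^2 * P (v x)))" by (rule ennreal_leI)
   then show "ennreal (Y x) <= ennreal (La^2 * N^2) * (indicator (ball x0 b) x * ennreal (P (v x)))"
    by (cases "x \<in> ball x0 b") (simp_all add: ennreal_mult')
  qed
  also have "\<dots> = ennreal (La^2 * N^2) * (\<integral>\<^sup>+x. indicator (ball x0 b) x * ennreal (P (v x)) \<partial>lborel)"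
   by (rule nn_integral_cmult) measurable
  finally show ?thesis .
 qed
 \<comment> \<open>\<open>f1 j\<close> is C^1 and converges to \<Phi>(v) on the closed outer ball,
   while its squared gradients on the inner ball converge to something below X. The translation
   estimate for \<open>f1 j\<close> therefore survives in the limit by Fatou's lemma.\<close>
 define f1 where "f1 j x = \<theta> x * \<Phi> (u j x - k0)" for j x
 define g1 where "g1 j x = \<theta> x *\<^sub>R (\<phi> (u j x - k0) *\<^sub>R W j x) + \<Phi> (u j x - k0) *\<^sub>R \<theta>' x" for j x
 have f1: "C1 (f1 j) (g1 j)" for j unfolding f1_def[abs_def] g1_def[abs_def] by (intro C1_mult \<theta> C1_compose[OF uC1 der(1)] \<phi>)
 have [measurable]: "f1 j \<in> \<B>" "g1 j \<in> \<B>" for j unfolding f1_def g1_def by measurable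
 have f1lim: "(\<lambda>j. f1 j x) \<longlonglongrightarrow> \<Phi> (v x)" if x: "x \<in> cball x0 b" for x
 proof (cases "x \<in> K3")
  case True
  then have x\<Omega>: "x \<in> \<Omega>" using K3\<Omega> by auto
  have "(\<lambda>j. f1 j x) \<longlonglongrightarrow> \<theta> x * \<Phi> (w x - k0)"
   unfolding f1_def by (intro tendsto_intros cl[OF \<Phi>c] x\<Omega>)
  moreover have "\<theta> x * \<Phi> (w x - k0) = \<Phi> (w x - k0)"
   using van(2)[of "w x - k0"] inK[OF x\<Omega> x] \<theta>Kc[of x x] d(1) by (cases "w x - k0 <= k") auto
  ultimately show ?thesis using vw[where g = \<Phi>, OF x\<Omega> van(2)] by simp
 next
  case False
  have "\<Phi> (v x) = 0"
  proof (cases "x \<in> \<Omega>")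
   case True
   then have "w x - k0 <= k" using inK[OF True x] False KcK3 by auto
   then show ?thesis using vw[where g = \<Phi>, OF True van(2)] van(2) by simp
  qed (use k van(2) in \<open>simp add: v\<close>)
  then show ?thesis by (simp add: f1_def \<theta>K3[OF False])
 qed
 let ?w2 = "\<lambda>x. 2 * Q2^2 * (indicator K3 x * M x) + 2 * (Q3 * (C0 / d))^2 * indicator K3 x"
 have iw2: "integrable lborel ?w2" using iMK iK3 by simp
 have [measurable]: "ball x0 a \<in> sets borel" by simp
 let ?gl = "\<lambda>x. indicator (ball x0 a) x * (\<theta> x * (\<theta> x * ((\<phi> (w x - k0))^2 * (norm (G x))^2)))"
 have g1bd: "AE x in lborel. norm (indicator (ball x0 a) x * (norm (g1 j x))^2) <= ?w2 x" for j using limG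
 proof eventually_elim
  case (elim x)
  show ?case
  proof (cases "x \<in> K3")
   case True
   have "norm (g1 j x) <= Q2 * norm (W j x) + Q3 * (C0 / d)" unfolding g1_def
   proof (rule order_trans[OF norm_triangle_ineq], intro add_mono)
    have "\<theta> x * (\<bar>\<phi> (u j x - k0)\<bar> * norm (W j x)) <= 1 * (Q2 * norm (W j x))"
     using \<theta>(2,3)[of x] Q2(2)[OF uB] Q2(1) by (intro mult_mono) (auto intro!: mult_right_mono)
    then show "norm (\<theta> x *\<^sub>R (\<phi> (u j x - k0) *\<^sub>R W j x)) <= Q2 * norm (W j x)"
     using \<theta>(2)[of x] by (simp add: abs_mult mult.assoc)
    show "norm (\<Phi> (u j x - k0) *\<^sub>R \<theta>' x) <= Q3 * (C0 / d)"
     unfolding norm_scaleR by (rule mult_mono[OF Q3(2)[OF uB] \<theta>']) (use Q3 in auto)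
   qed
   then have "(norm (g1 j x))^2 <= (Q2 * norm (W j x) + Q3 * (C0 / d))^2" by (rule power_mono) simp
   also have "\<dots> <= 2 * (Q2 * norm (W j x))^2 + 2 * (Q3 * (C0 / d))^2"
    using sum_squares_bound[of "Q2 * norm (W j x)" "Q3 * (C0 / d)"] by (simp add: power2_sum)
   also have "\<dots> <= 2 * (Q2^2 * M x) + 2 * (Q3 * (C0 / d))^2" using elim True by (simp add: power_mult_distrib mult_left_mono)
   finally have "(norm (g1 j x))^2 <= ?w2 x" using True by (simp add: mult.assoc)
   then show ?thesis by (rule norm_indicator_mult_le) simp
  qed (simp add: g1_def \<theta>K3 \<theta>'K3)
 qed
 have ig1: "integrable lborel (\<lambda>x. indicator (ball x0 a) x * (norm (g1 j x))^2)" for j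
 proof (rule Bochner_Integration.integrable_bound[OF iw2])
  show "AE x in lborel. norm (indicator (ball x0 a) x * (norm (g1 j x))^2) <= norm (?w2 x)"
   using g1bd[of j] by eventually_elim (metis abs_ge_self order_trans real_norm_def)
 qed measurable
 have glim: "(\<lambda>j. LINT x|lborel. indicator (ball x0 a) x * (norm (g1 j x))^2) \<longlonglongrightarrow> (LINT x|lborel. ?gl x)"
 proof (rule integral_dominated_convergence[OF _ _ iw2 _ g1bd])
  show "AE x in lborel. (\<lambda>j. indicator (ball x0 a) x * (norm (g1 j x))^2) \<longlonglongrightarrow> ?gl x" using limG
  proof eventually_elim
   case (elim x)
   show ?case
   proof (cases "x \<in> K3 \<and> x \<in> ball x0 a")
    case True
    then have x: "x \<in> \<Omega>" "(\<lambda>j. W j x) \<longlonglongrightarrow> G x" using K3\<Omega> elim by auto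
    have xb: "x \<in> cball x0 b" using True ab by simp
    have "(\<lambda>j. indicator (ball x0 a) x * (norm (g1 j x))^2) \<longlonglongrightarrow>
      indicator (ball x0 a) x * (norm (\<theta> x *\<^sub>R (\<phi> (w x - k0) *\<^sub>R G x) + \<Phi> (w x - k0) *\<^sub>R \<theta>' x))^2"
     unfolding g1_def by (intro tendsto_intros cl[OF \<phi>] cl[OF \<Phi>c] x)
    moreover have "\<Phi> (w x - k0) *\<^sub>R \<theta>' x = 0"
     using van(2)[of "w x - k0"] inK[OF x(1) xb] \<theta>'Kc[of x] by (cases "w x - k0 <= k") auto
    ultimately show ?thesis using \<theta>(2)[of x] by (simp add: power_mult_distrib power2_eq_square mult_ac)
   next
    case False
    then show ?thesis by (auto simp: g1_def \<theta>K3 \<theta>'K3)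
   qed
  qed
 qed auto
 have glX: "(LINT x|lborel. ?gl x) <= (LINT x|lborel. X x)"
 proof (rule integral_mono_AE')
  show "AE x in lborel. ?gl x <= X x"
  proof (intro AE_I2)
   fix x
   have "\<theta> x * (\<theta> x * ((\<phi> (w x - k0))^2 * (norm (G x))^2)) <= 1 * (\<theta> x * ((\<phi> (w x - k0))^2 * (norm (G x))^2))"
    using \<theta> by (intro mult_right_mono) auto
   then show "?gl x <= X x" using \<eta>(3)[of x] X0[of x] by (cases "x \<in> ball x0 a") (simp_all add: X_def p_def mult_ac)
  qed
  show "AE x in lborel. 0 <= X x" using X0 by simp
 qed (rule iX)
 have tr: "(\<integral>\<^sup>+x. indicator (ball x0 a) x * indicator (ball x0 a) (x + h) * ennreal ((f1 j (x + h) - f1 j x)^2) \<partial>lborel)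
   <= ennreal ((norm h)^2 * (LINT x|lborel. indicator (ball x0 a) x * (norm (g1 j x))^2))" for j
 proof -
  have "(\<integral>\<^sup>+x. indicator (ball x0 a) x * ennreal ((norm (g1 j x))^2) \<partial>lborel) =
    (\<integral>\<^sup>+x. ennreal (indicator (ball x0 a) x * (norm (g1 j x))^2) \<partial>lborel)"
   by (intro nn_integral_cong) (simp add: indicator_def)
  also have "\<dots> = ennreal (LINT x|lborel. indicator (ball x0 a) x * (norm (g1 j x))^2)" using ig1 by (intro nn_integral_eq_integral) auto
  finally show ?thesis using C1_translation_estimate[OF f1[of j] convex_ball[of x0 a], of h] by (simp add: ennreal_mult')
 qed
 have "(\<integral>\<^sup>+x. indicator (ball x0 a) x * indicator (ball x0 a) (x + h) * ennreal ((\<Phi> (v (x + h)) - \<Phi> (v x))^2) \<partial>lborel) =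
   (\<integral>\<^sup>+x. liminf (\<lambda>j. indicator (ball x0 a) x * indicator (ball x0 a) (x + h) * ennreal ((f1 j (x + h) - f1 j x)^2)) \<partial>lborel)"
 proof (intro nn_integral_cong lim_imp_Liminf[symmetric] sequentially_bot)
  fix x
  show "(\<lambda>j. indicator (ball x0 a) x * indicator (ball x0 a) (x + h) * ennreal ((f1 j (x + h) - f1 j x)^2)) \<longlonglongrightarrow>
    indicator (ball x0 a) x * indicator (ball x0 a) (x + h) * ennreal ((\<Phi> (v (x + h)) - \<Phi> (v x))^2)"
  proof (cases "x \<in> ball x0 a \<and> x + h \<in> ball x0 a")
   case True
   then have "x \<in> cball x0 b" "x + h \<in> cball x0 b" using ab by auto
   then have "(\<lambda>j. ennreal ((f1 j (x + h) - f1 j x)^2)) \<longlonglongrightarrow> ennreal ((\<Phi> (v (x + h)) - \<Phi> (v x))^2)"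
    by (intro tendsto_ennrealI tendsto_intros f1lim)
   then show ?thesis using True by simp
  qed auto
 qed
 also have "\<dots> <= liminf (\<lambda>j. \<integral>\<^sup>+x. indicator (ball x0 a) x * indicator (ball x0 a) (x + h) * ennreal ((f1 j (x + h) - f1 j x)^2) \<partial>lborel)"
  by (rule nn_integral_liminf) measurable
 also have "\<dots> <= liminf (\<lambda>j. ennreal ((norm h)^2 * (LINT x|lborel. indicator (ball x0 a) x * (norm (g1 j x))^2)))"
  by (intro Liminf_mono always_eventually allI tr)
 also have "\<dots> = ennreal ((norm h)^2 * (LINT x|lborel. ?gl x))"
  by (intro lim_imp_Liminf sequentially_bot tendsto_ennrealI tendsto_mult tendsto_const glim)
 also have "\<dots> <= ennreal ((norm h)^2 * (4 / lam^2 * (LINT x|lborel. Y x)))" by (intro ennreal_leI mult_left_mono order_trans[OF glX XY]) auto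
 also have "\<dots> = ennreal ((norm h)^2 * (4 / lam^2)) * ennreal (LINT x|lborel. Y x)" by (simp add: ennreal_mult'[symmetric] mult.assoc)
 also have "\<dots> <= ennreal ((norm h)^2 * (4 / lam^2)) * (ennreal (La^2 * N^2) * (\<integral>\<^sup>+x. indicator (ball x0 b) x * ennreal (P (v x)) \<partial>lborel))"
  by (intro mult_left_mono YP) auto
 also have "\<dots> = ennreal ((norm h)^2 * (4 / lam^2 * (La^2 * N^2))) * (\<integral>\<^sup>+x. indicator (ball x0 b) x * ennreal (P (v x)) \<partial>lborel)"
  by (simp add: ennreal_mult'[symmetric] mult.assoc[symmetric])
 finally show ?thesis .
qed

section \<open>De Giorgi iteration\<close>

text \<open>Compactness of the superlevel sets is a boundary condition in disguise: approaching the
  boundary of \<Omega> inside D, w cannot stay above k0 + \<delta>. A point outside \<Omega> thus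
  has a neighbourhood avoiding the superlevel set, where the truncation is small.\<close>

lemma continuous_on_truncation:
 fixes w :: "'a::euclidean_space => real"
 assumes "open \<Omega>" "continuous_on \<Omega> w" "open D"
  and cl: "\<And>K \<delta>. compact K ==> K \<subseteq> D ==> 0 < \<delta> ==> compact {x \<in> \<Omega> \<inter> K. k0 + \<delta> <= w x}"
 shows "continuous_on D (\<lambda>x. if x \<in> \<Omega> then max 0 (w x - k0) else 0)"
proof (rule continuous_at_imp_continuous_on, rule ballI)
 fix x assume "x \<in> D"
 let ?v = "\<lambda>x. if x \<in> \<Omega> then max 0 (w x - k0) else 0"
 show "isCont ?v x"
 proof (cases "x \<in> \<Omega>")
  case True
  have "isCont (\<lambda>x. max 0 (w x - k0)) x" using assms(1,2) True by (auto intro!: continuous_intros simp: continuous_on_eq_continuous_at)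
  moreover have "\<forall>\<^sub>F y in nhds x. ?v y = max 0 (w y - k0)" using eventually_nhds_in_open[OF assms(1) True] by eventually_elim simp
  ultimately show ?thesis using isCont_cong by fast
 next
  case False
  obtain r where r: "r > 0" "cball x r \<subseteq> D" using \<open>open D\<close> \<open>x \<in> D\<close> open_contains_cball by blast
  show ?thesis unfolding continuous_at_eps_delta
  proof (intro allI impI)
   fix \<epsilon> :: real assume "0 < \<epsilon>"
   define S where "S = {y \<in> \<Omega> \<inter> cball x r. k0 + \<epsilon> <= w y}"
   have "compact S" unfolding S_def by (rule cl) (use r \<open>0 < \<epsilon>\<close> in auto)
   then have "open (- S)" by (simp add: compact_imp_closed open_Compl)
   moreover have "x \<in> - S" using False by (simp add: S_def)
   ultimately obtain d where d: "d > 0" "ball x d \<subseteq> - S" using open_contains_ball by blast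
   have "dist (?v y) (?v x) < \<epsilon>" if "dist y x < min d r" for y
   proof -
    have "y \<in> ball x d" "y \<in> cball x r" using that by (auto simp: dist_commute)
    then have "y \<in> \<Omega> ==> w y < k0 + \<epsilon>" using d(2) by (auto simp: S_def)
    then show ?thesis using False \<open>0 < \<epsilon>\<close> by (auto simp: dist_real_def)
   qed
   then show "\<exists>d>0. \<forall>y. dist y x < d --> dist (?v y) (?v x) < \<epsilon>" using d(1) r(1) by (intro exI[of _ "min d r"]) auto
  qed
 qed
qed

lemma DG_truncated_solution:
 assumes lam: "0 < lam" "0 <= La"
 shows "\<exists>L>0. \<forall>U (w::'a::euclidean_space => real) G F \<Omega> D k0. wsol lam La U w G F \<and> open \<Omega> \<and> \<Omega> \<subseteq> U \<and> open D \<and>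
   (\<forall>K \<delta>. compact K \<and> K \<subseteq> D \<and> 0 < \<delta> --> compact {x \<in> \<Omega> \<inter> K. k0 + \<delta> <= w x}) -->
   DG L D (\<lambda>x. if x \<in> \<Omega> then max 0 (w x - k0) else 0)"
proof -
 obtain C0 where C0: "0 < C0 \<and> (\<forall>(S::'a set) \<delta>. S \<in> sets borel \<and> 0 < \<delta> -->
   (\<exists>\<theta> \<theta>'. C1 \<theta> \<theta>' \<and> (\<forall>x. 0 <= \<theta> x \<and> \<theta> x <= 1) \<and> (\<forall>x. ball x \<delta> \<subseteq> S --> \<theta> x = 1) \<and>
    (\<forall>x. ball x \<delta> \<inter> S = {} --> \<theta> x = 0) \<and> (\<forall>x. norm (\<theta>' x) <= C0 / \<delta>)))"
  using ex_cutoff[where ?'a = 'a] by (elim exE) (rule that)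
 \<comment> \<open>The cutoff from radius a to radius b is built at scale (b - a) / 4, so its
   gradient is at most 4 \<open>C0\<close> / (b - a).\<close>
 define L where "L = 4 / lam^2 * (La^2 * (4 * C0)^2) + 1"
 have "0 < L" by (auto simp: L_def intro!: add_nonneg_pos)
 moreover have "DG L D (\<lambda>x. if x \<in> \<Omega> then max 0 (w x - k0) else 0)"
  if "wsol lam La U w G F \<and> open \<Omega> \<and> \<Omega> \<subseteq> U \<and> open D \<and>
   (\<forall>K \<delta>. compact K \<and> K \<subseteq> D \<and> 0 < \<delta> --> compact {x \<in> \<Omega> \<inter> K. k0 + \<delta> <= w x})"
  for U G F \<Omega> D k0 and w :: "'a => real"
 proof -
  have sol: "wsol lam La U w G F" and \<Omega>: "open \<Omega>" "\<Omega> \<subseteq> U" and D: "open D"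
   and cl: "\<And>K \<delta>. compact K ==> K \<subseteq> D ==> 0 < \<delta> ==> compact {x \<in> \<Omega> \<inter> K. k0 + \<delta> <= w x}"
   using that by auto
  define v where "v = (\<lambda>x. if x \<in> \<Omega> then max 0 (w x - k0) else 0)"
  have [measurable]: "w \<in> \<B>" "\<Omega> \<in> sets borel" using sol \<Omega> by (auto simp: wsol_def wgrad_def)
  have vm: "v \<in> \<B>" unfolding v_def by measurable
  have vc: "continuous_on D v" unfolding v_def
   by (rule continuous_on_truncation[OF \<Omega>(1) _ D cl]) (use sol \<Omega> in \<open>auto simp: wsol_def intro: continuous_on_subset\<close>)
  have main: "(\<integral>\<^sup>+x. indicator (ball x0 a) x * indicator (ball x0 a) (x + h) * ennreal ((\<Phi> (v (x + h)) - \<Phi> (v x))^2) \<partial>lborel)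
     <= ennreal (L * (norm h)^2 / (b - a)^2) * (\<integral>\<^sup>+x. indicator (ball x0 b) x * ennreal (P (v x)) \<partial>lborel)"
   if ab: "0 < a" "a < b" "cball x0 b \<subseteq> D" "0 < k" and c: "continuous_on UNIV \<phi>" "continuous_on UNIV P" "\<forall>s. 0 <= P s"
    and van: "\<forall>s\<le>k. \<phi> s = 0 \<and> \<Phi> s = 0 \<and> \<Psi> s = 0"
    and der: "\<forall>s. (\<Phi> has_real_derivative \<phi> s) (at s)" "\<forall>s. (\<Psi> has_real_derivative (\<phi> s)^2) (at s)"
    and PP: "\<forall>x\<in>ball x0 b. (\<Psi> (v x))^2 <= P (v x) * (\<phi> (v x))^2"
   for x0 a b k \<phi> \<Phi> \<Psi> P h
  proof -
   let ?S = "ball x0 ((a + b) / 2)" and ?\<delta> = "(b - a) / 4"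
   have "?S \<in> sets borel \<and> 0 < ?\<delta>" using ab by simp
   from C0[THEN conjunct2, rule_format, OF this] obtain \<eta> \<eta>' where
    T: "C1 \<eta> \<eta>' \<and> (\<forall>x. 0 <= \<eta> x \<and> \<eta> x <= 1) \<and> (\<forall>x. ball x ?\<delta> \<subseteq> ?S --> \<eta> x = 1) \<and>
    (\<forall>x. ball x ?\<delta> \<inter> ?S = {} --> \<eta> x = 0) \<and> (\<forall>x. norm (\<eta>' x) <= C0 / ?\<delta>)"
    by (elim exE) (rule that)
   have \<eta>1: "\<eta> x = 1" if "x \<in> ball x0 a" for x
   proof (rule T[THEN conjunct2, THEN conjunct2, THEN conjunct1, rule_format], rule subsetI)
    fix z assume "z \<in> ball x ?\<delta>"
    moreover have "dist x0 z <= dist x0 x + dist x z" by (rule dist_triangle)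
    ultimately show "z \<in> ?S" using that ab by (simp add: field_simps)
   qed
   have \<eta>0: "\<eta> x = 0" if "x \<notin> ball x0 b" for x
   proof (rule T[THEN conjunct2, THEN conjunct2, THEN conjunct2, THEN conjunct1, rule_format], rule ccontr)
    assume "ball x ?\<delta> \<inter> ?S \<noteq> {}"
    then obtain z where "dist x z < ?\<delta>" "dist x0 z < (a + b) / 2" by auto
    moreover have "dist x0 x <= dist x0 z + dist x z" by (metis dist_commute dist_triangle)
    ultimately show False using that ab by (simp add: field_simps)
   qed
   have Kc: "compact {x \<in> \<Omega> \<inter> cball x0 b. k0 + k <= w x}" by (rule cl) (use ab in auto)
   have "(\<integral>\<^sup>+x. indicator (ball x0 a) x * indicator (ball x0 a) (x + h) * ennreal ((\<Phi> (v (x + h)) - \<Phi> (v x))^2) \<partial>lborel)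
     <= ennreal ((norm h)^2 * (4 / lam^2 * (La^2 * (C0 / ?\<delta>)^2))) * (\<integral>\<^sup>+x. indicator (ball x0 b) x * ennreal (P (v x)) \<partial>lborel)"
    by (rule energy_estimate[OF sol lam \<Omega> v_def ab(4) Kc _ _ ab(1,2), where \<eta> = \<eta> and \<eta>' = \<eta>' and \<phi> = \<phi> and \<Psi> = \<Psi>])
      (use T \<eta>1 \<eta>0 c van der PP in auto)
   also have "\<dots> <= ennreal (L * (norm h)^2 / (b - a)^2) * (\<integral>\<^sup>+x. indicator (ball x0 b) x * ennreal (P (v x)) \<partial>lborel)"
   proof (intro mult_right_mono ennreal_leI)
    have "(norm h)^2 * (4 / lam^2 * (La^2 * (C0 / ?\<delta>)^2)) = (L - 1) * (norm h)^2 / (b - a)^2"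
     by (simp add: L_def power_mult_distrib power_divide)
    also have "\<dots> <= L * (norm h)^2 / (b - a)^2" by (intro divide_right_mono mult_right_mono) auto
    finally show "(norm h)^2 * (4 / lam^2 * (La^2 * (C0 / ?\<delta>)^2)) <= L * (norm h)^2 / (b - a)^2" .
   qed auto
   finally show ?thesis .
  qed
  show ?thesis unfolding v_def[symmetric] DG_def
  proof (intro conjI vm vc allI impI; (elim conjE)?)
   show "0 <= v x" for x by (simp add: v_def)
  qed (rule main; assumption)
 qed
 ultimately show ?thesis by blast
qed

section \<open>A Poincare type inequality and De Giorgi's first lemma\<close>

text \<open>The translation estimate is integrated over all h of norm below \<rho>. A point x with
  \<Phi>(v x) nonzero that sees zeros of \<Phi>(v) of measure m within distance \<rho> collects at
  least m \<Phi>(v x)^2 from the differences to these zeros.\<close>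

lemma DG_basic:
 fixes v :: "'a::euclidean_space => real"
 assumes DG: "DG L D v" and L: "0 <= L" and ab: "0 < a" "a < b" "cball x0 b \<subseteq> D" "0 < k" "0 < \<rho>"
  and c: "continuous_on UNIV \<phi>" "continuous_on UNIV P" "\<And>s. 0 <= P s"
  and van: "\<And>s. s <= k ==> \<phi> s = 0 \<and> \<Phi> s = 0 \<and> \<Psi> s = 0"
  and der: "\<And>s. (\<Phi> has_real_derivative \<phi> s) (at s)" "\<And>s. (\<Psi> has_real_derivative (\<phi> s)^2) (at s)"
  and PP: "\<And>x. x \<in> ball x0 b ==> (\<Psi> (v x))^2 <= P (v x) * (\<phi> (v x))^2"
  and m: "\<And>x. x \<in> ball x0 a ==> \<Phi> (v x) \<noteq> 0 ==> m <= emeasure lborel {y \<in> ball x0 a. dist x y < \<rho> \<and> \<Phi> (v y) = 0}"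
 shows "m * (\<integral>\<^sup>+x. indicator (ball x0 a) x * ennreal ((\<Phi> (v x))^2) \<partial>lborel) \<le>
   ennreal (L * \<rho>^2 / (b - a)^2) * emeasure lborel (ball (0::'a) \<rho>) * (\<integral>\<^sup>+x. indicator (ball x0 b) x * ennreal (P (v x)) \<partial>lborel)"
proof -
 have [measurable]: "v \<in> \<B>" using DG by (simp add: DG_def)
 have "continuous_on UNIV \<Phi>" using der by (meson DERIV_isCont continuous_at_imp_continuous_on)
 then have [measurable]: "\<Phi> \<in> \<B>" by (rule borel_measurable_continuous_onI)
 have [measurable]: "P \<in> \<B>" by (rule borel_measurable_continuous_onI[OF c(2)])
 define f where "f x = \<Phi> (v x)" for x
 have [measurable]: "f \<in> \<B>" unfolding f_def by measurable
 have [measurable]: "ball x0 a \<in> sets borel" "ball (0::'a) \<rho> \<in> sets borel" by auto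
 let ?I = "\<integral>\<^sup>+x. indicator (ball x0 b) x * ennreal (P (v x)) \<partial>lborel"
 let ?g = "\<lambda>x h. indicator (ball (0::'a) \<rho>) h * (indicator (ball x0 a) x * indicator (ball x0 a) (x + h) * ennreal ((f (x + h) - f x)^2))"
 have "m * (\<integral>\<^sup>+x. indicator (ball x0 a) x * ennreal ((\<Phi> (v x))^2) \<partial>lborel) =
   (\<integral>\<^sup>+x. m * (indicator (ball x0 a) x * ennreal ((f x)^2)) \<partial>lborel)"
  unfolding f_def[symmetric] by (rule nn_integral_cmult[symmetric]) measurable
 also have "\<dots> <= (\<integral>\<^sup>+x. \<integral>\<^sup>+h. ?g x h \<partial>lborel \<partial>lborel)"
 proof (intro nn_integral_mono)
  fix x :: 'a
  show "m * (indicator (ball x0 a) x * ennreal ((f x)^2)) <= (\<integral>\<^sup>+h. ?g x h \<partial>lborel)"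
  proof (cases "x \<in> ball x0 a \<and> f x \<noteq> 0")
   case True
   let ?Z = "{y \<in> ball x0 a. dist x y < \<rho> \<and> \<Phi> (v y) = 0}"
   have Z: "?Z = {y \<in> space borel. dist x0 y < a \<and> dist x y < \<rho> \<and> f y = 0}" by (auto simp: f_def)
   have [measurable]: "?Z \<in> sets borel" unfolding Z by measurable
   have "m * (indicator (ball x0 a) x * ennreal ((f x)^2)) <= emeasure lborel ?Z * ennreal ((f x)^2)"
    using True m[of x] by (simp add: f_def mult_right_mono)
   also have "\<dots> = (\<integral>\<^sup>+y. indicator ?Z y * ennreal ((f x)^2) \<partial>lborel)" by (simp add: nn_integral_multc)
   also have "\<dots> = (\<integral>\<^sup>+h. indicator ?Z (h + x) * ennreal ((f x)^2) \<partial>lborel)"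
    by (rule lborel_nn_integral_shift[symmetric]) measurable
   also have "\<dots> <= (\<integral>\<^sup>+h. ?g x h \<partial>lborel)"
   proof (intro nn_integral_mono)
    fix h
    show "indicator ?Z (h + x) * ennreal ((f x)^2) <= ?g x h"
    proof (cases "h + x \<in> ?Z")
     case Z: True
     then have "h \<in> ball 0 \<rho>" "x + h \<in> ball x0 a" "f (x + h) = 0" by (auto simp: dist_norm add.commute f_def norm_minus_commute)
     then show ?thesis using True Z by simp
    qed simp
   qed
   finally show ?thesis .
  qed (auto simp: indicator_def)
 qed
 also have "\<dots> = (\<integral>\<^sup>+h. \<integral>\<^sup>+x. ?g x h \<partial>lborel \<partial>lborel)" by (rule lborel_pair.Fubini') measurable
 also have "\<dots> <= (\<integral>\<^sup>+h. indicator (ball (0::'a) \<rho>) h * (ennreal (L * \<rho>^2 / (b - a)^2) * ?I) \<partial>lborel)"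
 proof (intro nn_integral_mono)
  fix h :: 'a
  have e: "(\<integral>\<^sup>+x. indicator (ball x0 a) x * indicator (ball x0 a) (x + h) * ennreal ((f (x + h) - f x)^2) \<partial>lborel)
    <= ennreal (L * (norm h)^2 / (b - a)^2) * ?I"
   unfolding f_def by (rule DG[unfolded DG_def, THEN conjunct2, THEN conjunct2, THEN conjunct2, THEN spec[of _ x0], THEN spec[of _ a],
      THEN spec[of _ b], THEN spec[of _ k], THEN spec[of _ \<phi>], THEN spec[of _ \<Phi>], THEN spec[of _ \<Psi>], THEN spec[of _ P],
      THEN spec[of _ h], THEN mp])
     (use ab c van der PP in auto)
  show "(\<integral>\<^sup>+x. ?g x h \<partial>lborel) <= indicator (ball (0::'a) \<rho>) h * (ennreal (L * \<rho>^2 / (b - a)^2) * ?I)"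
  proof (cases "h \<in> ball 0 \<rho>")
   case True
   have "ennreal (L * (norm h)^2 / (b - a)^2) <= ennreal (L * \<rho>^2 / (b - a)^2)"
    using True L by (intro ennreal_leI divide_right_mono mult_left_mono power_mono) auto
   then have "ennreal (L * (norm h)^2 / (b - a)^2) * ?I <= ennreal (L * \<rho>^2 / (b - a)^2) * ?I" by (rule mult_right_mono) simp
   then show ?thesis using e True by simp
  qed simp
 qed
 also have "\<dots> = ennreal (L * \<rho>^2 / (b - a)^2) * emeasure lborel (ball (0::'a) \<rho>) * ?I" by (simp add: nn_integral_multc mult_ac)
 finally show ?thesis .
qed

text \<open>The centre is reached by moving from x towards x0 by \<rho> / 2, or is x0 itself if that
  is nearer. So even points near the sphere see a volume of order \<rho>^n of the ball.\<close>

lemma half_ball_in_ball_Int: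
 fixes x :: "'a::euclidean_space"
 assumes "x \<in> ball x0 a" "0 < \<rho>" "\<rho> <= a"
 obtains z where "ball z (\<rho> / 2) \<subseteq> {y \<in> ball x0 a. dist x y < \<rho>}"
proof (cases "dist x x0 <= \<rho> / 2")
 case True
 have "ball x0 (\<rho> / 2) \<subseteq> {y \<in> ball x0 a. dist x y < \<rho>}"
 proof
  fix y assume "y \<in> ball x0 (\<rho> / 2)"
  then show "y \<in> {y \<in> ball x0 a. dist x y < \<rho>}" using True assms dist_triangle[of x y x0] by simp
 qed
 then show thesis by (rule that)
next
 case False
 define D where "D = dist x x0"
 define z where "z = x + (\<rho> / 2 / D) *\<^sub>R (x0 - x)"
 have D: "D > \<rho> / 2" "D > 0" "D < a" using False assms by (auto simp: D_def dist_commute)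
 have n: "norm (x0 - x) = D" by (simp add: D_def dist_norm norm_minus_commute)
 have "dist x z = \<bar>\<rho> / 2 / D\<bar> * norm (x0 - x)" by (simp add: z_def dist_norm)
 then have zx: "dist x z = \<rho> / 2" using D n assms(2) by simp
 have "x0 - z = (1 - \<rho> / 2 / D) *\<^sub>R (x0 - x)" by (simp add: z_def algebra_simps)
 then have "dist x0 z = \<bar>1 - \<rho> / 2 / D\<bar> * D" by (simp add: dist_norm n)
 also have "\<dots> = D - \<rho> / 2" using D by (simp add: field_simps)
 finally have zx0: "dist x0 z = D - \<rho> / 2" .
 have "ball z (\<rho> / 2) \<subseteq> {y \<in> ball x0 a. dist x y < \<rho>}"
 proof
  fix y assume "y \<in> ball z (\<rho> / 2)"
  then show "y \<in> {y \<in> ball x0 a. dist x y < \<rho>}" using zx zx0 D dist_triangle[of x y z] dist_triangle[of x0 y z] by simp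
 qed
 then show thesis by (rule that)
qed

lemma has_real_derivative_max_power:
 "((\<lambda>s. (max 0 (s - k)) ^ Suc (Suc n)) has_real_derivative real (Suc (Suc n)) * (max 0 (s - k)) ^ Suc n) (at s)"
proof -
 consider "s > k" | "s < k" | "s = k" by linarith
 then show ?thesis
 proof cases
  case 1
  have "((\<lambda>s. (s - k) ^ Suc (Suc n)) has_real_derivative real (Suc (Suc n)) * (max 0 (s - k)) ^ Suc n) (at s)"
  proof -
   have d: "((\<lambda>s. s - k) has_real_derivative 1) (at s)" by (auto intro!: derivative_eq_intros)
   from DERIV_power[OF d, of "Suc (Suc n)"] show ?thesis using 1 by (simp add: max_def del: power_Suc)
  qed
  then show ?thesis by (rule DERIV_cong_ev[THEN iffD1, rotated -1, OF _ refl _ refl])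
     (use 1 in \<open>auto simp: max_def intro!: eventually_mono[OF eventually_nhds_in_open[of "{k<..}"]]\<close>)
 next
  case 2
  have "((\<lambda>s. 0) has_real_derivative real (Suc (Suc n)) * (max 0 (s - k)) ^ Suc n) (at s)" using 2 by (simp add: max_def)
  then show ?thesis by (rule DERIV_cong_ev[THEN iffD1, rotated -1, OF _ refl _ refl])
     (use 2 in \<open>auto simp: max_def intro!: eventually_mono[OF eventually_nhds_in_open[of "{..<k}"]]\<close>)
 next
  case 3
  have "((\<lambda>h. \<bar>h\<bar> ^ Suc n) \<longlongrightarrow> \<bar>0\<bar> ^ Suc n) (at (0::real))" by (intro tendsto_intros)
  then have "((\<lambda>h::real. \<bar>h\<bar> ^ Suc n) \<longlongrightarrow> 0) (at 0)" by simp
  then have "((\<lambda>h. (max 0 h) ^ Suc (Suc n) / h) \<longlongrightarrow> 0) (at (0::real))"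
  proof (rule Lim_null_comparison[rotated])
   have "norm ((max 0 h) ^ Suc (Suc n) / h) <= \<bar>h\<bar> ^ Suc n" for h :: real
    by (cases "h > 0") (simp add: max_def, simp add: max_def del: power_Suc)
   then show "\<forall>\<^sub>F h::real in at 0. norm ((max 0 h) ^ Suc (Suc n) / h) <= \<bar>h\<bar> ^ Suc n" by simp
  qed
  then show ?thesis using 3 by (simp add: DERIV_def)
 qed
qed

lemma ennreal_mult_le_cancel:
 assumes "ennreal A * y <= ennreal B * z" "0 < A" "0 <= B"
 shows "y <= ennreal (B / A) * z"
proof -
 have "ennreal (1 / A) * (ennreal A * y) <= ennreal (1 / A) * (ennreal B * z)" by (rule mult_left_mono[OF assms(1)]) simp
 then show ?thesis using assms(2,3) by (simp add: mult.assoc[symmetric] ennreal_mult'[symmetric])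
qed

lemma ennreal_half_le:
 assumes "ennreal a <= z + ennreal (a / 2)" "0 <= a" shows "ennreal (a / 2) <= z"
proof (cases z)
 case (real b)
 then have "ennreal a <= ennreal (b + a / 2)" using assms by simp
 then have "a <= b + a / 2" using real assms(2) by (subst (asm) ennreal_le_iff) auto
 then show ?thesis using real by (simp add: ennreal_leI)
qed simp

lemma open_emeasure_zero_imp_empty:
 assumes "open U" "emeasure lborel (U :: 'a::euclidean_space set) = 0" shows "U = {}"
proof -
 have "U \<in> null_sets lborel" using assms by auto
 then have "U \<in> null_sets lebesgue" by (rule null_sets_completionI)
 then show ?thesis using open_not_negligible[OF assms(1)] negligible_iff_null_sets by blast
qed

lemma emeasure_ball_power:
 assumes "0 <= r"
 shows "emeasure lborel (ball (x::'a::euclidean_space) r) = ennreal (unit_ball_vol (real DIM('a)) * r ^ DIM('a))" using assms by (rule emeasure_ball)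

text \<open>\<open>Y j\<close> is the fourth power integral of the truncation at level
  \<open>kk j\<close> over the ball of radius \<open>rr j\<close>. By Chebyshev the inductive bound
  on \<open>Y j\<close> makes the set above the next level no larger than half a ball of radius
  \<rho> / 2, where \<rho> = \<rho>0 r 2^-j; hence every point sees enough zeros at scale \<rho> and
  \<open>DG_basic\<close> gives \<open>Y (Suc j)\<close> \<le> C \<rho>0^2 \<open>Y j\<close>.
  Smallness of \<rho>0 makes the decay geometric, which reproduces the inductive bound.\<close>

lemma DG_first_lemma:
 assumes L: "0 <= L"
 shows "\<exists>\<nu>>0. \<forall>D (v::'a::euclidean_space => real) x0 r m d. DG L D v \<and> 0 < r \<and> ball x0 r \<subseteq> D \<and> 0 <= m \<and> 0 < d \<and>
   (\<forall>x\<in>ball x0 r. v x <= m + d) \<and> emeasure lborel {x \<in> ball x0 r. m < v x} <= ennreal \<nu> * emeasure lborel (ball x0 r) -->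
   (\<forall>x\<in>ball x0 (r / 2). v x <= m + d / 2)"
proof -
 let ?n = "DIM('a)"
 define V where "V = unit_ball_vol (real ?n)"
 have V: "0 < V" unfolding V_def by simp
 define C where "C = 128 * 2 ^ ?n * (L + 1)"
 \<comment> \<open>16 q = 2^-n: Chebyshev with fourth powers and level gaps of order 2^-j loses
   16^j, and the volume at scale \<rho> shrinks like 2^(-jn).\<close>
 define q :: real where "q = 1 / (16 * 2 ^ ?n)"
 have Cq: "0 < C" "0 < q" using L by (auto simp: C_def q_def add_nonneg_pos)
 define \<rho>0 where "\<rho>0 = min (1 / 2) (sqrt (q / C))"
 have \<rho>0: "0 < \<rho>0" "\<rho>0 <= 1 / 2" using Cq by (auto simp: \<rho>0_def)
 have \<rho>0q: "C * \<rho>0^2 <= q"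
 proof -
  have "\<rho>0^2 <= (sqrt (q / C))^2" using \<rho>0 by (intro power_mono) (auto simp: \<rho>0_def)
  then show ?thesis using Cq by (simp add: field_simps)
 qed
 \<comment> \<open>The value for which the Chebyshev bound equals half the volume of a ball of
   radius \<rho> / 2, for every j.\<close>
 define \<nu> where "\<nu> = \<rho>0 ^ ?n / (2 ^ ?n * 8192)"
 have \<nu>: "0 < \<nu>" using \<rho>0 by (simp add: \<nu>_def)
 have "v x <= m + d / 2"
  if DG: "DG L D v" and r: "0 < r" "ball x0 r \<subseteq> D" and md: "0 <= m" "0 < d"
   and bd: "\<forall>x\<in>ball x0 r. v x <= m + d" and em: "emeasure lborel {x \<in> ball x0 r. m < v x} <= ennreal \<nu> * emeasure lborel (ball x0 r)"
   and x: "x \<in> ball x0 (r / 2)"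
  for D and v :: "'a => real" and x0 r m d x
 proof -
  have [measurable]: "v \<in> \<B>" and vc: "continuous_on D v" using DG by (auto simp: DG_def)
  have [measurable]: "ball x0 s \<in> sets borel" for s by simp
  \<comment> \<open>The levels increase from m + d/4 towards m + d/2, the radii decrease from 3r/4
    towards r/2; consecutive gaps are d 2^-j / 8 and r 2^-j / 8.\<close>
  define kk where "kk j = m + d * (1 / 2 - (1 / 2) ^ j / 4)" for j :: nat
  define rr where "rr j = r * (1 / 2 + (1 / 2) ^ j / 4)" for j :: nat
  define Y where "Y j = (\<integral>\<^sup>+x. indicator (ball x0 (rr j)) x * ennreal ((max 0 (v x - kk j) / d) ^ 4) \<partial>lborel)" for j
  have p2: "(0::real) < (1 / 2) ^ j" "(1 / 2 :: real) ^ j <= 1" for j :: nat by (auto simp: power_le_one)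
  have kk: "m + d / 4 <= kk j" "kk j <= kk (Suc j)" "kk j <= m + d / 2" "kk (Suc j) - kk j = d * (1 / 2) ^ j / 8" for j
   using p2[of j] md by (auto simp: kk_def field_simps)
  have kk0: "0 < kk j" "m < kk j" for j using kk(1)[of j] md by auto
  have rr: "0 < rr j" "rr j < r" "rr (Suc j) < rr j" "r / 2 < rr j" "rr j - rr (Suc j) = r * (1 / 2) ^ j / 8" for j
  proof -
   define p :: real where "p = (1 / 2) ^ j"
   have p: "0 < p" "p <= 1" "(1 / 2 :: real) ^ Suc j = p / 2" using p2[of j] by (auto simp: p_def)
   have e: "rr j = r / 2 + r * p / 4" "rr (Suc j) = r / 2 + r * p / 8" unfolding rr_def p(3) p_def[symmetric] by (simp_all add: field_simps)
   have "0 < r * p" "r * p <= r" using p r by (auto simp: mult_left_le)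
   then show "0 < rr j" "rr j < r" "rr (Suc j) < rr j" "r / 2 < rr j" "rr j - rr (Suc j) = r * (1 / 2) ^ j / 8"
    using r(1) unfolding e p_def[symmetric] by linarith+
  qed
  have main: "Y j <= ennreal (q ^ j * (\<nu> * (V * r ^ ?n)))" for j
  proof (induction j)
   case 0
   have [measurable]: "{x \<in> ball x0 r. m < v x} \<in> sets borel" unfolding mem_ball by measurable
   have "Y 0 <= (\<integral>\<^sup>+x. indicator {x \<in> ball x0 r. m < v x} x \<partial>lborel)" unfolding Y_def
   proof (intro nn_integral_mono)
    fix x
    show "indicator (ball x0 (rr 0)) x * ennreal ((max 0 (v x - kk 0) / d) ^ 4) <= indicator {x \<in> ball x0 r. m < v x} x"
    proof (cases "x \<in> ball x0 (rr 0) \<and> kk 0 < v x")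
     case True
     then have xr: "x \<in> ball x0 r" "m < v x" using rr(2)[of 0] kk0(2)[of 0] by auto
     then have "v x - kk 0 <= d" using bd kk0(2)[of 0] by fastforce
     then have "((v x - kk 0) / d) ^ 4 <= 1" using True md by (intro power_le_one) auto
     then show ?thesis using True xr by (simp add: max_def)
    qed (auto simp: max_def)
   qed
   also have "\<dots> = emeasure lborel {x \<in> ball x0 r. m < v x}" by simp
   also have "\<dots> <= ennreal (\<nu> * (V * r ^ ?n))" using em r \<nu> by (simp add: emeasure_ball_power V_def[symmetric] ennreal_mult'[symmetric])
   finally show ?case by simp
  next
   case (Suc j)
   define a b k \<rho> where "a = rr (Suc j)" "b = rr j" "k = kk (Suc j)" "\<rho> = \<rho>0 * r * (1 / 2) ^ j"
   define t where "t s = max 0 (s - k)" for s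
   have \<rho>: "0 < \<rho>" "\<rho> <= a"
   proof -
    show "0 < \<rho>" using \<rho>0 r by (simp add: a_b_k_\<rho>_def)
    have "\<rho> <= (1 / 2) * r * 1" unfolding a_b_k_\<rho>_def using \<rho>0 r p2[of j] by (intro mult_mono) auto
    also have "\<dots> <= a" using rr(4)[of "Suc j"] by (simp add: a_b_k_\<rho>_def)
    finally show "\<rho> <= a" .
   qed
   let ?T = "{y \<in> ball x0 a. k < v y}"
   have [measurable]: "?T \<in> sets borel" unfolding mem_ball by measurable
   have T: "emeasure lborel ?T <= ennreal (V * (\<rho> / 2) ^ ?n / 2)"
   proof -
    have "emeasure lborel ?T = (\<integral>\<^sup>+y. indicator ?T y \<partial>lborel)" by simp
    also have "\<dots> <= (\<integral>\<^sup>+x. ennreal ((8 * 2 ^ j) ^ 4) * (indicator (ball x0 (rr j)) x * ennreal ((max 0 (v x - kk j) / d) ^ 4)) \<partial>lborel)"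
    proof (intro nn_integral_mono)
     fix y
     show "indicator ?T y <= ennreal ((8 * 2 ^ j) ^ 4) * (indicator (ball x0 (rr j)) y * ennreal ((max 0 (v y - kk j) / d) ^ 4))"
     proof (cases "y \<in> ?T")
      case True
      then have y: "y \<in> ball x0 (rr j)" using rr(3)[of j] by (auto simp: a_b_k_\<rho>_def)
      have "d * (1 / 2) ^ j / 8 <= v y - kk j" using True kk(4)[of j] by (simp add: a_b_k_\<rho>_def)
      moreover have "kk j <= v y" using True kk(2)[of j] by (simp add: a_b_k_\<rho>_def)
      ultimately have "1 <= 8 * 2 ^ j * (max 0 (v y - kk j) / d)" using md by (simp add: field_simps max_def)
      then have "1 <= (8 * 2 ^ j * (max 0 (v y - kk j) / d)) ^ 4" by (rule one_le_power)
      then have "ennreal 1 <= ennreal ((8 * 2 ^ j) ^ 4 * (max 0 (v y - kk j) / d) ^ 4)" by (intro ennreal_leI) (simp only: power_mult_distrib)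
      then show ?thesis using True y by (simp add: ennreal_mult')
     qed simp
    qed
    also have "\<dots> = ennreal ((8 * 2 ^ j) ^ 4) * Y j" unfolding Y_def by (rule nn_integral_cmult) measurable
    also have "\<dots> <= ennreal ((8 * 2 ^ j) ^ 4) * ennreal (q ^ j * (\<nu> * (V * r ^ ?n)))" by (intro mult_left_mono Suc) simp
    also have "\<dots> = ennreal (4096 * (16 * q) ^ j * \<nu> * V * r ^ ?n)"
    proof -
     have "((2::real) ^ j) ^ 4 = 16 ^ j" using power_mult[of "2::real" j 4] power_mult[of "2::real" 4 j] by (simp add: mult.commute)
     then have eq: "(8 * 2 ^ j) ^ 4 * (q ^ j * (\<nu> * (V * r ^ ?n))) = 4096 * (16 * q) ^ j * \<nu> * V * r ^ ?n"
      by (simp add: power_mult_distrib mult_ac)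
     have "ennreal ((8 * 2 ^ j) ^ 4) * ennreal (q ^ j * (\<nu> * (V * r ^ ?n))) = ennreal ((8 * 2 ^ j) ^ 4 * (q ^ j * (\<nu> * (V * r ^ ?n))))"
      by (rule ennreal_mult'[symmetric]) simp
     then show ?thesis by (simp only: eq)
    qed
    also have "\<dots> <= ennreal (V * (\<rho> / 2) ^ ?n / 2)"
    proof (rule ennreal_leI)
     have "V * (\<rho> / 2) ^ ?n / 2 = V * r ^ ?n * (\<rho>0 ^ ?n / 2 ^ ?n / 2) * ((1 / 2) ^ j) ^ ?n"
      by (simp add: a_b_k_\<rho>_def power_mult_distrib power_divide mult_ac)
     also have "((1 / 2 :: real) ^ j) ^ ?n = (16 * q) ^ j"
     proof -
      have "16 * q = (1 / 2) ^ ?n" by (simp add: q_def power_divide)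
      then show ?thesis by (metis mult.commute power_mult)
     qed
     also have "V * r ^ ?n * (\<rho>0 ^ ?n / 2 ^ ?n / 2) * (16 * q) ^ j = 4096 * (16 * q) ^ j * \<nu> * V * r ^ ?n" by (simp add: \<nu>_def mult_ac)
     finally show "4096 * (16 * q) ^ j * \<nu> * V * r ^ ?n <= V * (\<rho> / 2) ^ ?n / 2" by (rule eq_refl[OF sym])
    qed
    finally show ?thesis .
   qed
   \<comment> \<open>With t = max 0 (s - k) and \<Phi> = (t/d)^2, the square of \<Phi> is the
     integrand of \<open>Y\<close>; the antiderivative \<Psi> of \<phi>^2 satisfies \<Psi>^2 =
     (16/9) t^6/d^8, below P \<phi>^2 = 4 t^6/d^8.\<close>
   have Phi: "((\<lambda>s. (t s)^2 / d^2) has_real_derivative 2 * t s / d^2) (at s)" for s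
    using DERIV_cdivide[OF has_real_derivative_max_power[of k 0 s], of "d^2"] by (simp add: t_def power2_eq_square)
   have Psi: "((\<lambda>s. 4 / 3 * (t s) ^ 3 / d ^ 4) has_real_derivative (2 * t s / d^2)^2) (at s)" for s
    using DERIV_cdivide[OF DERIV_cmult[OF has_real_derivative_max_power[of k 1 s], of "4 / 3"], of "d ^ 4"]
    by (simp add: t_def power2_eq_square power3_eq_cube power4_eq_xxxx mult_ac eval_nat_numeral)
   have "ennreal (V * (\<rho> / 2) ^ ?n / 2) * (\<integral>\<^sup>+x. indicator (ball x0 a) x * ennreal (((t (v x))^2 / d^2)^2) \<partial>lborel) \<le>
    ennreal (L * \<rho>^2 / (b - a)^2) * emeasure lborel (ball (0::'a) \<rho>) * (\<integral>\<^sup>+x. indicator (ball x0 b) x * ennreal ((t (v x) / d) ^ 4) \<partial>lborel)"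
   proof (rule DG_basic[OF DG L, where k = k and \<phi> = "\<lambda>s. 2 * t s / d^2" and \<Phi> = "\<lambda>s. (t s)^2 / d^2" and \<Psi> = "\<lambda>s. 4 / 3 * (t s) ^ 3 / d ^ 4" and P = "\<lambda>s. (t s / d) ^ 4"])
    show "0 < a" "a < b" "0 < k" "0 < \<rho>" using rr kk0 \<rho> by (auto simp: a_b_k_\<rho>_def)
    show "cball x0 b \<subseteq> D" using rr(2)[of j] r(2) by (auto simp: a_b_k_\<rho>_def subset_iff)
    show "continuous_on UNIV (\<lambda>s. 2 * t s / d^2)" "continuous_on UNIV (\<lambda>s. (t s / d) ^ 4)"
     using md unfolding t_def by (auto intro!: continuous_intros)
    show "0 <= (t s / d) ^ 4" for s by simp
    show "2 * t s / d^2 = 0 \<and> (t s)^2 / d^2 = 0 \<and> 4 / 3 * t s ^ 3 / d ^ 4 = 0" if "s <= k" for s using that by (simp add: t_def)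
    show "(4 / 3 * t (v x) ^ 3 / d ^ 4)^2 <= (t (v x) / d) ^ 4 * (2 * t (v x) / d^2)^2" for x
    proof -
     have "(4 / 3 * t (v x) ^ 3 / d ^ 4)^2 = 16 / 9 * ((t (v x)) ^ 6 / d ^ 8)" by (simp add: power_mult_distrib power_divide power_mult[symmetric])
     also have "\<dots> <= 4 * ((t (v x)) ^ 6 / d ^ 8)" by (intro mult_right_mono) auto
     also have "\<dots> = (t (v x) / d) ^ 4 * (2 * t (v x) / d^2)^2"
      by (simp add: power_mult_distrib power_divide power_mult[symmetric] power_add[symmetric])
     finally show ?thesis .
    qed
    fix x assume xa: "x \<in> ball x0 a"
    let ?Z = "{y \<in> ball x0 a. dist x y < \<rho> \<and> (t (v y))^2 / d^2 = 0}"
    have Z: "?Z = {y \<in> space borel. dist x0 y < a \<and> dist x y < \<rho> \<and> v y <= k}" using md by (auto simp: t_def)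
    have [measurable]: "?Z \<in> sets borel" unfolding Z by measurable
    obtain z where z: "ball z (\<rho> / 2) \<subseteq> {y \<in> ball x0 a. dist x y < \<rho>}" using half_ball_in_ball_Int[OF xa \<rho>] .
    have "ennreal (V * (\<rho> / 2) ^ ?n) = emeasure lborel (ball z (\<rho> / 2))" using \<rho> by (simp add: emeasure_ball_power V_def)
    also have "\<dots> <= emeasure lborel (?Z \<union> ?T)"
    proof (rule emeasure_mono)
     show "ball z (\<rho> / 2) \<subseteq> ?Z \<union> ?T" using z Z by fastforce
    qed measurable
    also have "\<dots> <= emeasure lborel ?Z + emeasure lborel ?T" by (rule emeasure_subadditive) measurable
    also have "\<dots> <= emeasure lborel ?Z + ennreal (V * (\<rho> / 2) ^ ?n / 2)" by (intro add_left_mono T)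
    finally show "ennreal (V * (\<rho> / 2) ^ ?n / 2) <= emeasure lborel ?Z" by (rule ennreal_half_le) (use V \<rho> in auto)
   qed (rule Phi Psi)+
   then have "ennreal (V * (\<rho> / 2) ^ ?n / 2) * Y (Suc j) \<le>
    ennreal (L * \<rho>^2 / (b - a)^2 * (V * \<rho> ^ ?n)) * (\<integral>\<^sup>+x. indicator (ball x0 b) x * ennreal ((t (v x) / d) ^ 4) \<partial>lborel)"
    using \<rho> L V
    by (simp add: Y_def emeasure_ball_power V_def[symmetric] ennreal_mult'[symmetric] power_divide power_mult[symmetric] a_b_k_\<rho>_def(1,3) t_def)
   also have "\<dots> <= ennreal (L * \<rho>^2 / (b - a)^2 * (V * \<rho> ^ ?n)) * Y j" unfolding Y_def
   proof (intro mult_left_mono nn_integral_mono)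
    fix x
    have "(t (v x) / d) ^ 4 <= (max 0 (v x - kk j) / d) ^ 4"
     using kk(2)[of j] md by (intro power_mono divide_right_mono) (auto simp: t_def a_b_k_\<rho>_def)
    then show "indicator (ball x0 b) x * ennreal ((t (v x) / d) ^ 4) <= indicator (ball x0 (rr j)) x * ennreal ((max 0 (v x - kk j) / d) ^ 4)"
     by (intro mult_mono ennreal_leI) (auto simp: a_b_k_\<rho>_def)
   qed auto
   finally have "Y (Suc j) <= ennreal (L * \<rho>^2 / (b - a)^2 * (V * \<rho> ^ ?n) / (V * (\<rho> / 2) ^ ?n / 2)) * Y j"
    by (rule ennreal_mult_le_cancel) (use V \<rho> L in auto)
   also have "L * \<rho>^2 / (b - a)^2 * (V * \<rho> ^ ?n) / (V * (\<rho> / 2) ^ ?n / 2) = 128 * 2 ^ ?n * L * \<rho>0^2"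
   proof -
    have ba: "b - a = r * (1 / 2) ^ j / 8" using rr(5)[of j] by (simp add: a_b_k_\<rho>_def)
    have "L * \<rho>^2 / (b - a)^2 = 64 * L * \<rho>0^2" unfolding ba using r by (simp add: a_b_k_\<rho>_def power_mult_distrib power_divide)
    moreover have "(V * \<rho> ^ ?n) / (V * (\<rho> / 2) ^ ?n / 2) = 2 * 2 ^ ?n" using V \<rho> by (simp add: power_divide)
    moreover have "L * \<rho>^2 / (b - a)^2 * (V * \<rho> ^ ?n) / (V * (\<rho> / 2) ^ ?n / 2) =
      (L * \<rho>^2 / (b - a)^2) * ((V * \<rho> ^ ?n) / (V * (\<rho> / 2) ^ ?n / 2))" by (rule times_divide_eq_right[symmetric])
    ultimately show ?thesis by (simp only:) simp
   qed
   also have "ennreal (128 * 2 ^ ?n * L * \<rho>0^2) * Y j <= ennreal q * ennreal (q ^ j * (\<nu> * (V * r ^ ?n)))"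
   proof (intro mult_mono ennreal_leI Suc)
    have "128 * 2 ^ ?n * L * \<rho>0^2 <= C * \<rho>0^2" by (intro mult_right_mono) (auto simp: C_def)
    then show "128 * 2 ^ ?n * L * \<rho>0^2 <= q" using \<rho>0q by linarith
   qed auto
   also have "\<dots> = ennreal (q ^ Suc j * (\<nu> * (V * r ^ ?n)))" using Cq by (simp add: ennreal_mult'[symmetric] mult.assoc)
   finally show ?case .
  qed
  let ?U = "{y \<in> ball x0 (r / 2). m + d / 2 < v y}"
  have sub: "ball x0 (r / 2) \<subseteq> D" using r by (auto simp: subset_iff)
  have opU: "open ?U"
  proof -
   have "open (ball x0 (r / 2) \<inter> v -` {m + d / 2<..})" by (rule continuous_open_preimage[OF continuous_on_subset[OF vc sub]]) auto
   then show ?thesis by (simp add: vimage_def Int_def Collect_conj_eq[symmetric])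
  qed
  \<comment> \<open>The truncation at the limiting level is dominated by every \<open>Y j\<close>,
    so its integral is 0; as v is continuous, the superlevel set is open, and an open null set is
    empty.\<close>
  have "emeasure lborel ?U = 0"
  proof -
   let ?Z = "\<integral>\<^sup>+x. indicator ?U x * ennreal ((max 0 (v x - (m + d / 2)) / d) ^ 4) \<partial>lborel"
   have [measurable]: "?U \<in> sets borel" using opU by simp
   have le: "?Z <= ennreal (q ^ j * (\<nu> * (V * r ^ ?n)))" for j
   proof (rule order_trans[OF _ main], unfold Y_def, intro nn_integral_mono mult_mono ennreal_leI power_mono divide_right_mono)
    fix x
    show "max 0 (v x - (m + d / 2)) <= max 0 (v x - kk j)" using kk(3)[of j] by auto
    show "(indicator ?U x :: ennreal) <= indicator (ball x0 (rr j)) x" using rr(4)[of j] by (auto simp: indicator_def)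
   qed (use md in auto)
   have q1: "q < 1"
   proof -
    have "(1::real) <= 2 ^ ?n" by simp
    then have "(1::real) < 16 * 2 ^ ?n" by linarith
    then show ?thesis by (simp add: q_def)
   qed
   have "(\<lambda>j. ennreal (q ^ j * (\<nu> * (V * r ^ ?n)))) \<longlonglongrightarrow> ennreal (0 * (\<nu> * (V * r ^ ?n)))"
    using Cq q1 by (intro tendsto_ennrealI tendsto_mult tendsto_const LIMSEQ_realpow_zero) auto
   then have "?Z <= ennreal (0 * (\<nu> * (V * r ^ ?n)))" by (rule LIMSEQ_le_const) (use le in blast)
   then have "?Z = 0" by simp
   then have "AE x in lborel. indicator ?U x * ennreal ((max 0 (v x - (m + d / 2)) / d) ^ 4) = 0" by (subst (asm) nn_integral_0_iff_AE) auto
   then have "AE x in lborel. x \<notin> ?U"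
   proof eventually_elim
    case (elim x)
    show ?case
    proof
     assume xU: "x \<in> ?U"
     then have "0 < (max 0 (v x - (m + d / 2)) / d) ^ 4" using md by (intro zero_less_power) auto
     then show False using elim xU by (simp add: indicator_def)
    qed
   qed
   then show ?thesis by (subst (asm) AE_iff_measurable[OF _ refl]) auto
  qed
  then have "?U = {}" by (rule open_emeasure_zero_imp_empty[OF opU])
  then show ?thesis using x by force
 qed
 then show ?thesis using \<nu> by (intro exI[of _ \<nu>]) blast
qed

section \<open>The logarithmic estimate and the growth lemma\<close>

lemma antiderivative_vanishing:
 fixes \<phi> :: "real => real"
 assumes c: "continuous_on UNIV \<phi>" and z: "\<And>s. s <= k ==> \<phi> s = 0"
 obtains \<Phi> where "\<And>s. s <= k ==> \<Phi> s = 0" "\<And>s. (\<Phi> has_real_derivative \<phi> s) (at s)"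
proof
 define \<Phi> where "\<Phi> s = integral {k..s} \<phi>" for s
 show z': "\<Phi> s = 0" if "s <= k" for s
 proof (cases "s = k")
  case False
  then have "{k..s} = {}" using that by auto
  then show ?thesis by (simp add: \<Phi>_def)
 qed (simp add: \<Phi>_def)
 show "(\<Phi> has_real_derivative \<phi> s) (at s)" for s
 proof (cases "s < k")
  case True
  have "((\<lambda>s. 0) has_real_derivative \<phi> s) (at s)" using z[of s] True by simp
  then show ?thesis by (rule DERIV_cong_ev[THEN iffD1, rotated -1, OF _ refl _ refl])
     (use True z' in \<open>auto intro!: eventually_mono[OF eventually_nhds_in_open[of "{..<k}"]]\<close>)
 next
  case False
  define \<Psi> where "\<Psi> s = integral {k - 1..s} \<phi>" for s
  have ci: "\<phi> integrable_on {a..b}" for a b by (rule integrable_continuous_interval[OF continuous_on_subset[OF c]]) simp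
  have eq: "\<Psi> t = \<Phi> t" if "t > k - 1" for t
  proof (cases "t \<ge> k")
   case True
   have "integral {k - 1..k} \<phi> = 0" using Henstock_Kurzweil_Integration.integral_cong[of "{k - 1..k}" \<phi> "\<lambda>_. 0"] z by simp
   then show ?thesis using Henstock_Kurzweil_Integration.integral_combine[of "k - 1" k t \<phi>] True ci by (simp add: \<Psi>_def \<Phi>_def)
  next
   case False
   have "integral {k - 1..t} \<phi> = 0" using Henstock_Kurzweil_Integration.integral_cong[of "{k - 1..t}" \<phi> "\<lambda>_. 0"] z False by simp
   then show ?thesis using z'[of t] False by (simp add: \<Psi>_def)
  qed
  have "(\<Psi> has_vector_derivative \<phi> s) (at s within {k - 1..s + 1})" unfolding \<Psi>_def
   by (rule integral_has_vector_derivative[OF continuous_on_subset[OF c]]) (use False in auto)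
  then have "(\<Psi> has_real_derivative \<phi> s) (at s)"
   using False by (subst (asm) at_within_Icc_at) (auto simp: has_real_derivative_iff_has_vector_derivative)
  then show ?thesis by (rule DERIV_cong_ev[THEN iffD1, rotated -1, OF _ refl _ refl])
     (use False eq in \<open>auto intro!: eventually_mono[OF eventually_nhds_in_open[of "{k - 1<..}"]]\<close>)
 qed
qed

text \<open>\<Phi> is a C^1 substitute for -log(1 + e - s/d), cut off below the level d/4. It
  reaches size log(1/(4e))/4 for s in ((1 - e) d, d], while \<Psi>^2 \<le> \<phi>^2 permits the
  choice P = 1, so its energy is bounded independently of e. The minimum in \<phi> keeps the
  denominator positive beyond d.\<close>

lemma log_test_functions:
 fixes d e :: real
 assumes d: "0 < d" and e: "0 < e" "e < 1 / 4"
 obtains \<phi> \<Phi> \<Psi> where "continuous_on UNIV \<phi>"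
  "\<And>s. s <= d / 4 ==> \<phi> s = 0 \<and> \<Phi> s = 0 \<and> \<Psi> s = 0"
  "\<And>s. (\<Phi> has_real_derivative \<phi> s) (at s)" "\<And>s. (\<Psi> has_real_derivative (\<phi> s)^2) (at s)"
  "\<And>s. s <= d ==> (\<Psi> s)^2 <= (\<phi> s)^2"
  "\<And>s. (1 - e) * d < s ==> s <= d ==> ln (1 / (4 * e)) / 4 <= \<Phi> s"
proof -
 define \<phi> where "\<phi> s = (max 0 (s / d - 1 / 4)) / (1 + e - min (s / d) 1) / d" for s
 have den: "0 < 1 + e - min (s / d) 1" for s using e by (auto simp: min_def)
 have c: "continuous_on UNIV \<phi>" unfolding \<phi>_def using d den by (intro continuous_intros) (auto simp: less_imp_neq[symmetric])
 have z: "\<phi> s = 0" if "s <= d / 4" for s using that d by (simp add: \<phi>_def field_simps)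
 have z2: "(\<phi> s)^2 = 0" if "s <= d / 4" for s using z[OF that] by simp
 have nn: "0 <= \<phi> s" for s using den[of s] d by (simp add: \<phi>_def)
 obtain \<Phi> where \<Phi>: "\<And>s. s <= d / 4 ==> \<Phi> s = 0" "\<And>s. (\<Phi> has_real_derivative \<phi> s) (at s)"
  using antiderivative_vanishing[OF c z] by blast
 have c2: "continuous_on UNIV (\<lambda>s. (\<phi> s)^2)" by (intro continuous_intros c)
 obtain \<Psi> where \<Psi>: "\<And>s. s <= d / 4 ==> \<Psi> s = 0" "\<And>s. (\<Psi> has_real_derivative (\<phi> s)^2) (at s)"
  using antiderivative_vanishing[OF c2 z2] by blast
 have \<Phi>_mono: "\<Phi> s <= \<Phi> t" if "s <= t" for s t by (rule DERIV_nonneg_imp_nondecreasing[OF that]) (use \<Phi>(2) nn in blast)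
 have \<Psi>_mono: "\<Psi> s <= \<Psi> t" if "s <= t" for s t
  by (rule DERIV_nonneg_imp_nondecreasing[OF that]) (use \<Psi>(2) zero_le_power2 in blast)
 have \<Psi>le: "(\<Psi> s)^2 <= (\<phi> s)^2" if s: "s <= d" for s
 proof (cases "s <= d / 4")
  case False
  \<comment> \<open>R' is at least \<phi>^2, and R is at most \<phi> because s/d - 1/4 is at most 1;
    so the antiderivative \<Psi> of \<phi>^2 lies below \<phi>.\<close>
  define R where "R s = (s / d - 1 / 4)^2 / (1 + e - s / d) / d" for s
  have "(R (d / 4) - \<Psi> (d / 4)) <= (R s - \<Psi> s)"
  proof (rule DERIV_nonneg_imp_nondecreasing[of "d / 4" s "\<lambda>s. R s - \<Psi> s"])
   fix t assume t: "d / 4 <= t" "t <= s"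
   define T where "T = t / d"
   have "1 / 4 <= T" "T <= 1" using t s d by (auto simp: T_def field_simps)
   then have T: "1 / 4 <= T" "T <= 1" "0 < 1 + e - T" using e by auto
   have ne: "1 + e - t / d \<noteq> 0" using T by (simp add: T_def)
   have "(R has_real_derivative ((2 * (T - 1 / 4) / d * (1 + e - T) + (T - 1 / 4)^2 / d) / (1 + e - T)^2 / d)) (at t)"
   proof -
    have 1: "((\<lambda>s. (s / d - 1 / 4)^2) has_real_derivative 2 * (T - 1 / 4) / d) (at t)"
     using d by (auto intro!: derivative_eq_intros simp: T_def)
    have 2: "((\<lambda>s. 1 + e - s / d) has_real_derivative - (1 / d)) (at t)" using d by (auto intro!: derivative_eq_intros)
    from DERIV_cdivide[OF DERIV_divide[OF 1 2 ne], of d] show ?thesis unfolding R_def by (simp add: T_def[symmetric] power2_eq_square)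
   qed
   then have "((\<lambda>s. R s - \<Psi> s) has_real_derivative ((2 * (T - 1 / 4) / d * (1 + e - T) + (T - 1 / 4)^2 / d) / (1 + e - T)^2 / d) - (\<phi> t)^2) (at t)"
    by (intro DERIV_diff \<Psi>(2))
   moreover have "(\<phi> t)^2 <= (2 * (T - 1 / 4) / d * (1 + e - T) + (T - 1 / 4)^2 / d) / (1 + e - T)^2 / d"
   proof -
    have "(\<phi> t)^2 = ((T - 1 / 4)^2 / d) / (1 + e - T)^2 / d"
     using T by (simp add: \<phi>_def T_def[symmetric] max_def min_def power_divide power2_eq_square)
    also have "\<dots> <= (2 * (T - 1 / 4) / d * (1 + e - T) + (T - 1 / 4)^2 / d) / (1 + e - T)^2 / d" using T d by (intro divide_right_mono) auto
    finally show ?thesis .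
   qed
   ultimately show "\<exists>y. ((\<lambda>s. R s - \<Psi> s) has_real_derivative y) (at t) \<and> 0 <= y" by force
  qed (use False in auto)
  then have "\<Psi> s <= R s" using \<Psi>(1)[of "d / 4"] d by (simp add: R_def)
  also have "R s <= \<phi> s"
  proof -
   have T: "1 / 4 <= s / d" "s / d <= 1" using False s d by (auto simp: field_simps)
   have "(s / d - 1 / 4)^2 <= s / d - 1 / 4" using T mult_left_le[of "s / d - 1 / 4" "s / d - 1 / 4"] by (simp add: power2_eq_square)
   then have "R s <= (s / d - 1 / 4) / (1 + e - s / d) / d" unfolding R_def by (intro divide_right_mono) (use T e d in linarith)+
   then show ?thesis using T by (simp add: \<phi>_def max_def min_def)
  qed
  finally have "\<Psi> s <= \<phi> s" .
  moreover have "0 <= \<Psi> s" using \<Psi>_mono[of "d / 4" s] \<Psi>(1)[of "d / 4"] False by simp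
  ultimately show ?thesis by (simp add: power_mono)
 qed (simp add: \<Psi>(1))
 have \<Phi>ge: "ln (1 / (4 * e)) / 4 <= \<Phi> s" if s: "(1 - e) * d < s" "s <= d" for s
 proof -
  \<comment> \<open>On [d/2, s] the function \<phi> is at least -S', since s/d - 1/4 is at least 1/4
    there; thus \<Phi> gains at least what S loses.\<close>
  define S where "S s = ln (1 + e - s / d) / 4" for s
  have sd: "s / d <= 1" "1 - e < s / d" using s d by (auto simp: field_simps)
  have "d / 2 <= s"
  proof -
   have "1 / 2 * d <= (1 - e) * d" using e d by (intro mult_right_mono) auto
   then show ?thesis using s by simp
  qed
  then have "\<Phi> (d / 2) + S (d / 2) <= \<Phi> s + S s"
  proof (rule DERIV_nonneg_imp_nondecreasing)
   fix t assume t: "d / 2 <= t" "t <= s"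
   define T where "T = t / d"
   have "1 / 2 <= T" "T <= 1" using t s d by (auto simp: T_def field_simps)
   then have T: "1 / 2 <= T" "T <= 1" "0 < 1 + e - T" using e by auto
   have pos: "0 < 1 + e - t / d" using T by (simp add: T_def)
   have "(S has_real_derivative - (1 / 4 / (1 + e - T) / d)) (at t)" unfolding S_def using pos d by (auto intro!: derivative_eq_intros simp: T_def)
   then have "((\<lambda>s. \<Phi> s + S s) has_real_derivative \<phi> t + - (1 / 4 / (1 + e - T) / d)) (at t)" by (intro DERIV_add \<Phi>(2))
   moreover have "1 / 4 / (1 + e - T) / d <= \<phi> t"
   proof -
    have "1 / 4 / (1 + e - T) / d <= (T - 1 / 4) / (1 + e - T) / d" using T d by (intro divide_right_mono) auto
    then show ?thesis using T by (simp add: \<phi>_def T_def[symmetric] max_def min_def)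
   qed
   ultimately show "\<exists>y. ((\<lambda>s. \<Phi> s + S s) has_real_derivative y) (at t) \<and> 0 <= y" by force
  qed
  moreover have "0 <= \<Phi> (d / 2)" using \<Phi>_mono[of "d / 4" "d / 2"] \<Phi>(1)[of "d / 4"] d by simp
  ultimately have "S (d / 2) - S s <= \<Phi> s" by linarith
  moreover have "ln (1 / (4 * e)) / 4 <= S (d / 2) - S s"
  proof -
   have "ln (1 / (4 * e)) = ln (1 / 2) - ln (2 * e)" using ln_div[of "1 / 2" "2 * e"] e by simp
   moreover have "ln (1 / 2) <= ln (1 + e - d / 2 / d)" using e d by (intro ln_mono) auto
   moreover have "ln (1 + e - s / d) <= ln (2 * e)" using e sd by (intro ln_mono) auto
   ultimately show ?thesis by (simp add: S_def)
  qed
  ultimately show ?thesis by linarith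
 qed
 show thesis by (rule that[OF c _ \<Phi>(2) \<Psi>(2) \<Psi>le \<Phi>ge]) (use z \<Phi>(1) \<Psi>(1) in auto)
qed

text \<open>The logarithm vanishes on the fraction \<mu> of the ball, so \<open>DG_basic\<close> at
  scale 2r bounds the integral of its square by its bounded energy. Since it is large where v > (1 -
  e) d, that set has a small share of the ball, and the first lemma applies to it.\<close>

lemma DG_growth:
 assumes L: "0 <= L" and \<mu>: "0 < \<mu>"
 shows "\<exists>c>0. c < 1 \<and> (\<forall>D (v::'a::euclidean_space => real) x0 r d. DG L D v \<and> 0 < r \<and> ball x0 (2 * r) \<subseteq> D \<and> 0 < d \<and>
   (\<forall>x\<in>ball x0 (2 * r). v x <= d) \<and> ennreal \<mu> * emeasure lborel (ball x0 r) <= emeasure lborel {x \<in> ball x0 r. v x = 0} -->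
   (\<forall>x\<in>ball x0 (r / 2). v x <= (1 - c) * d))"
proof -
 let ?n = "DIM('a)"
 define V where "V = unit_ball_vol (real ?n)"
 have V: "0 < V" unfolding V_def by simp
 show ?thesis using DG_first_lemma[OF L, where 'a = 'a]
 proof (elim exE conjE, goal_cases)
 case (1 \<nu>)
 note \<nu> = 1(1) and first = 1(2)
 define C where "C = 16 * L * 2 ^ ?n * (3 / 2) ^ ?n + 1"
 have C: "0 < C" using L by (auto simp: C_def intro!: add_nonneg_pos)
 \<comment> \<open>\<Phi> is at least T/4 above the level (1 - e) d; T is the value for which
   Chebyshev leaves exactly the share \<nu> of the first lemma, and e = exp(-T)/4 realises
   it.\<close>
 define T where "T = 4 * sqrt (C / (\<mu> * \<nu>))"
 have T: "0 < T" using C \<mu> \<nu> by (simp add: T_def)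
 define e where "e = exp (- T) / 4"
 have e: "0 < e" "e < 1 / 4" using T by (auto simp: e_def)
 have lne: "ln (1 / (4 * e)) / 4 = sqrt (C / (\<mu> * \<nu>))" by (simp add: e_def ln_div T_def)
 have "v x <= (1 - e / 2) * d"
  if DG: "DG L D v" and r: "0 < r" "ball x0 (2 * r) \<subseteq> D" and d: "0 < d" and bd: "\<forall>x\<in>ball x0 (2 * r). v x <= d"
   and em: "ennreal \<mu> * emeasure lborel (ball x0 r) <= emeasure lborel {x \<in> ball x0 r. v x = 0}" and x: "x \<in> ball x0 (r / 2)"
  for D and v :: "'a => real" and x0 r d x
 proof -
  have [measurable]: "v \<in> \<B>" using DG by (auto simp: DG_def)
  have [measurable]: "ball x0 s \<in> sets borel" for s by simp
  obtain \<phi> \<Phi> \<Psi> where f: "continuous_on UNIV \<phi>"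
   "\<And>s. s <= d / 4 ==> \<phi> s = 0 \<and> \<Phi> s = 0 \<and> \<Psi> s = 0"
   "\<And>s. (\<Phi> has_real_derivative \<phi> s) (at s)" "\<And>s. (\<Psi> has_real_derivative (\<phi> s)^2) (at s)"
   "\<And>s. s <= d ==> (\<Psi> s)^2 <= (\<phi> s)^2"
   "\<And>s. (1 - e) * d < s ==> s <= d ==> ln (1 / (4 * e)) / 4 <= \<Phi> s" using log_test_functions[OF d e] by blast
  have [measurable]: "\<Phi> \<in> \<B>"
   by (rule borel_measurable_continuous_onI) (use f(3) in \<open>meson DERIV_isCont continuous_at_imp_continuous_on\<close>)
  define B where "B = V * r ^ ?n"
  have B: "0 < B" using V r by (simp add: B_def)
  have eB: "emeasure lborel (ball x0 r) = ennreal B" using r by (simp add: emeasure_ball_power B_def V_def)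
  let ?I = "\<integral>\<^sup>+x. indicator (ball x0 r) x * ennreal ((\<Phi> (v x))^2) \<partial>lborel"
  have "ennreal (\<mu> * B) * ?I \<le>
    ennreal (L * (2 * r)^2 / (3 / 2 * r - r)^2) * emeasure lborel (ball (0::'a) (2 * r)) * (\<integral>\<^sup>+x. indicator (ball x0 (3 / 2 * r)) x * ennreal 1 \<partial>lborel)"
  proof (rule DG_basic[OF DG L, where k = "d / 4" and \<phi> = \<phi> and \<Phi> = \<Phi> and \<Psi> = \<Psi> and P = "\<lambda>_. 1"])
   show "cball x0 (3 / 2 * r) \<subseteq> D" using r by (auto simp: subset_iff)
   show "(\<Psi> (v x))^2 <= 1 * (\<phi> (v x))^2" if "x \<in> ball x0 (3 / 2 * r)" for x using f(5)[of "v x"] bd that r(1) by auto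
   show "ennreal (\<mu> * B) <= emeasure lborel {y \<in> ball x0 r. dist x y < 2 * r \<and> \<Phi> (v y) = 0}" if xr: "x \<in> ball x0 r" for x
   proof -
    have "ennreal (\<mu> * B) <= emeasure lborel {x \<in> ball x0 r. v x = 0}" using em eB \<mu> by (simp add: ennreal_mult')
    also have "\<dots> <= emeasure lborel {y \<in> ball x0 r. dist x y < 2 * r \<and> \<Phi> (v y) = 0}"
    proof (rule emeasure_mono)
     have "dist x y < 2 * r" if "y \<in> ball x0 r" for y using that xr dist_triangle[of x y x0] by (simp add: dist_commute)
     moreover have "\<Phi> 0 = 0" using f(2)[of 0] d by simp
     ultimately show "{x \<in> ball x0 r. v x = 0} \<subseteq> {y \<in> ball x0 r. dist x y < 2 * r \<and> \<Phi> (v y) = 0}" by auto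
     have "{y \<in> ball x0 r. dist x y < 2 * r \<and> \<Phi> (v y) = 0} = {y \<in> space borel. dist x0 y < r \<and> dist x y < 2 * r \<and> \<Phi> (v y) = 0}"
      by auto
     also have "\<dots> \<in> sets borel" by measurable
     finally show "{y \<in> ball x0 r. dist x y < 2 * r \<and> \<Phi> (v y) = 0} \<in> sets lborel" by simp
    qed
    finally show ?thesis .
   qed
  qed (use r d f in auto)
  also have "\<dots> = ennreal (16 * L * 2 ^ ?n * (3 / 2) ^ ?n * B * B)"
  proof -
   have "L * (2 * r)^2 / (3 / 2 * r - r)^2 = 16 * L" using r by (simp add: field_simps power2_eq_square)
   moreover have "emeasure lborel (ball (0::'a) (2 * r)) = ennreal (2 ^ ?n * B)"
    using r by (simp add: emeasure_ball_power B_def V_def power_mult_distrib mult_ac)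
   moreover have "(\<integral>\<^sup>+x. indicator (ball x0 (3 / 2 * r)) x * ennreal 1 \<partial>lborel) = ennreal ((3 / 2) ^ ?n * B)"
    using r by (simp add: emeasure_ball_power B_def V_def power_mult_distrib[symmetric] mult_ac)
   ultimately show ?thesis using L B by (simp add: ennreal_mult'[symmetric] mult_ac)
  qed
  also have "\<dots> <= ennreal (C * B * B)" using B by (intro ennreal_leI mult_right_mono) (auto simp: C_def)
  finally have 1: "ennreal (\<mu> * B) * ?I <= ennreal (C * B * B) * 1" by simp
  have I: "?I <= ennreal (C * B / \<mu>)" using ennreal_mult_le_cancel[OF 1] \<mu> B C by simp
  let ?T = "{y \<in> ball x0 r. (1 - e) * d < v y}"
  have [measurable]: "?T \<in> sets borel" unfolding mem_ball by measurable
  have "ennreal (C / (\<mu> * \<nu>)) * emeasure lborel ?T = (\<integral>\<^sup>+y. ennreal (C / (\<mu> * \<nu>)) * indicator ?T y \<partial>lborel)"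
   by (rule nn_integral_cmult_indicator[symmetric]) simp
  also have "\<dots> <= ?I"
  proof (intro nn_integral_mono)
   fix y
   show "ennreal (C / (\<mu> * \<nu>)) * indicator ?T y <= indicator (ball x0 r) y * ennreal ((\<Phi> (v y))^2)"
   proof (cases "y \<in> ?T")
    case True
    then have "v y <= d" using bd r(1) by auto
    then have "sqrt (C / (\<mu> * \<nu>)) <= \<Phi> (v y)" using f(6)[of "v y"] True lne by auto
    then have "(sqrt (C / (\<mu> * \<nu>)))^2 <= (\<Phi> (v y))^2" using C \<mu> \<nu> by (intro power_mono) auto
    then show ?thesis using True C \<mu> \<nu> by (simp add: ennreal_leI)
   qed simp
  qed
  also note I
  finally have 2: "ennreal (C / (\<mu> * \<nu>)) * emeasure lborel ?T <= ennreal (C * B / \<mu>) * 1" by simp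
  have Tn: "emeasure lborel ?T <= ennreal (\<nu> * B)" using ennreal_mult_le_cancel[OF 2] C B \<mu> \<nu> by (simp add: mult.commute)
  \<comment> \<open>The first lemma starts at level (1 - e) d with gap e d and removes half of this
    gap.\<close>
  have "v x <= (1 - e) * d + e * d / 2"
  proof (rule first[rule_format, where D = D and v = v and ?x0.0 = x0 and r = r and m = "(1 - e) * d" and d = "e * d"], intro conjI ballI)
   show "v y <= (1 - e) * d + e * d" if "y \<in> ball x0 r" for y using that bd r(1) by (auto simp: algebra_simps)
   show "emeasure lborel ?T <= ennreal \<nu> * emeasure lborel (ball x0 r)" using Tn eB \<nu> by (simp add: ennreal_mult')
   show "ball x0 r \<subseteq> D" using r by (auto simp: subset_iff)
  qed (use DG r d e x in auto)
  then show ?thesis by (simp add: algebra_simps)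
 qed
 then show ?thesis using e by (intro exI[of _ "e / 2"]) auto
 qed
qed

lemma DG_growth_ball:
 assumes L: "0 <= L" and \<theta>: "0 < \<theta>"
 shows "\<exists>c>0. c < 1 \<and> (\<forall>D (v::'a::euclidean_space => real) x0 r d y. DG L D v \<and> 0 < r \<and> ball x0 (2 * r) \<subseteq> D \<and> 0 < d \<and>
   (\<forall>x\<in>ball x0 (2 * r). v x <= d) \<and> ball y (\<theta> * r) \<subseteq> ball x0 r \<and> (\<forall>x\<in>ball y (\<theta> * r). v x = 0) -->
   (\<forall>x\<in>ball x0 (r / 2). v x <= (1 - c) * d))"
proof -
 have "0 < \<theta> ^ DIM('a)" using \<theta> by simp
 from DG_growth[OF L this, where 'a = 'a] obtain c where c: "0 < c" "c < 1"
  and g: "\<forall>D (v::'a => real) x0 r d. DG L D v \<and> 0 < r \<and> ball x0 (2 * r) \<subseteq> D \<and> 0 < d \<and>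
   (\<forall>x\<in>ball x0 (2 * r). v x <= d) \<and> ennreal (\<theta> ^ DIM('a)) * emeasure lborel (ball x0 r) <= emeasure lborel {x \<in> ball x0 r. v x = 0} -->
   (\<forall>x\<in>ball x0 (r / 2). v x <= (1 - c) * d)"
  by (elim exE conjE) (rule that)
 have "v x <= (1 - c) * d"
  if DG: "DG L D v" and r: "0 < r" "ball x0 (2 * r) \<subseteq> D" and d: "0 < d" and bd: "\<forall>x\<in>ball x0 (2 * r). v x <= d"
   and y: "ball y (\<theta> * r) \<subseteq> ball x0 r" "\<forall>x\<in>ball y (\<theta> * r). v x = 0" and x: "x \<in> ball x0 (r / 2)"
  for D and v :: "'a => real" and x0 r d y x
 proof (rule g[rule_format, where D = D and v = v and ?x0.0 = x0 and r = r and d = d], intro conjI)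
  have [measurable]: "v \<in> \<B>" using DG by (auto simp: DG_def)
  have "{x \<in> ball x0 r. v x = 0} = {x \<in> space borel. dist x0 x < r \<and> v x = 0}" by auto
  also have "\<dots> \<in> sets borel" by measurable
  finally have m: "{x \<in> ball x0 r. v x = 0} \<in> sets borel" .
  have "ennreal (\<theta> ^ DIM('a)) * emeasure lborel (ball x0 r) = emeasure lborel (ball y (\<theta> * r))"
   using r \<theta> by (simp add: emeasure_ball_power ennreal_mult'[symmetric] power_mult_distrib mult_ac)
  also have "\<dots> <= emeasure lborel {x \<in> ball x0 r. v x = 0}" by (rule emeasure_mono) (use y m in auto)
  finally show "ennreal (\<theta> ^ DIM('a)) * emeasure lborel (ball x0 r) <= emeasure lborel {x \<in> ball x0 r. v x = 0}" .
 qed (use that in auto)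
 then show ?thesis using c by (intro exI[of _ c]) auto
qed

section \<open>Elliptic measure\<close>

type_synonym 'm poles = "'m point => (real ^ 'm) measure"

text \<open>
 The properties of elliptic measure used below; the only trace of the operator is the constant \<open>L\<close>,
 which depends on the dimension and the ellipticity alone.
\<close>

definition adm :: "real => ('m::finite poles) => bool" where
 "adm L \<omega> \<longleftrightarrow> (\<forall>X\<in>half_space. sets (\<omega> X) = sets borel \<and> emeasure (\<omega> X) (space (\<omega> X)) = 1) \<and>
   (\<forall>g. continuous_compact_support g -->
    continuous_on half_space (solution_with_data \<omega> g) \<and>
    (\<forall>x. (solution_with_data \<omega> g \<longlongrightarrow> g x) (at (x, 0) within half_space)) \<and>
    (\<forall>\<Omega> D k. open \<Omega> \<and> \<Omega> \<subseteq> half_space \<and> open D \<and>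
      (\<forall>K \<delta>. compact K \<and> K \<subseteq> D \<and> 0 < \<delta> --> compact {X \<in> \<Omega> \<inter> K. k + \<delta> <= solution_with_data \<omega> g X}) -->
      DG L D (\<lambda>X. if X \<in> \<Omega> then max 0 (solution_with_data \<omega> g X - k) else 0)))"

lemma open_half_space: "open (half_space :: 'm::finite point set)" unfolding half_space_def by (intro open_Collect_less continuous_intros)

section \<open>From weak solutions to admissible families\<close>

lemma ex_borel_version:
 fixes f :: "'a::euclidean_space => 'b::euclidean_space"
 assumes f: "f \<in> borel_measurable lebesgue"
 obtains f' where "f' \<in> \<B>" "AE x in lborel. f x = f' x"
proof -
 have "\<forall>b\<in>Basis. \<exists>g. g \<in> \<B> \<and> (AE x in lborel. f x \<bullet> b = g x)"
 proof
  fix b :: 'b assume "b \<in> Basis"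
  have "(\<lambda>x. f x \<bullet> b) \<in> borel_measurable lebesgue" using f by measurable
  from completion_ex_borel_measurable_real[OF this]
  show "\<exists>g. g \<in> \<B> \<and> (AE x in lborel. f x \<bullet> b = g x)" by auto
 qed
 from bchoice[OF this] obtain g where "\<forall>b\<in>Basis. g b \<in> \<B> \<and> (AE x in lborel. f x \<bullet> b = g b x)"
  by (elim exE) (rule that)
 then have g: "\<And>b. b \<in> Basis ==> g b \<in> \<B>"
  "\<And>b. b \<in> Basis ==> AE x in lborel. f x \<bullet> b = g b x" by simp_all
 show thesis
 proof
  show "(\<lambda>x. \<Sum>b\<in>Basis. g b x *\<^sub>R b) \<in> \<B>" using g(1) by (intro borel_measurable_sum borel_measurable_scaleR) auto
  have "AE x in lborel. \<forall>b\<in>Basis. f x \<bullet> b = g b x" by (intro AE_finite_allI g(2)) auto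
  then show "AE x in lborel. f x = (\<Sum>b\<in>Basis. g b x *\<^sub>R b)"
  proof eventually_elim
   case (elim x)
   have "f x = (\<Sum>b\<in>Basis. (f x \<bullet> b) *\<^sub>R b)" by (simp add: euclidean_representation)
   then show ?case using elim by simp
  qed
 qed
qed

lemma borel_measurable_lebesgue_of_borel: "f \<in> \<B> ==> f \<in> borel_measurable lebesgue" by (simp add: measurable_completion)

lemma lebesgue_integral_borel_version:
 fixes f f' :: "'a::euclidean_space => real"
 assumes "f' \<in> \<B>" "f \<in> borel_measurable lebesgue" "AE x in lborel. f x = f' x"
 shows "(LINT x|lebesgue. f x) = (LINT x|lborel. f' x)"
  and "integrable lebesgue f \<longleftrightarrow> integrable lborel f'"
proof -
 have ae: "AE x in lebesgue. f x = f' x" using assms(3) by (rule AE_completion)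
 have m: "f' \<in> borel_measurable lebesgue" by (rule borel_measurable_lebesgue_of_borel[OF assms(1)])
 have "(LINT x|lebesgue. f x) = (LINT x|lebesgue. f' x)" by (rule integral_cong_AE[OF assms(2) m ae])
 also have "\<dots> = (LINT x|lborel. f' x)" by (rule integral_completion) (use assms in simp)
 finally show "(LINT x|lebesgue. f x) = (LINT x|lborel. f' x)" .
 have "integrable lebesgue f \<longleftrightarrow> integrable lebesgue f'" by (rule integrable_cong_AE[OF assms(2) m ae])
 also have "\<dots> \<longleftrightarrow> integrable lborel f'" by (rule integrable_completion) (use assms in simp)
 finally show "integrable lebesgue f \<longleftrightarrow> integrable lborel f'" .
qed

lemma continuous_on_test_function:
 assumes "test_function U \<phi>" shows "continuous_on UNIV \<phi>" "continuous_on UNIV (grad \<phi>)"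
 using assms C1_continuous_grad[OF C1_Ck] Ck_continuous unfolding test_function_def by blast+

text \<open>Weak gradients in the sense of the statement are Lebesgue measurable only; the estimates are
 carried out with Borel representatives.\<close>

lemma wgrad_of_has_weak_gradient:
 fixes u :: "'a::euclidean_space => real"
 assumes U: "open U" and u: "u' \<in> \<B>" "\<And>x. x \<in> U ==> u' x = u x" "\<And>x. \<bar>u' x\<bar> <= B"
  and G: "has_weak_gradient U u G"
  and G': "G' \<in> \<B>" "AE x in lborel. (if x \<in> U then G x else 0) = G' x"
 shows "wgrad U u' G'"
proof -
 have [measurable]: "u' \<in> \<B>" "G' \<in> \<B>" "U \<in> sets borel" using u G' U by auto
 have Ul: "U \<in> sets lebesgue" using U by (simp add: lborelD)
 have Gm: "(\<lambda>x. if x \<in> U then G x else 0) \<in> borel_measurable lebesgue"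
  using G Ul unfolding has_weak_gradient_def L2_loc_def by (subst borel_measurable_if) auto
 have "integrable lborel (\<lambda>x. indicator K x * (norm (G' x))^2)" if K: "compact K" "K \<subseteq> U" for K
 proof -
  have [measurable]: "K \<in> sets borel" using K by (simp add: borel_compact)
  have "integrable lebesgue (\<lambda>x. indicator K x *\<^sub>R (norm (G x))^2)"
   using G K unfolding has_weak_gradient_def L2_loc_def set_integrable_def by blast
  also have "(\<lambda>x. indicator K x *\<^sub>R (norm (G x))^2) = (\<lambda>x. indicator K x * (norm (if x \<in> U then G x else 0))^2)"
   using K by (auto simp: indicator_def fun_eq_iff)
  finally have i: "integrable lebesgue (\<lambda>x. indicator K x * (norm (if x \<in> U then G x else 0))^2)" .
  have Kl: "(indicator K :: 'a => real) \<in> borel_measurable lebesgue" by (rule borel_measurable_lebesgue_of_borel) measurable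
  have m: "(\<lambda>x. indicator K x * (norm (if x \<in> U then G x else 0))^2) \<in> borel_measurable lebesgue" using Kl Gm by measurable
  have ae: "AE x in lborel. indicator K x * (norm (if x \<in> U then G x else 0))^2 = indicator K x * (norm (G' x))^2"
   using G'(2) by eventually_elim simp
  show ?thesis by (rule lebesgue_integral_borel_version(2)[OF _ m ae, THEN iffD1, OF _ i]) measurable
 qed
 moreover have "(LINT x|lborel. u' x * (grad \<phi> x \<bullet> b)) = - (LINT x|lborel. (G' x \<bullet> b) * \<phi> x)"
  if \<phi>: "test_function U \<phi>" and b: "b \<in> Basis" for \<phi> b
 proof -
  have [measurable]: "\<phi> \<in> \<B>" "grad \<phi> \<in> \<B>"
   by (rule borel_measurable_continuous_onI, rule continuous_on_test_function[OF \<phi>])+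
  have z: "grad \<phi> x = 0" "\<phi> x = 0" if "x \<notin> U" for x
  proof -
   let ?S = "closure {x. \<phi> x \<noteq> 0}"
   have out: "\<phi> y = 0" if "y \<in> - ?S" for y
   proof (rule ccontr)
    assume "\<phi> y \<noteq> 0"
    then have "y \<in> {x. \<phi> x \<noteq> 0}" by simp
    then have "y \<in> ?S" by (rule subsetD[OF closure_subset])
    then show False using that by simp
   qed
   have x: "x \<in> - ?S" using that \<phi> unfolding test_function_def by blast
   have C: "C1 \<phi> (grad \<phi>)" by (rule C1_Ck, rule \<phi>[unfolded test_function_def, THEN conjunct1, THEN spec])
   have "open (- ?S)" by (intro open_Compl closed_closure)
   then show "grad \<phi> x = 0" by (rule C1_grad_zero[OF C _ x out])
   show "\<phi> x = 0" by (rule out[OF x])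
  qed
  have "(LINT x:U|lebesgue. u x * (grad \<phi> x \<bullet> b)) = (LINT x|lborel. u' x * (grad \<phi> x \<bullet> b))"
  proof -
   have "(\<lambda>x. indicator U x *\<^sub>R (u x * (grad \<phi> x \<bullet> b))) = (\<lambda>x. u' x * (grad \<phi> x \<bullet> b))"
    using u(2) z by (auto simp: indicator_def fun_eq_iff)
   then show ?thesis unfolding set_lebesgue_integral_def by (simp add: integral_completion)
  qed
  moreover have "(LINT x:U|lebesgue. (G x \<bullet> b) * \<phi> x) = (LINT x|lborel. (G' x \<bullet> b) * \<phi> x)"
  proof -
   have e: "(\<lambda>x. indicator U x *\<^sub>R ((G x \<bullet> b) * \<phi> x)) = (\<lambda>x. ((if x \<in> U then G x else 0) \<bullet> b) * \<phi> x)"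
    by (auto simp: indicator_def fun_eq_iff)
   have \<phi>l: "\<phi> \<in> borel_measurable lebesgue" by (rule borel_measurable_lebesgue_of_borel) measurable
   have m: "(\<lambda>x. ((if x \<in> U then G x else 0) \<bullet> b) * \<phi> x) \<in> borel_measurable lebesgue"
    using Gm \<phi>l by (intro borel_measurable_times borel_measurable_inner) auto
   show ?thesis unfolding set_lebesgue_integral_def e
    by (rule lebesgue_integral_borel_version(1)[OF _ m]) (use G'(2) in \<open>auto elim!: eventually_mono\<close>)
  qed
  ultimately show ?thesis using G \<phi> b unfolding has_weak_gradient_def by auto
 qed
 ultimately show ?thesis unfolding wgrad_def using U u(3) by auto
qed

lemma norm_le_entries:
 fixes T :: "'a::euclidean_space \<Rightarrow>\<^sub>L 'a"
 assumes "\<And>i j. i \<in> Basis ==> j \<in> Basis ==> \<bar>T j \<bullet> i\<bar> <= M"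
 shows "norm (T \<xi>) <= real DIM('a) * real DIM('a) * M * norm \<xi>"
proof -
 have lin: "linear (blinfun_apply T)" by (rule bounded_linear.linear[OF blinfun.bounded_linear_right])
 have "norm (T \<xi>) <= (\<Sum>i\<in>Basis. \<bar>T \<xi> \<bullet> i\<bar>)" by (rule norm_le_l1)
 also have "\<dots> <= (\<Sum>i\<in>(Basis::'a set). \<Sum>j\<in>(Basis::'a set). M * norm \<xi>)"
 proof (rule sum_mono)
  fix i :: 'a assume i: "i \<in> Basis"
  have "T \<xi> = (\<Sum>j\<in>Basis. (\<xi> \<bullet> j) *\<^sub>R T j)"
   using linear_sum[OF lin, of "\<lambda>j. (\<xi> \<bullet> j) *\<^sub>R j" Basis] linear_scale[OF lin] by (simp add: euclidean_representation)
  then have "\<bar>T \<xi> \<bullet> i\<bar> = \<bar>\<Sum>j\<in>Basis. (\<xi> \<bullet> j) * (T j \<bullet> i)\<bar>" by (simp add: inner_sum_left)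
  also have "\<dots> <= (\<Sum>j\<in>Basis. \<bar>(\<xi> \<bullet> j) * (T j \<bullet> i)\<bar>)" by (rule sum_abs)
  also have "\<dots> <= (\<Sum>j\<in>(Basis::'a set). M * norm \<xi>)"
  proof (rule sum_mono)
   fix j :: 'a assume j: "j \<in> Basis"
   have "0 <= M" using assms[OF i j] by linarith
   have "\<bar>\<xi> \<bullet> j\<bar> * \<bar>T j \<bullet> i\<bar> <= norm \<xi> * M"
    using assms[OF i j] Basis_le_norm[OF j, of \<xi>] \<open>0 \<le> M\<close> by (intro mult_mono) auto
   then show "\<bar>(\<xi> \<bullet> j) * (T j \<bullet> i)\<bar> <= M * norm \<xi>" by (simp add: abs_mult mult.commute)
  qed
  finally show "\<bar>T \<xi> \<bullet> i\<bar> <= (\<Sum>j\<in>(Basis::'a set). M * norm \<xi>)" .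
 qed
 finally show ?thesis by (simp add: mult.assoc)
qed

text \<open>The solution is extended by zero off the half space, G and F are Borel representatives
  of the weak gradient and of A G. Coercivity is ellipticity evaluated at the gradient; the growth
  constant is the crude bound by entries.\<close>

lemma wsol_of_weak_solution:
 fixes A :: "'m::finite point => 'm point \<Rightarrow>\<^sub>L 'm point" and u :: "'m point => real"
 assumes ell: "elliptic lam Lam A" and u: "weak_solution A u" "continuous_on half_space u" "bounded (u ` half_space)"
 shows "\<exists>G F. wsol lam (real DIM('m point) * real DIM('m point) * \<bar>Lam\<bar>) half_space (\<lambda>x. if x \<in> half_space then u x else 0) G F"
proof -
 let ?H = "half_space :: 'm point set"
 let ?La = "real DIM('m point) * real DIM('m point) * \<bar>Lam\<bar>"
 let ?u = "\<lambda>x. if x \<in> ?H then u x else 0"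
 obtain G0 where G0: "has_weak_gradient ?H u G0"
  and sol: "\<And>\<phi>. test_function ?H \<phi> ==> (LINT X:?H|lebesgue. A X (G0 X) \<bullet> grad \<phi> X) = 0"
  using u(1) unfolding weak_solution_def by blast
 have Hb [measurable]: "?H \<in> sets borel" by (rule borel_open[OF open_half_space])
 have Hl: "?H \<in> sets lebesgue" using Hb by (simp add: lborelD)
 define Gz where "Gz x = (if x \<in> ?H then G0 x else 0)" for x
 have Gm: "Gz \<in> borel_measurable lebesgue"
  unfolding Gz_def[abs_def] using G0 Hl unfolding has_weak_gradient_def L2_loc_def by (subst borel_measurable_if) auto
 obtain G where G: "G \<in> \<B>" "AE x in lborel. Gz x = G x" using ex_borel_version[OF Gm] by blast
 define a where "a i j x = (if x \<in> ?H then A x j \<bullet> i else 0)" for i j x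
 have am: "a i j \<in> borel_measurable lebesgue" if "i \<in> Basis" "j \<in> Basis" for i j
  using ell that Hl unfolding a_def[abs_def] elliptic_def by (subst borel_measurable_if) auto
 define Fz where "Fz x = (if x \<in> ?H then A x (G0 x) else 0)" for x
 \<comment> \<open>Measurability of the coefficients is available entry by entry only, so the flux
   is expanded in the standard basis.\<close>
 have Fz: "Fz x = (\<Sum>i\<in>Basis. (\<Sum>j\<in>Basis. (Gz x \<bullet> j) * a i j x) *\<^sub>R i)" for x
 proof (cases "x \<in> ?H")
  case True
  have lin: "linear (blinfun_apply (A x))" by (rule bounded_linear.linear[OF blinfun.bounded_linear_right])
  have "A x (G0 x) = (\<Sum>j\<in>Basis. (G0 x \<bullet> j) *\<^sub>R A x j)"
   using linear_sum[OF lin, of "\<lambda>j. (G0 x \<bullet> j) *\<^sub>R j" Basis] linear_scale[OF lin] by (simp add: euclidean_representation)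
  then have "A x (G0 x) \<bullet> i = (\<Sum>j\<in>Basis. (Gz x \<bullet> j) * a i j x)" for i using True by (simp add: inner_sum_left a_def Gz_def)
  then show ?thesis using True euclidean_representation[of "A x (G0 x)"] by (simp add: Fz_def)
 qed (simp add: Fz_def a_def)
 have Fm: "Fz \<in> borel_measurable lebesgue"
  unfolding Fz[abs_def] by (intro borel_measurable_sum borel_measurable_scaleR borel_measurable_times borel_measurable_inner Gm am) auto
 obtain F where F: "F \<in> \<B>" "AE x in lborel. Fz x = F x" using ex_borel_version[OF Fm] by blast
 obtain B where B: "\<And>x. x \<in> ?H ==> \<bar>u x\<bar> <= B" using u(3) unfolding bounded_iff by (metis image_eqI real_norm_def)
 have "0 < lam" using ell by (simp add: elliptic_def)
 have ub: "?u \<in> \<B>"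
 proof -
  have "(\<lambda>x. indicator ?H x *\<^sub>R u x) \<in> \<B>" by (rule borel_measurable_continuous_on_indicator[OF Hb u(2)])
  also have "(\<lambda>x. indicator ?H x *\<^sub>R u x) = ?u" by (auto simp: indicator_def fun_eq_iff)
  finally show ?thesis .
 qed
 have wg: "wgrad ?H ?u G" by (rule wgrad_of_has_weak_gradient[OF open_half_space ub _ _ G0 G(1), of "max B 0"])
    (use B G(2) in \<open>auto simp: Gz_def le_max_iff_disj\<close>)
 have restr: "AE x in lborel. x \<in> ?H --> P x" if "AE x in lebesgue_on ?H. P x" for P
 proof -
  have "AE x in lebesgue. x \<in> ?H --> P x" using that Hl by (subst (asm) AE_restrict_space_iff) auto
  then show ?thesis by (simp add: AE_completion_iff)
 qed
 have ent: "AE x in lborel. x \<in> ?H --> (\<forall>i\<in>Basis. \<forall>j\<in>Basis. \<bar>A x j \<bullet> i\<bar> <= Lam)"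
 proof -
  have "AE x in lebesgue_on ?H. \<forall>i\<in>Basis. \<forall>j\<in>Basis. \<bar>A x j \<bullet> i\<bar> <= Lam"
   using ell unfolding elliptic_def by (intro AE_finite_allI) auto
  then show ?thesis by (rule restr)
 qed
 have pos: "AE x in lborel. x \<in> ?H --> (\<forall>\<xi>. lam * (norm \<xi>)^2 <= A x \<xi> \<bullet> \<xi>)"
 proof (rule restr)
  show "AE x in lebesgue_on ?H. \<forall>\<xi>. lam * (norm \<xi>)^2 <= A x \<xi> \<bullet> \<xi>"
   using ell unfolding elliptic_def by (elim conjE) (erule eventually_mono, blast)
 qed
 have FG: "AE x in lborel. lam * (norm (G x))^2 <= F x \<bullet> G x \<and> norm (F x) <= ?La * norm (G x)" using G(2) F(2) ent pos
 proof eventually_elim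
  case (elim x)
  show ?case
  proof (cases "x \<in> ?H")
   case True
   then have e: "G x = G0 x" "F x = A x (G0 x)" using elim by (auto simp: Gz_def Fz_def)
   have "\<bar>A x j \<bullet> i\<bar> <= \<bar>Lam\<bar>" if "i \<in> Basis" "j \<in> Basis" for i j using elim(3) True that by force
   then show ?thesis unfolding e using norm_le_entries[of "A x" "\<bar>Lam\<bar>" "G0 x"] elim(4) True by blast
  next
   case False
   then have "G x = 0" "F x = 0" using elim by (auto simp: Gz_def Fz_def)
   then show ?thesis by simp
  qed
 qed
 have wf: "wflux ?H F" unfolding wflux_def
 proof (intro conjI allI impI open_half_space F(1))
  fix K :: "'m point set" assume K: "compact K \<and> K \<subseteq> ?H"
  have [measurable]: "F \<in> \<B>" "K \<in> sets borel" using F(1) K by (auto simp: borel_compact)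
  have i: "integrable lborel (\<lambda>x. ?La^2 * (indicator K x * (norm (G x))^2))" using wg K by (auto simp: wgrad_def)
  show "integrable lborel (\<lambda>x. indicator K x * (norm (F x))^2)"
  proof (rule Bochner_Integration.integrable_bound[OF i])
   show "AE x in lborel. norm (indicator K x * (norm (F x))^2) <= norm (?La^2 * (indicator K x * (norm (G x))^2))" using FG
   proof eventually_elim
    case (elim x)
    then have "(norm (F x))^2 <= (?La * norm (G x))^2" by (intro power_mono) auto
    then show ?case by (cases "x \<in> K") (auto simp: power_mult_distrib)
   qed
  qed measurable
 next
  fix \<phi> assume \<phi>: "test_function ?H \<phi>"
  have [measurable]: "grad \<phi> \<in> \<B>" by (rule borel_measurable_continuous_onI, rule continuous_on_test_function[OF \<phi>])
  have [measurable]: "F \<in> \<B>" by (rule F(1))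
  have e: "(\<lambda>x. indicator ?H x *\<^sub>R (A x (G0 x) \<bullet> grad \<phi> x)) = (\<lambda>x. Fz x \<bullet> grad \<phi> x)"
   by (auto simp: indicator_def Fz_def fun_eq_iff)
  have gl: "grad \<phi> \<in> borel_measurable lebesgue" by (rule borel_measurable_lebesgue_of_borel) measurable
  have "(LINT X:?H|lebesgue. A X (G0 X) \<bullet> grad \<phi> X) = (LINT x|lborel. F x \<bullet> grad \<phi> x)" unfolding set_lebesgue_integral_def e
   by (rule lebesgue_integral_borel_version(1)) (use F(2) Fm gl in \<open>auto elim!: eventually_mono intro!: borel_measurable_inner\<close>)
  then show "(LINT x|lborel. F x \<bullet> grad \<phi> x) = 0" using sol[OF \<phi>] by simp
 qed
 have "continuous_on ?H ?u" using u(2) by (rule continuous_on_eq) simp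
 then show ?thesis using wg wf FG unfolding wsol_def by blast
qed

lemma adm_of_elliptic_measure:
 assumes "0 < lam"
 shows "\<exists>L\<ge>0. \<forall>(A :: 'm::finite point => 'm point \<Rightarrow>\<^sub>L 'm point) \<omega>. elliptic lam Lam A \<and> elliptic_measure A \<omega> --> adm L \<omega>"
proof -
 let ?La = "real DIM('m point) * real DIM('m point) * \<bar>Lam\<bar>"
 have "0 <= ?La" by simp
 from DG_truncated_solution[OF assms this, where 'a = "'m point"]
 obtain L where L: "0 < L" and tr: "\<forall>U (w::'m point => real) G F \<Omega> D k0. wsol lam ?La U w G F \<and> open \<Omega> \<and> \<Omega> \<subseteq> U \<and> open D \<and>
   (\<forall>K \<delta>. compact K \<and> K \<subseteq> D \<and> 0 < \<delta> --> compact {x \<in> \<Omega> \<inter> K. k0 + \<delta> <= w x}) -->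
   DG L D (\<lambda>x. if x \<in> \<Omega> then max 0 (w x - k0) else 0)"
  by (elim exE conjE) (rule that)
 have "adm L \<omega>" if ell: "elliptic lam Lam A" and em: "elliptic_measure A \<omega>"
  for A :: "'m point => 'm point \<Rightarrow>\<^sub>L 'm point" and \<omega> unfolding adm_def
 proof (intro conjI allI impI)
  show "\<forall>X\<in>half_space. sets (\<omega> X) = sets borel \<and> emeasure (\<omega> X) (space (\<omega> X)) = 1"
   using em by (auto simp: elliptic_measure_def)
  fix g :: "real ^ 'm => real" assume g: "continuous_compact_support g"
  let ?u = "solution_with_data \<omega> g"
  have bd: "bounded_dirichlet_solution A g ?u" using em g by (auto simp: elliptic_measure_def)
  then show "continuous_on half_space ?u" "(?u \<longlongrightarrow> g x) (at (x, 0) within half_space)" for x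
   by (auto simp: bounded_dirichlet_solution_def)
  fix \<Omega> D k
  assume a: "open \<Omega> \<and> \<Omega> \<subseteq> half_space \<and> open D \<and>
      (\<forall>K \<delta>. compact K \<and> K \<subseteq> D \<and> 0 < \<delta> --> compact {X \<in> \<Omega> \<inter> K. k + \<delta> <= ?u X})"
  let ?w = "\<lambda>x. if x \<in> half_space then ?u x else 0"
  obtain G F where s: "wsol lam ?La half_space ?w G F" using wsol_of_weak_solution[OF ell, of ?u] bd by (auto simp: bounded_dirichlet_solution_def)
  have se: "{X \<in> \<Omega> \<inter> K. k + \<delta> <= ?w X} = {X \<in> \<Omega> \<inter> K. k + \<delta> <= ?u X}" for K \<delta> using a by auto
  have "DG L D (\<lambda>x. if x \<in> \<Omega> then max 0 (?w x - k) else 0)"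
   by (rule tr[rule_format, of half_space ?w G F \<Omega> D k], unfold se, intro conjI s) (use a in simp_all)
  moreover have "(\<lambda>x. if x \<in> \<Omega> then max 0 (?w x - k) else 0) = (\<lambda>x. if x \<in> \<Omega> then max 0 (?u x - k) else 0)"
   using a by (auto simp: fun_eq_iff)
  ultimately show "DG L D (\<lambda>X. if X \<in> \<Omega> then max 0 (?u X - k) else 0)" by simp
 qed
 then show ?thesis using L by (intro exI[of _ L]) auto
qed

abbreviation "dsol \<equiv> solution_with_data"
abbreviation "ccs \<equiv> continuous_compact_support"

section \<open>Solutions with continuous data and their truncations\<close>

lemma ccs_bounded:
 fixes g :: "'a::euclidean_space => real"
 assumes "ccs g" obtains B where "0 < B" "\<And>x. \<bar>g x\<bar> <= B"
proof -
 have c: "continuous_on UNIV g" "compact (closure {x. g x \<noteq> 0})" using assms by (auto simp: continuous_compact_support_def)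
 have "compact (g ` closure {x. g x \<noteq> 0})" by (rule compact_continuous_image[OF continuous_on_subset[OF c(1)] c(2)]) simp
 then obtain B where B: "0 < B" "\<forall>y\<in>g ` closure {x. g x \<noteq> 0}. norm y <= B" using compact_imp_bounded bounded_pos by blast
 have "\<bar>g x\<bar> <= B" for x
 proof (cases "g x = 0")
  case False
  then have "x \<in> closure {x. g x \<noteq> 0}" using closure_subset[of "{x. g x \<noteq> 0}"] by blast
  then show ?thesis using B(2) by auto
 qed (use B in simp)
 then show thesis using that B(1) by blast
qed

lemma ccs_lincomb:
 fixes f g :: "'a::euclidean_space => real"
 assumes "ccs f" "ccs g" shows "ccs (\<lambda>x. a * f x + b * g x)"
proof -
 have c: "compact (closure {x. f x \<noteq> 0} \<union> closure {x. g x \<noteq> 0})" using assms by (auto simp: continuous_compact_support_def)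
 have "{x. a * f x + b * g x \<noteq> 0} \<subseteq> closure {x. f x \<noteq> 0} \<union> closure {x. g x \<noteq> 0}"
 proof
  fix x assume "x \<in> {x. a * f x + b * g x \<noteq> 0}"
  then have "x \<in> {x. f x \<noteq> 0} \<or> x \<in> {x. g x \<noteq> 0}" by auto
  then show "x \<in> closure {x. f x \<noteq> 0} \<union> closure {x. g x \<noteq> 0}"
   by (elim disjE) (rule UnI1, erule subsetD[OF closure_subset], rule UnI2, erule subsetD[OF closure_subset])
 qed
 then have "bounded {x. a * f x + b * g x \<noteq> 0}" using compact_imp_bounded[OF c] bounded_subset by blast
 then show ?thesis using assms by (auto simp: continuous_compact_support_def compact_closure intro!: continuous_intros)
qed

lemma ccs_measurable: "ccs g ==> g \<in> \<B>" by (auto simp: continuous_compact_support_def intro: borel_measurable_continuous_onI)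

lemma adm_measure:
 assumes "adm L \<omega>" "X \<in> half_space"
 shows "sets (\<omega> X) = sets borel" "finite_measure (\<omega> X)" "space (\<omega> X) = UNIV" "measure (\<omega> X) UNIV = 1"
proof -
 note p = assms(1)[unfolded adm_def, THEN conjunct1, THEN bspec, OF assms(2)]
 show s: "sets (\<omega> X) = sets borel" by (rule p[THEN conjunct1])
 show sp: "space (\<omega> X) = UNIV" using sets_eq_imp_space_eq[OF s] by simp
 have e: "emeasure (\<omega> X) UNIV = 1" using p[THEN conjunct2] by (simp only: sp)
 show "finite_measure (\<omega> X)" by (rule finite_measureI) (simp add: sp e)
 show "measure (\<omega> X) UNIV = 1" by (simp add: measure_def e)
qed

lemma adm_measurable: "adm L \<omega> ==> X \<in> half_space ==> g \<in> \<B> ==> g \<in> borel_measurable (\<omega> X)"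
 by (subst measurable_cong_sets[OF adm_measure(1) refl])

lemma adm_integrable:
 fixes g :: "real ^ 'm::finite => real"
 assumes "adm L \<omega>" "X \<in> half_space" "g \<in> \<B>" "\<And>x. \<bar>g x\<bar> <= B"
 shows "integrable (\<omega> X) g"
proof -
 interpret finite_measure "\<omega> X" by (rule adm_measure(2)[OF assms(1,2)])
 show ?thesis by (rule integrable_const_bound[of _ B]) (simp add: assms(4), rule adm_measurable[OF assms(1-3)])
qed

lemma adm_integrable_ccs:
 assumes "adm L \<omega>" "X \<in> half_space" "ccs g" shows "integrable (\<omega> X) g"
proof -
 obtain B where "\<And>x. \<bar>g x\<bar> <= B" using ccs_bounded[OF assms(3)] by blast
 then show ?thesis by (rule adm_integrable[OF assms(1,2) ccs_measurable[OF assms(3)]])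
qed

lemma dsol_lincomb:
 assumes "adm L \<omega>" "X \<in> half_space" "ccs f" "ccs g"
 shows "dsol \<omega> (\<lambda>x. a * f x + b * g x) X = a * dsol \<omega> f X + b * dsol \<omega> g X" unfolding solution_with_data_def
 using adm_integrable_ccs[OF assms(1,2,3)] adm_integrable_ccs[OF assms(1,2,4)] by simp

lemma dsol_bounds:
 fixes g :: "real ^ 'm::finite => real"
 assumes "adm L \<omega>" "X \<in> half_space" "g \<in> \<B>" "\<And>x. m <= g x \<and> g x <= M"
 shows "m <= dsol \<omega> g X" "dsol \<omega> g X <= M"
proof -
 interpret finite_measure "\<omega> X" by (rule adm_measure(2)[OF assms(1,2)])
 have "\<bar>g x\<bar> <= max \<bar>m\<bar> \<bar>M\<bar>" for x using assms(4)[of x] by linarith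
 then have i: "integrable (\<omega> X) g" by (rule adm_integrable[OF assms(1-3)])
 have c: "(LINT x|\<omega> X. a) = a" for a :: real using adm_measure(3,4)[OF assms(1,2)] by simp
 have "(LINT x|\<omega> X. m) <= dsol \<omega> g X" "dsol \<omega> g X <= (LINT x|\<omega> X. M)"
  unfolding solution_with_data_def by (rule integral_mono; use i assms(4) in simp)+
 then show "m <= dsol \<omega> g X" "dsol \<omega> g X <= M" by (simp_all only: c)
qed

definition trunc :: "('m::finite poles) => (real ^ 'm => real) => real => 'm point set => 'm point => real" where
 "trunc \<omega> g k \<Omega> X = (if X \<in> \<Omega> then max 0 (dsol \<omega> g X - k) else 0)"

lemma snd_in_half_space: "X \<in> half_space \<longleftrightarrow> 0 < snd X" by (simp add: half_space_def)

text \<open>Turns boundary inequalities into the compactness condition of \<open>adm\<close>. A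
  limit of points in a superlevel set either lies in the half space, where continuity and
  \<open>side\<close> apply, or on its boundary, where the attained boundary values and
  \<open>bot\<close> apply. D may reach below the boundary, and this is how boundary points become
  interior points of a De Giorgi class.\<close>

lemma DG_trunc:
 fixes \<omega> :: "'m::finite poles"
 assumes adm: "adm L \<omega>" and g: "ccs g" and \<Omega>: "open \<Omega>" "\<Omega> \<subseteq> half_space" and D: "open D"
  and bot: "\<And>x. (x, 0) \<in> D ==> (x, 0) \<in> closure \<Omega> ==> g x <= k"
  and side: "\<And>X. X \<in> D ==> X \<in> half_space ==> X \<notin> \<Omega> ==> X \<in> closure \<Omega> ==> dsol \<omega> g X <= k"
 shows "DG L D (trunc \<omega> g k \<Omega>)"
proof -
 let ?u = "dsol \<omega> g"
 note p = adm[unfolded adm_def, THEN conjunct2, THEN spec[of _ g], THEN mp, OF g]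
 have uc: "continuous_on half_space ?u" and ub: "\<And>x. (?u \<longlongrightarrow> g x) (at (x, 0) within half_space)"
  using p[THEN conjunct1] p[THEN conjunct2, THEN conjunct1] by simp_all
 have cl: "compact {X \<in> \<Omega> \<inter> K. k + \<delta> <= ?u X}" if K: "compact K" "K \<subseteq> D" and \<delta>: "0 < \<delta>" for K \<delta>
 proof -
  let ?S = "{X \<in> \<Omega> \<inter> K. k + \<delta> <= ?u X}"
  have "closed ?S" unfolding closed_sequential_limits
  proof (intro allI impI, elim conjE)
   fix X l assume X: "\<forall>n. X n \<in> ?S" and lim: "X \<longlonglongrightarrow> l"
   have XK: "\<And>n. X n \<in> K" and X\<Omega>: "\<forall>n. X n \<in> \<Omega>" using X by auto
   have lK: "l \<in> K" by (rule closed_sequentially[OF compact_imp_closed[OF K(1)] XK lim])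
   have lcl: "l \<in> closure \<Omega>" using X\<Omega> lim unfolding closure_sequential by (intro exI[of _ X]) simp
   show "l \<in> ?S"
   proof (cases "l \<in> half_space")
    case True
    have "isCont ?u l" using uc True by (simp add: continuous_on_eq_continuous_at[OF open_half_space])
    then have "(\<lambda>n. ?u (X n)) \<longlonglongrightarrow> ?u l" by (rule isCont_tendsto_compose[OF _ lim])
    then have "k + \<delta> <= ?u l" by (rule LIMSEQ_le_const) (use X in auto)
    then show ?thesis using side[of l] lK lcl K(2) True \<delta> by force
   next
    case False
    have "(\<lambda>n. snd (X n)) \<longlonglongrightarrow> snd l" by (intro tendsto_intros lim)
    then have "0 <= snd l"
     by (rule LIMSEQ_le_const) (use X \<Omega>(2) in \<open>auto simp: snd_in_half_space intro!: exI[of _ 0] less_imp_le\<close>)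
    then have l0: "l = (fst l, 0)" using False by (simp add: snd_in_half_space prod_eq_iff)
    have XH: "X n \<in> half_space - {(fst l, 0)}" for n
    proof -
     have "X n \<in> half_space" using X\<Omega> \<Omega>(2) by blast
     then show ?thesis by (cases "X n") (simp add: snd_in_half_space)
    qed
    have "(?u \<circ> X) \<longlonglongrightarrow> g (fst l)"
     by (rule ub[of "fst l", unfolded tendsto_at_iff_sequentially, THEN spec[of _ X], THEN mp, THEN mp])
       (use XH lim l0 in simp_all)
    then have "k + \<delta> <= g (fst l)" by (rule LIMSEQ_le_const) (use X in auto)
    then show ?thesis using bot[of "fst l"] l0 lK lcl K(2) \<delta> by force
   qed
  qed
  then have "compact (K \<inter> ?S)" using K(1) by (rule compact_Int_closed[rotated])
  moreover have "K \<inter> ?S = ?S" by auto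
  ultimately show ?thesis by simp
 qed
 have "DG L D (\<lambda>X. if X \<in> \<Omega> then max 0 (?u X - k) else 0)"
  by (rule p[THEN conjunct2, THEN conjunct2, THEN spec[of _ \<Omega>], THEN spec[of _ D], THEN spec[of _ k], THEN mp])
    (intro conjI allI impI \<Omega> D, elim conjE, rule cl)
 then show ?thesis by (simp add: trunc_def[abs_def])
qed

lemma dist_point: "dist ((x, s) :: 'm::finite point) (x, t) = \<bar>s - t\<bar>" by (simp add: dist_prod_def dist_real_def)

lemma snd_dist: "\<bar>snd X - snd Y\<bar> <= dist X (Y :: 'm::finite point)" using dist_snd_le[of X Y] by (simp add: dist_real_def)

section \<open>Boundary decay and the maximum principle\<close>

text \<open>The truncation at level k, extended by zero, is of class \<open>DG\<close> on the full
  ball about the boundary point. It vanishes on the ball of radius R/4 about the point at depth R/4,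
  and the growth lemma applies with this zero set.\<close>

lemma boundary_growth:
 assumes L: "0 <= L"
 shows "\<exists>c>0. c < 1 \<and> (\<forall>(\<omega> :: 'm::finite poles) g x R k d. adm L \<omega> \<and> ccs g \<and> 0 < R \<and> 0 < d \<and>
   (\<forall>y\<in>ball x R. g y <= k) \<and> (\<forall>X\<in>half_space \<inter> ball (x, 0) R. dsol \<omega> g X <= k + d) -->
   (\<forall>X\<in>half_space \<inter> ball (x, 0) (R / 4). dsol \<omega> g X <= k + (1 - c) * d))"
proof -
 have half: "(0::real) < 1 / 2" by simp
 show ?thesis using DG_growth_ball[OF L half, where 'a = "'m point"]
 proof (elim exE conjE, goal_cases)
 case (1 c)
 note c = 1(1,2) and gr = 1(3)
 have "dsol \<omega> g X <= k + (1 - c) * d"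
  if adm: "adm L \<omega>" and g: "ccs g" and R: "0 < R" "0 < d" and gk: "\<forall>y\<in>ball x R. g y <= k"
   and bd: "\<forall>X\<in>half_space \<inter> ball (x, 0) R. dsol \<omega> g X <= k + d" and X: "X \<in> half_space" "X \<in> ball (x, 0) (R / 4)"
  for \<omega> :: "'m poles" and g x R k d X
 proof -
  let ?v = "trunc \<omega> g k half_space"
  have DG: "DG L (ball (x, 0) R) ?v"
  proof (rule DG_trunc[OF adm g open_half_space])
   fix y assume "(y, 0) \<in> ball (x, 0::real) R"
   then have "y \<in> ball x R" using dist_fst_le[of "(x, 0::real)" "(y, 0)"] by simp
   then show "g y <= k" using gk by blast
  qed auto
  have "?v X <= (1 - c) * d"
  proof (rule gr[rule_format, of "ball (x, 0) R" ?v "R / 2" "(x, 0)" d "(x, - (R / 4))"], intro conjI ballI)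
   show "?v Y <= d" if "Y \<in> ball (x, 0) (2 * (R / 2))" for Y
   proof (cases "Y \<in> half_space")
    case True
    then have "dsol \<omega> g Y <= k + d" using that by (intro bd[THEN bspec]) simp
    then show ?thesis using R by (simp add: trunc_def)
   qed (use R in \<open>simp add: trunc_def\<close>)
   show "ball (x, - (R / 4)) (1 / 2 * (R / 2)) \<subseteq> ball (x, 0) (R / 2)"
   proof
    fix Y assume "Y \<in> ball (x, - (R / 4)) (1 / 2 * (R / 2))"
    then show "Y \<in> ball (x, 0) (R / 2)" using dist_triangle[of "(x, 0)" Y "(x, - (R / 4))"] R by (simp add: dist_point)
   qed
   show "?v Y = 0" if "Y \<in> ball (x, - (R / 4)) (1 / 2 * (R / 2))" for Y
    using that snd_dist[of "(x, - (R / 4))" Y] by (auto simp: trunc_def snd_in_half_space)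
  qed (use DG R X in auto)
  then show ?thesis using X by (simp add: trunc_def max_def split: if_splits)
 qed
 then show ?thesis using c by (intro exI[of _ c]) blast
 qed
qed

lemma boundary_decay:
 assumes L: "0 <= L"
 shows "\<exists>c>0. c < 1 \<and> (\<forall>(\<omega> :: 'm::finite poles) g x R k d j. adm L \<omega> \<and> ccs g \<and> 0 < R \<and> 0 < d \<and>
   (\<forall>y\<in>ball x R. g y <= k) \<and> (\<forall>X\<in>half_space \<inter> ball (x, 0) R. dsol \<omega> g X <= k + d) -->
   (\<forall>X\<in>half_space \<inter> ball (x, 0) (R / 4 ^ j). dsol \<omega> g X <= k + (1 - c) ^ j * d))"
proof -
 show ?thesis using boundary_growth[OF L, where 'm = 'm]
 proof (elim exE conjE, goal_cases)
 case (1 c)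
 note c = 1(1,2) and gr = 1(3)
 have "\<forall>X\<in>half_space \<inter> ball (x, 0) (R / 4 ^ j). dsol \<omega> g X <= k + (1 - c) ^ j * d"
  if adm: "adm L \<omega>" and g: "ccs g" and R: "0 < R" "0 < d" and gk: "\<forall>y\<in>ball x R. g y <= k"
   and bd: "\<forall>X\<in>half_space \<inter> ball (x, 0) R. dsol \<omega> g X <= k + d"
  for \<omega> :: "'m poles" and g x R k d j
 proof (induction j)
  case 0
  then show ?case using bd by simp
 next
  case (Suc j)
  have "R / 4 ^ j <= R" using R by (simp add: divide_le_eq)
  then have "\<forall>y\<in>ball x (R / 4 ^ j). g y <= k" using gk by auto
  then have "\<forall>X\<in>half_space \<inter> ball (x, 0) (R / 4 ^ j / 4). dsol \<omega> g X <= k + (1 - c) * ((1 - c) ^ j * d)"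
   using gr[rule_format, of \<omega> g "R / 4 ^ j" "(1 - c) ^ j * d" x k]
    adm g R c Suc by simp
  then show ?case by (simp add: mult_ac)
 qed
 then show ?thesis using c by (intro exI[of _ c]) blast
 qed
qed

text \<open>j steps of decay start from the trivial bound 1 on the ball of radius M t, with M = 2
  4^j; the factor 2 leaves (x, t) strictly inside the last ball, which has radius 2t.\<close>

lemma dsol_small_near_zero_data:
 assumes L: "0 <= L" and \<eta>: "0 < \<eta>"
 shows "\<exists>M\<ge>1. \<forall>(\<omega> :: 'm::finite poles) g x t. adm L \<omega> \<and> ccs g \<and> (\<forall>y. 0 <= g y \<and> g y <= 1) \<and>
   0 < t \<and> (\<forall>y\<in>ball x (M * t). g y = 0) --> dsol \<omega> g (x, t) <= \<eta>"
proof -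
 show ?thesis using boundary_decay[OF L, where 'm = 'm]
 proof (elim exE conjE, goal_cases)
 case (1 c)
 note c = 1(1,2) and gr = 1(3)
 obtain j where j: "(1 - c) ^ j < \<eta>" using real_arch_pow_inv[OF \<eta>, of "1 - c"] c by auto
 have "dsol \<omega> g (x, t) <= \<eta>"
  if adm: "adm L \<omega>" and g: "ccs g" and g01: "\<forall>y. 0 <= g y \<and> g y <= 1" and t: "0 < t" and z: "\<forall>y\<in>ball x (2 * 4 ^ j * t). g y = 0"
  for \<omega> :: "'m poles" and g x t
 proof -
  have "dsol \<omega> g (x, t) <= 0 + (1 - c) ^ j * 1"
  proof (rule gr[rule_format, of \<omega> g "2 * 4 ^ j * t" 1 x 0 _ j], intro conjI ballI)
   show "dsol \<omega> g X <= 0 + 1" if "X \<in> half_space \<inter> ball (x, 0) (2 * 4 ^ j * t)" for X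
    using dsol_bounds(2)[OF adm _ ccs_measurable[OF g], of X 0 1] that g01 by simp
   show "(x, t) \<in> half_space \<inter> ball (x, 0) (2 * 4 ^ j * t / 4 ^ j)" using t by (simp add: snd_in_half_space dist_point)
  qed (use adm g t z in auto)
  then show ?thesis using j by simp
 qed
 moreover have "(1::real) <= 2 * 4 ^ j"
 proof -
  have "(1::real) <= 4 ^ j" by simp
  then show ?thesis by linarith
 qed
 ultimately show ?thesis by (intro exI[of _ "2 * 4 ^ j"]) blast
 qed
qed

text \<open>\<Omega> may be unbounded, so compactness is not at hand. The truncation is of class
  \<open>DG\<close> on the whole space and vanishes in the lower half space; around the boundary
  point below any Y a ball of radius 4 times the height of Y contains a fixed share of zeros. The
  global bound therefore improves by the factor 1 - c, again and again.\<close>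

lemma maximum_principle:
 fixes \<omega> :: "'m::finite poles"
 assumes L: "0 <= L" and adm: "adm L \<omega>" and g: "ccs g" and \<Omega>: "open \<Omega>" "\<Omega> \<subseteq> half_space"
  and bot: "\<And>x. (x, 0) \<in> closure \<Omega> ==> g x <= k"
  and side: "\<And>X. X \<in> half_space ==> X \<notin> \<Omega> ==> X \<in> closure \<Omega> ==> dsol \<omega> g X <= k"
  and X: "X \<in> \<Omega>"
 shows "dsol \<omega> g X <= k"
proof -
 have half: "(0::real) < 1 / 2" by simp
 show ?thesis using DG_growth_ball[OF L half, where 'a = "'m point"]
 proof (elim exE conjE, goal_cases)
 case (1 c)
 note c = 1(1,2) and gr = 1(3)
 let ?v = "trunc \<omega> g k \<Omega>"
 have DG: "DG L UNIV ?v" by (rule DG_trunc[OF adm g \<Omega> open_UNIV]) (use bot side in auto)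
 obtain B where B: "0 < B" "\<And>x. \<bar>g x\<bar> <= B" using ccs_bounded[OF g] by blast
 have gB: "- B <= g x \<and> g x <= B" for x using B(2)[of x] by auto
 have vb: "?v Y <= B + \<bar>k\<bar>" for Y using dsol_bounds(2)[OF adm _ ccs_measurable[OF g] gB, of Y] \<Omega>(2) B(1) by (auto simp: trunc_def)
 have dec: "?v Y <= (1 - c) ^ j * (B + \<bar>k\<bar>)" for j Y
 proof (induction j arbitrary: Y)
  case 0
  then show ?case using vb by simp
 next
  case (Suc j)
  show ?case
  proof (cases "Y \<in> \<Omega>")
   case False
   then show ?thesis using c B by (simp add: trunc_def)
  next
   case True
   then have pos: "0 < snd Y" using \<Omega>(2) by (auto simp: snd_in_half_space)
   define x0 where "x0 = (fst Y, 0::real)"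
   define r where "r = 4 * snd Y"
   have Yr: "dist x0 Y < r / 2" using pos dist_point[of "fst Y" 0 "snd Y"] by (simp add: x0_def r_def)
   have "?v Y <= (1 - c) * ((1 - c) ^ j * (B + \<bar>k\<bar>))"
   proof (rule gr[rule_format, of UNIV ?v r x0 "(1 - c) ^ j * (B + \<bar>k\<bar>)" "(fst Y, - (r / 2))"], intro conjI ballI)
    show "ball (fst Y, - (r / 2)) (1 / 2 * r) \<subseteq> ball x0 r"
    proof
     fix Z assume "Z \<in> ball (fst Y, - (r / 2)) (1 / 2 * r)"
     then show "Z \<in> ball x0 r" using dist_triangle[of x0 Z "(fst Y, - (r / 2))"] pos by (simp add: dist_point x0_def r_def)
    qed
    show "?v Z = 0" if "Z \<in> ball (fst Y, - (r / 2)) (1 / 2 * r)" for Z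
    proof -
     have "snd Z < 0" using that snd_dist[of "(fst Y, - (r / 2))" Z] by auto
     then show ?thesis using \<Omega>(2) by (auto simp: trunc_def snd_in_half_space)
    qed
   qed (use DG pos c B Suc Yr in \<open>auto simp: r_def\<close>)
   then show ?thesis by simp
  qed
 qed
 have "(\<lambda>j. (1 - c) ^ j * (B + \<bar>k\<bar>)) \<longlonglongrightarrow> 0 * (B + \<bar>k\<bar>)"
  using c by (intro tendsto_mult tendsto_const LIMSEQ_realpow_zero) auto
 then have "?v X <= 0" using LIMSEQ_le_const[of _ 0 "?v X"] dec by simp
 then show ?thesis using X by (simp add: trunc_def max_def split: if_splits)
 qed
qed

section \<open>Interior oscillation and a qualitative Harnack inequality\<close>

lemma ccs_uminus: "ccs g ==> ccs (\<lambda>x. - g x)" using ccs_lincomb[of g g "-1" 0] by simp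

lemma dsol_uminus:
 assumes "adm L \<omega>" "X \<in> half_space" "ccs g" shows "dsol \<omega> (\<lambda>x. - g x) X = - dsol \<omega> g X"
 using dsol_lincomb[OF assms(1,2,3,3), of "-1" 0] by simp

lemma interior_DG_trunc:
 assumes "adm L \<omega>" "ccs g" "ball X r \<subseteq> half_space"
 shows "DG L (ball X r) (trunc \<omega> g k half_space)"
proof (rule DG_trunc[OF assms(1,2) open_half_space order_refl open_ball])
 fix x assume "(x, 0) \<in> ball X r"
 then have "(x, 0) \<in> half_space" using assms(3) by (rule subsetD[rotated])
 then show "g x <= k" by (simp add: snd_in_half_space)
qed simp

lemma interior_growth:
 assumes L: "0 <= L" and \<theta>: "0 < \<theta>"
 shows "\<exists>c>0. c < 1 \<and> (\<forall>(\<omega> :: 'm::finite poles) g Z r y N e. adm L \<omega> \<and> ccs g \<and> 0 < r \<and> ball Z (2 * r) \<subseteq> half_space \<and> 0 < e \<and>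
   (\<forall>Y\<in>ball Z (2 * r). dsol \<omega> g Y <= N) \<and> ball y (\<theta> * r) \<subseteq> ball Z r \<and> (\<forall>Y\<in>ball y (\<theta> * r). dsol \<omega> g Y <= N - e) -->
   (\<forall>Y\<in>ball Z (r / 2). dsol \<omega> g Y <= N - c * e))"
proof -
 show ?thesis using DG_growth_ball[OF L \<theta>, where 'a = "'m point"]
 proof (elim exE conjE, goal_cases)
 case (1 c)
 note c = 1(1,2) and gr = 1(3)
 have "dsol \<omega> g Y <= N - c * e"
  if adm: "adm L \<omega>" and g: "ccs g" and r: "0 < r" "ball Z (2 * r) \<subseteq> half_space" and e: "0 < e"
   and N: "\<forall>Y\<in>ball Z (2 * r). dsol \<omega> g Y <= N" and y: "ball y (\<theta> * r) \<subseteq> ball Z r" "\<forall>Y\<in>ball y (\<theta> * r). dsol \<omega> g Y <= N - e"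
   and Y: "Y \<in> ball Z (r / 2)"
  for \<omega> :: "'m poles" and g Z r y N e Y
 proof -
  let ?v = "trunc \<omega> g (N - e) half_space"
  have "?v Y <= (1 - c) * e"
  proof (rule gr[rule_format, of "ball Z (2 * r)" ?v r Z e y, OF _ Y], intro conjI ballI)
   show "DG L (ball Z (2 * r)) ?v" by (rule interior_DG_trunc[OF adm g r(2)])
   show "?v W <= e" if "W \<in> ball Z (2 * r)" for W using N[THEN bspec, OF that] e by (simp add: trunc_def)
   show "?v W = 0" if "W \<in> ball y (\<theta> * r)" for W using y(2)[THEN bspec, OF that] by (simp add: trunc_def)
  qed (use r e y in simp_all)
  moreover have "Y \<in> half_space" using Y r by (intro subsetD[OF r(2)]) simp
  ultimately have "dsol \<omega> g Y - (N - e) <= (1 - c) * e" by (simp add: trunc_def)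
  then show ?thesis by (simp add: algebra_simps)
 qed
 note * = this
 show ?thesis by (rule exI[of _ c], intro conjI c allI impI ballI, elim conjE, rule *; assumption)
 qed
qed

text \<open>The solution lies on one side of the midpoint m + d/2 on at least half of the ball, so
  the truncation of u or of -u vanishes there and the growth lemma applies to it. Only one half of
  the range is improved, whence c/2.\<close>

lemma interior_oscillation:
 assumes L: "0 <= L"
 shows "\<exists>c>0. c < 1 \<and> (\<forall>(\<omega> :: 'm::finite poles) g X r m d. adm L \<omega> \<and> ccs g \<and> 0 < r \<and> ball X (2 * r) \<subseteq> half_space \<and> 0 < d \<and>
   (\<forall>Y\<in>ball X (2 * r). m <= dsol \<omega> g Y \<and> dsol \<omega> g Y <= m + d) -->
   (\<exists>m'. \<forall>Y\<in>ball X (r / 2). m' <= dsol \<omega> g Y \<and> dsol \<omega> g Y <= m' + (1 - c) * d))"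
proof -
 have half: "(0::real) < 1 / 2" by simp
 show ?thesis using DG_growth[OF L half, where 'a = "'m point"]
 proof (elim exE conjE, goal_cases)
 case (1 c)
 note c = 1(1,2) and gr = 1(3)
 have "\<exists>m'. \<forall>Y\<in>ball X (r / 2). m' <= dsol \<omega> g Y \<and> dsol \<omega> g Y <= m' + (1 - c / 2) * d"
  if adm: "adm L \<omega>" and g: "ccs g" and r: "0 < r" "ball X (2 * r) \<subseteq> half_space" and d: "0 < d"
   and N: "\<forall>Y\<in>ball X (2 * r). m <= dsol \<omega> g Y \<and> dsol \<omega> g Y <= m + d"
  for \<omega> :: "'m poles" and g X r m d
 proof -
  let ?v = "trunc \<omega> g (m + d / 2) half_space"
  let ?w = "trunc \<omega> (\<lambda>x. - g x) (- (m + d / 2)) half_space"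
  have DGv: "DG L (ball X (2 * r)) ?v" by (rule interior_DG_trunc[OF adm g r(2)])
  have DGw: "DG L (ball X (2 * r)) ?w" by (rule interior_DG_trunc[OF adm ccs_uminus[OF g] r(2)])
  have H: "Y \<in> half_space" if "Y \<in> ball X (2 * r)" for Y using that r(2) by (rule subsetD[rotated])
  have w: "?w Y = max 0 (m + d / 2 - dsol \<omega> g Y)" "?v Y = max 0 (dsol \<omega> g Y - (m + d / 2))" if "Y \<in> ball X (2 * r)" for Y
   using H[OF that] dsol_uminus[OF adm _ g, of Y] by (simp_all add: trunc_def)
  have sub: "Y \<in> ball X (2 * r)" if "Y \<in> ball X r" for Y using that r by simp
  have sub2: "Y \<in> ball X (2 * r)" if "Y \<in> ball X (r / 2)" for Y using that r by simp
  have [measurable]: "?v \<in> \<B>" "?w \<in> \<B>" using DGv DGw by (simp_all add: DG_def)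
  let ?S = "{Y \<in> ball X r. ?v Y = 0}" and ?T = "{Y \<in> ball X r. ?w Y = 0}"
  have [measurable]: "?S \<in> sets borel" "?T \<in> sets borel" unfolding mem_ball by measurable
  have "ball X r \<subseteq> ?S \<union> ?T"
  proof
   fix Y assume "Y \<in> ball X r"
   then show "Y \<in> ?S \<union> ?T" using w[OF sub[of Y]] by (cases "dsol \<omega> g Y <= m + d / 2") simp_all
  qed
  then have "emeasure lborel (ball X r) <= emeasure lborel (?S \<union> ?T)" by (rule emeasure_mono) measurable
  also have "\<dots> <= emeasure lborel ?S + emeasure lborel ?T" by (rule emeasure_subadditive) measurable
  finally have le: "emeasure lborel (ball X r) <= emeasure lborel ?S + emeasure lborel ?T" .
  have hf: "ennreal (1 / 2) * emeasure lborel (ball X r) + ennreal (1 / 2) * emeasure lborel (ball X r) = emeasure lborel (ball X r)"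
  proof -
   have "ennreal (1 / 2) + ennreal (1 / 2) = ennreal (1 / 2 + 1 / 2)" by (rule ennreal_plus[symmetric]) auto
   then have "ennreal (1 / 2) + ennreal (1 / 2) = 1" by (simp only:) simp
   then show ?thesis by (simp only: distrib_right[symmetric]) simp
  qed
  have "ennreal (1 / 2) * emeasure lborel (ball X r) <= emeasure lborel ?S \<or> ennreal (1 / 2) * emeasure lborel (ball X r) <= emeasure lborel ?T"
  proof (rule ccontr)
   assume "\<not> ?thesis"
   then have "emeasure lborel ?S + emeasure lborel ?T < ennreal (1 / 2) * emeasure lborel (ball X r) + ennreal (1 / 2) * emeasure lborel (ball X r)"
    by (intro add_strict_mono) (simp_all add: not_le)
   then show False using le hf by simp
  qed
  then show ?thesis
  proof
   assume a: "ennreal (1 / 2) * emeasure lborel (ball X r) <= emeasure lborel ?S"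
   have "?v Y <= (1 - c) * (d / 2)" if "Y \<in> ball X (r / 2)" for Y
   proof (rule gr[rule_format, of "ball X (2 * r)" ?v r X "d / 2", OF _ that], intro conjI ballI)
    show "?v W <= d / 2" if "W \<in> ball X (2 * r)" for W unfolding w(2)[OF that] using N[THEN bspec, OF that] d by (intro max.boundedI) auto
   qed (use r d a DGv in simp_all)
   note v = this
   have "m <= dsol \<omega> g Y \<and> dsol \<omega> g Y <= m + (1 - c / 2) * d" if "Y \<in> ball X (r / 2)" for Y
   proof -
    have "dsol \<omega> g Y - (m + d / 2) <= (1 - c) * (d / 2)" using v[OF that] w(2)[OF sub2[OF that]] by linarith
    then show ?thesis using N[THEN bspec, OF sub2[OF that]] by (simp add: algebra_simps)
   qed
   then show ?thesis by (intro exI[of _ m]) simp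
  next
   assume a: "ennreal (1 / 2) * emeasure lborel (ball X r) <= emeasure lborel ?T"
   have "?w Y <= (1 - c) * (d / 2)" if "Y \<in> ball X (r / 2)" for Y
   proof (rule gr[rule_format, of "ball X (2 * r)" ?w r X "d / 2", OF _ that], intro conjI ballI)
    show "?w W <= d / 2" if "W \<in> ball X (2 * r)" for W unfolding w(1)[OF that] using N[THEN bspec, OF that] d by (intro max.boundedI) auto
   qed (use r d a DGw in simp_all)
   note v = this
   have "m + c / 2 * d <= dsol \<omega> g Y \<and> dsol \<omega> g Y <= m + c / 2 * d + (1 - c / 2) * d" if "Y \<in> ball X (r / 2)" for Y
   proof -
    have "m + d / 2 - dsol \<omega> g Y <= (1 - c) * (d / 2)" using v[OF that] w(1)[OF sub2[OF that]] by linarith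
    then show ?thesis using N[THEN bspec, OF sub2[OF that]] by (simp add: algebra_simps)
   qed
   then show ?thesis by (intro exI[of _ "m + c / 2 * d"]) simp
  qed
 qed
 note * = this
 show ?thesis by (rule exI[of _ "c / 2"], intro conjI allI impI, use c in simp, use c in simp, elim conjE, rule *; assumption)
 qed
qed

lemma ball_in_half_space: "r <= snd X ==> ball X r \<subseteq> (half_space :: 'm::finite point set)"
proof
 fix Y assume "r <= snd X" "Y \<in> ball X r"
 then show "Y \<in> half_space" using snd_dist[of X Y] by (simp add: snd_in_half_space)
qed

text \<open>Iterating the oscillation decay on balls of radius 4^-j times the height gives a modulus
  of continuity common to all operators and all data with values in [0, 1].\<close>

lemma dsol_equicontinuous:
 assumes L: "0 <= L" and \<eta>: "0 < \<eta>"
 shows "\<exists>\<theta>>0. \<theta> <= 1 \<and> (\<forall>(\<omega> :: 'm::finite poles) g X Y. adm L \<omega> \<and> ccs g \<and> (\<forall>y. 0 <= g y \<and> g y <= 1) \<and>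
   X \<in> half_space \<and> dist X Y < \<theta> * snd X --> \<bar>dsol \<omega> g X - dsol \<omega> g Y\<bar> <= \<eta>)"
proof -
 show ?thesis using interior_oscillation[OF L, where 'm = 'm]
 proof (elim exE conjE, goal_cases)
 case (1 c)
 note c = 1(1,2) and gr = 1(3)
 obtain j where j: "(1 - c) ^ j < \<eta>" using real_arch_pow_inv[OF \<eta>, of "1 - c"] c by auto
 have "\<bar>dsol \<omega> g X - dsol \<omega> g Y\<bar> <= \<eta>"
  if adm: "adm L \<omega>" and g: "ccs g" and g01: "\<forall>y. 0 <= g y \<and> g y <= 1" and X: "X \<in> half_space" and XY: "dist X Y < 1 / 4 ^ j * snd X"
  for \<omega> :: "'m poles" and g X Y
 proof -
  have t: "0 < snd X" using X by (simp add: snd_in_half_space)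
  have "\<exists>m. \<forall>Y\<in>ball X (snd X / 4 ^ i). m <= dsol \<omega> g Y \<and> dsol \<omega> g Y <= m + (1 - c) ^ i" for i
  proof (induction i)
   case 0
   have "0 <= dsol \<omega> g Y \<and> dsol \<omega> g Y <= 0 + 1" if "Y \<in> ball X (snd X)" for Y
    using dsol_bounds[OF adm subsetD[OF ball_in_half_space[OF order_refl] that] ccs_measurable[OF g], of 0 1] g01 by simp
   then show ?case by (intro exI[of _ 0]) simp
  next
   case (Suc i)
   then obtain m where m: "\<forall>Y\<in>ball X (snd X / 4 ^ i). m <= dsol \<omega> g Y \<and> dsol \<omega> g Y <= m + (1 - c) ^ i" by (elim exE)
   have "1 <= (4::real) ^ i" by simp
   then have le: "snd X / 4 ^ i <= snd X" using t by (simp add: divide_le_eq)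
   have "\<exists>m'. \<forall>Y\<in>ball X (snd X / 4 ^ i / 2 / 2). m' <= dsol \<omega> g Y \<and> dsol \<omega> g Y <= m' + (1 - c) * (1 - c) ^ i"
    by (rule gr[rule_format, of \<omega> g "snd X / 4 ^ i / 2" X "(1 - c) ^ i" m]) (use adm g t c m ball_in_half_space[OF le] in simp)
   then show ?case by (simp add: mult.commute)
  qed
  from this[of j] obtain m where m: "\<forall>Y\<in>ball X (snd X / 4 ^ j). m <= dsol \<omega> g Y \<and> dsol \<omega> g Y <= m + (1 - c) ^ j" by (elim exE)
  have "X \<in> ball X (snd X / 4 ^ j)" "Y \<in> ball X (snd X / 4 ^ j)" using t XY by simp_all
  from m[THEN bspec, OF this(1)] m[THEN bspec, OF this(2)] j show ?thesis by linarith
 qed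
 note * = this
 show ?thesis by (rule exI[of _ "1 / 4 ^ j"], intro conjI allI impI, simp, simp add: divide_le_eq, elim conjE, rule *; assumption)
 qed
qed

text \<open>Equicontinuity turns the value at X into a lower bound \<tau>/2 on a small ball. The
  growth lemma for -u, with upper bound 0, spreads positivity from a small ball to a ball of radius
  \<rho>/2, and a chain of balls along the segment carries it to Y.\<close>

lemma qualitative_harnack:
 assumes L: "0 <= L" and \<tau>: "0 < \<tau>" and \<kappa>: "0 < \<kappa>" "\<kappa> <= 1"
 shows "\<exists>c>0. \<forall>(\<omega> :: 'm::finite poles) g X Y. adm L \<omega> \<and> ccs g \<and> (\<forall>y. 0 <= g y \<and> g y <= 1) \<and>
   X \<in> half_space \<and> dist X Y <= snd X / \<kappa> \<and> \<kappa> * snd X <= snd Y \<and> \<tau> <= dsol \<omega> g X --> c <= dsol \<omega> g Y"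
proof -
 show ?thesis using dsol_equicontinuous[OF L half_gt_zero[OF \<tau>], where 'm = 'm]
 proof (elim exE conjE, goal_cases)
 case (1 \<theta>)
 note \<theta> = 1(1,2) and eq = 1(3)
 \<comment> \<open>With \<rho> = \<kappa> snd X / 3, the ball of radius \<theta>1 \<rho> lies both
   in the ball of radius \<rho> and in the ball of radius \<theta> snd X of equicontinuity.\<close>
 define \<theta>1 where "\<theta>1 = min 1 (3 * \<theta> / \<kappa>)"
 have \<theta>1: "0 < \<theta>1" using \<theta> \<kappa> by (simp add: \<theta>1_def)
 have lower: "\<exists>c>0. \<forall>(\<omega> :: 'm poles) g Z r y e. adm L \<omega> \<and> ccs g \<and> (\<forall>y. 0 <= g y \<and> g y <= 1) \<and> 0 < r \<and> ball Z (2 * r) \<subseteq> half_space \<and> 0 < e \<and>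
   ball y (\<theta>' * r) \<subseteq> ball Z r \<and> (\<forall>Y\<in>ball y (\<theta>' * r). e <= dsol \<omega> g Y) --> (\<forall>Y\<in>ball Z (r / 2). c * e <= dsol \<omega> g Y)"
  if \<theta>': "0 < \<theta>'" for \<theta>'
 proof -
  obtain c where c: "0 < c" "c < 1"
   and gr: "\<forall>(\<omega> :: 'm poles) g Z r y N e. adm L \<omega> \<and> ccs g \<and> 0 < r \<and> ball Z (2 * r) \<subseteq> half_space \<and> 0 < e \<and>
   (\<forall>Y\<in>ball Z (2 * r). dsol \<omega> g Y <= N) \<and> ball y (\<theta>' * r) \<subseteq> ball Z r \<and> (\<forall>Y\<in>ball y (\<theta>' * r). dsol \<omega> g Y <= N - e) -->
   (\<forall>Y\<in>ball Z (r / 2). dsol \<omega> g Y <= N - c * e)"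
   using interior_growth[OF L \<theta>', where 'm = 'm] by (elim exE conjE) (rule that)
  have "c * e <= dsol \<omega> g Y"
   if adm: "adm L \<omega>" and g: "ccs g" and g01: "\<forall>y. 0 <= g y \<and> g y <= 1" and r: "0 < r" "ball Z (2 * r) \<subseteq> half_space" "0 < e"
    "ball y (\<theta>' * r) \<subseteq> ball Z r" and y: "\<forall>Y\<in>ball y (\<theta>' * r). e <= dsol \<omega> g Y" and Y: "Y \<in> ball Z (r / 2)"
   for \<omega> :: "'m poles" and g Z r y e Y
  proof -
   have H: "W \<in> half_space" if "W \<in> ball Z (2 * r)" for W using that r(2) by (rule subsetD[rotated])
   have "dsol \<omega> (\<lambda>x. - g x) Y <= 0 - c * e"
   proof (rule gr[rule_format, of \<omega> "\<lambda>x. - g x" r Z e 0 y, OF _ Y], intro conjI ballI adm ccs_uminus g r)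
    show "dsol \<omega> (\<lambda>x. - g x) W <= 0" if "W \<in> ball Z (2 * r)" for W
     using dsol_uminus[OF adm H[OF that] g] dsol_bounds(1)[OF adm H[OF that] ccs_measurable[OF g], of 0 1] g01 by simp
    show "dsol \<omega> (\<lambda>x. - g x) W <= 0 - e" if "W \<in> ball y (\<theta>' * r)" for W
    proof -
     have "W \<in> ball Z r" using that r(4) by (rule subsetD[rotated])
     then have "W \<in> half_space" using r(1) by (intro H) simp
     then show ?thesis using dsol_uminus[OF adm _ g, of W] y[THEN bspec, OF that] by simp
    qed
   qed
   moreover have "Y \<in> half_space" using Y r(1) by (intro H) simp
   ultimately show ?thesis using dsol_uminus[OF adm _ g, of Y] by simp
  qed
  note * = this
  show ?thesis by (rule exI[of _ c], intro conjI c allI impI ballI, elim conjE, rule *; assumption)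
 qed
 show ?thesis using lower[OF \<theta>1]
 proof (elim exE conjE, goal_cases)
 case (1 c1)
 note c1 = 1(1) and low1 = 1(2)
 have q: "(0::real) < 1 / 4" by simp
 show ?thesis using lower[OF q]
 proof (elim exE conjE, goal_cases)
 case (1 c2)
 note c2 = 1(1) and low2 = 1(2)
 \<comment> \<open>The segment has length at most snd X / \<kappa>, so N steps place consecutive
   centres at distance at most \<kappa> snd X / 12 = \<rho>/4; the ball of radius \<rho>/4 about the
   next centre then lies in the ball of radius \<rho>/2 about the previous one.\<close>
 define N where "N = Suc (nat \<lceil>12 / \<kappa>^2\<rceil>)"
 have N: "12 / \<kappa>^2 <= real N" "0 < real N" unfolding N_def by linarith+
 have c: "0 < c2 ^ N * (c1 * (\<tau> / 2))" using c1 c2 \<tau> by simp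
 show ?thesis
 proof (rule exI[of _ "c2 ^ N * (c1 * (\<tau> / 2))"], intro conjI c allI impI, elim conjE, goal_cases)
 case (1 \<omega> g X Y)
 note adm = 1(1) and g = 1(2) and g01 = 1(3) and X = 1(4) and XY = 1(5,6) and uX = 1(7)
 show ?case
 proof -
  have t: "0 < snd X" using X by (simp add: snd_in_half_space)
  define \<rho> where "\<rho> = \<kappa> * snd X / 3"
  have \<rho>: "0 < \<rho>" using t \<kappa> by (simp add: \<rho>_def)
  define Z where "Z i = X + (real i / real N) *\<^sub>R (Y - X)" for i :: nat
  have sZ: "\<kappa> * snd X <= snd (Z i)" if "i <= N" for i
  proof -
   define s where "s = real i / real N"
   have s: "0 <= s" "s <= 1" using that N by (auto simp: s_def)
   have "(1 - s) * (\<kappa> * snd X) + s * (\<kappa> * snd X) <= (1 - s) * snd X + s * snd Y"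
    using s XY(2) \<kappa> t by (intro add_mono mult_left_mono) (auto simp: mult_le_cancel_right1)
   moreover have "snd (Z i) = (1 - s) * snd X + s * snd Y" by (simp add: Z_def s_def algebra_simps)
   ultimately show ?thesis by (simp add: algebra_simps)
  qed
  have bH: "ball (Z i) (2 * \<rho>) \<subseteq> half_space" if "i <= N" for i
  proof (rule ball_in_half_space)
   have "0 < \<kappa> * snd X" using \<kappa> t by simp
   then show "2 * \<rho> <= snd (Z i)" using sZ[OF that] by (simp add: \<rho>_def)
  qed
  have dZ: "dist (Z i) (Z (Suc i)) <= \<rho> / 4" for i
  proof -
   have e: "Z (Suc i) - Z i = (1 / real N) *\<^sub>R (Y - X)" by (simp add: Z_def add_divide_distrib scaleR_left_distrib)
   have "dist (Z i) (Z (Suc i)) = norm (Z (Suc i) - Z i)" by (simp add: dist_norm norm_minus_commute)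
   also have "\<dots> = dist X Y / real N" unfolding e by (simp add: dist_norm norm_minus_commute)
   also have "\<dots> <= (snd X / \<kappa>) / (12 / \<kappa>^2)" using XY(1) N \<kappa> t by (intro frac_le) auto
   also have "\<dots> = \<rho> / 4" using \<kappa> by (simp add: \<rho>_def power2_eq_square)
   finally show ?thesis .
  qed
  have main: "\<forall>W\<in>ball (Z i) (\<rho> / 2). c2 ^ i * (c1 * (\<tau> / 2)) <= dsol \<omega> g W" if "i <= N" for i using that
  proof (induction i)
   case 0
   have Z0: "Z 0 = X" by (simp add: Z_def)
   have "\<forall>W\<in>ball X (\<rho> / 2). c1 * (\<tau> / 2) <= dsol \<omega> g W"
   proof (rule low1[THEN spec[of _ \<omega>], THEN spec[of _ g], THEN spec[of _ X], THEN spec[of _ \<rho>], THEN spec[of _ X], THEN spec[of _ "\<tau> / 2"], THEN mp], intro conjI ballI adm g g01 \<rho>)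
    show "ball X (2 * \<rho>) \<subseteq> half_space" using bH[of 0] Z0 by simp
    have "\<theta>1 * \<rho> <= 1 * \<rho>" using \<rho> by (intro mult_right_mono) (auto simp: \<theta>1_def)
    then show "ball X (\<theta>1 * \<rho>) \<subseteq> ball X \<rho>" by (intro subset_ball) simp
    fix W assume W: "W \<in> ball X (\<theta>1 * \<rho>)"
    have "\<theta>1 * \<rho> <= (3 * \<theta> / \<kappa>) * \<rho>" using \<rho> by (intro mult_right_mono) (auto simp: \<theta>1_def)
    also have "\<dots> = \<theta> * snd X" using \<kappa> by (simp add: \<rho>_def)
    finally have "dist X W < \<theta> * snd X" using W by simp
    then have "\<bar>dsol \<omega> g X - dsol \<omega> g W\<bar> <= \<tau> / 2" by (intro eq[rule_format, of \<omega> g X W] conjI adm g g01 X)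
    then show "\<tau> / 2 <= dsol \<omega> g W" using uX by linarith
   qed (use \<tau> in simp)
   then show ?case using Z0 by simp
  next
   case (Suc i)
   have "\<forall>W\<in>ball (Z (Suc i)) (\<rho> / 2). c2 * (c2 ^ i * (c1 * (\<tau> / 2))) <= dsol \<omega> g W"
   proof (rule low2[THEN spec[of _ \<omega>], THEN spec[of _ g], THEN spec[of _ "Z (Suc i)"], THEN spec[of _ \<rho>], THEN spec[of _ "Z (Suc i)"], THEN spec[of _ "c2 ^ i * (c1 * (\<tau> / 2))"], THEN mp], intro conjI ballI adm g g01 \<rho> bH Suc.prems)
    show "ball (Z (Suc i)) (1 / 4 * \<rho>) \<subseteq> ball (Z (Suc i)) \<rho>" using \<rho> by (intro subset_ball) simp
    fix W assume "W \<in> ball (Z (Suc i)) (1 / 4 * \<rho>)"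
    then have "W \<in> ball (Z i) (\<rho> / 2)" using dZ[of i] dist_triangle[of "Z i" W "Z (Suc i)"] by simp
    then show "c2 ^ i * (c1 * (\<tau> / 2)) <= dsol \<omega> g W" using Suc by simp
   qed (use c1 c2 \<tau> in simp)
   then show ?case by (simp add: mult.assoc)
  qed
  have "Z N = Y" using N by (simp add: Z_def)
  then show ?thesis using main[of N] \<rho> by simp
 qed
 qed
 qed
 qed
 qed
qed

section \<open>Comparison of solutions that vanish on a piece of the boundary\<close>

text \<open>Two bounds are carried together: s everywhere, and the much stronger -M s from height
  \<delta> \<rho> on. Shrinking the ball by 3/4 multiplies both by the same a, so the step can be
  iterated. The upper bound improves by boundary growth near the boundary; the strong bound is
  pushed down from height \<delta> \<rho> to 3/4 of it by interior growth.\<close>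

lemma boundary_harnack_step:
 assumes L: "0 <= L"
 shows "\<exists>a \<delta> M. 0 < a \<and> a < 1 \<and> 0 < \<delta> \<and> \<delta> <= 1 / 4 \<and> 0 < M \<and> (\<forall>(\<omega> :: 'm::finite poles) f y \<rho> s.
   adm L \<omega> \<and> ccs f \<and> 0 < \<rho> \<and> 0 < s \<and> (\<forall>x\<in>ball y \<rho>. f x <= 0) \<and>
   (\<forall>X\<in>half_space \<inter> ball (y, 0) \<rho>. dsol \<omega> f X <= s) \<and> (\<forall>X\<in>half_space \<inter> ball (y, 0) \<rho>. \<delta> * \<rho> <= snd X --> dsol \<omega> f X <= - (M * s)) -->
   (\<forall>X\<in>half_space \<inter> ball (y, 0) (3 / 4 * \<rho>). dsol \<omega> f X <= a * s) \<and>
   (\<forall>X\<in>half_space \<inter> ball (y, 0) (3 / 4 * \<rho>). \<delta> * (3 / 4 * \<rho>) <= snd X --> dsol \<omega> f X <= - (M * (a * s))))"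
proof -
 show ?thesis using boundary_growth[OF L, where 'm = 'm]
 proof (elim exE conjE, goal_cases)
 case (1 c0)
 note c0 = 1(1,2) and bg = 1(3)
 have tenth: "(0::real) < 1 / 10" by simp
 show ?thesis using interior_growth[OF L tenth, where 'm = 'm]
 proof (elim exE conjE, goal_cases)
 case (1 c1)
 note c1 = 1(1,2) and ig = 1(3)
 \<comment> \<open>With M = 2/c1 one has M a = 1 and c1 M = 2, so the interior growth bound s - c1
   (M + 1) s equals -M a s - c1 s, which leaves the required -M a s.\<close>
 define a where "a = c1 / 2"
 have a: "0 < a" "a < 1" using c1 by (auto simp: a_def)
 obtain J0 where J0: "(1 - c0) ^ J0 < a" using real_arch_pow_inv[OF a(1), of "1 - c0"] c0 by auto
 define J where "J = Suc J0"
 have J: "(1 - c0) ^ J <= a" "0 < real J"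
 proof -
  have "(1 - c0) ^ J <= (1 - c0) ^ J0" unfolding J_def by (rule power_decreasing) (use c0 in auto)
  then show "(1 - c0) ^ J <= a" using J0 by linarith
 qed (simp add: J_def)
 \<comment> \<open>Each of the J boundary growth steps uses balls of radius 8 \<delta> \<rho>;
   together they consume exactly a quarter of the radius \<rho>.\<close>
 define \<delta> where "\<delta> = 1 / (32 * real J)"
 have \<delta>: "0 < \<delta>" "\<delta> <= 1 / 4" "real J * (8 * \<delta>) = 1 / 4" using J by (auto simp: \<delta>_def J_def field_simps)
 define M where "M = 2 / c1"
 have M: "0 < M" using c1 by (simp add: M_def)
 have step: "(\<forall>X\<in>half_space \<inter> ball (y, 0) (3 / 4 * \<rho>). dsol \<omega> f X <= a * s) \<and>
   (\<forall>X\<in>half_space \<inter> ball (y, 0) (3 / 4 * \<rho>). \<delta> * (3 / 4 * \<rho>) <= snd X --> dsol \<omega> f X <= - (M * (a * s)))"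
  if adm: "adm L \<omega>" and f: "ccs f" and \<rho>: "0 < \<rho>" and s: "0 < s" and f0: "\<forall>x\<in>ball y \<rho>. f x <= 0"
   and up: "\<forall>X\<in>half_space \<inter> ball (y, 0) \<rho>. dsol \<omega> f X <= s"
   and lo: "\<forall>X\<in>half_space \<inter> ball (y, 0) \<rho>. \<delta> * \<rho> <= snd X --> dsol \<omega> f X <= - (M * s)"
  for \<omega> :: "'m poles" and f y \<rho> s
 proof -
  have \<delta>\<rho>: "0 < \<delta> * \<rho>" using \<delta> \<rho> by simp
  have lo': "dsol \<omega> f X <= - (M * s)" if "X \<in> half_space" "dist (y, 0) X < \<rho>" "\<delta> * \<rho> <= snd X" for X
   using lo[THEN bspec, of X, THEN mp] that by simp
  have up': "dsol \<omega> f X <= s" if "X \<in> half_space" "dist (y, 0) X < \<rho>" for X using up[THEN bspec, of X] that by simp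
  have Ms: "0 < M * s" using M s by simp
  have it: "\<forall>X\<in>half_space \<inter> ball (y, 0) (\<rho> - real j * (8 * \<delta>) * \<rho>). dsol \<omega> f X <= (1 - c0) ^ j * s" if "j <= J" for j
   using that
  proof (induction j)
   case 0
   then show ?case using up by simp
  next
   case (Suc j)
   let ?\<rho> = "\<rho> - real j * (8 * \<delta>) * \<rho>"
   have IH: "dsol \<omega> f X <= (1 - c0) ^ j * s" if "X \<in> half_space" "dist (y, 0) X < ?\<rho>" for X
    using Suc.IH[THEN bspec, of X] Suc.prems that by simp
   have pj: "0 < (1 - c0) ^ j * s" "0 < (1 - c0) ^ Suc j * s" using c0 s by simp_all
   show ?case
   proof (intro ballI)
    fix X assume "X \<in> half_space \<inter> ball (y, 0) (\<rho> - real (Suc j) * (8 * \<delta>) * \<rho>)"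
    then have X: "X \<in> half_space" "dist (y, 0) X < ?\<rho> - 8 * \<delta> * \<rho>" by (auto simp: algebra_simps)
    have le: "?\<rho> <= \<rho>" using \<delta> \<rho> by simp
    show "dsol \<omega> f X <= (1 - c0) ^ Suc j * s"
    proof (cases "\<delta> * \<rho> <= snd X")
     case True
     have "dsol \<omega> f X <= - (M * s)" by (rule lo'[OF X(1) _ True]) (use X(2) le \<delta>\<rho> in linarith)
     then show ?thesis using pj Ms by linarith
    next
     case False
     have dyx: "dist y (fst X) <= dist (y, 0) X" using dist_fst_le[of "(y, 0)" X] by simp
     have "dsol \<omega> f X <= 0 + (1 - c0) * ((1 - c0) ^ j * s)"
     proof (rule bg[rule_format, of \<omega> f "8 * \<delta> * \<rho>" "(1 - c0) ^ j * s" "fst X" 0], intro conjI ballI adm f pj)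
      show "0 < 8 * \<delta> * \<rho>" using \<delta>\<rho> by simp
      show "f x <= 0" if "x \<in> ball (fst X) (8 * \<delta> * \<rho>)" for x
      proof -
       have "dist (fst X) x < 8 * \<delta> * \<rho>" using that by (simp only: mem_ball)
       then have "dist y x < \<rho>" using dyx X(2) le dist_triangle[of y x "fst X"] by linarith
       then show ?thesis using f0 by simp
      qed
      show "dsol \<omega> f W <= 0 + (1 - c0) ^ j * s" if "W \<in> half_space \<inter> ball (fst X, 0) (8 * \<delta> * \<rho>)" for W
      proof -
       have "dist (y, 0::real) (fst X, 0) = dist y (fst X)" by (simp add: dist_prod_def)
       moreover have "dist (fst X, 0) W < 8 * \<delta> * \<rho>" using that by (simp only: Int_iff mem_ball)
       ultimately have "dist (y, 0) W < ?\<rho>" using dyx X(2) dist_triangle[of "(y, 0)" W "(fst X, 0::real)"] by linarith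
       then show ?thesis using IH[of W] that by simp
      qed
      have "0 < snd X" using X(1) by (simp add: snd_in_half_space)
      then have "dist (fst X, 0) X < 8 * \<delta> * \<rho> / 4" using False \<delta>\<rho> dist_point[of "fst X" 0 "snd X"] by simp
      then show "X \<in> half_space \<inter> ball (fst X, 0) (8 * \<delta> * \<rho> / 4)" using X(1) by simp
     qed
     then show ?thesis by (simp add: mult.assoc)
    qed
   qed
  qed
  have first: "dsol \<omega> f X <= a * s" if "X \<in> half_space" "dist (y, 0) X < 3 / 4 * \<rho>" for X
  proof -
   have "\<rho> - real J * (8 * \<delta>) * \<rho> = 3 / 4 * \<rho>" unfolding \<delta>(3) by simp
   then have "X \<in> half_space \<inter> ball (y, 0) (\<rho> - real J * (8 * \<delta>) * \<rho>)" unfolding Int_iff mem_ball using that by linarith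
   then have "dsol \<omega> f X <= (1 - c0) ^ J * s" by (rule it[OF order_refl, THEN bspec])
   also have "\<dots> <= a * s" using J s by (intro mult_right_mono) auto
   finally show ?thesis .
  qed
  have second: "dsol \<omega> f X <= - (M * (a * s))" if X: "X \<in> half_space" "dist (y, 0) X < 3 / 4 * \<rho>" "\<delta> * (3 / 4 * \<rho>) <= snd X" for X
  proof (cases "\<delta> * \<rho> <= snd X")
   case True
   have "dsol \<omega> f X <= - (M * s)" by (rule lo'[OF X(1) _ True]) (use X(2) \<rho> in linarith)
   moreover have "M * (a * s) <= M * s" using a s M by (intro mult_left_mono) auto
   ultimately show ?thesis by linarith
  next
   case False
   define t where "t = snd X"
   have t: "0 < t" "t < \<delta> * \<rho>" "\<delta> * \<rho> <= 4 / 3 * t" using X False by (auto simp: t_def snd_in_half_space)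
   have d4: "\<delta> * \<rho> <= 1 / 4 * \<rho>" using \<delta> \<rho> by (intro mult_right_mono) auto
   \<comment> \<open>2r = 0.9 t keeps the doubled ball in the half space. The ball of radius r/10
     about y' has heights above t + 0.8 r = 1.36 t, more than 4t/3 and hence at least \<delta>
     \<rho>, where the strong bound is available.\<close>
   define r where "r = 45 / 100 * t"
   define y' where "y' = (fst X, t + 9 / 10 * r)"
   have Xt: "X = (fst X, t)" by (simp add: t_def)
   have dXy: "dist X y' = 9 / 10 * r" using t by (subst Xt) (simp add: y'_def dist_point r_def)
   have sub: "ball y' (1 / 10 * r) \<subseteq> ball X r"
   proof
    fix W assume "W \<in> ball y' (1 / 10 * r)"
    then show "W \<in> ball X r" using dXy dist_triangle[of X W y'] by simp
   qed
   have bH: "ball X (2 * r) \<subseteq> half_space" by (rule ball_in_half_space) (use t in \<open>simp add: r_def t_def\<close>)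
   have inr: "dist (y, 0) W < \<rho>" if "W \<in> ball X (2 * r)" for W using that X(2) t d4 dist_triangle[of "(y, 0)" W X] by (simp add: r_def)
   have "dsol \<omega> f X <= s - c1 * ((M + 1) * s)"
   proof (rule ig[rule_format, of \<omega> f r X "(M + 1) * s" s y'], intro conjI ballI adm f bH sub)
    show "0 < r" using t by (simp add: r_def)
    then show "X \<in> ball X (r / 2)" by simp
    show "0 < (M + 1) * s" using M s by simp
    show "dsol \<omega> f W <= s" if "W \<in> ball X (2 * r)" for W by (rule up'[OF subsetD[OF bH that] inr[OF that]])
    show "dsol \<omega> f W <= s - (M + 1) * s" if W: "W \<in> ball y' (1 / 10 * r)" for W
    proof -
     have W2: "W \<in> ball X (2 * r)" using subsetD[OF sub W] t by (simp add: r_def)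
     have "\<bar>t + 9 / 10 * r - snd W\<bar> < 1 / 10 * r" using W snd_dist[of y' W] by (simp add: y'_def)
     then have "\<delta> * \<rho> <= snd W" using t by (simp add: r_def abs_if split: if_splits)
     then have "dsol \<omega> f W <= - (M * s)" by (rule lo'[OF subsetD[OF bH W2] inr[OF W2]])
     then show ?thesis by (simp add: algebra_simps)
    qed
   qed
   also have "\<dots> = - (M * (a * s)) - c1 * s" using c1 by (simp add: M_def a_def field_simps)
   finally show ?thesis using c1 s mult_pos_pos[of c1 s] by linarith
  qed
  show ?thesis by (intro conjI ballI impI; rule first second; simp)
 qed
 note * = step
 show ?thesis
  by (rule exI[of _ a], rule exI[of _ \<delta>], rule exI[of _ M], intro conjI[OF a(1)] conjI[OF a(2)] conjI[OF \<delta>(1)] conjI[OF \<delta>(2)] conjI[OF M] allI impI, elim conjE, rule *; assumption)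
 qed
 qed
qed

text \<open>On the balls of radius (3/4)^i \<rho> the strong negative bound persists from height
  \<delta> (3/4)^i \<rho> on; every point above y falls into this range for a suitable i.\<close>

lemma boundary_harnack_line:
 assumes L: "0 <= L"
 shows "\<exists>\<delta> M. 0 < \<delta> \<and> \<delta> <= 1 / 4 \<and> 0 < M \<and> (\<forall>(\<omega> :: 'm::finite poles) f y \<rho> t.
   adm L \<omega> \<and> ccs f \<and> 0 < \<rho> \<and> (\<forall>x\<in>ball y \<rho>. f x <= 0) \<and>
   (\<forall>X\<in>half_space \<inter> ball (y, 0) \<rho>. dsol \<omega> f X <= 1) \<and> (\<forall>X\<in>half_space \<inter> ball (y, 0) \<rho>. \<delta> * \<rho> <= snd X --> dsol \<omega> f X <= - M) \<and>
   0 < t \<and> t < \<rho> --> dsol \<omega> f (y, t) <= 0)"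
proof -
 show ?thesis using boundary_harnack_step[OF L, where 'm = 'm]
 proof (elim exE conjE, goal_cases)
 case (1 a \<delta> M)
 note a = 1(1,2) and \<delta> = 1(3,4) and M = 1(5) and st = 1(6)
 show ?thesis
 proof (rule exI[of _ \<delta>], rule exI[of _ M], intro conjI[OF \<delta>(1)] conjI[OF \<delta>(2)] conjI[OF M] allI impI, elim conjE, goal_cases)
 case (1 \<omega> f y \<rho> t)
 note adm = 1(1) and f = 1(2) and \<rho> = 1(3) and f0 = 1(4) and up = 1(5) and lo = 1(6) and t = 1(7,8)
 show ?case
 proof -
  define R where "R i = (3 / 4) ^ i * \<rho>" for i :: nat
  have R: "0 < R i" "R i <= \<rho>" "R (Suc i) = 3 / 4 * R i" for i using \<rho> by (auto simp: R_def power_le_one mult_left_le_one_le)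
  have main: "(\<forall>X\<in>half_space \<inter> ball (y, 0) (R i). dsol \<omega> f X <= a ^ i) \<and>
    (\<forall>X\<in>half_space \<inter> ball (y, 0) (R i). \<delta> * R i <= snd X --> dsol \<omega> f X <= - (M * a ^ i))" for i
  proof (induction i)
   case 0
   then show ?case using up lo by (simp add: R_def)
  next
   case (Suc i)
   have f0': "\<forall>x\<in>ball y (R i). f x <= 0"
   proof
    fix x assume "x \<in> ball y (R i)"
    then have "x \<in> ball y \<rho>" using R(2)[of i] by simp
    then show "f x <= 0" by (rule f0[THEN bspec])
   qed
   have "0 < a ^ i" using a by simp
   then have "(\<forall>X\<in>half_space \<inter> ball (y, 0) (3 / 4 * R i). dsol \<omega> f X <= a * a ^ i) \<and>
    (\<forall>X\<in>half_space \<inter> ball (y, 0) (3 / 4 * R i). \<delta> * (3 / 4 * R i) <= snd X --> dsol \<omega> f X <= - (M * (a * a ^ i)))"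
    by (intro st[rule_format, of \<omega> f "R i" "a ^ i" y]
      conjI adm f R f0' Suc[THEN conjunct1] Suc[THEN conjunct2])
   then show ?case unfolding R(3) power_Suc .
  qed
  have "(\<lambda>i. \<delta> * R i) \<longlonglongrightarrow> \<delta> * (0 * \<rho>)"
   unfolding R_def by (intro tendsto_intros LIMSEQ_realpow_zero) auto
  then have "\<forall>\<^sub>F i in sequentially. \<delta> * R i < t" using t by (intro order_tendstoD(2)) auto
  then have ex: "\<exists>i. \<delta> * R i <= t" by (auto simp: eventually_sequentially intro: less_imp_le)
  \<comment> \<open>The least i puts t above \<delta> R i but below \<delta> times the previous
    radius; as \<delta> \<le> 1/4 < 3/4, this gives t < R i.\<close>
  define i where "i = (LEAST i. \<delta> * R i <= t)"
  have i: "\<delta> * R i <= t" unfolding i_def by (rule LeastI_ex[OF ex])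
  have "t < R i"
  proof (cases i)
   case 0
   then show ?thesis using t by (simp add: R_def)
  next
   case (Suc j)
   then have "j < i" by simp
   then have "\<not> \<delta> * R j <= t" unfolding i_def by (rule not_less_Least)
   then have "t < \<delta> * R j" by simp
   also have "\<dots> <= 1 / 4 * R j" using \<delta> R(1)[of j] by (intro mult_right_mono) auto
   also have "\<dots> <= R i" using R(1)[of j] R(3)[of j] Suc by simp
   finally show ?thesis .
  qed
  then have "(y, t) \<in> half_space \<inter> ball (y, 0) (R i)" using t by (simp add: snd_in_half_space dist_point)
  then have "dsol \<omega> f (y, t) <= - (M * a ^ i)" using main[of i, THEN conjunct2, THEN bspec, of "(y, t)"] i by simp
  moreover have "0 < M * a ^ i" using M a by simp
  ultimately show ?thesis by linarith
 qed
 qed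
 qed
qed

text \<open>Applied to f = h - C g on the hemisphere of radius 2r about (z, 0): at heights of order
  r the Harnack inequality for g makes f \<le> -M, and near the boundary, where both data vanish,
  \<open>boundary_harnack_line\<close> gives f \<le> 0. The maximum principle carries f \<le> 0 to
  the exterior.\<close>

lemma comparison_ccs:
 assumes L: "0 <= L" and \<tau>: "0 < \<tau>"
 shows "\<exists>C>0. \<forall>(\<omega> :: 'm::finite poles) g h z r X. adm L \<omega> \<and> ccs g \<and> ccs h \<and> (\<forall>y. 0 <= g y \<and> g y <= 1) \<and> (\<forall>y. 0 <= h y \<and> h y <= 1) \<and>
   0 < r \<and> (\<forall>y. y \<notin> ball z r --> g y = 0 \<and> h y = 0) \<and> \<tau> <= dsol \<omega> g (z, r) \<and> X \<in> half_space \<and> 2 * r <= dist (z, 0) X --> dsol \<omega> h X <= C * dsol \<omega> g X"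
proof -
 show ?thesis using boundary_harnack_line[OF L, where 'm = 'm]
 proof (elim exE conjE, goal_cases)
 case (1 \<delta> M)
 note \<delta> = 1(1,2) and M = 1(3) and line = 1(4)
 have \<kappa>: "0 < \<delta> / 2" "\<delta> / 2 <= 1" using \<delta> by auto
 show ?thesis using qualitative_harnack[OF L \<tau> \<kappa>, where 'm = 'm]
 proof (elim exE conjE, goal_cases)
 case (1 c)
 note c = 1(1) and qh = 1(2)
 \<comment> \<open>Since h \<le> 1 and g \<ge> c there, f \<le> 1 - C c = -M.\<close>
 define C where "C = (1 + M) / c"
 have C: "0 < C" "C * c = 1 + M" using c M by (auto simp: C_def)
 show ?thesis
 proof (rule exI[of _ C], intro conjI[OF C(1)] allI impI, elim conjE, goal_cases)
 case (1 \<omega> g h z r X)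
 note adm = 1(1) and g = 1(2) and h = 1(3) and g01 = 1(4) and h01 = 1(5) and r = 1(6) and supp = 1(7) and tau = 1(8) and X = 1(9,10)
 show ?case
 proof -
  define f where "f x = 1 * h x + (- C) * g x" for x
  have f: "ccs f" unfolding f_def[abs_def] by (rule ccs_lincomb[OF h g])
  have fs: "dsol \<omega> f Y = dsol \<omega> h Y - C * dsol \<omega> g Y" if "Y \<in> half_space" for Y
   using dsol_lincomb[OF adm that h g, of 1 "- C"] by (simp add: f_def[abs_def])
  have g0: "0 <= dsol \<omega> g Y" "dsol \<omega> h Y <= 1" if "Y \<in> half_space" for Y
   using dsol_bounds[OF adm that ccs_measurable[OF g], of 0 1] dsol_bounds[OF adm that ccs_measurable[OF h], of 0 1] g01 h01 by simp_all
  have up: "dsol \<omega> f Y <= 1" if "Y \<in> half_space" for Y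
  proof -
   have "0 <= C * dsol \<omega> g Y" using C(1) g0(1)[OF that] by simp
   then show ?thesis using fs[OF that] g0(2)[OF that] by linarith
  qed
  have low: "dsol \<omega> f Y <= - M" if Y: "Y \<in> half_space" "dist (z, 0) Y <= 3 * r" "\<delta> * (r / 2) <= snd Y" for Y
  proof -
   have "dist (z, r) Y <= r + 3 * r" using dist_triangle[of "(z, r)" Y "(z, 0)"] Y(2) r by (simp add: dist_point)
   also have "\<dots> <= r / (\<delta> / 2)" using \<delta> r by (simp add: field_simps)
   finally have "c <= dsol \<omega> g Y" using Y r by (intro qh[rule_format, of \<omega> g "(z, r)" Y] conjI adm g g01 tau)
     (simp_all add: snd_in_half_space)
   then have "C * c <= C * dsol \<omega> g Y" using C by (intro mult_left_mono) auto
   then show ?thesis using fs[OF Y(1)] g0[OF Y(1)] C by linarith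
  qed
  have sphere: "dsol \<omega> f Y <= 0" if Y: "Y \<in> half_space" "dist (z, 0) Y = 2 * r" for Y
  proof (cases "\<delta> * (r / 2) <= snd Y")
   case True
   have "dsol \<omega> f Y <= - M" by (rule low[OF Y(1) _ True]) (use Y(2) r in simp)
   then show ?thesis using M by simp
  next
   case False
   have t: "0 < snd Y" using Y(1) by (simp add: snd_in_half_space)
   have "\<delta> * (r / 2) <= 1 / 4 * (r / 2)" using \<delta> r by (intro mult_right_mono) auto
   then have t2: "snd Y < r / 8" using False by simp
   have Yp: "Y = (fst Y, snd Y)" by simp
   have dY: "dist (fst Y, 0) Y = snd Y" using dist_point[of "fst Y" 0 "snd Y"] t by simp
   have dzy: "dist (z, 0::real) (fst Y, 0) = dist z (fst Y)" by (simp add: dist_prod_def)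
   have "dist (z, 0) Y <= dist z (fst Y) + snd Y" using dist_triangle[of "(z, 0)" Y "(fst Y, 0::real)"] dY dzy by simp
   then have far: "3 / 2 * r <= dist z (fst Y)" using Y(2) t2 r by simp
   have near: "dist z (fst Y) <= 2 * r" using dist_fst_le[of "(z, 0)" Y] Y(2) by simp
   have "dsol \<omega> f (fst Y, snd Y) <= 0"
   proof (rule line[rule_format, of \<omega> f "r / 2" "fst Y" "snd Y"],
     intro conjI ballI impI adm f t)
    show "f x <= 0" if "x \<in> ball (fst Y) (r / 2)" for x
    proof -
     have "x \<notin> ball z r" using that far dist_triangle[of z "fst Y" x] by (simp add: dist_commute)
     then show ?thesis using supp[rule_format, of x] by (simp add: f_def)
    qed
    show "dsol \<omega> f W <= 1" if "W \<in> half_space \<inter> ball (fst Y, 0) (r / 2)" for W using up that by simp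
    show "dsol \<omega> f W <= - M" if "W \<in> half_space \<inter> ball (fst Y, 0) (r / 2)" "\<delta> * (r / 2) <= snd W" for W
    proof (rule low[OF _ _ that(2)])
     show "dist (z, 0) W <= 3 * r" using that(1) dzy near dist_triangle[of "(z, 0)" W "(fst Y, 0::real)"] r by simp
    qed (use that in simp)
   qed (use r t2 in simp_all)
   then show ?thesis by simp
  qed
  \<comment> \<open>On the exterior region the data of g and h vanish at the bottom, and the
    hemisphere is the remaining boundary.\<close>
  define \<Omega> where "\<Omega> = half_space \<inter> {Y. 2 * r < dist (z, 0) Y}"
  have op: "open \<Omega>" unfolding \<Omega>_def by (intro open_Int open_half_space open_Collect_less continuous_intros)
  have cl: "2 * r <= dist (z, 0) Y" if "Y \<in> closure \<Omega>" for Y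
  proof -
   have "closed {Y. 2 * r <= dist (z, 0::real) Y}" by (intro closed_Collect_le continuous_intros)
   then have "closure \<Omega> \<subseteq> {Y. 2 * r <= dist (z, 0) Y}" by (intro closure_minimal) (auto simp: \<Omega>_def)
   then show ?thesis using that by (rule subsetD[THEN CollectD])
  qed
  have "dsol \<omega> f X <= 0"
  proof (cases "dist (z, 0) X = 2 * r")
   case True
   then show ?thesis by (rule sphere[OF X(1)])
  next
   case False
   show ?thesis
   proof (rule maximum_principle[OF L adm f op])
    show "\<Omega> \<subseteq> half_space" by (simp add: \<Omega>_def)
    show "X \<in> \<Omega>" using X False by (simp add: \<Omega>_def)
    show "f x <= 0" if "(x, 0) \<in> closure \<Omega>" for x
    proof -
     have "x \<notin> ball z r" using cl[OF that] r by (simp add: dist_prod_def)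
     then show ?thesis using supp[rule_format, of x] by (simp add: f_def)
    qed
    show "dsol \<omega> f W <= 0" if "W \<in> half_space" "W \<notin> \<Omega>" "W \<in> closure \<Omega>" for W
     by (rule sphere[OF that(1)]) (use cl[OF that(3)] that in \<open>simp add: \<Omega>_def\<close>)
   qed
  qed
  then show ?thesis using fs[OF X(1)] by simp
 qed
 qed
 qed
 qed
qed

section \<open>Passage from continuous data to Borel sets\<close>

lemma finite_borel_regular:
 fixes M :: "'a::euclidean_space measure"
 assumes M: "sets M = sets borel" "finite_measure M" and E: "E \<in> sets borel" and e: "0 < e"
 obtains K U where "compact K" "open U" "K \<subseteq> E" "E \<subseteq> U" "measure M E < measure M K + e" "measure M U < measure M E + e"
proof -
 interpret finite_measure M by (rule M(2))
 have fin: "emeasure M (space M) \<noteq> \<infinity>" by simp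
 have "\<exists>K. compact K \<and> K \<subseteq> E \<and> measure M E < measure M K + e"
 proof (cases "measure M E = 0")
  case True
  then show ?thesis using e by (intro exI[of _ "{}"]) simp
 next
  case False
  then have "0 < measure M E" using measure_nonneg[of M E] by linarith
  then have "ennreal (measure M E - e) < emeasure M E" unfolding emeasure_eq_measure using e by (intro ennreal_lessI) auto
  then have "\<exists>K\<in>{K. K \<subseteq> E \<and> compact K}. ennreal (measure M E - e) < emeasure M K"
   unfolding inner_regular[OF M(1) fin E] less_SUP_iff .
  then obtain K where K: "K \<subseteq> E" "compact K" "ennreal (measure M E - e) < emeasure M K" by auto
  have "measure M E - e < measure M K"
   using K(3) unfolding emeasure_eq_measure by (cases "0 <= measure M E - e") (auto simp: ennreal_less_iff ennreal_neg not_le intro: less_le_trans)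
  then show ?thesis using K by (intro exI[of _ K]) simp
 qed
 then obtain K where K: "compact K" "K \<subseteq> E" "measure M E < measure M K + e" by (elim exE conjE) (rule that)
 have "emeasure M E < ennreal (measure M E + e)" unfolding emeasure_eq_measure using e measure_nonneg[of M E] by (intro ennreal_lessI) linarith+
 then have "\<exists>U\<in>{U. E \<subseteq> U \<and> open U}. emeasure M U < ennreal (measure M E + e)"
  by (subst (asm) outer_regular[OF M(1) fin E]) (simp add: INF_less_iff)
 then obtain U where U: "E \<subseteq> U" "open U" "emeasure M U < ennreal (measure M E + e)" by auto
 have "measure M U < measure M E + e" using U(3) unfolding emeasure_eq_measure by (simp add: ennreal_less_iff)
 then show thesis by (rule that[OF K(1) U(2) K(2) U(1) K(3)])
qed

lemma ccs_urysohn: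
 assumes KU: "compact K" "open U" "K \<subseteq> (U :: 'a::euclidean_space set)"
 obtains g where "ccs g" "\<forall>y. 0 <= g y \<and> g y <= 1" "\<forall>y\<in>K. g y = 1" "\<forall>y. y \<notin> U --> g y = 0"
proof -
 obtain R where R: "K \<subseteq> ball 0 R" using compact_imp_bounded[OF KU(1)] by (auto dest: bounded_subset_ballD)
 have closed: "closed K" "closed (- (U \<inter> ball 0 R))" using KU by (auto simp: compact_imp_closed closed_Compl)
 have disj: "K \<inter> - (U \<inter> ball 0 R) = {}" using KU(3) R by auto
 obtain g :: "'a => real" where g: "continuous_on UNIV g" "\<And>x. g x \<in> closed_segment 1 0" "\<And>x. x \<in> K ==> g x = 1"
   "\<And>x. x \<in> - (U \<inter> ball 0 R) ==> g x = 0" by (rule Urysohn[OF closed disj, of 1 0]) (rule that)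
 have g01: "0 <= g x" "g x <= 1" for x using g(2)[of x] by (auto simp: closed_segment_eq_real_ivl)
 have "{x. g x \<noteq> 0} \<subseteq> ball 0 R" using g(4) by force
 then have ccs: "ccs g" using g(1) bounded_subset[OF bounded_ball] by (simp add: continuous_compact_support_def compact_closure)
 have zero: "g y = 0" if "y \<notin> U" for y using that g(4) by simp
 show thesis by (rule that[OF ccs]) (use g01 g(3) zero in auto)
qed

text \<open>One function serves two measures: the inner compact sets of both are united and the
  outer open sets are intersected, together with V, before Urysohn's lemma is applied. Inequalities
  between two poles need such a common approximant.\<close>

lemma ccs_approx:
 fixes M N :: "'a::euclidean_space measure"
 assumes M: "sets M = sets borel" "finite_measure M" and N: "sets N = sets borel" "finite_measure N"
  and E: "E \<in> sets borel" "E \<subseteq> V" "open V" and e: "0 < e"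
 obtains g where "ccs g" "\<forall>y. 0 <= g y \<and> g y <= 1" "\<forall>y. y \<notin> V --> g y = 0"
  "\<bar>(LINT y|M. g y) - measure M E\<bar> < e" "\<bar>(LINT y|N. g y) - measure N E\<bar> < e"
proof -
 obtain K1 U1 where 1: "compact K1" "open U1" "K1 \<subseteq> E" "E \<subseteq> U1" "measure M E < measure M K1 + e" "measure M U1 < measure M E + e"
  by (rule finite_borel_regular[OF M E(1) e])
 obtain K2 U2 where 2: "compact K2" "open U2" "K2 \<subseteq> E" "E \<subseteq> U2" "measure N E < measure N K2 + e" "measure N U2 < measure N E + e"
  by (rule finite_borel_regular[OF N E(1) e])
 define K where "K = K1 \<union> K2"
 define U where "U = U1 \<inter> U2 \<inter> V"
 have KU: "compact K" "open U" "K \<subseteq> U" using 1 2 E by (auto simp: K_def U_def)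
 obtain g where ccs: "ccs g" and g: "\<forall>y. 0 <= g y \<and> g y <= 1" "\<forall>y\<in>K. g y = 1" "\<forall>y. y \<notin> U --> g y = 0"
  by (rule ccs_urysohn[OF KU])
 have g01: "0 <= g x" "g x <= 1" and zero: "x \<notin> U ==> g x = 0" for x using g by simp_all
 have main: "\<bar>(LINT y|P. g y) - measure P E\<bar> < e"
  if P: "sets P = sets borel" "finite_measure P" and A: "compact A" "open B" "A \<subseteq> K" "U \<subseteq> B" "measure P E < measure P A + e" "measure P B < measure P E + e"
  for P :: "'a measure" and A B
 proof -
  interpret finite_measure P by (rule P(2))
  have gm: "g \<in> borel_measurable P" using ccs_measurable[OF ccs] by (simp add: measurable_cong_sets[OF P(1) refl])
  have int: "integrable P g" by (rule integrable_const_bound[OF _ gm, of 1]) (simp add: g01)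
  have AB: "A \<in> sets P" "B \<in> sets P" using A P by (auto simp: compact_imp_closed)
  have i: "integrable P (indicator A :: 'a => real)" "integrable P (indicator B :: 'a => real)"
   using AB by (auto simp: integrable_indicator_iff less_top[symmetric])
  have "measure P A = (LINT y|P. indicator A y)" using AB by simp
  also have "\<dots> <= (LINT y|P. g y)" by (rule integral_mono[OF i(1) int]) (use g(2) g01 A(3) in \<open>auto simp: indicator_def\<close>)
  finally have 3: "measure P A <= (LINT y|P. g y)" .
  have "(LINT y|P. g y) <= (LINT y|P. indicator B y)"
   by (rule integral_mono[OF int i(2)]) (use g01 zero subsetD[OF A(4)] in \<open>force simp: indicator_def\<close>)
  also have "\<dots> = measure P B" using AB by simp
  finally show ?thesis using 3 A(5,6) by linarith
 qed
 show thesis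
 proof (rule that[OF ccs])
  show "\<bar>(LINT y|M. g y) - measure M E\<bar> < e" by (rule main[OF M 1(1,2) _ _ 1(5,6)]) (auto simp: K_def U_def)
  show "\<bar>(LINT y|N. g y) - measure N E\<bar> < e" by (rule main[OF N 2(1,2) _ _ 2(5,6)]) (auto simp: K_def U_def)
 qed (use g01 zero in \<open>auto simp: U_def\<close>)
qed

lemma dsol_indicator:
 assumes "adm L \<omega>" "X \<in> half_space" "E \<in> sets borel"
 shows "dsol \<omega> (indicator E) X = measure (\<omega> X) E"
proof -
 have "E \<in> sets (\<omega> X)" using adm_measure(1)[OF assms(1,2)] assms(3) by simp
 then show ?thesis by (simp add: solution_with_data_def)
qed

lemma adm_approx:
 assumes adm: "adm L \<omega>" "X \<in> half_space" "Y \<in> half_space" and E: "E \<in> sets borel" "E \<subseteq> V" "open V" and e: "0 < e"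
 obtains g where "ccs g" "\<forall>y. 0 <= g y \<and> g y <= 1" "\<forall>y. y \<notin> V --> g y = 0"
  "\<bar>dsol \<omega> g X - measure (\<omega> X) E\<bar> < e" "\<bar>dsol \<omega> g Y - measure (\<omega> Y) E\<bar> < e"
proof (rule ccs_approx[OF adm_measure(1,2)[OF adm(1,2)] adm_measure(1,2)[OF adm(1,3)] E e])
 fix g assume g: "ccs g" "\<forall>y. 0 <= g y \<and> g y <= 1" "\<forall>y. y \<notin> V --> g y = 0"
  "\<bar>(LINT y|\<omega> X. g y) - measure (\<omega> X) E\<bar> < e" "\<bar>(LINT y|\<omega> Y. g y) - measure (\<omega> Y) E\<bar> < e"
 show thesis by (rule that[OF g(1-3)]) (use g(4,5) in \<open>simp_all only: solution_with_data_def\<close>)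
qed

lemma adm_measure_mono:
 assumes "adm L \<omega>" "X \<in> half_space" "F \<in> sets borel" "E \<subseteq> F"
 shows "measure (\<omega> X) E <= measure (\<omega> X) F"
proof -
 interpret finite_measure "\<omega> X" by (rule adm_measure(2)[OF assms(1,2)])
 show ?thesis by (rule finite_measure_mono[OF assms(4)]) (simp add: adm_measure(1)[OF assms(1,2)] assms(3))
qed

lemma adm_measure_le_1: "adm L \<omega> ==> X \<in> half_space ==> measure (\<omega> X) E <= 1"
 using adm_measure_mono[of L \<omega> X UNIV E] adm_measure(4)[of L \<omega> X] by simp

lemma adm_measure_Compl:
 assumes "adm L \<omega>" "X \<in> half_space" "E \<in> sets borel"
 shows "measure (\<omega> X) (- E) = 1 - measure (\<omega> X) E"
proof -
 interpret finite_measure "\<omega> X" by (rule adm_measure(2)[OF assms(1,2)])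
 show ?thesis using finite_measure_compl[of E] adm_measure[OF assms(1,2)] assms(3) by (simp add: Compl_eq_Diff_UNIV)
qed

lemma measure_equicontinuous:
 assumes L: "0 <= L" and \<eta>: "0 < \<eta>"
 shows "\<exists>\<theta>>0. \<theta> <= 1 \<and> (\<forall>(\<omega> :: 'm::finite poles) E X Y. adm L \<omega> \<and> E \<in> sets borel \<and>
   X \<in> half_space \<and> dist X Y < \<theta> * snd X --> \<bar>measure (\<omega> X) E - measure (\<omega> Y) E\<bar> <= \<eta>)"
proof -
 have \<eta>3: "0 < \<eta> / 3" using \<eta> by simp
 show ?thesis using dsol_equicontinuous[OF L \<eta>3, where 'm = 'm]
 proof (elim exE conjE, goal_cases)
 case (1 \<theta>)
 note \<theta> = 1(1,2) and eq = 1(3)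
 show ?thesis
 proof (rule exI[of _ \<theta>], intro conjI[OF \<theta>(1)] conjI[OF \<theta>(2)] allI impI, elim conjE, goal_cases)
 case (1 \<omega> E X Y)
 note adm = 1(1) and E = 1(2) and X = 1(3) and XY = 1(4)
 show ?case
 proof -
  have "\<theta> * snd X <= snd X" using \<theta> X by (simp add: snd_in_half_space mult_left_le_one_le)
  then have Y: "Y \<in> half_space" using XY snd_dist[of X Y] by (simp add: snd_in_half_space)
  obtain g where g: "ccs g" "\<forall>y. 0 <= g y \<and> g y <= 1"
   "\<bar>dsol \<omega> g X - measure (\<omega> X) E\<bar> < \<eta> / 3" "\<bar>dsol \<omega> g Y - measure (\<omega> Y) E\<bar> < \<eta> / 3"
   by (rule adm_approx[OF adm X Y E subset_UNIV open_UNIV \<eta>3])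
  have "\<bar>dsol \<omega> g X - dsol \<omega> g Y\<bar> <= \<eta> / 3" by (intro eq[rule_format, of \<omega> g X Y] conjI adm g X XY)
  then show ?thesis using g(3,4) by linarith
 qed
 qed
 qed
qed

lemma measure_harnack:
 assumes L: "0 <= L" and \<tau>: "0 < \<tau>" and \<kappa>: "0 < \<kappa>" "\<kappa> <= 1"
 shows "\<exists>c>0. \<forall>(\<omega> :: 'm::finite poles) E X Y. adm L \<omega> \<and> E \<in> sets borel \<and>
   X \<in> half_space \<and> dist X Y <= snd X / \<kappa> \<and> \<kappa> * snd X <= snd Y \<and> \<tau> <= measure (\<omega> X) E --> c <= measure (\<omega> Y) E"
proof -
 have \<tau>2: "0 < \<tau> / 2" using \<tau> by simp
 show ?thesis using qualitative_harnack[OF L \<tau>2 \<kappa>, where 'm = 'm]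
 proof (elim exE conjE, goal_cases)
 case (1 c)
 note c = 1(1) and qh = 1(2)
 show ?thesis
 proof (rule exI[of _ "c / 2"], intro conjI[OF half_gt_zero[OF c]] allI impI, elim conjE, goal_cases)
 case (1 \<omega> E X Y)
 note adm = 1(1) and E = 1(2) and X = 1(3) and XY = 1(4,5) and t = 1(6)
 show ?case
 proof -
  have "0 < \<kappa> * snd X" using \<kappa> X by (simp add: snd_in_half_space)
  then have Y: "Y \<in> half_space" using XY(2) by (simp add: snd_in_half_space)
  have e: "0 < min (\<tau> / 2) (c / 2)" using \<tau> c by simp
  obtain g where g: "ccs g" "\<forall>y. 0 <= g y \<and> g y <= 1"
   "\<bar>dsol \<omega> g X - measure (\<omega> X) E\<bar> < min (\<tau> / 2) (c / 2)" "\<bar>dsol \<omega> g Y - measure (\<omega> Y) E\<bar> < min (\<tau> / 2) (c / 2)"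
   by (rule adm_approx[OF adm X Y E subset_UNIV open_UNIV e])
  have "\<tau> / 2 <= dsol \<omega> g X" using g(3) t by linarith
  then have "c <= dsol \<omega> g Y" by (intro qh[rule_format, of \<omega> g X Y] conjI adm g X XY)
  then show ?thesis using g(4) by linarith
 qed
 qed
 qed
qed

lemma measure_small_near_zero_data:
 assumes L: "0 <= L" and \<eta>: "0 < \<eta>"
 shows "\<exists>M\<ge>1. \<forall>(\<omega> :: 'm::finite poles) E x t. adm L \<omega> \<and> E \<in> sets borel \<and>
   0 < t \<and> E \<inter> ball x (M * t) = {} --> measure (\<omega> (x, t)) E <= \<eta>"
proof -
 have \<eta>2: "0 < \<eta> / 2" using \<eta> by simp
 show ?thesis using dsol_small_near_zero_data[OF L \<eta>2, where 'm = 'm]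
 proof (elim exE conjE, goal_cases)
 case (1 M)
 note M = 1(1) and nz = 1(2)
 have M2: "1 <= 2 * M" using M by simp
 show ?thesis
 proof (rule exI[of _ "2 * M"], intro conjI[OF M2] allI impI, elim conjE, goal_cases)
 case (1 \<omega> E x t)
 note adm = 1(1) and E = 1(2) and t = 1(3) and Eb = 1(4)
 show ?case
 proof -
  have X: "(x, t) \<in> half_space" using t by (simp add: snd_in_half_space)
  have lt: "M * t < 2 * M * t" using M t by simp
  have sub: "E \<subseteq> - cball x (M * t)"
  proof
   fix y assume "y \<in> E"
   then have "\<not> dist x y < 2 * M * t" using Eb by auto
   then show "y \<in> - cball x (M * t)" using lt by simp
  qed
  have op: "open (- cball x (M * t))" by (simp add: open_Compl)
  obtain g where g: "ccs g" "\<forall>y. 0 <= g y \<and> g y <= 1" "\<forall>y. y \<notin> - cball x (M * t) --> g y = 0"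
   "\<bar>dsol \<omega> g (x, t) - measure (\<omega> (x, t)) E\<bar> < \<eta> / 2" by (rule adm_approx[OF adm X X E sub op \<eta>2])
  have "\<forall>y\<in>ball x (M * t). g y = 0" using g(3) by simp
  then have "dsol \<omega> g (x, t) <= \<eta> / 2" by (intro nz[rule_format, of \<omega> g t x] conjI adm g t)
  then show ?thesis using g(4) by linarith
 qed
 qed
 qed
qed

text \<open>Change of pole: a subset that is noticeable in the ball from its own scale keeps a fixed
  share of the ball from every distant pole. It serves the Vitali sums in
  \<open>shadow_growth\<close> and small cubes in \<open>A_infinity_of_carleson\<close>.\<close>

lemma measure_comparison:
 assumes L: "0 <= L" and \<tau>: "0 < \<tau>"
 shows "\<exists>C>0. \<forall>(\<omega> :: 'm::finite poles) E z r X. adm L \<omega> \<and> E \<in> sets borel \<and> E \<subseteq> ball z r \<and>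
   0 < r \<and> \<tau> <= measure (\<omega> (z, r)) E \<and> X \<in> half_space \<and> 2 * r <= dist (z, 0) X --> measure (\<omega> X) (ball z r) <= C * measure (\<omega> X) E"
proof -
 have \<tau>2: "0 < \<tau> / 2" using \<tau> by simp
 show ?thesis using comparison_ccs[OF L \<tau>2, where 'm = 'm]
 proof (elim exE conjE, goal_cases)
 case (1 C)
 note C = 1(1) and cp = 1(2)
 show ?thesis
 proof (rule exI[of _ C], intro conjI[OF C] allI impI, elim conjE, goal_cases)
 case (1 \<omega> E z r X)
 note adm = 1(1) and E = 1(2,3) and r = 1(4) and t = 1(5) and X = 1(6) and far = 1(7)
 show ?case
 proof (rule field_le_epsilon)
  fix d :: real assume d: "0 < d"
  \<comment> \<open>The approximation error enters once directly and once multiplied by C; the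
    choice gives C e + e \<le> d and leaves at least \<tau>/2 at the pole (z, r).\<close>
  define e where "e = min (\<tau> / 2) (d / (C + 1))"
  have e: "0 < e" "e <= \<tau> / 2" "e <= d / (C + 1)" unfolding e_def using \<tau> d C by (simp, intro min.cobounded1, intro min.cobounded2)
  then have Ce: "C * e + e <= d" using C by (simp add: field_simps)
  have Z: "(z, r) \<in> half_space" using r by (simp add: snd_in_half_space)
  obtain g where g: "ccs g" "\<forall>y. 0 <= g y \<and> g y <= 1" "\<forall>y. y \<notin> ball z r --> g y = 0"
   "\<bar>dsol \<omega> g (z, r) - measure (\<omega> (z, r)) E\<bar> < e" "\<bar>dsol \<omega> g X - measure (\<omega> X) E\<bar> < e"
   by (rule adm_approx[OF adm Z X E open_ball e(1)])
  obtain h where h: "ccs h" "\<forall>y. 0 <= h y \<and> h y <= 1" "\<forall>y. y \<notin> ball z r --> h y = 0"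
   "\<bar>dsol \<omega> h X - measure (\<omega> X) (ball z r)\<bar> < e"
   by (rule adm_approx[OF adm X X borel_open[OF open_ball] order_refl open_ball e(1)])
  have tau: "\<tau> / 2 <= dsol \<omega> g (z, r)" using g(4) e(2) t by linarith
  have supp: "\<forall>y. y \<notin> ball z r --> g y = 0 \<and> h y = 0" using g(3) h(3) by simp
  have "dsol \<omega> h X <= C * dsol \<omega> g X" by (intro cp[rule_format, of \<omega> g h r z X]
     conjI adm g(1,2) h(1,2) r supp tau X far)
  also have "\<dots> <= C * (measure (\<omega> X) E + e)" using g(5) C by (intro mult_left_mono) auto
  finally show "measure (\<omega> X) (ball z r) <= C * measure (\<omega> X) E + d" using h(4) Ce by (simp add: distrib_left)
 qed
 qed
 qed
qed

section \<open>The Carleson condition and thick sets\<close>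

text \<open>The C^1 estimate for mollifications: at scale at most d their gradients on B are
  mollifications of G cut off to K, whose L^2 norm does not exceed that of G on K. Fatou's lemma
  gives the limit.\<close>

lemma wgrad_translation_estimate:
 fixes u :: "'a::euclidean_space => real"
 assumes w: "wgrad U u G" and B: "convex B" "B \<in> sets borel" and K: "compact K" "K \<subseteq> U"
  and d: "0 < d" "\<And>x. x \<in> B ==> cball x d \<subseteq> K" and c: "\<And>x. x \<in> B ==> isCont u x"
 shows "(\<integral>\<^sup>+x. indicator B x * indicator B (x + h) * ennreal ((u (x + h) - u x)^2) \<partial>lborel) \<le>
   ennreal ((norm h)^2) * (\<integral>\<^sup>+x. indicator K x * ennreal ((norm (G x))^2) \<partial>lborel)"
proof -
 have [measurable]: "u \<in> \<B>" "G \<in> \<B>" using w by (auto simp: wgrad_def)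
 have [measurable]: "B \<in> sets borel" "K \<in> sets borel" using B K by (auto simp: compact_imp_closed)
 obtain Bd where Bd: "\<And>x. \<bar>u x\<bar> <= Bd" using w by (auto simp: wgrad_def)
 define e where "e j = d / (real j + 1)" for j :: nat
 have e: "0 < e j" "e j <= d" for j using d(1) by (simp_all add: e_def field_simps)
 have "(\<lambda>j. d * (1 / (real j + 1))) \<longlonglongrightarrow> d * 0"
  by (intro tendsto_intros) (use LIMSEQ_inverse_real_of_nat in \<open>simp add: inverse_eq_divide add.commute\<close>)
 then have elim: "e \<longlonglongrightarrow> 0" by (simp add: e_def[abs_def])
 let ?G = "\<lambda>x. indicator K x *\<^sub>R G x"
 have [measurable]: "mol (e j) u \<in> \<B>" for j by measurable
 have grad: "- (LINT z|lborel. u z *\<^sub>R grad (mollr (e j)) (z - x)) = mol (e j) ?G x" if x: "x \<in> B" for j x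
 proof -
  have sub: "cball x (e j) \<subseteq> K" using d(2)[OF x] e(2)[of j] by auto
  have "mol (e j) G x = mol (e j) ?G x" unfolding mol_def
  proof (intro Bochner_Integration.integral_cong refl)
   fix z
   show "mollr (e j) (z - x) *\<^sub>R G z = mollr (e j) (z - x) *\<^sub>R (indicator K z *\<^sub>R G z)"
    using sub mollr_zero[OF e(1)[of j], of "z - x"] by (cases "dist x z <= e j") (auto simp: subset_iff dist_norm norm_minus_commute)
  qed
  then show ?thesis using grad_mol_eq[OF w e(1) order_trans[OF sub K(2)]] by simp
 qed
 have tr: "(\<integral>\<^sup>+x. indicator B x * indicator B (x + h) * ennreal ((mol (e j) u (x + h) - mol (e j) u x)^2) \<partial>lborel)
   <= ennreal ((norm h)^2) * (\<integral>\<^sup>+x. indicator K x * ennreal ((norm (G x))^2) \<partial>lborel)" for j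
 proof -
  note C1_translation_estimate[OF C1_mol[OF _ Bd e(1)[of j]] B, where h = h]
  also have "(\<integral>\<^sup>+x. indicator B x * ennreal ((norm (- (LINT z|lborel. u z *\<^sub>R grad (mollr (e j)) (z - x))))^2) \<partial>lborel)
    <= (\<integral>\<^sup>+x. ennreal ((norm (mol (e j) ?G x))^2) \<partial>lborel)"
   by (intro nn_integral_mono) (simp add: grad[symmetric] split: split_indicator)
  also have "\<dots> <= (\<integral>\<^sup>+x. ennreal ((norm (?G x))^2) \<partial>lborel)" by (rule mol_L2_le[OF _ e(1)]) measurable
  also have "\<dots> = (\<integral>\<^sup>+x. indicator K x * ennreal ((norm (G x))^2) \<partial>lborel)"
   by (intro nn_integral_cong) (simp split: split_indicator)
  finally show ?thesis by (simp add: mult_left_mono)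
 qed
 have "(\<integral>\<^sup>+x. indicator B x * indicator B (x + h) * ennreal ((u (x + h) - u x)^2) \<partial>lborel) =
   (\<integral>\<^sup>+x. liminf (\<lambda>j. indicator B x * indicator B (x + h) * ennreal ((mol (e j) u (x + h) - mol (e j) u x)^2)) \<partial>lborel)"
 proof (intro nn_integral_cong lim_imp_Liminf[symmetric] sequentially_bot)
  fix x
  show "(\<lambda>j. indicator B x * indicator B (x + h) * ennreal ((mol (e j) u (x + h) - mol (e j) u x)^2)) \<longlonglongrightarrow>
    indicator B x * indicator B (x + h) * ennreal ((u (x + h) - u x)^2)"
  proof (cases "x \<in> B \<and> x + h \<in> B")
   case True
   then have "(\<lambda>j. ennreal ((mol (e j) u (x + h) - mol (e j) u x)^2)) \<longlonglongrightarrow> ennreal ((u (x + h) - u x)^2)"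
    by (intro tendsto_ennrealI tendsto_intros mol_tendsto c e elim) auto
   then show ?thesis using True by simp
  qed auto
 qed
 also have "\<dots> <= liminf (\<lambda>j. \<integral>\<^sup>+x. indicator B x * indicator B (x + h) * ennreal ((mol (e j) u (x + h) - mol (e j) u x)^2) \<partial>lborel)"
  by (rule nn_integral_liminf) measurable
 also have "\<dots> <= liminf (\<lambda>j::nat. ennreal ((norm h)^2) * (\<integral>\<^sup>+x. indicator K x * ennreal ((norm (G x))^2) \<partial>lborel))"
  by (intro Liminf_mono always_eventually allI tr)
 finally show ?thesis by (simp add: Liminf_const)
qed

lemma half_space_measure_continuous:
 fixes \<omega> :: "'m::finite poles"
 assumes L: "0 <= L" and adm: "adm L \<omega>" and E: "E \<in> sets borel"
 shows "continuous_on half_space (\<lambda>X. measure (\<omega> X) E)"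
proof (rule continuous_onI)
 fix X :: "'m point" and e :: real assume X: "X \<in> half_space" and e: "0 < e"
 have e2: "0 < e / 2" using e by simp
 obtain \<theta> where \<theta>: "0 < \<theta>" and eq: "\<forall>(\<omega> :: 'm poles) E X Y. adm L \<omega> \<and> E \<in> sets borel \<and>
   X \<in> half_space \<and> dist X Y < \<theta> * snd X --> \<bar>measure (\<omega> X) E - measure (\<omega> Y) E\<bar> <= e / 2"
  using measure_equicontinuous[OF L e2, where 'm = 'm] by (elim exE conjE) (rule that)
 have "dist (measure (\<omega> Y) E) (measure (\<omega> X) E) <= e" if "dist Y X < \<theta> * snd X" for Y
 proof -
  have "dist X Y < \<theta> * snd X" using that by (simp add: dist_commute)
  then have "\<bar>measure (\<omega> X) E - measure (\<omega> Y) E\<bar> <= e / 2" by (intro eq[rule_format, of \<omega> E X Y] conjI adm E X)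
  then show ?thesis using e unfolding dist_real_def by linarith
 qed
 moreover have "0 < \<theta> * snd X" using \<theta> X by (simp add: snd_in_half_space)
 ultimately show "\<exists>d>0. \<forall>Y\<in>half_space. dist Y X < d --> dist (measure (\<omega> Y) E) (measure (\<omega> X) E) <= e"
  by (intro exI[of _ "\<theta> * snd X"]) simp
qed

text \<open>Equicontinuity costs at most 1/8 at each pole, so the gap of 1/2 is still 1/4 on small
  balls about (x, s) and (y, s). Translation by h = (y - x, 0) maps one ball to the other, and the
  translation estimate converts the gap into gradient energy at heights comparable with d.\<close>

lemma oscillation_energy:
 assumes L: "0 <= L" and M: "1 <= M"
 shows "\<exists>c>0. \<forall>(\<omega> :: 'm::finite poles) H G x y d s. adm L \<omega> \<and> H \<in> sets borel \<and>
   has_weak_gradient half_space (dsol \<omega> (indicator H)) G \<and> 0 < d \<and> dist x y = d / 2 \<and> s = d / (8 * M) \<and>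
   3 / 4 <= measure (\<omega> (x, s)) H \<and> measure (\<omega> (y, s)) H <= 1 / 4 -->
   ennreal (c * d ^ CARD('m)) <= (\<integral>\<^sup>+X. indicator (ball x d \<times> {s / 4 .. 2 * s}) X * ennreal (snd X * (norm (G X))^2) \<partial>lebesgue)"
proof -
 have e8: "(0::real) < 1 / 8" by simp
 show ?thesis using measure_equicontinuous[OF L e8, where 'm = 'm]
 proof (elim exE conjE, goal_cases)
 case (1 \<theta>)
 note \<theta> = 1(1,2) and eq = 1(3)
 define n where "n = CARD('m)"
 have dim: "DIM('m point) = Suc n" by (simp add: n_def)
 define V where "V = unit_ball_vol (real (Suc n))"
 have V: "0 < V" by (simp add: V_def)
 define q where "q = \<theta> / 2 / (8 * M)"
 have q: "0 < q" using \<theta> M by (simp add: q_def)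
 \<comment> \<open>The factors are the weight s/4, the division by |h|^2 = d^2/4, the squared gap
   1/16 and the volume of the ball of radius q d in dimension n + 1; with s = d/(8M) they multiply
   to c d^n.\<close>
 define c where "c = (1 / (8 * M) / 4) * (4 * (1 / 16 * (V * q ^ Suc n)))"
 have c: "0 < c" using V q M by (simp add: c_def)
 show ?thesis
 proof (rule exI[of _ c], intro conjI[OF c] allI impI, elim conjE, goal_cases)
 case (1 \<omega> H G x y d s)
 note adm = 1(1) and H = 1(2) and G = 1(3) and d = 1(4) and xy = 1(5) and s = 1(6) and hi = 1(7) and lo = 1(8)
 show ?case
 proof -
  have s0: "0 < s" "s <= d / 8" using d M by (simp_all add: s field_simps)
  define u where "u X = (if X \<in> half_space then measure (\<omega> X) H else 0)" for X
  have cont: "continuous_on half_space u" using half_space_measure_continuous[OF L adm H] by (rule continuous_on_eq) (simp add: u_def)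
  have um: "u \<in> \<B>"
  proof -
   have "(\<lambda>X. if X \<in> half_space then u X else 0) \<in> \<B>"
    by (rule borel_measurable_continuous_on_if[OF borel_open[OF open_half_space] cont continuous_on_const])
   moreover have "(\<lambda>X. if X \<in> half_space then u X else 0) = u" by (auto simp: u_def)
   ultimately show ?thesis by simp
  qed
  define G0 where "G0 X = (if X \<in> half_space then G X else 0)" for X
  have "G \<in> borel_measurable (lebesgue_on half_space)" using G by (simp add: has_weak_gradient_def L2_loc_def)
  then have "G0 \<in> borel_measurable lebesgue" unfolding G0_def[abs_def] by (rule borel_measurable_if_I) (simp add: borel_open open_half_space)
  then obtain G' where G': "G' \<in> \<B>" "AE X in lborel. G0 X = G' X" by (rule ex_borel_version)
  have w: "wgrad half_space u G'"
  proof (rule wgrad_of_has_weak_gradient[OF open_half_space um _ _ G G'(1)])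
   show "u X = dsol \<omega> (indicator H) X" if "X \<in> half_space" for X using dsol_indicator[OF adm that H] that by (simp add: u_def)
   show "\<bar>u X\<bar> <= 1" for X using adm_measure_le_1[OF adm, of X H] by (simp add: u_def)
   show "AE X in lborel. (if X \<in> half_space then G X else 0) = G' X" using G'(2) by (simp add: G0_def)
  qed
  define B where "B = ball x (3 / 4 * d) \<times> {s / 2 <..< 3 / 2 * s}"
  define K where "K = cball x (7 / 8 * d) \<times> {s / 4 .. 2 * s}"
  have B: "convex B" "open B" by (auto simp: B_def convex_Times open_Times)
  have K: "compact K" "K \<subseteq> half_space" using s0 by (auto simp: K_def compact_Times snd_in_half_space)
  have near: "cball X (s / 4) \<subseteq> K" if "X \<in> B" for X
  proof
   fix Y assume "Y \<in> cball X (s / 4)"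
   then have "dist (fst X) (fst Y) <= s / 4" "\<bar>snd X - snd Y\<bar> <= s / 4" using dist_fst_le[of X Y] snd_dist[of X Y] by simp_all
   moreover have "dist x (fst X) < 3 / 4 * d" "s / 2 < snd X" "snd X < 3 / 2 * s" using that by (auto simp: B_def mem_Times_iff)
   ultimately have "dist x (fst Y) <= 7 / 8 * d" "s / 4 <= snd Y" "snd Y <= 2 * s" using dist_triangle[of x "fst Y" "fst X"] s0 by linarith+
   then show "Y \<in> K" by (simp add: K_def mem_Times_iff)
  qed
  have isc: "isCont u X" if "X \<in> B" for X
  proof -
   have "X \<in> half_space" by (rule subsetD[OF order_trans[OF near[OF that] K(2)]]) (use s0 in simp)
   then show ?thesis using continuous_on_eq_continuous_at[OF open_half_space, of u] cont by simp
  qed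
  define h where "h = (y - x, 0::real)"
  have nh: "norm h = d / 2" using xy by (simp add: h_def norm_Pair dist_norm norm_minus_commute)
  have sq: "0 < s / 4" using s0 by simp
  have Bb: "B \<in> sets borel" using B(2) by simp
  note tr = wgrad_translation_estimate[OF w B(1) Bb K sq near isc, where h = h]
  have low: "indicator (ball (x, s) (\<theta> / 2 * s)) X * ennreal (1 / 16) <= indicator B X * indicator B (X + h) * ennreal ((u (X + h) - u X)^2)" for X
  proof (cases "X \<in> ball (x, s) (\<theta> / 2 * s)")
   case True
   have ts: "\<theta> / 2 * s <= s / 2" "\<theta> / 2 * s < \<theta> * s" using \<theta> s0 by simp_all
   have dX: "dist (x, s) X < \<theta> / 2 * s" using True by simp
   have df: "dist x (fst X) < s / 2" "\<bar>s - snd X\<bar> < s / 2" using dist_fst_le[of "(x, s)" X] snd_dist[of "(x, s)" X] dX ts by simp_all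
   have dXh: "dist (y, s) (X + h) = dist (x, s) X" by (simp add: h_def dist_prod_def dist_norm plus_prod_def algebra_simps)
   have XB: "X \<in> B" unfolding B_def mem_Times_iff mem_ball greaterThanLessThan_iff using df s0 by (intro conjI) linarith+
   have "dist x (fst (X + h)) <= dist x y + dist y (fst (X + h))" by (rule dist_triangle)
   moreover have "dist y (fst (X + h)) = dist x (fst X)" by (simp add: h_def dist_norm algebra_simps)
   moreover have "snd (X + h) = snd X" by (simp add: h_def)
   ultimately have XhB: "X + h \<in> B" unfolding B_def mem_Times_iff mem_ball greaterThanLessThan_iff using df s0 xy by (intro conjI) linarith+
   have H1: "\<bar>measure (\<omega> (x, s)) H - measure (\<omega> X) H\<bar> <= 1 / 8"
    using dX ts s0 by (intro eq[rule_format, of \<omega> H "(x, s)" X] conjI adm H)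
      (simp_all add: snd_in_half_space)
   have H2: "\<bar>measure (\<omega> (y, s)) H - measure (\<omega> (X + h)) H\<bar> <= 1 / 8"
    using dX dXh ts s0 by (intro eq[rule_format, of \<omega> H "(y, s)" "X + h"] conjI adm H)
      (simp_all add: snd_in_half_space)
   have "X \<in> half_space" "X + h \<in> half_space" using XB XhB s0 by (auto simp: B_def mem_Times_iff snd_in_half_space)
   then have "u X = measure (\<omega> X) H" "u (X + h) = measure (\<omega> (X + h)) H" by (simp_all add: u_def)
   then have "1 / 4 <= \<bar>u (X + h) - u X\<bar>" using H1 H2 hi lo by linarith
   then have "(1 / 4)^2 <= \<bar>u (X + h) - u X\<bar>^2" by (intro power_mono) auto
   then have "1 / 16 <= (u (X + h) - u X)^2" by (simp add: power_divide)
   then show ?thesis using True XB XhB by (simp add: ennreal_leI)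
  qed simp
  have rr: "0 <= \<theta> / 2 * s" using \<theta> s0 by simp
  have [measurable]: "ball (x, s) (\<theta> / 2 * s) \<in> sets borel" by simp
  have "ennreal (1 / 16 * (V * (q * d) ^ Suc n)) = ennreal (1 / 16) * emeasure lborel (ball (x, s) (\<theta> / 2 * s))"
   unfolding emeasure_ball_power[OF rr] dim V_def[symmetric] using V q d by (simp add: ennreal_mult'[symmetric] q_def s)
  also have "\<dots> = (\<integral>\<^sup>+X. ennreal (1 / 16) * indicator (ball (x, s) (\<theta> / 2 * s)) X \<partial>lborel)"
   by (rule nn_integral_cmult_indicator[symmetric]) simp
  also have "\<dots> <= (\<integral>\<^sup>+X. indicator B X * indicator B (X + h) * ennreal ((u (X + h) - u X)^2) \<partial>lborel)"
   by (intro nn_integral_mono) (simp only: low mult.commute[of "ennreal (1 / 16)"])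
  also note tr
  finally have 1: "ennreal (1 / 16 * (V * (q * d) ^ Suc n)) <= ennreal ((d / 2)^2) * (\<integral>\<^sup>+X. indicator K X * ennreal ((norm (G' X))^2) \<partial>lborel)"
   unfolding nh .
  have [measurable]: "K \<in> sets borel" "G' \<in> \<B>" using K(1) G' by (auto simp: compact_imp_closed)
  have cc: "c * d ^ n = (s / 4 * (4 / d^2)) * (1 / 16 * (V * (q * d) ^ Suc n))"
   using d M unfolding c_def s by (simp add: field_simps power2_eq_square power_mult_distrib)
  have "ennreal (c * d ^ n) = ennreal (s / 4 * (4 / d^2)) * ennreal (1 / 16 * (V * (q * d) ^ Suc n))"
   unfolding cc using s0 d by (intro ennreal_mult') simp
  also have "\<dots> <= ennreal (s / 4 * (4 / d^2)) * (ennreal ((d / 2)^2) * (\<integral>\<^sup>+X. indicator K X * ennreal ((norm (G' X))^2) \<partial>lborel))"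
   by (intro mult_left_mono 1) simp
  also have "\<dots> = ennreal (s / 4) * (\<integral>\<^sup>+X. indicator K X * ennreal ((norm (G' X))^2) \<partial>lborel)"
   using s0 d by (simp add: mult.assoc[symmetric] ennreal_mult'[symmetric] power_divide)
  also have "\<dots> = (\<integral>\<^sup>+X. ennreal (s / 4) * (indicator K X * ennreal ((norm (G' X))^2)) \<partial>lborel)"
   by (rule nn_integral_cmult[symmetric]) measurable
  also have "\<dots> <= (\<integral>\<^sup>+X. indicator (ball x d \<times> {s / 4 .. 2 * s}) X * ennreal (snd X * (norm (G X))^2) \<partial>lborel)"
  proof (rule nn_integral_mono_AE, use G'(2) in eventually_elim)
   case (elim X)
   show ?case
   proof (cases "X \<in> K")
    case True
    then have "X \<in> half_space" "X \<in> ball x d \<times> {s / 4 .. 2 * s}" "s / 4 <= snd X" using K(2) d by (auto simp: K_def)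
    moreover have "s / 4 * (norm (G' X))^2 <= snd X * (norm (G' X))^2" by (rule mult_right_mono) (use calculation in auto)
    ultimately show ?thesis using True elim s0 by (simp add: G0_def ennreal_mult'[symmetric] ennreal_leI)
   qed simp
  qed
  also have "\<dots> = (\<integral>\<^sup>+X. indicator (ball x d \<times> {s / 4 .. 2 * s}) X * ennreal (snd X * (norm (G X))^2) \<partial>lebesgue)"
   by (simp add: nn_integral_completion)
  finally show ?thesis by (simp add: n_def)
 qed
 qed
 qed
qed

section \<open>Coverings, Whitney balls and shadows\<close>

text \<open>The form in which Vitali coverings are used: the covering sets A i are measured by M,
  while the disjoint pieces B i that pay for them may be measured by another measure N, on another
  space.\<close>

lemma countable_cover_emeasure:
 assumes I: "countable I" and A: "\<And>i. i \<in> I ==> A i \<in> sets M" and B: "\<And>i. i \<in> I ==> B i \<in> sets N" "disjoint_family_on B I"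
  and AB: "\<And>i. i \<in> I ==> emeasure M (A i) <= k * emeasure N (B i)" and F: "\<And>i. i \<in> I ==> B i \<subseteq> F" "F \<in> sets N"
 shows "emeasure M (\<Union>i\<in>I. A i) <= k * emeasure N F"
proof -
 define S where "S = to_nat_on I ` I"
 define f where "f n = from_nat_into I n" for n
 have f: "f n \<in> I" "to_nat_on I (f n) = n" if "n \<in> S" for n using that I by (auto simp: S_def f_def)
 have fI: "\<exists>n\<in>S. f n = i" if "i \<in> I" for i using that I by (intro bexI[of _ "to_nat_on I i"]) (auto simp: S_def f_def)
 let ?A = "\<lambda>n. if n \<in> S then A (f n) else {}"
 let ?B = "\<lambda>n. if n \<in> S then B (f n) else {}"
 have dB: "disjoint_family ?B" unfolding disjoint_family_on_def
 proof (intro ballI impI)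
  fix m n :: nat assume "m \<noteq> n"
  show "?B m \<inter> ?B n = {}"
  proof (cases "m \<in> S \<and> n \<in> S")
   case True
   then have "f m \<noteq> f n" using f(2)[of m] f(2)[of n] \<open>m \<noteq> n\<close> by metis
   then show ?thesis using True B(2) f(1) by (simp add: disjoint_family_on_def)
  qed auto
 qed
 have "(\<Union>i\<in>I. A i) = (\<Union>n. ?A n)"
 proof
  show "(\<Union>i\<in>I. A i) \<subseteq> (\<Union>n. ?A n)"
  proof
   fix x assume "x \<in> (\<Union>i\<in>I. A i)"
   then obtain i where i: "i \<in> I" "x \<in> A i" by auto
   obtain n where "n \<in> S" "f n = i" using fI[OF i(1)] by auto
   then show "x \<in> (\<Union>n. ?A n)" using i(2) by (intro UN_I[of n]) auto
  qed
  show "(\<Union>n. ?A n) \<subseteq> (\<Union>i\<in>I. A i)" using f(1) by (auto split: if_splits)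
 qed
 moreover have "emeasure M (\<Union>n. ?A n) <= (\<Sum>n. emeasure M (?A n))" using A f(1) by (intro emeasure_subadditive_countably) auto
 ultimately have "emeasure M (\<Union>i\<in>I. A i) <= (\<Sum>n. emeasure M (?A n))" by (simp only:)
 also have "\<dots> <= (\<Sum>n. k * emeasure N (?B n))" using AB f(1) by (intro suminf_le) auto
 also have "\<dots> = k * (\<Sum>n. emeasure N (?B n))" by simp
 also have "(\<Sum>n. emeasure N (?B n)) = emeasure N (\<Union>n. ?B n)" using B f(1) by (intro suminf_emeasure dB) auto
 also have "k * emeasure N (\<Union>n. ?B n) <= k * emeasure N F" using F f(1) by (intro mult_left_mono emeasure_mono) (auto split: if_splits)
 finally show ?thesis .
qed

lemma infdist_Compl:
 fixes V :: "'a::euclidean_space set"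
 assumes V: "open V" "V \<noteq> UNIV"
 shows "x \<in> V ==> 0 < infdist x (- V)" "ball x (infdist x (- V)) \<subseteq> V" "ball y t \<subseteq> V ==> t <= infdist x (- V) + dist x y"
proof -
 have c: "closed (- V)" "- V \<noteq> {}" using V by auto
 show "0 < infdist x (- V)" if "x \<in> V" using infdist_pos_not_in_closed[OF c, of x] that by simp
 show "ball x (infdist x (- V)) \<subseteq> V"
 proof
  fix y assume "y \<in> ball x (infdist x (- V))"
  then have "\<not> infdist x (- V) <= dist x y" by simp
  then show "y \<in> V" using infdist_le[of y "- V" x] by auto
 qed
 show "t <= infdist x (- V) + dist x y" if b: "ball y t \<subseteq> V"
 proof -
  obtain z where z: "z \<in> - V" "infdist x (- V) = dist x z" using infdist_attains_inf[OF c] by metis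
  then have "z \<notin> ball y t" using b by auto
  then show ?thesis using z(2) dist_triangle[of y z x] by (simp add: dist_commute)
 qed
qed

text \<open>Vitali's lemma for balls with a fifth of the distance to the complement as radius: the
  selected balls are disjoint and their fivefold enlargements cover V while remaining inside it. The
  bound B is the bound on radii which that lemma requires.\<close>

lemma whitney_cover:
 fixes V :: "'a::euclidean_space set"
 assumes V: "open V" "V \<noteq> UNIV" and B: "\<And>x. x \<in> V ==> infdist x (- V) <= B"
 shows "\<exists>C\<subseteq>V. countable C \<and> V \<subseteq> (\<Union>x\<in>C. ball x (infdist x (- V))) \<and> disjoint_family_on (\<lambda>x. ball x (infdist x (- V) / 5)) C"
proof -
 have S: "V \<subseteq> (\<Union>x\<in>V. ball x (infdist x (- V) / 5))" using infdist_Compl(1)[OF V] by auto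
 have r: "0 < infdist x (- V) / 5 \<and> infdist x (- V) / 5 <= B / 5" if "x \<in> V" for x using infdist_Compl(1)[OF V that] B[OF that] by simp
 obtain C where C: "countable C" "C \<subseteq> V" "pairwise (\<lambda>x y. disjnt (ball x (infdist x (- V) / 5)) (ball y (infdist y (- V) / 5))) C"
   "V \<subseteq> (\<Union>x\<in>C. ball x (5 * (infdist x (- V) / 5)))" by (rule Vitali_covering_lemma_balls[OF S r])
 then show ?thesis by (intro exI[of _ C]) (auto simp: disjoint_family_on_def pairwise_def disjnt_def)
qed

lemma emeasure_cube:
 assumes "0 <= l" shows "emeasure lborel (cube (c :: real ^ 'm::finite) l) = ennreal (l ^ CARD('m))"
proof -
 have "\<bar>x $ i - c $ i\<bar> < l / 2 \<longleftrightarrow> c $ i - l / 2 < x $ i \<and> x $ i < c $ i + l / 2" for x :: "real ^ 'm" and i by linarith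
 then have "cube c l = box (c - (\<chi> i. l / 2)) (c + (\<chi> i. l / 2))" unfolding cube_def by (simp add: set_eq_iff mem_box_cart)
 moreover have "(c + (\<chi> i. l / 2) - (c - (\<chi> i. l / 2))) \<bullet> b = l" if "b \<in> Basis" for b
  using that by (auto simp: Basis_vec_def inner_axis)
 moreover have "(c - (\<chi> i. l / 2)) \<bullet> b <= (c + (\<chi> i. l / 2)) \<bullet> b" if "b \<in> Basis" for b
  using that assms by (auto simp: Basis_vec_def inner_axis)
 ultimately show ?thesis by (simp add: emeasure_lborel_box)
qed

lemma cube_open: "open (cube c l)"
proof -
 have "cube c l = (\<Inter>i. {x. \<bar>(x - c) $ i\<bar> < l / 2})" by (auto simp: cube_def)
 also have "open \<dots>" by (intro open_INT open_Collect_less continuous_intros ballI) auto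
 finally show ?thesis .
qed

lemma ball_subset_cube: "ball c (l / 2) \<subseteq> cube c l"
proof
 fix x assume "x \<in> ball c (l / 2)"
 then have "norm (x - c) < l / 2" by (simp add: dist_norm norm_minus_commute)
 then show "x \<in> cube c l" unfolding cube_def mem_Collect_eq by (intro allI le_less_trans[OF component_le_norm_cart])
qed

text \<open>The projection to the boundary, with aperture b, of the poles from which E is seen with
  measure above \<tau>. S restricts the heights: an initial segment below a in the layer
  construction, all heights in the fattening of level sets.\<close>

definition shadow :: "('m::finite poles) => real set => real => real => (real ^ 'm) set => (real ^ 'm) set" where
 "shadow \<omega> S b \<tau> E = (\<Union>(y, s) \<in> {(y, s). 0 < s \<and> s \<in> S \<and> \<tau> < measure (\<omega> (y, s)) E}. ball y (b * s))"

lemma open_shadow: "open (shadow \<omega> S b \<tau> E)" unfolding shadow_def by auto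

lemma ball_subset_shadow: "0 < s ==> s \<in> S ==> \<tau> < measure (\<omega> (y, s)) E ==> ball y (b * s) \<subseteq> shadow \<omega> S b \<tau> E"
 unfolding shadow_def by (rule order_trans[OF _ UN_upper[of "(y, s)"]]) simp_all

lemma shadowE:
 assumes "x \<in> shadow \<omega> S b \<tau> E"
 obtains y s where "0 < s" "s \<in> S" "\<tau> < measure (\<omega> (y, s)) E" "dist y x < b * s" using assms unfolding shadow_def by auto

text \<open>At a pole (y, s) of the shadow the part of E within distance b' s still has measure
  \<tau>/2, the rest being too far away. Harnack lifts the pole to height 5 b' s, and the comparison
  bounds the ball of that radius by the local part of E, as seen from X. Vitali makes the local
  parts disjoint, so they sum to at most E. The condition N a \<le> snd X keeps X outside the
  doubled balls.\<close>

lemma shadow_growth: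
 assumes L: "0 <= L" and \<tau>: "0 < \<tau>" and b: "0 < b"
 shows "\<exists>C N. 0 < C \<and> 0 < N \<and> (\<forall>(\<omega> :: 'm::finite poles) E X a. adm L \<omega> \<and> E \<in> sets borel \<and>
   X \<in> half_space \<and> 0 < a \<and> N * a <= snd X --> measure (\<omega> X) (shadow \<omega> {..<a} b \<tau> E) <= C * measure (\<omega> X) E)"
proof -
 have \<tau>2: "0 < \<tau> / 2" using \<tau> by simp
 show ?thesis using measure_small_near_zero_data[OF L \<tau>2, where 'm = 'm]
 proof (elim exE conjE, goal_cases)
 case (1 M)
 note M = 1(1) and nz = 1(2)
 define b' where "b' = b + M"
 have b': "1 <= b'" "b <= b'" "M <= b'" using b M by (auto simp: b'_def)
 \<comment> \<open>The lift from (y, s) to (y, 5 b' s) covers a distance of at most s/\<kappa> = 5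
   b' s.\<close>
 define \<kappa> where "\<kappa> = 1 / (5 * b')"
 have \<kappa>: "0 < \<kappa>" "\<kappa> <= 1" using b' by (auto simp: \<kappa>_def)
 show ?thesis using measure_harnack[OF L \<tau>2 \<kappa>, where 'm = 'm]
 proof (elim exE conjE, goal_cases)
 case (1 c)
 note c = 1(1) and qh = 1(2)
 show ?thesis using measure_comparison[OF L c, where 'm = 'm]
 proof (elim exE conjE, goal_cases)
 case (1 C)
 note C = 1(1) and cp = 1(2)
 have N: "0 < 10 * b'" using b' by simp
 show ?thesis
 proof (rule exI[of _ C], rule exI[of _ "10 * b'"], intro conjI[OF C] conjI[OF N] allI impI, elim conjE, goal_cases)
 case (1 \<omega> E X a)
 note adm = 1(1) and E = 1(2) and X = 1(3) and a = 1(4,5)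
 show ?case
 proof -
  interpret finite_measure "\<omega> X" by (rule adm_measure(2)[OF adm X])
  have sets: "sets (\<omega> X) = sets borel" by (rule adm_measure(1)[OF adm X])
  define K where "K = {(y, s). 0 < s \<and> s < a \<and> \<tau> < measure (\<omega> (y, s)) E}"
  have Ki: "0 < snd i" "snd i < a" "\<tau> < measure (\<omega> i) E" if "i \<in> K" for i using that by (auto simp: K_def)
  have S: "shadow \<omega> {..<a} b \<tau> E \<subseteq> (\<Union>i\<in>K. ball (fst i) (b' * snd i))"
  proof
   fix x assume "x \<in> shadow \<omega> {..<a} b \<tau> E"
   then obtain y s where ys: "0 < s" "s \<in> {..<a}" "\<tau> < measure (\<omega> (y, s)) E" "dist y x < b * s" by (rule shadowE)
   have "b * s <= b' * s" using b' ys(1) by (intro mult_right_mono) auto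
   then have "dist y x < b' * s" using ys(4) by linarith
   then show "x \<in> (\<Union>i\<in>K. ball (fst i) (b' * snd i))" using ys(1-3) by (intro UN_I[of "(y, s)"]) (auto simp: K_def)
  qed
  have r: "0 < b' * snd i \<and> b' * snd i <= b' * a" if "i \<in> K" for i using Ki[OF that] b' by simp
  obtain I where I: "countable I" "I \<subseteq> K" "pairwise (\<lambda>i j. disjnt (ball (fst i) (b' * snd i)) (ball (fst j) (b' * snd j))) I"
   and cover: "shadow \<omega> {..<a} b \<tau> E \<subseteq> (\<Union>i\<in>I. ball (fst i) (5 * (b' * snd i)))"
   by (rule Vitali_covering_lemma_balls[OF S r])
  have "emeasure (\<omega> X) (\<Union>i\<in>I. ball (fst i) (5 * (b' * snd i))) <= ennreal C * emeasure (\<omega> X) E"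
  proof (rule countable_cover_emeasure[OF I(1), where B = "\<lambda>i. E \<inter> ball (fst i) (b' * snd i)"])
   show "disjoint_family_on (\<lambda>i. E \<inter> ball (fst i) (b' * snd i)) I" unfolding disjoint_family_on_def
   proof (intro ballI impI)
    fix i j assume "i \<in> I" "j \<in> I" "i \<noteq> j"
    then have "disjnt (ball (fst i) (b' * snd i)) (ball (fst j) (b' * snd j))" by (rule pairwiseD[OF I(3)])
    then show "(E \<inter> ball (fst i) (b' * snd i)) \<inter> (E \<inter> ball (fst j) (b' * snd j)) = {}" unfolding disjnt_def by blast
   qed
   fix i assume "i \<in> I"
   then have i: "i \<in> K" using I(2) by auto
   obtain y s where iys: "i = (y, s)" by (cases i)
   have s: "0 < s" "s < a" "\<tau> < measure (\<omega> (y, s)) E" using Ki[OF i] by (auto simp: iys)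
   let ?E = "E \<inter> ball y (b' * s)"
   have Y: "(y, s) \<in> half_space" using s by (simp add: snd_in_half_space)
   have ms: "M * s <= b' * s" using b' s by (intro mult_right_mono) auto
   have Eb: "?E \<in> sets borel" "E - ball y (b' * s) \<in> sets borel" using E by auto
   have "(E - ball y (b' * s)) \<inter> ball y (M * s) = {}" using ms by auto
   then have "measure (\<omega> (y, s)) (E - ball y (b' * s)) <= \<tau> / 2"
    by (intro nz[rule_format, of \<omega> "E - ball y (b' * s)" s y] conjI adm Eb s)
   moreover have "measure (\<omega> (y, s)) E <= measure (\<omega> (y, s)) ?E + measure (\<omega> (y, s)) (E - ball y (b' * s))"
   proof -
    have "measure (\<omega> (y, s)) (?E \<union> (E - ball y (b' * s))) <= measure (\<omega> (y, s)) ?E + measure (\<omega> (y, s)) (E - ball y (b' * s))"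
     by (rule measure_Un_le) (simp_all add: adm_measure(1)[OF adm Y] Eb)
    moreover have "?E \<union> (E - ball y (b' * s)) = E" by auto
    ultimately show ?thesis by simp
   qed
   ultimately have tau: "\<tau> / 2 <= measure (\<omega> (y, s)) ?E" using s(3) by linarith
   have s5: "s <= 5 * (b' * s)" "0 < 5 * (b' * s)" using b' s by simp_all
   have "\<kappa> * s <= s" using \<kappa> s by simp
   then have ks: "\<kappa> * snd (y, s) <= snd (y, 5 * (b' * s))" using s5 by simp
   have ds: "dist (y, s) (y, 5 * (b' * s)) <= snd (y, s) / \<kappa>" using s5 s by (simp add: dist_point \<kappa>_def)
   have "c <= measure (\<omega> (y, 5 * (b' * s))) ?E"
    by (intro qh[rule_format, of \<omega> ?E "(y, s)" "(y, 5 * (b' * s))"] conjI adm Eb Y tau ks ds)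
   moreover have "2 * (5 * (b' * s)) <= dist (y, 0) X"
   proof -
    have "10 * b' * s <= 10 * b' * a" using s b' by (intro mult_left_mono) auto
    then show ?thesis using a snd_dist[of "(y, 0)" X] X by (simp add: snd_in_half_space)
   qed
   moreover have "?E \<subseteq> ball y (5 * (b' * s))" using s5 by (intro order_trans[OF Int_lower2] subset_ball) simp
   ultimately have "measure (\<omega> X) (ball y (5 * (b' * s))) <= C * measure (\<omega> X) ?E"
    using s5 by (intro cp[rule_format, of \<omega> ?E y "5 * (b' * s)" X] conjI adm Eb X)
   then show "emeasure (\<omega> X) (ball (fst i) (5 * (b' * snd i))) <= ennreal C * emeasure (\<omega> X) (E \<inter> ball (fst i) (b' * snd i))"
    using C unfolding iys fst_conv snd_conv emeasure_eq_measure by (simp add: ennreal_mult'[symmetric] ennreal_leI)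
  qed (use E in \<open>auto simp: sets\<close>)
  moreover have "emeasure (\<omega> X) (shadow \<omega> {..<a} b \<tau> E) <= emeasure (\<omega> X) (\<Union>i\<in>I. ball (fst i) (5 * (b' * snd i)))"
   by (intro emeasure_mono cover) (simp add: sets borel_open open_UN)
  ultimately have "emeasure (\<omega> X) (shadow \<omega> {..<a} b \<tau> E) <= ennreal C * emeasure (\<omega> X) E" by simp
  then show ?thesis using C unfolding emeasure_eq_measure by (simp add: ennreal_mult'[symmetric])
 qed
 qed
 qed
 qed
 qed
qed

text \<open>
 \<open>H\<close> contains the core of each Whitney ball of \<open>V (Suc k)\<close> but misses \<open>V k\<close>, so \<open>\<omega>(H)\<close> oscillates at
 the scale of every Whitney ball of every layer; the corresponding Whitney regions are disjoint
 because \<open>V (k + 2)\<close> is much fatter than \<open>V (k + 1)\<close>.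
\<close>

lemma layers_energy:
 fixes \<omega> :: "'m::finite poles" and V :: "nat => (real ^ 'm) set"
 assumes adm: "adm L \<omega>" and M: "1 <= M" and c: "0 < c"
  and nz: "\<And>E x t. E \<in> sets borel ==> 0 < t ==> E \<inter> ball x (M * t) = {} ==> measure (\<omega> (x, t)) E <= 1 / 8"
  and en: "\<And>H G x y d s. H \<in> sets borel ==> has_weak_gradient half_space (dsol \<omega> (indicator H)) G ==> 0 < d ==> dist x y = d / 2 ==> s = d / (8 * M) ==>
   3 / 4 <= measure (\<omega> (x, s)) H ==> measure (\<omega> (y, s)) H <= 1 / 4 ==>
   ennreal (c * d ^ CARD('m)) <= (\<integral>\<^sup>+X. indicator (ball x d \<times> {s / 4 .. 2 * s}) X * ennreal (snd X * (norm (G X))^2) \<partial>lebesgue)"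
  and V: "\<And>k. open (V k)" "\<And>k. V k \<noteq> UNIV" "\<And>k. V k \<subseteq> V (Suc k)"
  and step: "\<And>k y s. 0 < s ==> s < a ==> 1 / 8 < measure (\<omega> (y, s)) (V k) ==> ball y (200 * M * s) \<subseteq> V (Suc k)"
  and rad: "\<And>k x. k <= J ==> x \<in> V k ==> infdist x (- V k) < 20 * M * a"
 shows "\<exists>H\<in>sets borel. H \<subseteq> V J \<and> (\<forall>G. has_weak_gradient half_space (dsol \<omega> (indicator H)) G -->
   of_nat J * emeasure lborel (V 0) <= ennreal (unit_ball_vol (real CARD('m)) * 5 ^ CARD('m) / c) *
    (\<integral>\<^sup>+X. indicator (V J \<times> {0..a}) X * ennreal (snd X * (norm (G X))^2) \<partial>lebesgue))"
proof -
 have mono: "V i \<subseteq> V j" if "i <= j" for i j using lift_Suc_mono_le[of V, OF V(3) that] .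
 \<comment> \<open>A fifth of the Whitney radius: balls of radius \<open>d k x\<close> are disjoint
   within a layer, balls of radius 5 \<open>d k x\<close> fill it.\<close>
 define d where "d k x = infdist x (- V (Suc k)) / 5" for k x
 have "\<exists>C\<subseteq>V (Suc k). countable C \<and> V (Suc k) \<subseteq> (\<Union>x\<in>C. ball x (5 * d k x)) \<and> disjoint_family_on (\<lambda>x. ball x (d k x)) C" if "k < J" for k
  using whitney_cover[OF V(1,2), of "Suc k" "20 * M * a"] rad[of "Suc k"] that unfolding d_def by (simp add: less_imp_le)
 then have "\<forall>k\<in>{..<J}. \<exists>C. C\<subseteq>V (Suc k) \<and> countable C \<and> V (Suc k) \<subseteq> (\<Union>x\<in>C. ball x (5 * d k x)) \<and> disjoint_family_on (\<lambda>x. ball x (d k x)) C" by auto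
 then obtain C where C0: "\<forall>k\<in>{..<J}. C k \<subseteq> V (Suc k) \<and> countable (C k) \<and> V (Suc k) \<subseteq> (\<Union>x\<in>C k. ball x (5 * d k x)) \<and> disjoint_family_on (\<lambda>x. ball x (d k x)) (C k)"
  by (rule bchoice[THEN exE]) (rule that)
 have C: "C k \<subseteq> V (Suc k)" "countable (C k)" "V (Suc k) \<subseteq> (\<Union>x\<in>C k. ball x (5 * d k x))" "disjoint_family_on (\<lambda>x. ball x (d k x)) (C k)"
  if "k < J" for k using C0[THEN bspec, of k] that by simp_all
 have d: "0 < d k x" "ball x (5 * d k x) \<subseteq> V (Suc k)" "d k x < 4 * M * a" if "k < J" "x \<in> C k" for k x
  using infdist_Compl(1,2)[OF V(1,2), of x "Suc k"] rad[of "Suc k" x] subsetD[OF C(1)[OF that(1)] that(2)] that(1) by (simp_all add: d_def)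
 have dmax: "t <= 5 * d k x + dist x y" if "ball y t \<subseteq> V (Suc k)" for k x y t
  using infdist_Compl(3)[OF V(1,2) that, of x] by (simp add: d_def)
 define s where "s k x = d k x / (8 * M)" for k x
 have s: "0 < s k x" "2 * s k x < a" "M * s k x = d k x / 8" "200 * M * s k x = 25 * d k x" if "k < J" "x \<in> C k" for k x
  using d[OF that] M by (simp_all add: s_def field_simps)
 have same: "x = x'" if "k < J" "x \<in> C k" "x' \<in> C k" "z \<in> ball x (d k x)" "z \<in> ball x' (d k x')" for k x x' z
  using C(4)[OF that(1)] that unfolding disjoint_family_on_def by blast
 define H where "H = (\<Union>k\<in>{..<J}. (\<Union>x\<in>C k. ball x (d k x / 4)) - V k)"
 have Hb: "H \<in> sets borel" unfolding H_def using V(1) by (intro sets.finite_UN sets.Diff borel_open open_UN) auto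
 have HI: "z \<in> H" if "k < J" "x \<in> C k" "dist x z < d k x / 4" "z \<notin> V k" for k x z using that unfolding H_def by auto
 have HE: thesis if "z \<in> H" "\<And>k x. k < J ==> x \<in> C k ==> dist x z < d k x / 4 ==> z \<notin> V k ==> thesis" for z thesis
  using that(1) unfolding H_def by (elim UN_E DiffE) (rule that(2), auto)
 have HV: "H \<subseteq> V J"
 proof
  fix z assume "z \<in> H"
  then obtain k x where k: "k < J" "x \<in> C k" "dist x z < d k x / 4" by (rule HE)
  then have "z \<in> ball x (5 * d k x)" using d(1)[OF k(1,2)] by simp
  then have "z \<in> V (Suc k)" using d(2)[OF k(1,2)] by auto
  then show "z \<in> V J" using mono[of "Suc k" J] k(1) by auto
 qed
 define e :: "real ^ 'm" where "e = (SOME b. b \<in> Basis)"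
 have e: "norm e = 1" unfolding e_def by (intro norm_Basis SOME_Basis)
 define y where "y k x = x + (d k x / 2) *\<^sub>R e" for k x
 have dxy: "dist x (y k x) = d k x / 2" if "k < J" "x \<in> C k" for k x using d(1)[OF that] e by (simp add: y_def dist_norm)
 \<comment> \<open>Otherwise \<open>step\<close> would put a ball of radius 25 \<open>d k x\<close>
   about z into the next layer, but no ball there can exceed the distance 5 \<open>d k x\<close>
   from x to the complement by more than dist x z.\<close>
 have small: "measure (\<omega> (z, s k x)) (V k) <= 1 / 8" if kx: "k < J" "x \<in> C k" and z: "dist x z <= d k x / 2" for k x z
 proof (rule ccontr)
  assume "\<not> ?thesis"
  moreover have "s k x < a" using s(1,2)[OF kx] by simp
  ultimately have "ball z (25 * d k x) \<subseteq> V (Suc k)" using step[OF s(1)[OF kx], of z k] unfolding s(4)[OF kx] by simp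
  then have "25 * d k x <= 5 * d k x + dist x z" by (rule dmax)
  then show False using z d(1)[OF kx] by simp
 qed
 have pole: "(z, s k x) \<in> half_space" if "k < J" "x \<in> C k" for k x z using s(1)[OF that] by (simp add: snd_in_half_space)
 have Vb: "V k \<in> sets borel" for k using V(1) by simp
 have hi: "3 / 4 <= measure (\<omega> (x, s k x)) H" if kx: "k < J" "x \<in> C k" for k x
 proof -
  note adm_measure_Compl[OF adm pole[OF kx] Hb, of x]
  moreover have "measure (\<omega> (x, s k x)) (- H) <= measure (\<omega> (x, s k x)) (- ball x (d k x / 8) \<union> V k)"
  proof (rule adm_measure_mono[OF adm pole[OF kx]])
   show "- H \<subseteq> - ball x (d k x / 8) \<union> V k" using HI[OF kx] d(1)[OF kx] by fastforce
  qed (use Vb in auto)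
  moreover have "\<dots> <= measure (\<omega> (x, s k x)) (- ball x (d k x / 8)) + measure (\<omega> (x, s k x)) (V k)"
   by (rule measure_Un_le) (use Vb in \<open>auto simp: adm_measure(1)[OF adm pole[OF kx]]\<close>)
  moreover have "measure (\<omega> (x, s k x)) (- ball x (d k x / 8)) <= 1 / 8" by (rule nz[OF _ s(1)[OF kx]]) (use s(3)[OF kx] in auto)
  ultimately show ?thesis using small[OF kx, of x] d(1)[OF kx] by simp
 qed
 have lo: "measure (\<omega> (y k x, s k x)) H <= 1 / 4" if kx: "k < J" "x \<in> C k" for k x
 proof -
  let ?y = "y k x"
  \<comment> \<open>Points of H near y come from no core of layer k: cores of earlier layers lie
    inside \<open>V k\<close>, those of later layers were cut off \<open>V (Suc k)\<close>, which
    contains the point, and the only core of layer k that could meet the ball of radius d about x is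
    at distance more than d/8 from y.\<close>
  have near: "z \<in> V k" if z: "z \<in> H" "dist ?y z < d k x / 8" for z using z(1)
  proof (rule HE)
   fix k' x' assume k': "k' < J" "x' \<in> C k'" "dist x' z < d k' x' / 4" "z \<notin> V k'"
   have zx: "z \<in> ball x (d k x)" "\<not> dist x z < d k x / 4"
    using z(2) dxy[OF kx] dist_triangle[of x z ?y] dist_triangle[of x ?y z] d(1)[OF kx] by (simp_all add: dist_commute)
   have zx': "z \<in> ball x' (d k' x')" using k'(3) d(1)[OF k'(1,2)] by simp
   have sub: "ball w (d i w) \<subseteq> V (Suc i)" if "i < J" "w \<in> C i" for i w
    using d(1)[OF that] by (intro order_trans[OF subset_ball d(2)[OF that]]) simp
   consider "k' < k" | "k < k'" | "k' = k" by linarith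
   then show "z \<in> V k"
   proof cases
    case 1
    then show ?thesis using sub[OF k'(1,2)] zx' mono[of "Suc k'" k] by auto
   next
    case 2
    then have "z \<in> V k'" using sub[OF kx] zx(1) mono[of "Suc k" k'] by auto
    then show ?thesis using k'(4) by simp
   next
    case 3
    have "x' = x" by (rule same[OF kx(1) _ kx(2) _ zx(1)]) (use 3 k'(2) zx' in simp_all)
    then show ?thesis using k'(3) zx(2) 3 by simp
   qed
  qed
  have "measure (\<omega> (?y, s k x)) H <= measure (\<omega> (?y, s k x)) (- ball ?y (d k x / 8) \<union> V k)"
   by (rule adm_measure_mono[OF adm pole[OF kx]]) (use Vb near in auto)
  moreover have "\<dots> <= measure (\<omega> (?y, s k x)) (- ball ?y (d k x / 8)) + measure (\<omega> (?y, s k x)) (V k)"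
   by (rule measure_Un_le) (use Vb in \<open>auto simp: adm_measure(1)[OF adm pole[OF kx]]\<close>)
  moreover have "measure (\<omega> (?y, s k x)) (- ball ?y (d k x / 8)) <= 1 / 8" by (rule nz[OF _ s(1)[OF kx]]) (use s(3)[OF kx] in auto)
  ultimately show ?thesis using small[OF kx, of ?y] dxy[OF kx] by simp
 qed
 define R where "R k x = ball x (d k x) \<times> {s k x / 4 .. 2 * s k x}" for k x
 \<comment> \<open>A point (z, t) of the earlier region lies so deep above \<open>V (Suc k)\<close>
   that it sees this set with measure at least 7/8. By \<open>step\<close> the later layer then
   contains the ball of radius 200 M t about z; since t is at least a quarter of the later height,
   this is at least 25/4 of the later d, more than the possible 5 + 1.\<close>
 have Rdisj: "R k x \<inter> R k' x' = {}" if kx: "k < J" "x \<in> C k" and kx': "k' < J" "x' \<in> C k'" and kk: "k < k'" for k x k' x'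
 proof (rule ccontr)
  assume "R k x \<inter> R k' x' \<noteq> {}"
  then obtain z t where zt: "dist x z < d k x" "s k x / 4 <= t" "t <= 2 * s k x" "dist x' z < d k' x'" "s k' x' / 4 <= t" by (auto simp: R_def)
  have t: "0 < t" "t < a" using zt s(1,2)[OF kx] by linarith+
  have Mt: "M * t <= d k x / 4"
  proof -
   have "M * t <= M * (2 * s k x)" using M zt(3) by (intro mult_left_mono) auto
   then show ?thesis using s(3)[OF kx] by simp
  qed
  have "ball z (M * t) \<subseteq> ball x (5 * d k x)"
  proof
   fix w assume "w \<in> ball z (M * t)"
   then show "w \<in> ball x (5 * d k x)" using zt(1) Mt dist_triangle[of x w z] d(1)[OF kx] by simp
  qed
  then have "measure (\<omega> (z, t)) (- V (Suc k)) <= 1 / 8" using d(2)[OF kx] Vb by (intro nz t) auto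
  moreover have Z: "(z, t) \<in> half_space" using t by (simp add: snd_in_half_space)
  ultimately have "1 / 8 < measure (\<omega> (z, t)) (V (Suc k))" using adm_measure_Compl[OF adm Z Vb, of "Suc k"] by simp
  then have "ball z (200 * M * t) \<subseteq> V (Suc (Suc k))" by (rule step[OF t])
  then have "ball z (200 * M * t) \<subseteq> V (Suc k')" using mono[of "Suc (Suc k)" "Suc k'"] kk by auto
  then have "200 * M * t <= 5 * d k' x' + dist x' z" by (rule dmax)
  moreover have "200 * M * (s k' x' / 4) <= 200 * M * t" using zt(5) M by (intro mult_left_mono) auto
  ultimately show False using zt(4) s(4)[OF kx'] d(1)[OF kx'] by simp
 qed
 have RV: "R k x \<subseteq> V J \<times> {0..a}" "R k x \<subseteq> half_space" if kx: "k < J" "x \<in> C k" for k x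
 proof -
  have "ball x (d k x) \<subseteq> V (Suc k)" using d(1)[OF kx] by (intro order_trans[OF subset_ball d(2)[OF kx]]) simp
  also have "\<dots> \<subseteq> V J" using kx by (intro mono) simp
  finally show "R k x \<subseteq> V J \<times> {0..a}" using s(1,2)[OF kx] by (auto simp: R_def)
  show "R k x \<subseteq> half_space" using s(1)[OF kx] by (auto simp: R_def snd_in_half_space)
 qed
 let ?v = "unit_ball_vol (real CARD('m))"
 have "of_nat J * emeasure lborel (V 0) <= ennreal (?v * 5 ^ CARD('m) / c) *
    (\<integral>\<^sup>+X. indicator (V J \<times> {0..a}) X * ennreal (snd X * (norm (G X))^2) \<partial>lebesgue)"
  if G: "has_weak_gradient half_space (dsol \<omega> (indicator H)) G" for G
 proof -
  define f where "f X = ennreal (snd X * (norm (if X \<in> half_space then G X else 0))^2)" for X :: "'m point"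
  have "G \<in> borel_measurable (lebesgue_on half_space)" using G by (simp add: has_weak_gradient_def L2_loc_def)
  then have "(\<lambda>X. if X \<in> half_space then G X else 0) \<in> borel_measurable lebesgue"
   by (rule borel_measurable_if_I) (simp add: borel_open open_half_space)
  moreover have "(snd :: 'm point => real) \<in> borel_measurable lebesgue"
   by (rule borel_measurable_lebesgue_of_borel) (intro borel_measurable_continuous_onI continuous_intros)
  ultimately have fm: "f \<in> borel_measurable lebesgue" unfolding f_def[abs_def] by measurable
  define N where "N = density lebesgue f"
  have setsN: "A \<in> sets N" if "A \<in> sets borel" for A using that by (simp add: N_def)
  have Nf: "emeasure N A = (\<integral>\<^sup>+X. f X * indicator A X \<partial>lebesgue)" if "A \<in> sets borel" for A
   unfolding N_def using that by (intro emeasure_density fm) simp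
  have Rb: "R k x \<in> sets borel" for k x unfolding R_def by (intro borel_Times) auto
  define F where "F k = (\<Union>x\<in>C k. R k x)" for k
  have FN: "F k \<in> sets N" if "k < J" for k unfolding F_def using C(2)[OF that] Rb by (intro sets.countable_UN' setsN) auto
  \<comment> \<open>The Whitney balls of layer k + 1 cover \<open>V 0\<close>, and each has volume
    at most a constant times the energy of its region; so every layer pays at least for the volume
    of \<open>V 0\<close>.\<close>
  have level: "emeasure lborel (V 0) <= ennreal (?v * 5 ^ CARD('m) / c) * emeasure N (F k)" if k: "k < J" for k
  proof -
   have "emeasure lborel (V 0) <= emeasure lborel (\<Union>x\<in>C k. ball x (5 * d k x))"
    using C(3)[OF k] mono[of 0 "Suc k"] by (intro emeasure_mono) (auto intro!: borel_open open_UN simp: subset_iff)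
   also have "\<dots> <= ennreal (?v * 5 ^ CARD('m) / c) * emeasure N (F k)"
   proof (rule countable_cover_emeasure[OF C(2)[OF k], where B = "R k"])
    show "disjoint_family_on (R k) (C k)" unfolding disjoint_family_on_def
    proof (intro ballI impI)
     fix x x' assume x: "x \<in> C k" "x' \<in> C k" "x \<noteq> x'"
     then have "ball x (d k x) \<inter> ball x' (d k x') = {}" using C(4)[OF k] unfolding disjoint_family_on_def by blast
     then show "R k x \<inter> R k x' = {}" unfolding R_def by blast
    qed
    fix x assume x: "x \<in> C k"
    note kx = k x
    have "emeasure lborel (ball x (5 * d k x)) = ennreal (?v * (5 * d k x) ^ CARD('m))"
     using d(1)[OF kx] by (subst emeasure_ball_power) (simp_all add: less_imp_le)
    also have "\<dots> = ennreal (?v * 5 ^ CARD('m) / c) * ennreal (c * d k x ^ CARD('m))"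
     using c d(1)[OF kx] by (subst ennreal_mult'[symmetric]) (simp_all add: power_mult_distrib)
    also have "ennreal (c * d k x ^ CARD('m)) <= (\<integral>\<^sup>+X. indicator (R k x) X * ennreal (snd X * (norm (G X))^2) \<partial>lebesgue)"
     unfolding R_def by (rule en[OF Hb G d(1)[OF kx] dxy[OF kx] _ hi[OF kx] lo[OF kx]]) (simp add: s_def)
    also have "\<dots> = (\<integral>\<^sup>+X. f X * indicator (R k x) X \<partial>lebesgue)"
    proof (intro nn_integral_cong)
     fix X
     show "indicator (R k x) X * ennreal (snd X * (norm (G X))^2) = f X * indicator (R k x) X"
     proof (cases "X \<in> R k x")
      case True
      then have "X \<in> half_space" using RV(2)[OF kx] by (rule subsetD[rotated])
      then show ?thesis using True by (simp add: f_def)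
     qed simp
    qed
    also have "\<dots> = emeasure N (R k x)" by (rule Nf[symmetric, OF Rb])
    finally show "emeasure lborel (ball x (5 * d k x)) <= ennreal (?v * 5 ^ CARD('m) / c) * emeasure N (R k x)" by (simp add: mult_left_mono)
   qed (use setsN Rb FN[OF k] in \<open>auto simp: F_def\<close>)
   finally show ?thesis .
  qed
  have disjF: "disjoint_family_on F {..<J}" unfolding disjoint_family_on_def
  proof (intro ballI impI)
   fix k k' assume k: "k \<in> {..<J}" "k' \<in> {..<J}" "k \<noteq> k'"
   have "R k x \<inter> R k' x' = {}" if "x \<in> C k" "x' \<in> C k'" for x x'
    using Rdisj[of k x k' x'] Rdisj[of k' x' k x] k that by (cases "k < k'") (auto simp: Int_commute)
   then show "F k \<inter> F k' = {}" unfolding F_def by blast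
  qed
  have VJ: "V J \<times> {0..a} \<in> sets borel" using Vb by (intro borel_Times) auto
  have "of_nat J * emeasure lborel (V 0) = (\<Sum>k<J. emeasure lborel (V 0))" by simp
  also have "\<dots> <= (\<Sum>k<J. ennreal (?v * 5 ^ CARD('m) / c) * emeasure N (F k))" by (intro sum_mono level) simp
  also have "\<dots> = ennreal (?v * 5 ^ CARD('m) / c) * (\<Sum>k<J. emeasure N (F k))" by (simp add: sum_distrib_left)
  also have "(\<Sum>k<J. emeasure N (F k)) = emeasure N (\<Union>k<J. F k)" by (rule sum_emeasure[OF _ disjF]) (use FN in auto)
  also have "\<dots> <= emeasure N (V J \<times> {0..a})" using RV(1) setsN[OF VJ] by (intro emeasure_mono) (auto simp: F_def)
  also have "\<dots> = (\<integral>\<^sup>+X. f X * indicator (V J \<times> {0..a}) X \<partial>lebesgue)" by (rule Nf[OF VJ])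
  also have "\<dots> <= (\<integral>\<^sup>+X. indicator (V J \<times> {0..a}) X * ennreal (snd X * (norm (G X))^2) \<partial>lebesgue)"
   by (intro nn_integral_mono) (auto simp: f_def snd_in_half_space split: split_indicator)
  finally show ?thesis by (simp add: mult_left_mono)
 qed
 note * = this
 show ?thesis by (rule bexI[OF _ Hb], intro conjI[OF HV] allI impI, rule *)
qed

section \<open>Thick sets are charged, and the A-infinity property\<close>

text \<open>If E had measure below \<alpha>, an open superset in the ball with measure still below
  \<alpha> starts the chain of layers, each obtained by adding a shadow at heights below a.
  \<open>layers_energy\<close> then yields J times the volume of E within the budget of the Carleson
  condition.\<close>

lemma thick_sets_charged:
 assumes L: "0 <= L" and K: "K < \<infinity>" and \<epsilon>: "0 < \<epsilon>"
 shows "\<exists>\<alpha>>0. \<forall>(\<omega> :: 'm::finite poles) E x0 r. adm L \<omega> \<and> carleson_condition 1 K \<omega> \<and> E \<in> sets borel \<and>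
   0 < r \<and> E \<subseteq> ball x0 r \<and> ennreal (\<epsilon> * r ^ CARD('m)) < emeasure lborel E --> \<alpha> <= measure (\<omega> (x0, r)) E"
proof -
 define n where "n = CARD('m)"
 obtain K' where K': "0 <= K'" "K = ennreal K'" using K by (cases K) auto
 have e8: "(0::real) < 1 / 8" by simp
 show ?thesis using measure_small_near_zero_data[OF L e8, where 'm = 'm]
 proof (elim exE conjE, goal_cases)
 case (1 M)
 note M = 1(1) and nz = 1(2)
 show ?thesis using oscillation_energy[OF L M, where 'm = 'm]
 proof (elim exE conjE, goal_cases)
 case (1 c)
 note c = 1(1) and en = 1(2)
 define b where "b = 200 * M"
 have b: "0 < b" "200 <= b" using M by (simp_all add: b_def)
 show ?thesis using shadow_growth[OF L e8 b(1), where 'm = 'm]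
 proof (elim exE conjE, goal_cases)
 case (1 C1 N1)
 note C1 = 1(1) and N1 = 1(2) and gr = 1(3)
 define k0 where "k0 = unit_ball_vol (real n) * 5 ^ n / c"
 have k0: "0 < k0" using c by (simp add: k0_def)
 \<comment> \<open>J layers need energy at least J \<epsilon> r^n / \<open>k0\<close>, and the
   Carleson condition on the doubled cube of side 8r provides at most K' (8r)^n.\<close>
 obtain J where J: "k0 * (K' * 8 ^ n) < real J * \<epsilon>" using reals_Archimedean3[OF \<epsilon>] by blast
 have "0 <= k0 * (K' * 8 ^ n)" using k0 K' by simp
 then have J0: "1 <= J" using J by (cases J) auto
 \<comment> \<open>With a = r/D the J enlargements, each by at most (b + M) a, move the set by at
   most r, N1 a \<le> r admits (x0, r) as pole in \<open>shadow_growth\<close>, and a \<le>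
   r/200.\<close>
 define D where "D = real J * (b + M) + N1"
 have JbM: "1 * (b + M) <= real J * (b + M)" using J0 b M by (intro mult_right_mono) auto
 have D: "200 <= D" "real J * (b + M) <= D" "N1 <= D"
 proof -
  have "200 <= real J * (b + M)" by (rule order_trans[OF _ JbM]) (use b M in simp)
  then show "200 <= D" "real J * (b + M) <= D" "N1 <= D" unfolding D_def using N1 by linarith+
 qed
 define \<rho> where "\<rho> = 1 / D"
 have \<rho>: "0 < \<rho>" "\<rho> <= 1 / 200" "real J * (b + M) * \<rho> <= 1" "N1 * \<rho> <= 1" using D by (simp_all add: \<rho>_def field_simps)
 have \<kappa>: "0 < 5 * \<rho>" "5 * \<rho> <= 1" and t78: "(0::real) < 7 / 8" using \<rho> by simp_all
 show ?thesis using measure_harnack[OF L t78 \<kappa>, where 'm = 'm]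
 proof (elim exE conjE, goal_cases)
 case (1 c2)
 note c2 = 1(1) and qh = 1(2)
 \<comment> \<open>Adding a shadow multiplies the measure by at most 1 + C1, so starting below
   \<alpha> all J layers remain below the Harnack constant c2.\<close>
 define \<alpha> where "\<alpha> = c2 / (1 + C1) ^ J"
 have \<alpha>: "0 < \<alpha>" using c2 C1 by (simp add: \<alpha>_def)
 show ?thesis
 proof (rule exI[of _ \<alpha>], intro conjI[OF \<alpha>] allI impI, elim conjE, goal_cases)
 case (1 \<omega> E x0 r)
 note adm = 1(1) and carl = 1(2) and E = 1(3) and r = 1(4) and Er = 1(5) and big = 1(6)
 show ?case
 proof (rule ccontr)
  assume "\<not> \<alpha> <= measure (\<omega> (x0, r)) E"
  then have less: "0 < \<alpha> - measure (\<omega> (x0, r)) E" by simp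
  have X0: "(x0, r) \<in> half_space" using r by (simp add: snd_in_half_space)
  obtain K0 U where "open U" "E \<subseteq> U" and U: "measure (\<omega> (x0, r)) U < measure (\<omega> (x0, r)) E + (\<alpha> - measure (\<omega> (x0, r)) E)"
   by (rule finite_borel_regular[OF adm_measure(1,2)[OF adm X0] E less])
  define E0 where "E0 = U \<inter> ball x0 r"
  have E0: "open E0" "E \<subseteq> E0" "E0 \<subseteq> ball x0 r" using \<open>open U\<close> \<open>E \<subseteq> U\<close> Er by (auto simp: E0_def)
  have "measure (\<omega> (x0, r)) E0 <= measure (\<omega> (x0, r)) U"
   by (rule adm_measure_mono[OF adm X0]) (use \<open>open U\<close> in \<open>auto simp: E0_def\<close>)
  then have E0\<alpha>: "measure (\<omega> (x0, r)) E0 < \<alpha>" using U by simp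
  define a where "a = \<rho> * r"
  have a: "0 < a" "N1 * a <= r" "a <= r / 200" "real J * ((b + M) * a) <= r"
   using \<rho> r mult_right_mono[OF \<rho>(3), of r] mult_right_mono[OF \<rho>(4), of r] mult_right_mono[OF \<rho>(2), of r] by (simp_all add: a_def mult.assoc)
  define sh where "sh A = A \<union> shadow \<omega> {..<a} b (1 / 8) A" for A
  define V where "V k = (sh ^^ k) E0" for k
  have V0: "V 0 = E0" and VS: "V (Suc k) = V k \<union> shadow \<omega> {..<a} b (1 / 8) (V k)" for k by (simp_all add: V_def sh_def)
  have Vopen: "open (V k)" for k by (induction k) (simp_all add: V0 VS E0 open_Un open_shadow)
  then have Vb: "V k \<in> sets borel" for k by simp
  have nz': "measure (\<omega> (x, t)) B <= 1 / 8" if "B \<in> sets borel" "0 < t" "B \<inter> ball x (M * t) = {}" for B x t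
   by (intro nz[rule_format, of \<omega> B t x] conjI adm that)
  have Vball: "V k \<subseteq> ball x0 (r + real k * ((b + M) * a))" for k
  proof (induction k)
   case 0
   then show ?case using E0 by (simp add: V0)
  next
   case (Suc k)
   have le: "r + real k * ((b + M) * a) + (b + M) * a = r + real (Suc k) * ((b + M) * a)" by (simp add: algebra_simps)
   have pos: "0 <= (b + M) * a" using b M a by simp
   show ?case
   proof
    fix x assume "x \<in> V (Suc k)"
    then consider "x \<in> V k" | "x \<in> shadow \<omega> {..<a} b (1 / 8) (V k)" unfolding VS by auto
    then show "x \<in> ball x0 (r + real (Suc k) * ((b + M) * a))"
    proof cases
     case 1
     then have "dist x0 x < r + real k * ((b + M) * a)" using Suc by auto
     then show ?thesis using le pos by simp
    next
     case 2
     then obtain y s where ys: "0 < s" "s \<in> {..<a}" "1 / 8 < measure (\<omega> (y, s)) (V k)" "dist y x < b * s" by (rule shadowE)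
     then have "V k \<inter> ball y (M * s) \<noteq> {}" using nz'[OF Vb ys(1), of k y] by linarith
     then obtain z where z: "z \<in> V k" "dist y z < M * s" by auto
     have "dist x0 z < r + real k * ((b + M) * a)" using Suc z(1) by auto
     moreover have "(b + M) * s <= (b + M) * a" using ys b M by (intro mult_left_mono) auto
     ultimately have "dist x0 x < r + real k * ((b + M) * a) + (b + M) * a"
      using dist_triangle[of x0 x z] dist_triangle[of z x y] ys(4) z(2) by (simp add: dist_commute distrib_right)
     then show ?thesis using le by simp
    qed
   qed
  qed
  have V2: "V k \<subseteq> ball x0 (2 * r)" if "k <= J" for k
  proof -
   have "real k * ((b + M) * a) <= real J * ((b + M) * a)" using that b M a by (intro mult_right_mono) auto
   then have "ball x0 (r + real k * ((b + M) * a)) \<subseteq> ball x0 (2 * r)" using a by (intro subset_ball) linarith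
   then show ?thesis using Vball[of k] by simp
  qed
  have growth: "measure (\<omega> (x0, r)) (V k) <= (1 + C1) ^ k * measure (\<omega> (x0, r)) E0" for k
  proof (induction k)
   case 0
   then show ?case by (simp add: V0)
  next
   case (Suc k)
   have "measure (\<omega> (x0, r)) (V (Suc k)) <= measure (\<omega> (x0, r)) (V k) + measure (\<omega> (x0, r)) (shadow \<omega> {..<a} b (1 / 8) (V k))"
    unfolding VS by (rule measure_Un_le) (simp_all add: adm_measure(1)[OF adm X0] Vb open_shadow borel_open)
   also have "measure (\<omega> (x0, r)) (shadow \<omega> {..<a} b (1 / 8) (V k)) <= C1 * measure (\<omega> (x0, r)) (V k)"
    by (intro gr[rule_format, of \<omega> "V k" "(x0, r)" a] conjI adm Vb X0 a) (simp add: a)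
   also have "measure (\<omega> (x0, r)) (V k) + C1 * measure (\<omega> (x0, r)) (V k) = (1 + C1) * measure (\<omega> (x0, r)) (V k)"
    by (simp add: algebra_simps)
   also have "\<dots> <= (1 + C1) * ((1 + C1) ^ k * measure (\<omega> (x0, r)) E0)" using C1 Suc by (intro mult_left_mono) auto
   finally show ?case by (simp add: mult.assoc)
  qed
  have small: "measure (\<omega> (x0, r)) (V k) < c2" if "k <= J" for k
  proof -
   have "(1 + C1) ^ k <= (1 + C1) ^ J" using C1 that by (intro power_increasing) auto
   then have "(1 + C1) ^ k * measure (\<omega> (x0, r)) E0 <= (1 + C1) ^ J * measure (\<omega> (x0, r)) E0" by (intro mult_right_mono) auto
   also have "\<dots> < (1 + C1) ^ J * \<alpha>" using E0\<alpha> C1 by (intro mult_strict_left_mono) auto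
   also have "\<dots> = c2" using C1 by (simp add: \<alpha>_def)
   finally show ?thesis using growth[of k] by linarith
  qed
  have VU: "V k \<noteq> UNIV" for k using Vball[of k] bounded_subset[OF bounded_ball, of UNIV x0] not_bounded_UNIV[where 'a = "real ^ 'm"] by auto
  \<comment> \<open>A ball of radius 20 M a in \<open>V k\<close> would give \<open>V k\<close>
    measure 7/8 at height 20a above its centre, hence at least c2 at (x0, r) by Harnack, which the
    smallness of the layer forbids.\<close>
  have rad: "infdist x (- V k) < 20 * M * a" if k: "k <= J" and x: "x \<in> V k" for k x
  proof (rule ccontr)
   assume "\<not> ?thesis"
   then have "M * (20 * a) <= infdist x (- V k)" by simp
   then have "ball x (M * (20 * a)) \<subseteq> V k" using infdist_Compl(2)[OF Vopen VU] subset_ball by (meson order_trans)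
   then have "measure (\<omega> (x, 20 * a)) (- V k) <= 1 / 8" using Vb[of k] a by (intro nz') auto
   moreover have Z: "(x, 20 * a) \<in> half_space" using a by (simp add: snd_in_half_space)
   ultimately have "7 / 8 <= measure (\<omega> (x, 20 * a)) (V k)" using adm_measure_Compl[OF adm Z Vb, of k] by simp
   moreover have "dist (x, 20 * a) (x0, r) <= snd (x, 20 * a) / (5 * \<rho>)"
   proof -
    have "dist x0 x < 2 * r" using V2[OF k] x by auto
    moreover have "dist (x, 20 * a) (x0, 20 * a) = dist x x0" by (simp add: dist_prod_def)
    ultimately have "dist (x, 20 * a) (x0, r) <= 4 * r"
     using dist_triangle[of "(x, 20 * a)" "(x0, r)" "(x0, 20 * a)"] a r by (simp add: dist_point dist_commute)
    also have "4 * r = snd (x, 20 * a) / (5 * \<rho>)" using \<rho> by (simp add: a_def)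
    finally show ?thesis .
   qed
   moreover have "5 * \<rho> * snd (x, 20 * a) <= snd (x0, r)"
   proof -
    have "5 * \<rho> * (20 * a) <= 1 * (20 * a)" using \<kappa> a by (intro mult_right_mono) auto
    also have "\<dots> <= r" using a r by simp
    finally show ?thesis by simp
   qed
   ultimately have "c2 <= measure (\<omega> (x0, r)) (V k)" by (intro qh[rule_format, of \<omega> "V k" "(x, 20 * a)" "(x0, r)"] conjI adm Vb Z)
   then show False using small[OF k] by simp
  qed
  have step: "ball y (200 * M * s) \<subseteq> V (Suc k)" if "0 < s" "s < a" "1 / 8 < measure (\<omega> (y, s)) (V k)" for k y s
   unfolding VS b_def[symmetric] by (rule le_supI2, rule ball_subset_shadow) (use that in auto)
  have "\<exists>H\<in>sets borel. H \<subseteq> V J \<and> (\<forall>G. has_weak_gradient half_space (dsol \<omega> (indicator H)) G -->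
   of_nat J * emeasure lborel (V 0) <= ennreal (unit_ball_vol (real CARD('m)) * 5 ^ CARD('m) / c) *
    (\<integral>\<^sup>+X. indicator (V J \<times> {0..a}) X * ennreal (snd X * (norm (G X))^2) \<partial>lebesgue))"
  proof (rule layers_energy[where V = V and \<omega> = \<omega>, OF adm M c nz' _ Vopen VU _ step rad])
   show "V k \<subseteq> V (Suc k)" for k unfolding VS by simp
   show "ennreal (c * d ^ CARD('m)) <= (\<integral>\<^sup>+X. indicator (ball x d \<times> {s / 4 .. 2 * s}) X * ennreal (snd X * (norm (G X))^2) \<partial>lebesgue)"
    if "H \<in> sets borel" "has_weak_gradient half_space (dsol \<omega> (indicator H)) G" "0 < d" "dist x y = d / 2" "s = d / (8 * M)"
     "3 / 4 <= measure (\<omega> (x, s)) H" "measure (\<omega> (y, s)) H <= 1 / 4" for H G x y d s by (rule en[rule_format, of \<omega> H G d x y s])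
     (intro conjI adm that)
  qed
  then obtain H where H: "H \<in> sets borel" "H \<subseteq> V J" and HG0: "\<forall>G. has_weak_gradient half_space (dsol \<omega> (indicator H)) G -->
   of_nat J * emeasure lborel (V 0) <= ennreal (unit_ball_vol (real CARD('m)) * 5 ^ CARD('m) / c) * (\<integral>\<^sup>+X. indicator (V J \<times> {0..a}) X * ennreal (snd X * (norm (G X))^2) \<partial>lebesgue)"
   by (elim bexE conjE) (rule that)
  note HG = HG0[folded n_def, folded k0_def]
  have "ball x0 (2 * r) \<subseteq> cube x0 (4 * r)" "ball x0 (4 * r) \<subseteq> cube x0 (8 * r)"
   using ball_subset_cube[of x0 "4 * r"] ball_subset_cube[of x0 "8 * r"] by simp_all
  moreover have "ball x0 (2 * r) \<subseteq> ball x0 (4 * r)" using r by (intro subset_ball) simp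
  ultimately have VJ: "V J \<subseteq> cube x0 (4 * r)" "V J \<subseteq> cube x0 (8 * r)" using V2[of J] by auto
  have r4: "0 < 4 * r" using r by simp
  \<comment> \<open>Here \<gamma> = 1 enters: H lies in the cube of side 4r, and the energy is
    controlled over the cube of side 8r, which contains the layers.\<close>
  obtain G where G: "has_weak_gradient half_space (dsol \<omega> (indicator H)) G"
   and I: "(\<integral>\<^sup>+X\<in>carleson_box x0 ((1 + 1) * (4 * r)). ennreal (snd X * (norm (G X))^2) \<partial>lebesgue)
       / emeasure lebesgue (cube x0 ((1 + 1) * (4 * r))) <= K"
   using carl[unfolded carleson_condition_def, THEN spec[of _ x0], THEN spec[of _ "4 * r"], THEN spec[of _ H], THEN mp, OF conjI[OF r4 conjI[OF H(1) order_trans[OF H(2) VJ(1)]]]]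
   by (elim exE conjE) (rule that)
  have eight: "(1 + 1) * (4 * r) = 8 * r" by simp
  have vol: "emeasure lebesgue (cube x0 (8 * r)) = ennreal ((8 * r) ^ n)" using r by (simp add: emeasure_cube n_def cube_open borel_open)
  have "(\<integral>\<^sup>+X. indicator (V J \<times> {0..a}) X * ennreal (snd X * (norm (G X))^2) \<partial>lebesgue) \<le>
    (\<integral>\<^sup>+X\<in>carleson_box x0 (8 * r). ennreal (snd X * (norm (G X))^2) \<partial>lebesgue)"
   using VJ(2) a r by (intro nn_integral_mono) (auto simp: carleson_box_def subset_iff split: split_indicator)
  also have "\<dots> = (\<integral>\<^sup>+X\<in>carleson_box x0 (8 * r). ennreal (snd X * (norm (G X))^2) \<partial>lebesgue) / ennreal ((8 * r) ^ n) * ennreal ((8 * r) ^ n)"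
   using r by (simp add: ennreal_divide_times)
  also have "\<dots> <= K * ennreal ((8 * r) ^ n)" using I unfolding eight vol by (intro mult_right_mono) auto
  finally have I2: "(\<integral>\<^sup>+X. indicator (V J \<times> {0..a}) X * ennreal (snd X * (norm (G X))^2) \<partial>lebesgue) <= K * ennreal ((8 * r) ^ n)" .
  have "ennreal (real J * (\<epsilon> * r ^ n)) = of_nat J * ennreal (\<epsilon> * r ^ n)"
   using \<epsilon> r by (simp add: ennreal_mult' ennreal_of_nat_eq_real_of_nat)
  also have "\<dots> <= of_nat J * emeasure lborel (V 0)"
   using big E0(2) emeasure_mono[of E E0 lborel] E0(1) by (intro mult_left_mono) (auto simp: V0 n_def)
  also have "\<dots> <= ennreal k0 * (K * ennreal ((8 * r) ^ n))"
   using HG[THEN spec[of _ G], THEN mp, OF G] I2 by (meson mult_left_mono order_trans zero_le)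
  also have "\<dots> = ennreal (k0 * (K' * (8 * r) ^ n))" unfolding K'(2) using k0 K'(1) r by (simp add: ennreal_mult'[symmetric])
  finally have "real J * (\<epsilon> * r ^ n) <= k0 * (K' * (8 * r) ^ n)" using k0 K'(1) r by (simp add: ennreal_le_iff)
  then have "(real J * \<epsilon>) * r ^ n <= (k0 * (K' * 8 ^ n)) * r ^ n" by (simp add: power_mult_distrib mult.assoc)
  then show False using J r by (simp add: mult_le_cancel_right)
 qed
 qed
 qed
 qed
 qed
 qed
qed

lemma cube_subset_ball: "0 < l ==> cube (c :: real ^ 'm::finite) l \<subseteq> ball c (real CARD('m) * l)"
proof
 fix x assume l: "0 < l" and "x \<in> cube c l"
 then have "\<bar>(x - c) $ i\<bar> <= l / 2" for i by (simp add: cube_def less_imp_le)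
 then have "(\<Sum>i\<in>UNIV. \<bar>(x - c) $ i\<bar>) <= real CARD('m) * (l / 2)" using sum_bounded_above[of UNIV "\<lambda>i. \<bar>(x - c) $ i\<bar>" "l / 2"] by simp
 then have "norm (x - c) <= real CARD('m) * (l / 2)" using norm_le_l1_cart[of "x - c"] by linarith
 also have "\<dots> < real CARD('m) * l" using l by simp
 finally show "x \<in> ball c (real CARD('m) * l)" by (simp add: dist_norm norm_minus_commute)
qed

text \<open>If E fills the share \<epsilon> of the small cube, it has measure at least \<alpha> from
  the pole (c', \<rho>) at the scale of that cube. If the given pole is far from the small cube,
  \<open>measure_comparison\<close> preserves the share up to 1/C; if it is near, the cubes are of
  comparable size and Harnack bounds the measure of E below by c2 outright.\<close>

lemma A_infinity_of_carleson:
 fixes \<omega> :: "'m::finite poles"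
 assumes L: "0 <= L" and K: "K < \<infinity>" and adm: "adm L \<omega>" and carl: "carleson_condition 1 K \<omega>" and l: "0 < l"
 shows "A_infinity (cube c l) (\<omega> (c, l))" unfolding A_infinity_def
proof
 fix \<epsilon> :: real assume \<epsilon>: "\<epsilon> \<in> {0<..<1}"
 define n where "n = CARD('m)"
 have n: "1 <= real n" "0 < n" using one_le_card_finite[where 'a = 'm] by (auto simp: n_def)
 \<comment> \<open>The cube of side l' is placed in a ball of radius n l', which costs n^n in
   density; the factor 2 makes the inequality strict.\<close>
 have \<epsilon>': "0 < \<epsilon> / (2 * real n ^ n)" using \<epsilon> n by simp
 obtain \<alpha> where \<alpha>: "0 < \<alpha>" and thick: "\<forall>(\<omega> :: 'm poles) E x0 r. adm L \<omega> \<and> carleson_condition 1 K \<omega> \<and> E \<in> sets borel \<and>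
   0 < r \<and> E \<subseteq> ball x0 r \<and> ennreal (\<epsilon> / (2 * real n ^ n) * r ^ CARD('m)) < emeasure lborel E --> \<alpha> <= measure (\<omega> (x0, r)) E"
  using thick_sets_charged[OF L K \<epsilon>', where 'm = 'm] by (elim exE conjE) (rule that)
 obtain C where C: "0 < C" and cp: "\<forall>(\<omega> :: 'm poles) E z r X. adm L \<omega> \<and> E \<in> sets borel \<and> E \<subseteq> ball z r \<and>
   0 < r \<and> \<alpha> <= measure (\<omega> (z, r)) E \<and> X \<in> half_space \<and> 2 * r <= dist (z, 0) X --> measure (\<omega> X) (ball z r) <= C * measure (\<omega> X) E"
  using measure_comparison[OF L \<alpha>, where 'm = 'm] by (elim exE conjE) (rule that)
 have \<kappa>: "0 < 1 / (3 * real n)" "1 / (3 * real n) <= 1" using n by simp_all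
 obtain c2 where c2: "0 < c2" and qh: "\<forall>(\<omega> :: 'm poles) E X Y. adm L \<omega> \<and> E \<in> sets borel \<and>
   X \<in> half_space \<and> dist X Y <= snd X / (1 / (3 * real n)) \<and> 1 / (3 * real n) * snd X <= snd Y \<and> \<alpha> <= measure (\<omega> X) E --> c2 <= measure (\<omega> Y) E"
  using measure_harnack[OF L \<alpha> \<kappa>, where 'm = 'm] by (elim exE conjE) (rule that)
 have X: "(c, l) \<in> half_space" using l by (simp add: snd_in_half_space)
 define \<delta> where "\<delta> = min (1 / 2) (min (1 / C) c2)"
 have \<delta>: "0 < \<delta>" "\<delta> < 1" "\<delta> <= 1 / C" "\<delta> <= c2" using C c2 by (auto simp: \<delta>_def)
 have main: "measure lebesgue E / measure lebesgue (cube c' l') < \<epsilon>"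
  if l': "0 < l'" and sub: "cube c' l' \<subseteq> cube c l" and E: "E \<in> sets borel" "E \<subseteq> cube c' l'"
   and less: "measure (\<omega> (c, l)) E / measure (\<omega> (c, l)) (cube c' l') < \<delta>" for c' l' E
 proof (rule ccontr)
  assume neg: "\<not> ?thesis"
  let ?Q = "cube c' l'"
  have Qb: "?Q \<in> sets borel" by (simp add: cube_open borel_open)
  have volQ: "measure lborel ?Q = l' ^ n" using l' by (simp add: measure_def emeasure_cube n_def)
  have fin: "emeasure lborel E < \<infinity>"
   using emeasure_mono[OF E(2), of lborel] Qb l' by (simp add: emeasure_cube less_top[symmetric] top_unique) (metis ennreal_neq_top neq_top_trans)
  have "\<epsilon> * l' ^ n <= measure lborel E" using neg E Qb l' by (simp add: not_less volQ pos_le_divide_eq)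
  moreover have "0 < \<epsilon> * l' ^ n" using \<epsilon> l' by simp
  ultimately have "ennreal (\<epsilon> / 2 * l' ^ n) < ennreal (measure lborel E)" by (intro ennreal_lessI) auto
  also have "\<dots> = emeasure lborel E" using fin by (simp add: emeasure_eq_ennreal_measure)
  finally have big: "ennreal (\<epsilon> / (2 * real n ^ n) * (real n * l') ^ CARD('m)) < emeasure lborel E"
   using n by (simp add: n_def[symmetric] power_mult_distrib)
  define \<rho> where "\<rho> = real n * l'"
  have \<rho>: "0 < \<rho>" using n l' by (simp add: \<rho>_def)
  have Q\<rho>: "?Q \<subseteq> ball c' \<rho>" using cube_subset_ball[OF l', of c'] by (simp add: \<rho>_def n_def)
  have "\<alpha> <= measure (\<omega> (c', \<rho>)) E"
   by (intro thick[rule_format, of \<omega> E \<rho> c'] conjI adm carl E(1) \<rho> order_trans[OF E(2) Q\<rho>])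
    (use big in \<open>simp add: \<rho>_def\<close>)
  note charged = this
  have Z: "(c', \<rho>) \<in> half_space" using \<rho> by (simp add: snd_in_half_space)
  \<comment> \<open>A quotient with denominator 0 is 0 and would satisfy the hypothesis vacuously,
    so the measure must be shown to be positive. The Harnack constant may depend on the two poles
    here.\<close>
  have pos: "0 < measure (\<omega> (c, l)) E"
  proof -
   define \<kappa>1 where "\<kappa>1 = min 1 (min (\<rho> / (dist (c', \<rho>) (c, l) + 1)) (l / \<rho>))"
   have \<kappa>1: "0 < \<kappa>1" "\<kappa>1 <= 1" "\<kappa>1 <= \<rho> / (dist (c', \<rho>) (c, l) + 1)" "\<kappa>1 <= l / \<rho>"
    using \<rho> l by (auto simp: \<kappa>1_def intro!: divide_pos_pos add_nonneg_pos)
   obtain c3 where c3: "0 < c3" and qh3: "\<forall>(\<omega> :: 'm poles) E X Y. adm L \<omega> \<and> E \<in> sets borel \<and>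
     X \<in> half_space \<and> dist X Y <= snd X / \<kappa>1 \<and> \<kappa>1 * snd X <= snd Y \<and> \<alpha> <= measure (\<omega> X) E --> c3 <= measure (\<omega> Y) E"
    using measure_harnack[OF L \<alpha> \<kappa>1(1,2), where 'm = 'm] by (elim exE conjE) (rule that)
   have d: "0 < dist (c', \<rho>) (c, l) + 1" by (intro add_nonneg_pos) auto
   have "\<kappa>1 * (dist (c', \<rho>) (c, l) + 1) <= \<rho>" using \<kappa>1(3) d by (simp add: pos_le_divide_eq)
   then have "dist (c', \<rho>) (c, l) <= snd (c', \<rho>) / \<kappa>1" using \<kappa>1(1) by (simp add: pos_le_divide_eq algebra_simps)
   moreover have "\<kappa>1 * snd (c', \<rho>) <= snd (c, l)" using \<kappa>1(4) \<rho> by (simp add: pos_le_divide_eq)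
   ultimately have "c3 <= measure (\<omega> (c, l)) E" by (intro qh3[rule_format, of \<omega> E "(c', \<rho>)" "(c, l)"] conjI adm E(1) Z charged)
   then show ?thesis using c3 by simp
  qed
  have EQ: "measure (\<omega> (c, l)) E <= measure (\<omega> (c, l)) ?Q" by (rule adm_measure_mono[OF adm X Qb E(2)])
  then have lt: "measure (\<omega> (c, l)) E < \<delta> * measure (\<omega> (c, l)) ?Q" using less pos by (simp add: pos_divide_less_eq)
  show False
  proof (cases "2 * \<rho> <= dist (c', 0) (c, l)")
   case True
   have "measure (\<omega> (c, l)) ?Q <= measure (\<omega> (c, l)) (ball c' \<rho>)" by (rule adm_measure_mono[OF adm X _ Q\<rho>]) simp
   also have "\<dots> <= C * measure (\<omega> (c, l)) E" by (intro cp[rule_format, of \<omega> E c' \<rho> "(c, l)"]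
      conjI adm E(1) order_trans[OF E(2) Q\<rho>] \<rho> charged X True)
   finally have "1 / C * measure (\<omega> (c, l)) ?Q <= measure (\<omega> (c, l)) E" using C by (simp add: pos_divide_le_eq mult.commute)
   moreover have "\<delta> * measure (\<omega> (c, l)) ?Q <= 1 / C * measure (\<omega> (c, l)) ?Q" by (intro mult_right_mono \<delta>) simp
   ultimately show False using lt by linarith
  next
   case False
   have "l' <= l"
   proof (rule ccontr)
    assume "\<not> l' <= l"
    then have "l ^ n < l' ^ n" using l n by (intro power_strict_mono) auto
    moreover have "ennreal (l' ^ n) <= ennreal (l ^ n)"
     using emeasure_mono[OF sub, of lborel] l l' by (simp add: emeasure_cube n_def cube_open borel_open)
    ultimately show False using l by (simp add: ennreal_le_iff)
   qed
   then have "\<rho> <= real n * l" unfolding \<rho>_def by (intro mult_left_mono) auto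
   then have "1 / (3 * real n) * \<rho> <= 1 / (3 * real n) * (real n * l)" using n by (intro mult_left_mono) auto
   then have k1: "1 / (3 * real n) * snd (c', \<rho>) <= snd (c, l)" using n l by simp
   have "dist (c', \<rho>) (c, l) <= 3 * \<rho>" using False dist_triangle[of "(c', \<rho>)" "(c, l)" "(c', 0)"] \<rho> by (simp add: dist_point)
   also have "3 * \<rho> <= snd (c', \<rho>) / (1 / (3 * real n))" using n \<rho> mult_right_mono[of 1 "real n" \<rho>] by simp
   finally have "c2 <= measure (\<omega> (c, l)) E" by (intro qh[rule_format, of \<omega> E "(c', \<rho>)" "(c, l)"] conjI adm E(1) Z charged k1)
   moreover have "\<delta> * measure (\<omega> (c, l)) ?Q <= c2 * 1" using \<delta> c2 adm_measure_le_1[OF adm X] by (intro mult_mono) auto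
   ultimately show False using lt by linarith
  qed
 qed
 note * = this
 have \<delta>': "\<delta> \<in> {0<..<1}" using \<delta> by simp
 show "\<exists>\<delta>\<in>{0<..<1}. \<forall>c' l' E. 0 < l' \<and> cube c' l' \<subseteq> cube c l \<and> E \<in> sets borel \<and> E \<subseteq> cube c' l' -->
    measure (\<omega> (c, l)) E / measure (\<omega> (c, l)) (cube c' l') < \<delta> --> measure lebesgue E / measure lebesgue (cube c' l') < \<epsilon>"
  by (rule bexI[OF _ \<delta>'], intro allI impI, elim conjE, rule *; assumption)
qed

section \<open>Nontangential maximal functions\<close>

lemma dsol_mono:
 fixes f g :: "real ^ 'm::finite => real"
 assumes "adm L \<omega>" "X \<in> half_space" "f \<in> \<B>" "g \<in> \<B>"
  and "\<And>x. \<bar>f x\<bar> <= B" "\<And>x. \<bar>g x\<bar> <= B" "\<And>x. f x <= g x"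
 shows "dsol \<omega> f X <= dsol \<omega> g X" unfolding solution_with_data_def
 by (intro integral_mono adm_integrable[OF assms(1,2,3,5)] adm_integrable[OF assms(1,2,4,6)] assms(7))

lemma dsol_le_measure:
 assumes "adm L \<omega>" "X \<in> half_space" "g \<in> \<B>" "E \<in> sets borel"
  and "\<forall>y. 0 <= g y \<and> g y <= 1" "\<forall>y. y \<notin> E --> g y = 0"
 shows "dsol \<omega> g X <= measure (\<omega> X) E" unfolding dsol_indicator[OF assms(1,2,4), symmetric]
 by (rule dsol_mono[OF assms(1-3), where B = 1]) (use assms in \<open>auto simp: indicator_def\<close>)

lemma measure_le_dsol:
 assumes "adm L \<omega>" "X \<in> half_space" "g \<in> \<B>" "E \<in> sets borel"
  and "\<forall>y. 0 <= g y \<and> g y <= 1" "\<forall>y\<in>E. g y = 1"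
 shows "measure (\<omega> X) E <= dsol \<omega> g X" unfolding dsol_indicator[OF assms(1,2,4), symmetric]
 by (rule dsol_mono[OF assms(1,2) _ assms(3), where B = 1]) (use assms in \<open>auto simp: indicator_def\<close>)

section \<open>Fattening of open sets\<close>

text \<open>If V filled less than half of the ball, the remainder would be thick and hence charged
  by \<alpha>, so V would be seen from (y, s) with measure at most 1 - \<alpha>.\<close>

lemma charged_sets_thick:
 assumes L: "0 <= L" and K: "K < \<infinity>"
 shows "\<exists>\<alpha>>0. \<alpha> < 1 \<and> (\<forall>(\<omega> :: 'm::finite poles) V y s. adm L \<omega> \<and> carleson_condition 1 K \<omega> \<and> V \<in> sets borel \<and>
   0 < s \<and> 1 - \<alpha> < measure (\<omega> (y, s)) V --> emeasure lborel (ball y s) <= 2 * emeasure lborel (V \<inter> ball y s))"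
proof -
 define v where "v = unit_ball_vol (real CARD('m))"
 have v: "0 < v" "0 < v / 4" by (simp_all add: v_def)
 show ?thesis using thick_sets_charged[OF L K v(2), where 'm = 'm]
 proof (elim exE conjE, goal_cases)
 case (1 \<alpha>)
 note \<alpha> = 1(1) and thick = 1(2)
 have \<alpha>': "0 < min \<alpha> (1 / 2)" "min \<alpha> (1 / 2) < 1" using \<alpha> by auto
 show ?thesis
 proof (rule exI[of _ "min \<alpha> (1 / 2)"], intro conjI[OF \<alpha>'(1)] conjI[OF \<alpha>'(2)] allI impI, elim conjE, goal_cases)
 case (1 \<omega> V y s)
 note adm = 1(1) and carl = 1(2) and V = 1(3) and s = 1(4) and big = 1(5)
 show ?case
 proof (rule ccontr)
  assume neg: "\<not> ?thesis"
  have Y: "(y, s) \<in> half_space" using s by (simp add: snd_in_half_space)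
  let ?B = "ball y s"
  have eB: "emeasure lborel ?B = ennreal (v * s ^ CARD('m))" using s by (simp add: emeasure_ball_power v_def)
  have fin: "emeasure lborel A = ennreal (measure lborel A)" if "A \<subseteq> ?B" for A
  proof (rule emeasure_eq_ennreal_measure)
   have "emeasure lborel A <= emeasure lborel ?B" by (rule emeasure_mono[OF that]) simp
   then show "emeasure lborel A \<noteq> top" by (auto simp: eB top_unique)
  qed
  have "emeasure lborel (?B \<inter> V) + emeasure lborel (?B - V) = emeasure lborel ?B"
   using plus_emeasure[of "?B \<inter> V" lborel "?B - V"] V by (simp add: Int_Diff_Un Int_Diff_disjoint)
  then have "measure lborel (?B \<inter> V) + measure lborel (?B - V) = v * s ^ CARD('m)"
   unfolding eB using v s by (simp add: fin ennreal_plus[symmetric] del: ennreal_plus)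
  moreover have "2 * measure lborel (?B \<inter> V) < v * s ^ CARD('m)"
  proof -
   have "ennreal (2 * measure lborel (?B \<inter> V)) = 2 * emeasure lborel (V \<inter> ?B)" by (simp add: fin ennreal_mult' Int_commute)
   also have "\<dots> < ennreal (v * s ^ CARD('m))" using neg unfolding eB by (simp only: not_le)
   finally show ?thesis by (simp add: ennreal_less_iff)
  qed
  moreover have "0 < v * s ^ CARD('m)" using v s by simp
  ultimately have "v / 4 * s ^ CARD('m) < measure lborel (?B - V)" "0 < measure lborel (?B - V)" by simp_all
  then have lt: "ennreal (v / 4 * s ^ CARD('m)) < emeasure lborel (?B - V)" by (simp add: fin ennreal_lessI)
  have Eb: "?B - V \<in> sets borel" using V by auto
  have "\<alpha> <= measure (\<omega> (y, s)) (?B - V)" by (intro thick[rule_format, of \<omega> "?B - V" s y] conjI adm carl Eb s lt Diff_subset)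
  also have "\<dots> <= measure (\<omega> (y, s)) (- V)" by (rule adm_measure_mono[OF adm Y]) (use V in auto)
  also have "\<dots> = 1 - measure (\<omega> (y, s)) V" by (rule adm_measure_Compl[OF adm Y V])
  finally show False using big by simp
 qed
 qed
 qed
qed

text \<open>A ball under a pole of the shadow has at least half of its volume in V, so finite volume
  of V bounds the heights, as Vitali's lemma needs, and the disjoint balls are paid for by V
  itself.\<close>

lemma shadow_volume:
 fixes \<omega> :: "'m::finite poles"
 assumes V: "V \<in> sets borel" "emeasure lborel V < \<infinity>" and b: "1 <= b"
  and thick: "\<And>y s. 0 < s ==> \<tau> < measure (\<omega> (y, s)) V ==> emeasure lborel (ball y s) <= 2 * emeasure lborel (V \<inter> ball y s)"
 shows "\<exists>T. \<forall>y s. 0 < s \<and> \<tau> < measure (\<omega> (y, s)) V --> s <= T"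
  and "emeasure lborel (shadow \<omega> UNIV b \<tau> V) <= ennreal (2 * (5 * b) ^ CARD('m)) * emeasure lborel V"
proof -
 define v where "v = unit_ball_vol (real CARD('m))"
 have v: "0 < v" by (simp add: v_def)
 have eB: "emeasure lborel (ball y s) = ennreal (v * s ^ CARD('m))" if "0 <= s" for y :: "real ^ 'm" and s
  using that by (simp add: emeasure_ball_power v_def)
 define T where "T = 1 + 2 * measure lborel V / v"
 have fin: "emeasure lborel V = ennreal (measure lborel V)" using V by (intro emeasure_eq_ennreal_measure) auto
 have T: "s <= T" if s: "0 < s" "\<tau> < measure (\<omega> (y, s)) V" for y s
 proof (cases "s <= 1")
  case True
  then show ?thesis using v by (simp add: T_def add_increasing2)
 next
  case False
  have "ennreal (v * s ^ CARD('m)) <= 2 * emeasure lborel (V \<inter> ball y s)" using thick[OF s] s(1) by (simp add: eB)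
  also have "\<dots> <= 2 * emeasure lborel V" using V by (intro mult_left_mono emeasure_mono) auto
  also have "\<dots> = ennreal (2 * measure lborel V)" by (simp add: fin ennreal_mult')
  finally have "v * s ^ CARD('m) <= 2 * measure lborel V" by (simp add: ennreal_le_iff)
  then have "s ^ CARD('m) <= 2 * measure lborel V / v" using v by (simp add: pos_le_divide_eq mult.commute)
  moreover have "s <= s ^ CARD('m)" using False by (intro self_le_power) auto
  ultimately show ?thesis by (simp add: T_def)
 qed
 then show "\<exists>T. \<forall>y s. 0 < s \<and> \<tau> < measure (\<omega> (y, s)) V --> s <= T" by auto
 define I where "I = {(y, s). 0 < s \<and> \<tau> < measure (\<omega> (y, s)) V}"
 have I: "0 < snd i" "\<tau> < measure (\<omega> i) V" "snd i <= T" if "i \<in> I" for i using that T by (auto simp: I_def)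
 have S: "shadow \<omega> UNIV b \<tau> V \<subseteq> (\<Union>i\<in>I. ball (fst i) (b * snd i))" by (force simp: shadow_def I_def)
 have r: "0 < b * snd i \<and> b * snd i <= b * T" if "i \<in> I" for i using I[OF that] b by simp
 obtain C where C: "countable C" "C \<subseteq> I" "pairwise (\<lambda>i j. disjnt (ball (fst i) (b * snd i)) (ball (fst j) (b * snd j))) C"
  and cover: "shadow \<omega> UNIV b \<tau> V \<subseteq> (\<Union>i\<in>C. ball (fst i) (5 * (b * snd i)))"
  by (rule Vitali_covering_lemma_balls[OF S r])
 have "emeasure lborel (shadow \<omega> UNIV b \<tau> V) <= emeasure lborel (\<Union>i\<in>C. ball (fst i) (5 * (b * snd i)))"
  by (rule emeasure_mono[OF cover]) (simp add: borel_open open_UN)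
 also have "\<dots> <= ennreal (2 * (5 * b) ^ CARD('m)) * emeasure lborel V"
 proof (rule countable_cover_emeasure[OF C(1), where B = "\<lambda>i. V \<inter> ball (fst i) (snd i)"])
  have le: "ball (fst i) (snd i) \<subseteq> ball (fst i) (b * snd i)" if "i \<in> C" for i using I(1)[of i] that C(2) b by (intro subset_ball) auto
  show "disjoint_family_on (\<lambda>i. V \<inter> ball (fst i) (snd i)) C" unfolding disjoint_family_on_def
  proof (intro ballI impI)
   fix i j assume ij: "i \<in> C" "j \<in> C" "i \<noteq> j"
   then have "disjnt (ball (fst i) (b * snd i)) (ball (fst j) (b * snd j))" by (rule pairwiseD[OF C(3)])
   then show "(V \<inter> ball (fst i) (snd i)) \<inter> (V \<inter> ball (fst j) (snd j)) = {}" using le[OF ij(1)] le[OF ij(2)] unfolding disjnt_def by blast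
  qed
  fix i assume "i \<in> C"
  note i = I(1,2)[OF subsetD[OF C(2) this]]
  have "emeasure lborel (ball (fst i) (5 * (b * snd i))) = ennreal ((5 * b) ^ CARD('m)) * emeasure lborel (ball (fst i) (snd i))"
  proof -
   have "v * (5 * (b * snd i)) ^ CARD('m) = (5 * b) ^ CARD('m) * (v * snd i ^ CARD('m))" by (simp add: power_mult_distrib)
   moreover have "0 <= (5 * b) ^ CARD('m)" "0 <= 5 * (b * snd i)" using i(1) b by simp_all
   ultimately show ?thesis using i(1) by (simp only: eB ennreal_mult' less_imp_le)
  qed
  also have "\<dots> <= ennreal ((5 * b) ^ CARD('m)) * (2 * emeasure lborel (V \<inter> ball (fst i) (snd i)))"
   using thick[of "snd i" "fst i"] i by (intro mult_left_mono) auto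
  also have "\<dots> = ennreal (2 * (5 * b) ^ CARD('m)) * emeasure lborel (V \<inter> ball (fst i) (snd i))"
   using b by (simp add: ennreal_mult' mult_ac)
  finally show "emeasure lborel (ball (fst i) (5 * (b * snd i))) <= ennreal (2 * (5 * b) ^ CARD('m)) * emeasure lborel (V \<inter> ball (fst i) (snd i))" .
 qed (use V in auto)
 finally show "emeasure lborel (shadow \<omega> UNIV b \<tau> V) <= ennreal (2 * (5 * b) ^ CARD('m)) * emeasure lborel V" .
qed

text \<open>Maximum principle on the region where V is seen with less than 1 - \<alpha>/2. On its
  upper boundary the fat set V' contains the ball of radius M s and is seen with at least 1 -
  \<alpha>/4, so the quotient of these two numbers works as factor; on the bottom the limiting data
  are at most 1 - \<alpha>/2. Both sets are replaced by continuous data g and h.\<close>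

lemma shadow_comparison:
 fixes \<omega> :: "'m::finite poles"
 assumes L: "0 <= L" and adm: "adm L \<omega>" and \<alpha>: "0 < \<alpha>" "\<alpha> < 1" and M: "1 <= M"
  and nz: "\<And>E x t. E \<in> sets borel ==> 0 < t ==> E \<inter> ball x (M * t) = {} ==> measure (\<omega> (x, t)) E <= \<alpha> / 4"
  and V: "open V" "open V'" "V \<subseteq> V'" and fat: "\<And>y s. 0 < s ==> 1 - \<alpha> < measure (\<omega> (y, s)) V ==> ball y (2 * M * s) \<subseteq> V'"
  and T: "\<And>y s. 0 < s ==> 1 - \<alpha> < measure (\<omega> (y, s)) V ==> s <= T"
  and X0: "X0 \<in> half_space" "measure (\<omega> X0) V <= 1 - \<alpha>"
 shows "measure (\<omega> X0) V <= (1 - \<alpha> / 2) / (1 - \<alpha> / 4) * measure (\<omega> X0) V'"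
proof (rule field_le_epsilon)
 fix d :: real assume d: "0 < d"
 define e where "e = min (d / 2) (1 / 4)"
 have e: "0 < e" "e <= d / 2" "e <= 1 / 4" using d by (auto simp: e_def)
 define \<kappa> where "\<kappa> = (1 - \<alpha> / 2) / (1 - \<alpha> / 4)"
 have \<kappa>: "0 < \<kappa>" "\<kappa> * (1 - \<alpha> / 4) = 1 - \<alpha> / 2" "1 - \<alpha> / 2 <= \<kappa>" using \<alpha> by (auto simp: \<kappa>_def field_simps)
 have Vb: "V \<in> sets borel" "V' \<in> sets borel" using V by auto
 obtain g where g: "ccs g" "\<forall>y. 0 <= g y \<and> g y <= 1" "\<forall>y. y \<notin> V --> g y = 0" "\<bar>dsol \<omega> g X0 - measure (\<omega> X0) V\<bar> < e"
  by (rule adm_approx[OF adm X0(1) X0(1) Vb(1) order_refl V(1) e(1)])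
 have gc: "continuous_on UNIV g" "compact (closure {x. g x \<noteq> 0})" using g(1) by (auto simp: continuous_compact_support_def)
 have dc: "continuous_on half_space (dsol \<omega> g)" and lim: "(dsol \<omega> g \<longlongrightarrow> g x) (at (x, 0) within half_space)" for x
  using adm[unfolded adm_def, THEN conjunct2, THEN spec[of _ g], THEN mp, OF g(1)] by simp_all
 have gV: "dsol \<omega> g X <= measure (\<omega> X) V" if "X \<in> half_space" for X
  by (rule dsol_le_measure[OF adm that ccs_measurable[OF g(1)] Vb(1) g(2,3)])
 \<comment> \<open>The level 1 - \<alpha>/2 lies between 1 - \<alpha>, which X0 does not exceed, and
   1 - \<alpha>/4, which V' attains; both gaps are needed.\<close>
 define \<Sigma> where "\<Sigma> = {X \<in> half_space. 1 - \<alpha> / 2 <= dsol \<omega> g X}"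
 have \<Sigma>V: "0 < s" "1 - \<alpha> < measure (\<omega> (y, s)) V" if "(y, s) \<in> \<Sigma>" for y s
  using that gV[of "(y, s)"] \<alpha> by (auto simp: \<Sigma>_def snd_in_half_space)
 have \<Sigma>cl: "(0 < s \<and> (y, s) \<in> \<Sigma>) \<or> (s = 0 \<and> 1 - \<alpha> / 2 <= g y)" if ys: "(y, s) \<in> closure \<Sigma>" for y s
 proof -
  have "closure \<Sigma> \<subseteq> {X. 0 <= snd X}"
   by (rule closure_minimal) (auto simp: \<Sigma>_def snd_in_half_space intro!: closed_Collect_le continuous_intros)
  then have "0 <= s" using ys by auto
  moreover have "(y, s) \<in> \<Sigma>" if "0 < s"
  proof -
   have Y: "(y, s) \<in> half_space" using that by (simp add: snd_in_half_space)
   have "closedin (top_of_set half_space) \<Sigma>"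
    unfolding \<Sigma>_def by (rule continuous_closedin_preimage[OF dc closed_atLeast[of "1 - \<alpha> / 2"], unfolded vimage_def, simplified Int_def, simplified])
   then show ?thesis using ys Y by (auto simp: closedin_closed dest: closure_minimal[THEN subsetD, rotated])
  qed
  moreover have "1 - \<alpha> / 2 <= g y" if "s = 0"
  proof -
   have 1: "(dsol \<omega> g \<longlongrightarrow> g y) (at (y, 0) within \<Sigma>)" by (rule tendsto_within_subset[OF lim]) (auto simp: \<Sigma>_def)
   have "(y, 0) \<notin> \<Sigma>" by (auto simp: \<Sigma>_def snd_in_half_space)
   then have "at (y, 0) within \<Sigma> \<noteq> bot" using ys that by (simp add: trivial_limit_within islimpt_in_closure)
   moreover have "\<forall>\<^sub>F X in at (y, 0) within \<Sigma>. 1 - \<alpha> / 2 <= dsol \<omega> g X" by (auto simp: eventually_at_filter \<Sigma>_def)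
   ultimately show ?thesis using tendsto_lowerbound[OF 1] by blast
  qed
  ultimately show ?thesis by (cases "s = 0") auto
 qed
 obtain R where R: "{x. g x \<noteq> 0} \<subseteq> ball 0 R"
  using bounded_subset_ballD[OF bounded_subset[OF compact_imp_bounded[OF gc(2)] closure_subset], of 0] by blast
 have gne: "open {x. g x \<noteq> 0}"
 proof -
  have "open (- {x. g x = 0})" using closed_Collect_eq[OF gc(1) continuous_on_const] by (rule open_Compl)
  then show ?thesis by (simp add: Compl_eq)
 qed
 have "bounded \<Sigma>"
 proof (rule boundedI)
  fix X assume X: "X \<in> \<Sigma>"
  obtain y s where ys: "X = (y, s)" by (cases X)
  have s: "0 < s" "s <= T" using \<Sigma>V[of y s] T[of s y] X by (auto simp: ys)
  have "dsol \<omega> g X <= measure (\<omega> X) {x. g x \<noteq> 0}"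
   by (rule dsol_le_measure[OF adm _ ccs_measurable[OF g(1)] borel_open[OF gne] g(2)]) (use X in \<open>auto simp: \<Sigma>_def\<close>)
  then have "\<alpha> / 4 < measure (\<omega> (y, s)) {x. g x \<noteq> 0}" using X \<alpha> by (auto simp: \<Sigma>_def ys)
  then have "{x. g x \<noteq> 0} \<inter> ball y (M * s) \<noteq> {}" using nz[OF borel_open[OF gne] s(1), of y] by linarith
  then obtain z where z: "g z \<noteq> 0" "dist y z < M * s" by auto
  have "norm z < R" using R z(1) by auto
  then have "norm y <= R + M * s" using z(2) norm_triangle_ineq2[of y z] by (simp add: dist_norm)
  moreover have "M * s <= M * T" using s M by (intro mult_left_mono) auto
  ultimately show "norm X <= R + M * T + T" using norm_Pair_le[of y s] s by (simp add: ys)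
 qed
 then have cS: "compact (closure \<Sigma>)" by (simp add: compact_closure)
 \<comment> \<open>The union of the closed balls of radius M s over the closure of \<Sigma>, written
   as a continuous image of a compact set, so that a single h equals 1 on all of them.
   \<open>fat\<close> provides twice the radius, which accommodates the closed balls.\<close>
 define K1 where "K1 = (\<lambda>(X, w). fst X + (M * snd X) *\<^sub>R w) ` (closure \<Sigma> \<times> cball 0 1)"
 define K2 where "K2 = {x. e <= g x}"
 have "compact K1" unfolding K1_def case_prod_unfold by (intro compact_continuous_image compact_Times cS compact_cball continuous_intros)
 moreover have "compact K2"
 proof -
  have "closed K2" unfolding K2_def by (intro closed_Collect_le continuous_on_const gc(1))
  moreover have "bounded K2" by (rule bounded_subset[OF bounded_ball[of 0 R]]) (use R e in \<open>auto simp: K2_def subset_iff\<close>)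
  ultimately show ?thesis by (simp add: compact_eq_bounded_closed)
 qed
 moreover have "K1 \<subseteq> V'"
 proof
  fix x assume "x \<in> K1"
  then obtain y s w where x: "(y, s) \<in> closure \<Sigma>" "norm w <= 1" "x = y + (M * s) *\<^sub>R w" by (auto simp: K1_def)
  from \<Sigma>cl[OF x(1)] show "x \<in> V'"
  proof
   assume s: "0 < s \<and> (y, s) \<in> \<Sigma>"
   have Ms: "0 < M * s" using s M by simp
   have "dist y x = M * s * norm w" using Ms by (simp add: x(3) dist_norm)
   also have "\<dots> <= M * s * 1" using Ms x(2) by (intro mult_left_mono) auto
   finally have "x \<in> ball y (2 * M * s)" using Ms by simp
   then show ?thesis using fat[OF \<Sigma>V[of y s]] s by blast
  next
   assume s: "s = 0 \<and> 1 - \<alpha> / 2 <= g y"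
   then have "g y \<noteq> 0" using \<alpha> by auto
   then show ?thesis using s g(3) V(3) x(3) by auto
  qed
 qed
 moreover have "K2 \<subseteq> V'" using g(3) V(3) e by (auto simp: K2_def)
 ultimately have KK: "compact (K1 \<union> K2)" "K1 \<union> K2 \<subseteq> V'" by auto
 obtain h where h: "ccs h" "\<forall>y. 0 <= h y \<and> h y <= 1" "\<forall>y\<in>K1 \<union> K2. h y = 1" "\<forall>y. y \<notin> V' --> h y = 0"
  by (rule ccs_urysohn[OF KK(1) V(2) KK(2)])
 define f where "f x = 1 * g x + (- \<kappa>) * h x" for x
 have f: "ccs f" unfolding f_def[abs_def] by (rule ccs_lincomb[OF g(1) h(1)])
 have fs: "dsol \<omega> f X = dsol \<omega> g X - \<kappa> * dsol \<omega> h X" if "X \<in> half_space" for X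
  using dsol_lincomb[OF adm that g(1) h(1), of 1 "- \<kappa>"] by (simp add: f_def[abs_def])
 define \<Omega> where "\<Omega> = half_space \<inter> {X. dsol \<omega> g X < 1 - \<alpha> / 2}"
 have op: "open \<Omega>"
  using continuous_open_preimage[OF dc open_half_space open_lessThan[of "1 - \<alpha> / 2"]] by (simp add: \<Omega>_def vimage_def lessThan_def)
 have main: "dsol \<omega> f X0 <= e"
 proof (rule maximum_principle[OF L adm f op])
  show "\<Omega> \<subseteq> half_space" by (simp add: \<Omega>_def)
  show "X0 \<in> \<Omega>" using X0 gV[OF X0(1)] \<alpha> by (simp add: \<Omega>_def)
  show "f x <= e" if cl: "(x, 0) \<in> closure \<Omega>" for x
  proof (cases "e <= g x")
   case True
   have 1: "(dsol \<omega> g \<longlongrightarrow> g x) (at (x, 0) within \<Omega>)" by (rule tendsto_within_subset[OF lim]) (auto simp: \<Omega>_def)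
   have "(x, 0) \<notin> \<Omega>" by (auto simp: \<Omega>_def snd_in_half_space)
   then have "at (x, 0) within \<Omega> \<noteq> bot" using cl by (simp add: trivial_limit_within islimpt_in_closure)
   moreover have "\<forall>\<^sub>F X in at (x, 0) within \<Omega>. dsol \<omega> g X <= 1 - \<alpha> / 2" by (auto simp: eventually_at_filter \<Omega>_def)
   ultimately have "g x <= 1 - \<alpha> / 2" using tendsto_upperbound[OF 1] by blast
   moreover have "h x = 1" using h(3) True by (auto simp: K2_def)
   ultimately show ?thesis using \<kappa> e by (simp add: f_def)
  next
   case False
   have "0 <= \<kappa> * h x" using \<kappa> h(2) by simp
   then show ?thesis using False by (simp add: f_def)
  qed
  show "dsol \<omega> f X <= e" if X: "X \<in> half_space" "X \<notin> \<Omega>" "X \<in> closure \<Omega>" for X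
  proof -
   have X\<Sigma>: "X \<in> \<Sigma>" using X by (auto simp: \<Omega>_def \<Sigma>_def)
   have le: "dsol \<omega> g X <= 1 - \<alpha> / 2"
   proof -
    have "isCont (dsol \<omega> g) X" using dc X(1) continuous_on_eq_continuous_at[OF open_half_space] by blast
    then have 1: "(dsol \<omega> g \<longlongrightarrow> dsol \<omega> g X) (at X within \<Omega>)" unfolding isCont_def by (rule tendsto_within_subset) simp
    have "at X within \<Omega> \<noteq> bot" using X by (simp add: trivial_limit_within islimpt_in_closure)
    moreover have "\<forall>\<^sub>F X in at X within \<Omega>. dsol \<omega> g X <= 1 - \<alpha> / 2" by (auto simp: eventually_at_filter \<Omega>_def)
    ultimately show ?thesis using tendsto_upperbound[OF 1] by blast
   qed
   obtain y s where ys: "X = (y, s)" by (cases X)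
   have s: "0 < s" using X(1) by (simp add: ys snd_in_half_space)
   have sub: "ball y (M * s) \<subseteq> K1"
   proof
    fix x assume "x \<in> ball y (M * s)"
    then have nx: "norm (x - y) < M * s" by (simp add: dist_norm norm_minus_commute)
    have Ms: "0 < M * s" using s M by simp
    have "norm (inverse (M * s) *\<^sub>R (x - y)) = norm (x - y) / (M * s)" using Ms by (simp only: norm_scaleR real_norm_def abs_inverse abs_of_pos divide_inverse mult.commute)
    also have "\<dots> <= 1" using Ms nx by simp
    finally have n1: "inverse (M * s) *\<^sub>R (x - y) \<in> cball 0 1" by (simp only: mem_cball_0)
    have "M * s * inverse (M * s) = 1" using Ms by (intro right_inverse) linarith
    then have "x = (\<lambda>(X, w). fst X + (M * snd X) *\<^sub>R w) ((y, s), inverse (M * s) *\<^sub>R (x - y))"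
     by (simp only: case_prod_conv fst_conv snd_conv scaleR_scaleR) simp
    then show "x \<in> K1" unfolding K1_def by (rule image_eqI[OF _ SigmaI[OF subsetD[OF closure_subset X\<Sigma>[unfolded ys]] n1]])
   qed
   have Kb: "K1 \<in> sets borel" using \<open>compact K1\<close> by (simp add: compact_imp_closed)
   have Kc: "- K1 \<in> sets borel" using Kb by auto
   have "measure (\<omega> X) (- K1) <= \<alpha> / 4" unfolding ys by (rule nz[OF Kc s]) (use sub in auto)
   then have "1 - \<alpha> / 4 <= measure (\<omega> X) K1" using adm_measure_Compl[OF adm X(1) Kb] by simp
   also have "\<dots> <= dsol \<omega> h X" by (rule measure_le_dsol[OF adm X(1) ccs_measurable[OF h(1)] Kb h(2)]) (use h(3) in auto)
   finally have "\<kappa> * (1 - \<alpha> / 4) <= \<kappa> * dsol \<omega> h X" using \<kappa> by (intro mult_left_mono) auto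
   then show ?thesis using fs[OF X(1)] le \<kappa>(2) e by linarith
  qed
 qed
 have "\<kappa> * dsol \<omega> h X0 <= \<kappa> * measure (\<omega> X0) V'"
  using dsol_le_measure[OF adm X0(1) ccs_measurable[OF h(1)] Vb(2) h(2,4)] \<kappa> by (intro mult_left_mono) auto
 then show "measure (\<omega> X0) V <= (1 - \<alpha> / 2) / (1 - \<alpha> / 4) * measure (\<omega> X0) V' + d"
  unfolding \<kappa>_def[symmetric] using main fs[OF X0(1)] g(4) e by linarith
qed

text \<open>V' costs a bounded factor in volume, and from any pole over a point outside V', within
  aperture b, V is seen with only the fraction \<kappa> of V'. An aperture b > 1 includes the closed
  cones of aperture 1.\<close>

definition fattening :: "('m::finite poles) => real => real => real => (real ^ 'm) set => (real ^ 'm) set => bool" where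
 "fattening \<omega> b \<kappa> C V V' \<longleftrightarrow> open V' \<and> V \<subseteq> V' \<and> emeasure lborel V' <= ennreal C * emeasure lborel V \<and>
   (\<forall>z y s. z \<notin> V' \<and> 0 < s \<and> dist y z < b * s --> measure (\<omega> (y, s)) V <= \<kappa> * measure (\<omega> (y, s)) V')"

text \<open>V' is V with its full shadow at threshold 1 - \<alpha> and aperture b = 2M. A pole whose
  ball of radius b s reaches outside V' cannot exceed the threshold, so
  \<open>shadow_comparison\<close> applies at it.\<close>

lemma ex_fattening:
 assumes L: "0 <= L" and K: "K < \<infinity>"
 shows "\<exists>b \<kappa> C. 1 < b \<and> 0 < \<kappa> \<and> \<kappa> < 1 \<and> 0 < C \<and> (\<forall>(\<omega> :: 'm::finite poles) V. adm L \<omega> \<and> carleson_condition 1 K \<omega> \<and>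
   open V \<and> emeasure lborel V < \<infinity> --> (\<exists>V'. fattening \<omega> b \<kappa> C V V'))"
proof -
 show ?thesis using charged_sets_thick[OF L K, where 'm = 'm]
 proof (elim exE conjE, goal_cases)
 case (1 \<alpha>)
 note \<alpha> = 1(1,2) and thick = 1(3)
 have \<alpha>4: "0 < \<alpha> / 4" using \<alpha> by simp
 show ?thesis using measure_small_near_zero_data[OF L \<alpha>4, where 'm = 'm]
 proof (elim exE conjE, goal_cases)
 case (1 M)
 note M = 1(1) and nz = 1(2)
 define b where "b = 2 * M"
 define C where "C = 1 + 2 * (5 * b) ^ CARD('m)"
 define \<kappa> where "\<kappa> = (1 - \<alpha> / 2) / (1 - \<alpha> / 4)"
 have b: "1 < b" and C: "0 < C" and \<kappa>: "0 < \<kappa>" "\<kappa> < 1" using M \<alpha> by (auto simp: b_def C_def \<kappa>_def add_pos_nonneg)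
 show ?thesis
 proof (rule exI[of _ b], rule exI[of _ \<kappa>], rule exI[of _ C], intro conjI[OF b] conjI[OF \<kappa>(1)] conjI[OF \<kappa>(2)] conjI[OF C] allI impI, elim conjE, goal_cases)
 case (1 \<omega> V)
 note adm = 1(1) and carl = 1(2) and V = 1(3,4)
 show ?case
 proof -
  have Vb: "V \<in> sets borel" using V by simp
  have th: "emeasure lborel (ball y s) <= 2 * emeasure lborel (V \<inter> ball y s)" if "0 < s" "1 - \<alpha> < measure (\<omega> (y, s)) V" for y s
   by (intro thick[rule_format, of \<omega> V s y] conjI adm carl Vb that)
  have nz': "measure (\<omega> (x, t)) B <= \<alpha> / 4" if "B \<in> sets borel" "0 < t" "B \<inter> ball x (M * t) = {}" for B x t
   by (intro nz[rule_format, of \<omega> B t x] conjI adm that)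
  have "\<exists>T. \<forall>y s. 0 < s \<and> 1 - \<alpha> < measure (\<omega> (y, s)) V --> s <= T"
   by (rule shadow_volume(1)[OF Vb V(2) less_imp_le[OF b] th])
  then obtain T where T: "\<forall>y s. 0 < s \<and> 1 - \<alpha> < measure (\<omega> (y, s)) V --> s <= T" by (rule exE)
  define V' where "V' = V \<union> shadow \<omega> UNIV b (1 - \<alpha>) V"
  have V': "open V'" "V \<subseteq> V'" using V by (auto simp: V'_def open_shadow)
  have fat: "ball y (b * s) \<subseteq> V'" if "0 < s" "1 - \<alpha> < measure (\<omega> (y, s)) V" for y s
   unfolding V'_def by (rule le_supI2, rule ball_subset_shadow) (use that in auto)
  have "emeasure lborel V' <= emeasure lborel V + emeasure lborel (shadow \<omega> UNIV b (1 - \<alpha>) V)"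
   unfolding V'_def by (rule emeasure_subadditive) (simp_all add: Vb borel_open open_shadow)
  also have "\<dots> <= emeasure lborel V + ennreal (2 * (5 * b) ^ CARD('m)) * emeasure lborel V"
   by (intro add_left_mono shadow_volume(2)[OF Vb V(2) less_imp_le[OF b] th])
  also have "\<dots> = ennreal C * emeasure lborel V" using b by (simp add: C_def distrib_right)
  finally have vol: "emeasure lborel V' <= ennreal C * emeasure lborel V" .
  have "measure (\<omega> (y, s)) V <= \<kappa> * measure (\<omega> (y, s)) V'" if z: "z \<notin> V'" "0 < s" "dist y z < b * s" for z y s
   unfolding \<kappa>_def
  proof (rule shadow_comparison[OF L adm \<alpha> M nz' V(1) V'])
   show "ball y (2 * M * s) \<subseteq> V'" if "0 < s" "1 - \<alpha> < measure (\<omega> (y, s)) V" for y s using fat[OF that] by (simp add: b_def)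
   show "s <= T" if "0 < s" "1 - \<alpha> < measure (\<omega> (y, s)) V" for y s using T that by blast
   show "(y, s) \<in> half_space" using z by (simp add: snd_in_half_space)
   show "measure (\<omega> (y, s)) V <= 1 - \<alpha>"
   proof (rule ccontr)
    assume "\<not> ?thesis"
    then have "ball y (b * s) \<subseteq> V'" by (intro fat z) simp
    then show False using z by auto
   qed
  qed
  then show ?thesis unfolding fattening_def using V' vol by blast
 qed
 qed
 qed
 qed
qed

lemma fattening_trans:
 assumes 1: "fattening \<omega> b \<kappa> C V V'" and 2: "fattening \<omega> b \<kappa>' C' V' V''" and \<kappa>: "0 <= \<kappa>" and C: "0 <= C" "0 <= C'"
 shows "fattening \<omega> b (\<kappa> * \<kappa>') (C' * C) V V''" unfolding fattening_def
proof (intro conjI allI impI, goal_cases)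
 case 3
 have "emeasure lborel V'' <= ennreal C' * emeasure lborel V'" using 2 by (simp add: fattening_def)
 also have "\<dots> <= ennreal C' * (ennreal C * emeasure lborel V)" using 1 by (intro mult_left_mono) (simp_all add: fattening_def)
 finally show ?case using C by (simp add: ennreal_mult' mult.assoc)
next
 case (4 z y s)
 then have z: "z \<notin> V''" "0 < s" "dist y z < b * s" by auto
 then have "z \<notin> V'" using 2 by (auto simp: fattening_def)
 then have "measure (\<omega> (y, s)) V <= \<kappa> * measure (\<omega> (y, s)) V'" using 1 z(2,3) unfolding fattening_def by blast
 also have "\<dots> <= \<kappa> * (\<kappa>' * measure (\<omega> (y, s)) V'')" using 2 z \<kappa> unfolding fattening_def by (intro mult_left_mono) blast+
 finally show ?case by (simp add: mult.assoc)
qed (use 1 2 in \<open>auto simp: fattening_def\<close>)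

lemma ex_fattening_quarter:
 assumes L: "0 <= L" and K: "K < \<infinity>"
 shows "\<exists>b C. 1 < b \<and> 0 < C \<and> (\<forall>(\<omega> :: 'm::finite poles) V. adm L \<omega> \<and> carleson_condition 1 K \<omega> \<and>
   open V \<and> emeasure lborel V < \<infinity> --> (\<exists>V'. fattening \<omega> b (1 / 4) C V V'))"
proof -
 show ?thesis using ex_fattening[OF L K, where 'm = 'm]
 proof (elim exE conjE, goal_cases)
 case (1 b \<kappa> C)
 note b = 1(1) and \<kappa> = 1(2,3) and C = 1(4) and fat = 1(5)
 \<comment> \<open>j successive fattenings multiply the factors; volume grows by C^j, a constant of
   the same kind.\<close>
 obtain j where j: "\<kappa> ^ j < 1 / 4" using real_arch_pow_inv[of "1 / 4" \<kappa>] \<kappa> by auto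
 have Cj: "0 < C ^ j" using C by simp
 show ?thesis
 proof (rule exI[of _ b], rule exI[of _ "C ^ j"], intro conjI[OF b] conjI[OF Cj] allI impI, elim conjE, goal_cases)
 case (1 \<omega> V)
 note adm = 1(1) and carl = 1(2) and V = 1(3,4)
 show ?case
 proof -
  have "\<exists>V'. fattening \<omega> b (\<kappa> ^ i) (C ^ i) V V'" for i
  proof (induction i)
   case 0
   then show ?case using V by (intro exI[of _ V]) (simp add: fattening_def)
  next
   case (Suc i)
   then obtain V' where V': "fattening \<omega> b (\<kappa> ^ i) (C ^ i) V V'" by (rule exE)
   have "emeasure lborel V' <= ennreal (C ^ i) * emeasure lborel V" using V' by (simp add: fattening_def)
   also have "\<dots> < \<infinity>" using V by (simp add: ennreal_mult_less_top)
   finally have fin: "emeasure lborel V' < \<infinity>" .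
   have "open V'" using V' by (simp add: fattening_def)
   then have "\<exists>V''. fattening \<omega> b \<kappa> C V' V''" by (intro fat[rule_format, of \<omega> V'] conjI adm carl fin)
   then obtain V'' where "fattening \<omega> b \<kappa> C V' V''" by (rule exE)
   from fattening_trans[OF V' this] show ?case using \<kappa> C by (intro exI[of _ V'']) (simp add: mult.commute)
  qed
  then obtain V' where V': "fattening \<omega> b (\<kappa> ^ j) (C ^ j) V V'" by (rule exE)
  have mono: "\<kappa> ^ j * measure (\<omega> (y, s)) V' <= 1 / 4 * measure (\<omega> (y, s)) V'" for y s using j by (intro mult_right_mono) auto
  note V'' = V'[unfolded fattening_def]
  have "fattening \<omega> b (1 / 4) (C ^ j) V V'" unfolding fattening_def
   by (intro conjI allI impI V''[THEN conjunct1] V''[THEN conjunct2, THEN conjunct1] V''[THEN conjunct2, THEN conjunct2, THEN conjunct1]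
    order_trans[OF V''[THEN conjunct2, THEN conjunct2, THEN conjunct2, rule_format] mono]; elim conjE; assumption)
  then show ?thesis by (rule exI)
 qed
 qed
 qed
qed

section \<open>Dyadic level sets and the L^p bound\<close>

text \<open>The levels below a form a geometric series dominated by its largest term, because the
  powers at least halve from one level to the next. The subtracted term on the right makes the
  estimate telescope in the induction.\<close>

lemma dyadic_layers_le:
 fixes a B p :: real
 assumes a: "0 <= a" and B: "0 < B" and p: "1 <= p"
 shows "(\<Sum>n<N. (B / 2 ^ n) powr p * (if B / 2 ^ n < a then 1 else 0)) <= 2 * max 0 (a powr p - (B / 2 ^ N) powr p)"
proof (induction N)
 case (Suc N)
 let ?l = "\<lambda>n. (B / 2 ^ n) powr p"
 have "(2::real) powr 1 <= 2 powr p" using p by (intro powr_mono) auto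
 moreover have "?l N = 2 powr p * ?l (Suc N)" using B by (simp add: powr_mult[symmetric] field_simps)
 ultimately have half: "2 * ?l (Suc N) <= ?l N" by (simp add: mult_right_mono)
 show ?case
 proof (cases "B / 2 ^ N < a")
  case True
  have "?l N <= a powr p" using True B p by (intro powr_mono2) auto
  then have m: "max 0 (a powr p - ?l N) = a powr p - ?l N" by (intro max_absorb2) linarith
  have gen: "S + x <= 2 * m'" if "S <= 2 * m" "m = A - x" "2 * y <= x" "A - y <= m'" for S m m' A x y :: real using that by linarith
  have "(\<Sum>n<Suc N. ?l n * (if B / 2 ^ n < a then 1 else 0)) = (\<Sum>n<N. ?l n * (if B / 2 ^ n < a then 1 else 0)) + ?l N" using True by simp
  also have "\<dots> <= 2 * max 0 (a powr p - ?l (Suc N))" by (rule gen[OF Suc.IH m half max.cobounded2])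
  finally show ?thesis .
 next
  case False
  have "a powr p <= ?l N" using False a p by (intro powr_mono2) auto
  then have "(\<Sum>n<Suc N. ?l n * (if B / 2 ^ n < a then 1 else 0)) <= 0" using Suc.IH False by simp
  also have "0 <= 2 * max 0 (a powr p - ?l (Suc N))" by simp
  finally show ?thesis .
 qed
qed simp

lemma nontangential_max_le:
 assumes "\<And>X. X \<in> cone 1 z ==> \<bar>u X\<bar> <= c"
 shows "nontangential_max 1 u z <= c" "0 <= nontangential_max 1 u z"
proof -
 have ne: "(z, 1) \<in> cone 1 z" by (simp add: cone_def half_space_def)
 show "nontangential_max 1 u z <= c" unfolding nontangential_max_def by (rule cSUP_least) (use ne assms in auto)
 have "\<bar>u (z, 1)\<bar> <= nontangential_max 1 u z"
  unfolding nontangential_max_def by (rule cSUP_upper[OF ne]) (use assms in \<open>auto intro!: bdd_aboveI\<close>)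
 then show "0 <= nontangential_max 1 u z" by linarith
qed

text \<open>
 The sets \<open>V n\<close> absorb the level sets \<open>{B / 2^n < \<bar>F\<bar>}\<close>; each fattening gains a factor \<open>1/4\<close> on
 elliptic measure, which beats the growth \<open>2\<close> of the levels.
\<close>

lemma fattened_level_sets:
 fixes \<omega> :: "'m::finite poles"
 assumes adm: "adm L \<omega>" and F: "ccs F" and B: "0 < B" "\<And>x. \<bar>F x\<bar> <= B" and b: "1 < b"
  and V0: "V 0 = {}" and Vb: "\<And>n. V n \<in> sets borel" and fat: "\<And>n. fattening \<omega> b (1 / 4) C ({x. B / 2 ^ Suc n < \<bar>F x\<bar>} \<union> V n) (V (Suc n))"
  and z: "z \<notin> V n"
 shows "nontangential_max 1 (dsol \<omega> F) z <= 5 * (B / 2 ^ n)"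
proof -
 define Os where "Os n = {x. B / 2 ^ n < \<bar>F x\<bar>}" for n
 have Fc: "continuous_on UNIV F" using F by (simp add: continuous_compact_support_def)
 have Oo: "open (Os n)" for n unfolding Os_def by (intro open_Collect_less continuous_intros Fc)
 then have Ob: "Os n \<in> sets borel" for n by simp
 have O0: "Os 0 = {}" using B(2) by (auto simp: Os_def not_less)
 have sub: "V n \<subseteq> V (Suc n)" for n using fat[of n] by (auto simp: fattening_def)
 \<comment> \<open>The constant 4 reproduces itself: in terms of the next level l the old bound
   reads 8 l, the new level adds 2 l, and the fattening factor 1/4 leaves 10/4 \<le> 4.\<close>
 have sum_le: "(\<Sum>k\<le>n. 2 * (B / 2 ^ k) * measure (\<omega> (y, s)) (Os k)) <= 4 * (B / 2 ^ n) * measure (\<omega> (y, s)) (V n)"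
  if "z \<notin> V n" "0 < s" "dist y z < b * s" for n y s using that(1)
 proof (induction n)
  case 0
  then show ?case by (simp add: O0 V0)
 next
  case (Suc n)
  have Y: "(y, s) \<in> half_space" using that by (simp add: snd_in_half_space)
  let ?\<mu> = "measure (\<omega> (y, s))"
  let ?l = "B / 2 ^ Suc n"
  have U: "?\<mu> (V n) <= ?\<mu> (Os (Suc n) \<union> V n)" "?\<mu> (Os (Suc n)) <= ?\<mu> (Os (Suc n) \<union> V n)"
   using Ob Vb by (auto intro!: adm_measure_mono[OF adm Y])
  have decay: "?\<mu> (Os (Suc n) \<union> V n) <= 1 / 4 * ?\<mu> (V (Suc n))"
   using fat[of n] Suc.prems that(2,3) unfolding fattening_def Os_def by blast
  have zn: "z \<notin> V n" using Suc.prems sub by auto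
  have "(\<Sum>k\<le>Suc n. 2 * (B / 2 ^ k) * ?\<mu> (Os k)) <= 4 * (B / 2 ^ n) * ?\<mu> (V n) + 2 * ?l * ?\<mu> (Os (Suc n))"
   using Suc.IH[OF zn] by simp
  also have "4 * (B / 2 ^ n) * ?\<mu> (V n) = 8 * ?l * ?\<mu> (V n)" by simp
  also have "8 * ?l * ?\<mu> (V n) + 2 * ?l * ?\<mu> (Os (Suc n)) <= 8 * ?l * ?\<mu> (Os (Suc n) \<union> V n) + 2 * ?l * ?\<mu> (Os (Suc n) \<union> V n)"
   using U B by (intro add_mono mult_left_mono) auto
  also have "\<dots> = 10 * ?l * ?\<mu> (Os (Suc n) \<union> V n)" by (simp add: algebra_simps)
  also have "\<dots> <= 10 * ?l * (1 / 4 * ?\<mu> (V (Suc n)))" using B by (intro mult_left_mono decay) auto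
  also have "\<dots> <= 4 * ?l * ?\<mu> (V (Suc n))"
  proof -
   have "0 <= ?l * ?\<mu> (V (Suc n))" using B by simp
   then show ?thesis by simp
  qed
  finally show ?case .
 qed
 \<comment> \<open>A dyadic majorant of F: outside \<open>Os n\<close> the bound B / 2^n suffices,
   and each finer level doubles up to the previous one.\<close>
 let ?S = "\<lambda>n x. B / 2 ^ n + (\<Sum>k\<le>n. 2 * (B / 2 ^ k) * indicator (Os k) x)"
 have pt: "\<bar>F x\<bar> <= ?S n x" for n x
 proof (induction n)
  case 0
  then show ?case using B by (simp add: O0)
 next
  case (Suc n)
  have nn: "0 <= (\<Sum>k\<le>n. 2 * (B / 2 ^ k) * indicator (Os k) x)" using B by (intro sum_nonneg) auto
  show ?case
  proof (cases "x \<in> Os (Suc n)")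
   case True
   have "B / 2 ^ n = 2 * (B / 2 ^ Suc n)" by simp
   moreover have "0 <= B / 2 ^ Suc n" using B by simp
   ultimately show ?thesis using Suc True by (simp del: power_Suc)
  next
   case False
   then have "\<bar>F x\<bar> <= B / 2 ^ Suc n" by (simp add: Os_def not_less)
   then show ?thesis using nn False by (simp del: power_Suc)
  qed
 qed
 have "\<bar>dsol \<omega> F X\<bar> <= 5 * (B / 2 ^ n)" if "X \<in> cone 1 z" for X
 proof -
  obtain y s where X: "X = (y, s)" by (cases X)
  have s: "0 < s" "dist y z <= s" using that by (simp_all add: X cone_def half_space_def dist_norm)
  have Y: "X \<in> half_space" using s by (simp add: X snd_in_half_space)
  have "1 * s < b * s" using b s by (intro mult_strict_right_mono) auto
  then have bs: "dist y z < b * s" using s(2) by linarith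
  interpret finite_measure "\<omega> X" by (rule adm_measure(2)[OF adm Y])
  have Os: "Os k \<in> sets (\<omega> X)" for k using Ob by (simp add: adm_measure(1)[OF adm Y])
  have i: "integrable (\<omega> X) (indicator (Os k) :: _ => real)" for k using Os by (auto simp: integrable_indicator_iff less_top[symmetric])
  have iS: "integrable (\<omega> X) (?S n)" by (intro Bochner_Integration.integrable_add integrable_const Bochner_Integration.integrable_sum integrable_mult_right i)
  have "\<bar>dsol \<omega> F X\<bar> <= (LINT x|\<omega> X. \<bar>F x\<bar>)" unfolding solution_with_data_def by (rule integral_abs_bound)
  also have "\<dots> <= (LINT x|\<omega> X. ?S n x)" by (intro integral_mono integrable_abs adm_integrable_ccs[OF adm Y F] iS pt)
  also have "\<dots> = B / 2 ^ n + (\<Sum>k\<le>n. 2 * (B / 2 ^ k) * measure (\<omega> X) (Os k))"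
   using i Os adm_measure(3,4)[OF adm Y] by (simp add: integral_sum)
  also have "(\<Sum>k\<le>n. 2 * (B / 2 ^ k) * measure (\<omega> X) (Os k)) <= 4 * (B / 2 ^ n) * measure (\<omega> X) (V n)"
   unfolding X by (rule sum_le[OF z s(1) bs])
  also have "\<dots> <= 4 * (B / 2 ^ n) * 1" using adm_measure_le_1[OF adm Y] B by (intro mult_left_mono) auto
  finally show ?thesis by simp
 qed
 then show ?thesis by (rule nontangential_max_le(1))
qed

lemma ennreal_term_le_suminf: "f n <= (\<Sum>i. f i :: ennreal)" using sum_le_suminf[OF summableI, of "{n}" f] by simp

text \<open>The maximal function exceeds 5 B / 2^n only on \<open>V n\<close>. The volumes obey a
  recursion with factor D, and weighting by the p-th powers of the levels sums it up to the volumes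
  of the level sets of F, provided the weights fall by a factor of at least 2D.\<close>

lemma nontangential_max_powr_integral:
 assumes L: "0 <= L" and K: "K < \<infinity>"
 shows "\<exists>p0>1. \<forall>p\<ge>p0. \<exists>C::real. 0 < C \<and> (\<forall>(\<omega> :: 'm::finite poles) F. adm L \<omega> \<and> carleson_condition 1 K \<omega> \<and> ccs F -->
   (\<integral>\<^sup>+z. ennreal (\<bar>nontangential_max 1 (dsol \<omega> F) z\<bar> powr p) \<partial>lebesgue) <= ennreal C * (\<integral>\<^sup>+x. ennreal (\<bar>F x\<bar> powr p) \<partial>lebesgue))"
proof -
 show ?thesis using ex_fattening_quarter[OF L K, where 'm = 'm]
 proof (elim exE conjE, goal_cases)
 case (1 b D)
 note b = 1(1) and D = 1(2) and fat = 1(3)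
 \<comment> \<open>p \<ge> log 2 (2D) means that 2^p is at least 2D, so the weights shrink twice as
   fast as the volumes may grow; the maximum with 2 secures p0 > 1.\<close>
 define p0 where "p0 = max 2 (log 2 (2 * D))"
 have main: "(\<integral>\<^sup>+z. ennreal (\<bar>nontangential_max 1 (dsol \<omega> F) z\<bar> powr p) \<partial>lebesgue) <= ennreal (10 powr p * (4 * D)) * (\<integral>\<^sup>+x. ennreal (\<bar>F x\<bar> powr p) \<partial>lebesgue)"
  if p: "p0 <= p" and adm: "adm L \<omega>" and carl: "carleson_condition 1 K \<omega>" and F: "ccs F" for p and \<omega> :: "'m poles" and F
 proof -
  have p1: "1 <= p" "log 2 (2 * D) <= p" using p by (auto simp: p0_def)
  have "2 * D = 2 powr (log 2 (2 * D))" using D by simp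
  also have "\<dots> <= 2 powr p" using p1 by (intro powr_mono) auto
  finally have Dp: "2 * D <= 2 powr p" .
  obtain B where B: "0 < B" "\<And>x. \<bar>F x\<bar> <= B" by (rule ccs_bounded[OF F]) blast
  have Fc: "continuous_on UNIV F" "compact (closure {x. F x \<noteq> 0})" using F by (auto simp: continuous_compact_support_def)
  define Os where "Os n = {x. B / 2 ^ n < \<bar>F x\<bar>}" for n
  have Oo: "open (Os n)" for n unfolding Os_def by (intro open_Collect_less continuous_intros Fc)
  have Ofin: "emeasure lborel (Os n) < \<infinity>" for n
  proof -
   have "0 < B / 2 ^ n" using B by simp
   then have "Os n \<subseteq> {x. F x \<noteq> 0}" by (auto simp: Os_def)
   then have "Os n \<subseteq> closure {x. F x \<noteq> 0}" using closure_subset by (rule order_trans)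
   then have "emeasure lborel (Os n) <= emeasure lborel (closure {x. F x \<noteq> 0})" by (rule emeasure_mono) simp
   also have "\<dots> < \<infinity>" by (rule emeasure_compact_finite[OF Fc(2)])
   finally show ?thesis .
  qed
  \<comment> \<open>The conjunct for n = 0 records the empty starting set inside the invariant of
    the dependent choice.\<close>
  have "\<exists>V. \<forall>n. (open (V n) \<and> emeasure lborel (V n) < \<infinity> \<and> (n = 0 --> V n = {})) \<and> fattening \<omega> b (1 / 4) D (Os (Suc n) \<union> V n) (V (Suc n))"
  proof (rule dependent_nat_choice)
   show "\<exists>V. open V \<and> emeasure lborel V < \<infinity> \<and> ((0::nat) = 0 --> V = {})" by (intro exI[of _ "{}"]) simp
   fix V :: "(real ^ 'm) set" and n :: nat assume "open V \<and> emeasure lborel V < \<infinity> \<and> (n = 0 --> V = {})"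
   then have V: "open V" "emeasure lborel V < \<infinity>" by auto
   have U: "open (Os (Suc n) \<union> V)" using Oo V by auto
   have "emeasure lborel (Os (Suc n) \<union> V) <= emeasure lborel (Os (Suc n)) + emeasure lborel V" using Oo V by (intro emeasure_subadditive) auto
   also have "\<dots> < \<infinity>" using Ofin V by simp
   finally have Ufin: "emeasure lborel (Os (Suc n) \<union> V) < \<infinity>" .
   have "\<exists>V'. fattening \<omega> b (1 / 4) D (Os (Suc n) \<union> V) V'"
    by (intro fat[rule_format, of \<omega> "Os (Suc n) \<union> V"] conjI adm carl U Ufin)
   then obtain V' where V': "fattening \<omega> b (1 / 4) D (Os (Suc n) \<union> V) V'" by (rule exE)
   have "emeasure lborel V' <= ennreal D * emeasure lborel (Os (Suc n) \<union> V)" using V' by (simp add: fattening_def)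
   also have "\<dots> < \<infinity>" using Ufin by (simp add: ennreal_mult_less_top)
   finally show "\<exists>V'. (open V' \<and> emeasure lborel V' < \<infinity> \<and> (Suc n = 0 --> V' = {})) \<and> fattening \<omega> b (1 / 4) D (Os (Suc n) \<union> V) V'"
    using V'[unfolded fattening_def, THEN conjunct1] by (intro exI[of _ V'] conjI impI V') simp_all
  qed
  then obtain V where V0: "\<forall>n. (open (V n) \<and> emeasure lborel (V n) < \<infinity> \<and> (n = 0 --> V n = {})) \<and> fattening \<omega> b (1 / 4) D (Os (Suc n) \<union> V n) (V (Suc n))"
   by (rule exE)
  have V: "open (V n)" "emeasure lborel (V n) < \<infinity>" "V 0 = {}" "fattening \<omega> b (1 / 4) D (Os (Suc n) \<union> V n) (V (Suc n))" for n
   using V0[THEN spec, of n] V0[THEN spec, of 0] by simp_all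
  have off: "nontangential_max 1 (dsol \<omega> F) z <= 5 * (B / 2 ^ n)" if "z \<notin> V n" for z n
   by (rule fattened_level_sets[OF adm F B b V(3) borel_open[OF V(1)] V(4)[unfolded Os_def] that])
  have all: "\<bar>dsol \<omega> F X\<bar> <= B" if "X \<in> cone 1 z" for X z
  proof -
   have Y: "X \<in> half_space" using that by (auto simp: cone_def)
   have FB: "- B <= F x \<and> F x <= B" for x using B(2)[of x] by linarith
   show ?thesis using dsol_bounds[OF adm Y ccs_measurable[OF F] FB] by linarith
  qed
  have nt: "nontangential_max 1 (dsol \<omega> F) z <= B" "0 <= nontangential_max 1 (dsol \<omega> F) z" for z
   by (rule nontangential_max_le(1), erule all, rule nontangential_max_le(2), erule all)
  define l where "l n = (B / 2 ^ n) powr p" for n :: nat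
  have l: "0 < l n" for n using B by (simp add: l_def)
  have lS: "l (Suc n) * (2 * D) <= l n" for n
  proof -
   have "l (Suc n) * (2 * D) <= l (Suc n) * 2 powr p" using Dp l[of "Suc n"] by (intro mult_left_mono) auto
   also have "\<dots> = l n" using B by (simp add: l_def powr_mult[symmetric])
   finally show ?thesis .
  qed
  define v where "v n = measure lborel (V n)" for n
  define o' where "o' n = measure lborel (Os n)" for n
  have v: "emeasure lborel (V n) = ennreal (v n)" and o': "emeasure lborel (Os n) = ennreal (o' n)" for n
   unfolding v_def o'_def using V(2)[of n] Ofin[of n] by (auto intro!: emeasure_eq_ennreal_measure)
  have nn: "0 <= v n" "0 <= o' n" for n by (simp_all add: v_def o'_def)
  have vS: "v (Suc n) <= D * (o' (Suc n) + v n)" for n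
  proof -
   have "ennreal (v (Suc n)) <= ennreal D * emeasure lborel (Os (Suc n) \<union> V n)"
    using V(4)[of n] unfolding v[symmetric] by (simp add: fattening_def)
   also have "\<dots> <= ennreal D * (emeasure lborel (Os (Suc n)) + emeasure lborel (V n))"
    using Oo V(1) by (intro mult_left_mono emeasure_subadditive) auto
   also have "\<dots> = ennreal (D * (o' (Suc n) + v n))" using nn D by (simp add: v o' ennreal_mult')
   finally show ?thesis using nn D by (simp add: ennreal_le_iff)
  qed
  \<comment> \<open>Inserting the recursion returns half of the same sum, which is absorbed on the
    left; this is legitimate because the partial sums are finite.\<close>
  have T: "(\<Sum>n<N. l n * v n) <= 2 * D * (\<Sum>n<Suc N. l n * o' n)" for N
  proof -
   let ?T = "\<Sum>n<N. l n * v n" and ?A = "\<Sum>n<Suc N. l n * o' n"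
   have "?T <= (\<Sum>n<Suc N. l n * v n)" using l[of N] nn by simp
   also have "\<dots> = (\<Sum>n<N. l (Suc n) * v (Suc n))" by (subst sum.lessThan_Suc_shift) (simp add: v_def V(3))
   also have "\<dots> <= (\<Sum>n<N. D * (l (Suc n) * o' (Suc n)) + 1 / 2 * (l n * v n))"
   proof (rule sum_mono)
    fix n
    have "l (Suc n) * v (Suc n) <= l (Suc n) * (D * (o' (Suc n) + v n))" using l[of "Suc n"] by (intro mult_left_mono vS) auto
    also have "\<dots> = D * (l (Suc n) * o' (Suc n)) + 1 / 2 * (l (Suc n) * (2 * D) * v n)" by (simp add: algebra_simps)
    also have "\<dots> <= D * (l (Suc n) * o' (Suc n)) + 1 / 2 * (l n * v n)" using nn by (intro add_left_mono mult_left_mono mult_right_mono lS) auto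
    finally show "l (Suc n) * v (Suc n) <= D * (l (Suc n) * o' (Suc n)) + 1 / 2 * (l n * v n)" .
   qed
   also have "\<dots> = D * (\<Sum>n<N. l (Suc n) * o' (Suc n)) + 1 / 2 * ?T" by (simp only: sum.distrib sum_distrib_left)
   also have "(\<Sum>n<N. l (Suc n) * o' (Suc n)) <= ?A" using l[of 0] nn by (subst sum.lessThan_Suc_shift) simp
   finally show ?thesis using D by simp
  qed
  let ?I = "\<integral>\<^sup>+x. ennreal (\<bar>F x\<bar> powr p) \<partial>lborel"
  have [measurable]: "Os n \<in> sets borel" "V n \<in> sets borel" "F \<in> \<B>" for n using Oo V(1) ccs_measurable[OF F] by auto
  have A: "ennreal (\<Sum>n<N. l n * o' n) <= 2 * ?I" for N
  proof -
   have "ennreal (\<Sum>n<N. l n * o' n) = (\<Sum>n<N. \<integral>\<^sup>+x. ennreal (l n) * indicator (Os n) x \<partial>lborel)"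
    using nn less_imp_le[OF l] by (simp add: sum_ennreal[symmetric] ennreal_mult' o' nn_integral_cmult_indicator)
   also have "\<dots> = (\<integral>\<^sup>+x. (\<Sum>n<N. ennreal (l n) * indicator (Os n) x) \<partial>lborel)" by (rule nn_integral_sum[symmetric]) measurable
   also have "\<dots> <= (\<integral>\<^sup>+x. 2 * ennreal (\<bar>F x\<bar> powr p) \<partial>lborel)"
   proof (intro nn_integral_mono)
    fix x
    have "(\<Sum>n<N. ennreal (l n) * indicator (Os n) x) = (\<Sum>n<N. ennreal (l n * (if B / 2 ^ n < \<bar>F x\<bar> then 1 else 0)))"
     by (intro sum.cong refl) (simp add: Os_def indicator_def)
    also have "\<dots> = ennreal (\<Sum>n<N. l n * (if B / 2 ^ n < \<bar>F x\<bar> then 1 else 0))"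
     using less_imp_le[OF l] by (intro sum_ennreal) simp
    also have "\<dots> <= ennreal (2 * (\<bar>F x\<bar> powr p))"
    proof (rule ennreal_leI)
     have "(\<Sum>n<N. l n * (if B / 2 ^ n < \<bar>F x\<bar> then 1 else 0)) <= 2 * max 0 (\<bar>F x\<bar> powr p - (B / 2 ^ N) powr p)"
      unfolding l_def by (rule dyadic_layers_le[OF _ B(1) p1(1)]) simp
     also have "\<dots> <= 2 * (\<bar>F x\<bar> powr p)" by simp
     finally show "(\<Sum>n<N. l n * (if B / 2 ^ n < \<bar>F x\<bar> then 1 else 0)) <= 2 * (\<bar>F x\<bar> powr p)" .
    qed
    finally show "(\<Sum>n<N. ennreal (l n) * indicator (Os n) x) <= 2 * ennreal (\<bar>F x\<bar> powr p)" by (simp add: ennreal_mult')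
   qed
   also have "\<dots> = 2 * ?I" by (rule nn_integral_cmult) measurable
   finally show ?thesis .
  qed
  \<comment> \<open>For the least m with 10 B / 2^m below the value at z one has m = n + 1, since
    the value is at most B; so it lies between 5 B / 2^n and 10 B / 2^n. The lower bound puts z into
    \<open>V n\<close>, the upper one gives the weight.\<close>
  have pt: "ennreal (\<bar>nontangential_max 1 (dsol \<omega> F) z\<bar> powr p) <= (\<Sum>n. ennreal (10 powr p * l n) * indicator (V n) z)" for z
  proof (cases "nontangential_max 1 (dsol \<omega> F) z = 0")
   case False
   let ?u = "nontangential_max 1 (dsol \<omega> F) z"
   have u: "0 < ?u" using False nt(2)[of z] by linarith
   have "(\<lambda>n. 10 * B * (1 / 2) ^ n) \<longlonglongrightarrow> 10 * B * 0" by (intro tendsto_intros LIMSEQ_realpow_zero) auto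
   then have "\<forall>\<^sub>F n in sequentially. 10 * B * (1 / 2) ^ n < ?u" using u by (intro order_tendstoD(2)) auto
   then have ex: "\<exists>n. 10 * (B / 2 ^ n) < ?u" by (auto simp: eventually_sequentially power_divide)
   define m where "m = (LEAST n. 10 * (B / 2 ^ n) < ?u)"
   have m: "10 * (B / 2 ^ m) < ?u" unfolding m_def by (rule LeastI_ex[OF ex])
   have "m \<noteq> 0" using m nt(1)[of z] B(1) by (cases m) auto
   then obtain n where n: "m = Suc n" by (cases m) auto
   then have "\<not> 10 * (B / 2 ^ n) < ?u" using not_less_Least[of n "\<lambda>n. 10 * (B / 2 ^ n) < ?u"] unfolding m_def by simp
   then have un: "?u <= 10 * (B / 2 ^ n)" by simp
   have "5 * (B / 2 ^ n) < ?u" using m n by simp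
   then have zV: "z \<in> V n" using off[of z n] by linarith
   have "\<bar>?u\<bar> powr p <= (10 * (B / 2 ^ n)) powr p" using un u p1 by (intro powr_mono2) auto
   also have "\<dots> = 10 powr p * l n" unfolding l_def by (rule powr_mult)
   finally have "ennreal (\<bar>?u\<bar> powr p) <= ennreal (10 powr p * l n) * indicator (V n) z" using zV by (simp add: ennreal_leI)
   also have "\<dots> <= (\<Sum>n. ennreal (10 powr p * l n) * indicator (V n) z)" by (rule ennreal_term_le_suminf)
   finally show ?thesis .
  qed simp
  have "(\<integral>\<^sup>+z. ennreal (\<bar>nontangential_max 1 (dsol \<omega> F) z\<bar> powr p) \<partial>lebesgue) <= (\<integral>\<^sup>+z. (\<Sum>n. ennreal (10 powr p * l n) * indicator (V n) z) \<partial>lebesgue)"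
   by (intro nn_integral_mono pt)
  also have "\<dots> = (\<integral>\<^sup>+z. (\<Sum>n. ennreal (10 powr p * l n) * indicator (V n) z) \<partial>lborel)"
   by (rule nn_integral_completion)
  also have "\<dots> = (\<Sum>n. \<integral>\<^sup>+z. ennreal (10 powr p * l n) * indicator (V n) z \<partial>lborel)" by (rule nn_integral_suminf) measurable
  also have "\<dots> = (\<Sum>n. ennreal (10 powr p * (l n * v n)))"
  proof (rule suminf_cong)
   fix n
   have "(\<integral>\<^sup>+z. ennreal (10 powr p * l n) * indicator (V n) z \<partial>lborel) = ennreal (10 powr p * l n) * ennreal (v n)"
    unfolding v[symmetric] by (rule nn_integral_cmult_indicator) (simp add: V(1))
   then show "(\<integral>\<^sup>+z. ennreal (10 powr p * l n) * indicator (V n) z \<partial>lborel) = ennreal (10 powr p * (l n * v n))"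
    using less_imp_le[OF l[of n]] by (simp add: ennreal_mult'[symmetric] mult.assoc)
  qed
  also have "\<dots> <= ennreal (10 powr p * (4 * D)) * ?I"
  proof (rule suminf_le_const[OF summableI])
   fix N
   have "(\<Sum>n<N. ennreal (10 powr p * (l n * v n))) = ennreal (10 powr p * (\<Sum>n<N. l n * v n))"
    unfolding sum_distrib_left using nn less_imp_le[OF l] by (intro sum_ennreal) simp
   also have "\<dots> <= ennreal (10 powr p * (2 * D * (\<Sum>n<Suc N. l n * o' n)))" by (intro ennreal_leI mult_left_mono T) simp
   also have "\<dots> = ennreal (10 powr p * (2 * D)) * ennreal (\<Sum>n<Suc N. l n * o' n)"
    unfolding mult.assoc[symmetric] by (intro ennreal_mult') (use D in simp)
   also have "\<dots> <= ennreal (10 powr p * (2 * D)) * (2 * ?I)" by (intro mult_left_mono A) simp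
   also have "\<dots> = ennreal (10 powr p * (2 * D) * 2) * ?I" using D by (subst ennreal_mult') (simp_all add: mult.assoc)
   also have "10 powr p * (2 * D) * 2 = 10 powr p * (4 * D)" by simp
   finally show "(\<Sum>n<N. ennreal (10 powr p * (l n * v n))) <= ennreal (10 powr p * (4 * D)) * ?I" .
  qed
  also have "?I = (\<integral>\<^sup>+x. ennreal (\<bar>F x\<bar> powr p) \<partial>lebesgue)" by (simp add: nn_integral_completion)
  finally show ?thesis .
 qed
 show ?thesis
 proof (rule exI[of _ p0], intro conjI allI impI)
  show "1 < p0" by (simp add: p0_def)
  fix p assume p: "p0 <= p"
  have C: "0 < 10 powr p * (4 * D)" using D by simp
  note * = main[OF p]
  show "\<exists>C>0. \<forall>(\<omega> :: 'm poles) F. adm L \<omega> \<and> carleson_condition 1 K \<omega> \<and> ccs F -->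
   (\<integral>\<^sup>+z. ennreal (\<bar>nontangential_max 1 (dsol \<omega> F) z\<bar> powr p) \<partial>lebesgue) <= ennreal C * (\<integral>\<^sup>+x. ennreal (\<bar>F x\<bar> powr p) \<partial>lebesgue)"
   by (rule exI[of _ "10 powr p * (4 * D)"], intro conjI[OF C] allI impI, elim conjE, rule *; assumption)
 qed
 qed
qed

lemma Lp_norm_le:
 assumes p: "0 < p" and C: "0 < C" and le: "(\<integral>\<^sup>+x. ennreal (\<bar>f x\<bar> powr p) \<partial>lebesgue) <= ennreal C * (\<integral>\<^sup>+x. ennreal (\<bar>g x\<bar> powr p) \<partial>lebesgue)"
 shows "Lp_norm p f <= ennreal (C powr (1 / p)) * Lp_norm p g"
proof (cases "(\<integral>\<^sup>+x. ennreal (\<bar>g x\<bar> powr p) \<partial>lebesgue) = \<infinity>")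
 case True
 then show ?thesis using C by (simp add: Lp_norm_def ennreal_mult_top)
next
 case False
 obtain I where I: "0 <= I" "(\<integral>\<^sup>+x. ennreal (\<bar>g x\<bar> powr p) \<partial>lebesgue) = ennreal I"
  using False by (cases "\<integral>\<^sup>+x. ennreal (\<bar>g x\<bar> powr p) \<partial>lebesgue") auto
 have le': "(\<integral>\<^sup>+x. ennreal (\<bar>f x\<bar> powr p) \<partial>lebesgue) <= ennreal (C * I)" using le C I by (simp add: ennreal_mult')
 obtain J where J: "0 <= J" "(\<integral>\<^sup>+x. ennreal (\<bar>f x\<bar> powr p) \<partial>lebesgue) = ennreal J"
  using le' by (cases "\<integral>\<^sup>+x. ennreal (\<bar>f x\<bar> powr p) \<partial>lebesgue") (auto simp: top_unique)
 have "J <= C * I" using le' J I C by (simp add: ennreal_le_iff)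
 then have "J powr (1 / p) <= (C * I) powr (1 / p)" using J p by (intro powr_mono2) auto
 also have "\<dots> = C powr (1 / p) * I powr (1 / p)" using C I by (simp add: powr_mult)
 finally have "ennreal (J powr (1 / p)) <= ennreal (C powr (1 / p) * I powr (1 / p))" by (rule ennreal_leI)
 then show ?thesis using I J by (simp add: Lp_norm_def ennreal_mult')
qed

theorem corollary3p2:
  fixes lam Lam :: real
  assumes "0 < lam"
  shows "\<exists>\<gamma>>0. \<forall>K::ennreal. K < \<infinity> \<longrightarrow>
    (\<forall>(A :: 'm::finite point \<Rightarrow> 'm point \<Rightarrow>\<^sub>L 'm point) \<omega>.
       elliptic lam Lam A \<and> elliptic_measure A \<omega> \<and> carleson_condition \<gamma> K \<omega> \<longrightarrow>
       (\<forall>c l. 0 < l \<longrightarrow> A_infinity (cube c l) (\<omega> (c, l)))) \<and>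
    (\<exists>p0>1. \<forall>p\<ge>p0. \<exists>C::real. 0 < C \<and>
       (\<forall>(A :: 'm::finite point \<Rightarrow> 'm point \<Rightarrow>\<^sub>L 'm point) \<omega>.
          elliptic lam Lam A \<and> elliptic_measure A \<omega> \<and> carleson_condition \<gamma> K \<omega> \<longrightarrow>
          (\<forall>F. continuous_compact_support F \<longrightarrow>
             Lp_norm p (nontangential_max \<gamma> (solution_with_data \<omega> F))
               \<le> ennreal C * Lp_norm p F)))"
proof -
 obtain L where L: "0 <= L" and adm: "\<forall>(A :: 'm point => 'm point \<Rightarrow>\<^sub>L 'm point) \<omega>. elliptic lam Lam A \<and> elliptic_measure A \<omega> --> adm L \<omega>"
  using adm_of_elliptic_measure[OF assms, of Lam, where 'm = 'm] by (elim exE conjE) (rule that)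
 have adm': "adm L \<omega>" if "elliptic lam Lam A" "elliptic_measure A \<omega>" for A :: "'m point => 'm point \<Rightarrow>\<^sub>L 'm point" and \<omega>
  by (intro adm[rule_format, of A \<omega>] conjI that)
 have one: "A_infinity (cube c l) (\<omega> (c, l))"
  if "K < \<infinity>" "elliptic lam Lam A" "elliptic_measure A \<omega>" "carleson_condition 1 K \<omega>" "0 < l"
  for K and A :: "'m point => 'm point \<Rightarrow>\<^sub>L 'm point" and \<omega> c l
  by (rule A_infinity_of_carleson[OF L that(1) adm'[OF that(2,3)] that(4,5)])
 have two: "\<exists>p0>1. \<forall>p\<ge>p0. \<exists>C::real. 0 < C \<and>
    (\<forall>(A :: 'm point => 'm point \<Rightarrow>\<^sub>L 'm point) \<omega>. elliptic lam Lam A \<and> elliptic_measure A \<omega> \<and> carleson_condition 1 K \<omega> -->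
     (\<forall>F. ccs F --> Lp_norm p (nontangential_max 1 (dsol \<omega> F)) <= ennreal C * Lp_norm p F))" if K: "K < \<infinity>" for K
 proof -
  obtain p0 where p0: "1 < p0" and np: "\<forall>p\<ge>p0. \<exists>C::real. 0 < C \<and> (\<forall>(\<omega> :: 'm poles) F. adm L \<omega> \<and> carleson_condition 1 K \<omega> \<and> ccs F -->
   (\<integral>\<^sup>+z. ennreal (\<bar>nontangential_max 1 (dsol \<omega> F) z\<bar> powr p) \<partial>lebesgue) <= ennreal C * (\<integral>\<^sup>+x. ennreal (\<bar>F x\<bar> powr p) \<partial>lebesgue))"
   using nontangential_max_powr_integral[OF L K, where 'm = 'm] by (elim exE conjE) (rule that)
  show ?thesis
  proof (rule exI[of _ p0], intro conjI[OF p0] allI impI)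
   fix p assume p: "p0 <= p"
   obtain C where C: "0 < C" and CI: "\<forall>(\<omega> :: 'm poles) F. adm L \<omega> \<and> carleson_condition 1 K \<omega> \<and> ccs F -->
   (\<integral>\<^sup>+z. ennreal (\<bar>nontangential_max 1 (dsol \<omega> F) z\<bar> powr p) \<partial>lebesgue) <= ennreal C * (\<integral>\<^sup>+x. ennreal (\<bar>F x\<bar> powr p) \<partial>lebesgue)"
    using np[rule_format, of p, OF p] by (elim exE conjE) (rule that)
   have pp: "0 < p" using p p0 by simp
   have C': "0 < C powr (1 / p)" using C by simp
   have "Lp_norm p (nontangential_max 1 (dsol \<omega> F)) <= ennreal (C powr (1 / p)) * Lp_norm p F"
    if "elliptic lam Lam A" "elliptic_measure A \<omega>" "carleson_condition 1 K \<omega>" "ccs F"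
    for A :: "'m point => 'm point \<Rightarrow>\<^sub>L 'm point" and \<omega> F
    by (rule Lp_norm_le[OF pp C]) (intro CI[rule_format, of \<omega> F] conjI adm'[OF that(1,2)] that)
   note * = this
   show "\<exists>C::real. 0 < C \<and>
    (\<forall>(A :: 'm point => 'm point \<Rightarrow>\<^sub>L 'm point) \<omega>. elliptic lam Lam A \<and> elliptic_measure A \<omega> \<and> carleson_condition 1 K \<omega> -->
     (\<forall>F. ccs F --> Lp_norm p (nontangential_max 1 (dsol \<omega> F)) <= ennreal C * Lp_norm p F))"
    by (rule exI[of _ "C powr (1 / p)"], intro conjI[OF C'] allI impI, elim conjE, rule *; assumption)
  qed
 qed
 have one': "\<forall>(A :: 'm point => 'm point \<Rightarrow>\<^sub>L 'm point) \<omega>. elliptic lam Lam A \<and> elliptic_measure A \<omega> \<and> carleson_condition 1 K \<omega> -->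
    (\<forall>c l. 0 < l --> A_infinity (cube c l) (\<omega> (c, l)))" if K: "K < \<infinity>" for K
  by (intro allI impI, elim conjE, rule one[OF K]; assumption)
 show ?thesis by (rule exI[of _ 1], rule conjI[OF zero_less_one], rule allI, rule impI, rule conjI, erule one', erule two)
qed

end
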